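(* There is an absolute constant $c_0>0$, and for every $\gamma\ge1$ there are constants $c_1,c_2$ that depend only (polynomially) on $\gamma$, such that the following holds. Let $I\subset\{1,\dots,n\}$ be a fixed set with $|I|=m$. If $m\le n/(c_1\log^4n)$, then with probability at least $1-2\exp(-c_0\gamma\log^2n)$ with respect to $(G,\varepsilon',\varepsilon'')$, the random matrix $$B=\frac1{\sqrt m}R_I\Gamma_GD_{\varepsilon''}\frac1{\sqrt n}\Gamma_{\varepsilon'}\in\mathbb{R}^{m\times n}$$ is $\rho$-strongly regular for $$\rho=c_2\frac{\log^{5/2}n}{\sqrt m}.$$
   Context: For $x,y\in\mathbb{R}^n$, $\Gamma_xy=x\circledast y$ is the discrete circular convolution, so $\Gamma_x\in\mathbb{R}^{n\times n}$ is the circulant convolution matrix of $x$; $D_x=\mathrm{diag}(x_1,\dots,x_n)$; $R_Ix=\sum_{i\in I}x_ie_i$, viewed as a map into $\mathbb{R}^I\cong\mathbb{R}^m$. $G$ is a standard Gaussian vector in $\mathbb{R}^n$, $\varepsilon',\varepsilon''$ are Rademacher vectors in $\mathbb{R}^n$ (independent uniform $\pm1$ coordinates), and $G,\varepsilon',\varepsilon''$ are independent. For a vector $x$, $\|x\|_{[k]}=\sup_{|J|=k}\big(\sum_{i\in J}x_i^2\big)^{1/2}$. Let $U_s$ be the set of vectors on the Euclidean unit sphere $S^{n-1}$ with at most $s$ nonzero coordinates, and $\Sigma_{s,n}$ the set of vectors in the Euclidean unit ball of $\mathbb{R}^n$ with at most $s$ nonzero coordinates. A matrix $B\in\mathbb{R}^{m\times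 n}$ satisfies RIP$(s,\delta)$ if $\sup_{x\in U_s}\big|\|Bx\|_2^2-\|x\|_2^2\big|\le\delta$. For $\rho>0$ put $s_\rho=\lceil\rho^{-2}\rceil$. $B$ is $\rho$-regular if it satisfies RIP$(r,\rho\sqrt r)$ for all $1\le r\le s_\rho$. $B$ is $\rho$-strongly regular if it is $\rho$-regular and in addition $\sup_{x\in\Sigma_{r,n}}\|Bx\|_{[r]}\le\rho\sqrt r$ for all $1\le r\le s_\rho$. *)

theory Defs
  imports
    "HOL-Probability.Probability"
    "Jordan_Normal_Form.Matrix"
begin

no_notation vec_nth (infixl \<open>$\<close> 90)

text \<open>Vectors in \<open>\<real>\<^sup>n\<close> and matrices in \<open>\<real>\<^sup>m\<^sup>\<times>\<^sup>n\<close> are the dimension-carrying \<open>real vec\<close> and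
  \<open>real mat\<close>. Coordinates are indexed by \<open>{..<n}\<close>, representing \<open>\<int>/n\<int>\<close>, instead of
  \<open>{1..n}\<close>.\<close>

definition l2norm :: "real Matrix.vec \<Rightarrow> real" where
  "l2norm x = sqrt (scalar_prod x x)"

definition vec_support :: "real Matrix.vec \<Rightarrow> nat set" where
  "vec_support x = {i. i < dim_vec x \<and> x $ i \<noteq> 0}"

definition sparse_sphere :: "nat \<Rightarrow> nat \<Rightarrow> real Matrix.vec set" where
  "sparse_sphere n s = {x \<in> carrier_vec n. l2norm x = 1 \<and> card (vec_support x) \<le> s}"

definition sparse_ball :: "nat \<Rightarrow> nat \<Rightarrow> real Matrix.vec set" where
  "sparse_ball n s = {x \<in> carrier_vec n. l2norm x \<le> 1 \<and> card (vec_support x) \<le> s}"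

text \<open>For \<open>k\<close> larger than the dimension there is no index set of cardinality \<open>k\<close>; the minimum
  then makes \<open>topk_norm k\<close> the Euclidean norm rather than the supremum of the empty set.\<close>

definition topk_norm :: "nat \<Rightarrow> real Matrix.vec \<Rightarrow> real" where
  "topk_norm k x =
     (SUP J \<in> {J. J \<subseteq> {..<dim_vec x} \<and> card J = min k (dim_vec x)}. sqrt (\<Sum>i\<in>J. (x $ i)\<^sup>2))"

definition RIP :: "real mat \<Rightarrow> nat \<Rightarrow> real \<Rightarrow> bool" where
  "RIP B s \<delta> \<longleftrightarrow>
     (SUP x \<in> sparse_sphere (dim_col B) s. \<bar>(l2norm (B *\<^sub>v x))\<^sup>2 - (l2norm x)\<^sup>2\<bar>) \<le> \<delta>"

definition s_level :: "real \<Rightarrow> nat" where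
  "s_level \<rho> = nat \<lceil>\<rho> powi (-2)\<rceil>"

definition rho_regular :: "real \<Rightarrow> real mat \<Rightarrow> bool" where
  "rho_regular \<rho> B \<longleftrightarrow> (\<forall>r. 1 \<le> r \<and> r \<le> s_level \<rho> \<longrightarrow> RIP B r (\<rho> * sqrt (real r)))"

definition rho_strongly_regular :: "real \<Rightarrow> real mat \<Rightarrow> bool" where
  "rho_strongly_regular \<rho> B \<longleftrightarrow>
     rho_regular \<rho> B \<and>
     (\<forall>r. 1 \<le> r \<and> r \<le> s_level \<rho> \<longrightarrow>
        (SUP x \<in> sparse_ball (dim_col B) r. topk_norm r (B *\<^sub>v x)) \<le> \<rho> * sqrt (real r))"

definition circ_conv :: "nat \<Rightarrow> real Matrix.vec \<Rightarrow> real Matrix.vec \<Rightarrow> real Matrix.vec" where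
  "circ_conv n x y =
     Matrix.vec n (\<lambda>i. \<Sum>j<n. x $ nat ((int i - int j) mod int n) * y $ j)"

definition circ_mat :: "nat \<Rightarrow> real Matrix.vec \<Rightarrow> real mat" where
  "circ_mat n x = Matrix.mat n n (\<lambda>(i, j). x $ nat ((int i - int j) mod int n))"

lemma circ_mat_mult_vec:
  assumes "y \<in> carrier_vec n"
  shows "circ_mat n x *\<^sub>v y = circ_conv n x y"
  using assms
  by (intro eq_vecI)
     (auto simp: circ_mat_def circ_conv_def scalar_prod_def lessThan_atLeast0 intro!: sum.cong)

text \<open>The coordinates in \<open>I\<close>, in increasing order, identify \<open>\<real>\<^sup>I\<close> with \<open>\<real>\<^sup>m\<close>.\<close>

definition restrict_mat :: "nat \<Rightarrow> nat set \<Rightarrow> real mat" where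
  "restrict_mat n I =
     Matrix.mat (card I) n (\<lambda>(k, j). if j = sorted_list_of_set I ! k then 1 else 0)"

lemma restrict_mat_mult_vec:
  assumes "I \<subseteq> {..<n}" "x \<in> carrier_vec n"
  shows "restrict_mat n I *\<^sub>v x = Matrix.vec (card I) (\<lambda>k. x $ (sorted_list_of_set I ! k))"
proof (rule eq_vecI)
  fix k assume "k < dim_vec (Matrix.vec (card I) (\<lambda>k. x $ (sorted_list_of_set I ! k)))"
  then have k: "k < card I" by simp
  have "finite I" using assms(1) finite_subset by blast
  then have "sorted_list_of_set I ! k \<in> I"
    using k by (metis nth_mem sorted_list_of_set.length_sorted_key_list_of_set
        sorted_list_of_set.set_sorted_key_list_of_set)
  then have "sorted_list_of_set I ! k \<in> {0..<n}" using assms(1) by auto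
  then show "(restrict_mat n I *\<^sub>v x) $ k
      = Matrix.vec (card I) (\<lambda>k. x $ (sorted_list_of_set I ! k)) $ k"
    using k assms(2)
    by (auto simp: restrict_mat_def scalar_prod_def if_distrib[where f = "\<lambda>a. a * _"]
        sum.delta cong: if_cong)
qed (simp add: restrict_mat_def)

text \<open>\<open>B = (1/\<surd>m) R\<^sub>I \<Gamma>\<^sub>g D\<^sub>e\<^sub>'\<^sub>' (1/\<surd>n) \<Gamma>\<^sub>e\<^sub>'\<close>, where \<open>m = |I|\<close>.\<close>

definition B_mat :: "nat \<Rightarrow> nat set \<Rightarrow> real Matrix.vec \<Rightarrow> real Matrix.vec \<Rightarrow> real Matrix.vec \<Rightarrow> real mat"
  where
  "B_mat n I g e' e'' =
     (1 / sqrt (real (card I))) \<cdot>\<^sub>m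
       (restrict_mat n I * circ_mat n g * mat_diag n (\<lambda>i. e'' $ i) *
         ((1 / sqrt (real n)) \<cdot>\<^sub>m circ_mat n e'))"

definition gaussian_law :: "nat \<Rightarrow> (nat \<Rightarrow> real) measure" where
  "gaussian_law n = (\<Pi>\<^sub>M i\<in>{..<n}. std_normal_distribution)"

definition rademacher_law :: "nat \<Rightarrow> (nat \<Rightarrow> real) measure" where
  "rademacher_law n = (\<Pi>\<^sub>M i\<in>{..<n}. measure_pmf (pmf_of_set {-1, 1}))"

text \<open>The joint law of the independent triple \<open>(G, \<epsilon>', \<epsilon>'')\<close>.\<close>

definition joint_law :: "nat \<Rightarrow> ((nat \<Rightarrow> real) \<times> (nat \<Rightarrow> real) \<times> (nat \<Rightarrow> real)) measure" where
  "joint_law n = gaussian_law n \<Otimes>\<^sub>M (rademacher_law n \<Otimes>\<^sub>M rademacher_law n)"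

lemma prob_space_gaussian_law: "prob_space (gaussian_law n)"
  unfolding gaussian_law_def by (intro prob_space_PiM prob_space_normal_density) simp

lemma prob_space_rademacher_law: "prob_space (rademacher_law n)"
  unfolding rademacher_law_def by (intro prob_space_PiM prob_space_measure_pmf)

lemma prob_space_joint_law: "prob_space (joint_law n)"
  unfolding joint_law_def
  by (intro prob_space_pair prob_space_gaussian_law prob_space_rademacher_law)

end

theory Submission
  imports Defs
begin

text \<open>With \<open>z\<^sub>x = D\<^bsub>\<epsilon>''\<^esub> n\<^sup>-\<^sup>1\<^sup>/\<^sup>2 \<Gamma>\<^bsub>\<epsilon>'\<^esub> x\<close> one has \<open>\<surd>m B x = R\<^sub>I \<Gamma>\<^bsub>z\<^sub>x\<^esub> G\<close>, so for fixed signs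
  \<open>\<parallel>B x\<parallel>\<^sup>2 - \<parallel>x\<parallel>\<^sup>2\<close> is a Gaussian chaos. Its diagonal is a chi-square deviation. Its off-diagonal part
  is decoupled by averaging over Walsh signs and, conditionally on one half, chained as a linear form
  whose increments are governed by \<open>\<parallel>\<Gamma>\<^bsub>z\<^esub>\<parallel>\<close>, that is, by the largest Fourier coefficient of \<open>z\<close>.
  For this seminorm the sparse ball has nets of grid vectors, found by repeatedly halving the
  \<open>\<ell>\<^sub>1\<close> norm of an integer vector with well chosen signs. The input is that the Fourier functionals of
  \<open>z\<close> have small energy on every small set of coordinates; this holds with high probability in
  \<open>\<epsilon>''\<close> because \<open>n\<^sup>-\<^sup>1\<^sup>/\<^sup>2 \<Gamma>\<^bsub>\<epsilon>'\<^esub>\<close> is nearly isometric on sparse vectors, which is the same chaos argument for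
  Rademacher signs. The top-\<open>r\<close> norm is a supremum of the bilinear form \<open>\<langle>y, B x\<rangle>\<close> over sparse pairs and
  is chained in both variables.\<close>

subsection \<open>Circulant matrices and the discrete Fourier transform\<close>

text \<open>The exponent 5/2 arises as follows. A grid vector of level k consists of L 2^k unit
  steps, so its tail parameter is of order sqrt (L 2^k log n), while halving gives increments of
  order A sqrt (r log n / (L 2^k)), where A^2 bounds the energy of a Fourier functional per
  coordinate. The product does not depend on k, and the order of log n levels add up to A sqrt r
  log^2 n. For B the energy A^2 is of order (log n) / m, which supplies the last half power. The
  obstacle to chaining the quadratic form is that, conditionally on one half of the variables, the
  scale of a tail is the unknown norm of the other half. All these norms are bounded by one supremum
  M, and a quadratic inequality for M closes the argument. Apart from a term of order 1/n, the
  deviation is then of order K + K^2 for a chain bound K, which suffices only while \<rho> sqrt r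
  stays bounded. If \<rho> > 1, only r = 1 occurs and m is polylogarithmic; the matrix generated by
  a modulated column then has nearly orthogonal rows, and this replaces the nets.\<close>

definition cyc_diff :: "nat \<Rightarrow> nat \<Rightarrow> nat \<Rightarrow> nat" where
  "cyc_diff n s l = nat ((int s - int l) mod int n)"

lemma cyc_diff_less: "n > 0 \<Longrightarrow> cyc_diff n s l < n"
  by (simp add: cyc_diff_def nat_less_iff)

lemma int_cyc_diff: "n > 0 \<Longrightarrow> int (cyc_diff n s l) = (int s - int l) mod int n"
  by (simp add: cyc_diff_def)

text \<open>The reflection l -> s - l of Z/n is an involution. Through it a convolution can be
  summed over either argument.\<close>

lemma cyc_diff_invol:
  assumes "l < n"
  shows "cyc_diff n s (cyc_diff n s l) = l"
proof -
  have "(int s - (int s - int l) mod int n) mod int n = int l"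
    using assms by (metis add_diff_cancel_left' diff_add_cancel mod_diff_right_eq
        mod_pos_pos_trivial of_nat_0_le_iff of_nat_less_iff uminus_add_conv_diff)
  then show ?thesis
    using assms by (simp add: cyc_diff_def)
qed

lemma bij_cyc_diff_right: "n > 0 \<Longrightarrow> bij_betw (cyc_diff n s) {..<n} {..<n}"
  by (rule bij_betw_byWitness[where f' = "cyc_diff n s"]) (auto simp: cyc_diff_invol cyc_diff_less)

lemma bij_cyc_diff_left:
  assumes "n > 0"
  shows "bij_betw (\<lambda>s. cyc_diff n s l) {..<n} {..<n}"
proof -
  have "inj_on (\<lambda>s. cyc_diff n s l) {..<n}"
  proof (rule inj_onI)
    fix s t assume st: "s \<in> {..<n}" "t \<in> {..<n}" and "cyc_diff n s l = cyc_diff n t l"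
    then have "(int s - int l) mod int n = (int t - int l) mod int n"
      using assms by (metis int_cyc_diff)
    then have "int s mod int n = int t mod int n"
      by (metis diff_add_cancel mod_add_left_eq)
    then show "s = t" using st by simp
  qed
  moreover have "(\<lambda>s. cyc_diff n s l) ` {..<n} \<subseteq> {..<n}"
    using assms by (auto simp: cyc_diff_less)
  ultimately show ?thesis
    by (simp add: bij_betw_def endo_inj_surj)
qed

definition dft :: "nat \<Rightarrow> (nat \<Rightarrow> real) \<Rightarrow> nat \<Rightarrow> complex" where
  "dft n v k = (\<Sum>j<n. v j *\<^sub>R cis (2 * pi * real k * real j / real n))"

text \<open>A character of Z/n is multiplicative and ignores the multiple \<open>int n * q\<close>
  which the reduction removes.\<close>

lemma cis_cyc_diff:
  assumes "n > 0"
  shows "cis (2 * pi * real k * real (cyc_diff n s l) / real n)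
       = cis (2 * pi * real k * real s / real n) * cnj (cis (2 * pi * real k * real l / real n))"
proof -
  define q where "q = (int s - int l) div int n"
  have "int (cyc_diff n s l) = int s - int l - int n * q"
    using assms by (simp add: int_cyc_diff q_def minus_mult_div_eq_mod)
  then have "real (cyc_diff n s l) = real s - real l - real n * of_int q"
    by (metis of_int_diff of_int_mult of_int_of_nat_eq)
  then have s: "real s = real (cyc_diff n s l) + real l + real n * of_int q"
    by simp
  have "2 * pi * real k * real (cyc_diff n s l) / real n
    = 2 * pi * real k * real s / real n + - (2 * pi * real k * real l / real n)
      + 2 * pi * of_int (- int k * q)"
    unfolding s using assms by (simp add: field_simps)
  then have "cis (2 * pi * real k * real (cyc_diff n s l) / real n)
    = cis (2 * pi * real k * real s / real n) * cis (- (2 * pi * real k * real l / real n))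
      * cis (2 * pi * of_int (- int k * q))"
    by (simp only: cis_mult)
  moreover have "cis (2 * pi * of_int (- int k * q)) = 1"
    using cis_multiple_2pi[of "of_int (- int k * q)"] by (simp add: Ints_of_int mult.assoc)
  ultimately show ?thesis by (simp add: cis_cnj)
qed

text \<open>The products are powers of the root of unity \<open>w\<close>, which for a \<noteq> b
  differs from 1 because |a - b| < n; the geometric sum then vanishes.\<close>

lemma cis_orthogonality:
  assumes "a < n" "b < n"
  shows "(\<Sum>k<n. cis (2 * pi * real k * real a / real n) * cnj (cis (2 * pi * real k * real b / real n)))
       = (if a = b then of_nat n else 0)"
proof -
  have n: "n > 0" using assms by simp
  define w where "w = cis (2 * pi * (real a - real b) / real n)"
  have term_eq: "cis (2 * pi * real k * real a / real n) * cnj (cis (2 * pi * real k * real b / real n))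
      = w ^ k" for k
  proof -
    have "w ^ k = cis (real k * (2 * pi * (real a - real b) / real n))"
      unfolding w_def by (rule Complex.DeMoivre)
    then show ?thesis
      by (simp add: cis_cnj cis_mult algebra_simps diff_divide_distrib)
  qed
  show ?thesis
  proof (cases "a = b")
    case True
    then show ?thesis by (simp add: cis_cnj cis_mult)
  next
    case False
    have "w \<noteq> 1"
    proof
      assume "w = 1"
      then have "cos (2 * pi * (real a - real b) / real n) = 1"
        by (simp add: w_def complex_eq_iff)
      then obtain q :: int where "2 * pi * (real a - real b) / real n = of_int q * (2 * pi)"
        by (auto simp: cos_one_2pi_int)
      then have "(2 * pi) * (real a - real b) = (2 * pi) * (of_int q * real n)"
        using n by (simp add: divide_eq_eq mult_ac)
      then have "real a - real b = of_int q * real n"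
        by (simp only: mult_cancel_left) simp
      then have "int a - int b = q * int n"
        by (metis of_int_diff of_int_eq_iff of_int_mult of_int_of_nat_eq)
      then have "int a mod int n = int b mod int n"
        by (metis diff_add_cancel mod_mult_self3)
      then show False using assms False by simp
    qed
    moreover have "w ^ n = 1"
    proof -
      have "w ^ n = cis (2 * pi * of_int (int a - int b))"
        using n by (simp add: w_def Complex.DeMoivre)
      then show ?thesis
        using cis_multiple_2pi[of "of_int (int a - int b)"] by (simp add: Ints_of_int)
    qed
    ultimately have "(\<Sum>k<n. w ^ k) = 0"
      by (simp add: geometric_sum)
    then show ?thesis using False by (simp only: term_eq) simp
  qed
qed

lemma dft_parseval: "(\<Sum>k<n. (cmod (dft n v k))\<^sup>2) = real n * (\<Sum>j<n. (v j)\<^sup>2)"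
proof -
  let ?e = "\<lambda>k j. cis (2 * pi * real k * real j / real n)"
  have "complex_of_real (\<Sum>k<n. (cmod (dft n v k))\<^sup>2) = (\<Sum>k<n. dft n v k * cnj (dft n v k))"
    by (simp only: of_real_sum complex_norm_square)
  also have "\<dots> = (\<Sum>k<n. \<Sum>a<n. \<Sum>b<n. of_real (v a * v b) * (?e k a * cnj (?e k b)))"
    by (simp add: dft_def sum_product scaleR_conv_of_real mult_ac)
  also have "\<dots> = (\<Sum>a<n. \<Sum>b<n. of_real (v a * v b) * (\<Sum>k<n. ?e k a * cnj (?e k b)))"
    by (subst sum.swap, rule sum.cong[OF refl], subst sum.swap) (simp add: sum_distrib_left)
  also have "\<dots> = (\<Sum>a<n. \<Sum>b<n. of_real (v a * v b) * (if a = b then of_nat n else 0))"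
    by (intro sum.cong refl) (simp add: cis_orthogonality)
  also have "\<dots> = complex_of_real (real n * (\<Sum>j<n. (v j)\<^sup>2))"
    by (simp add: if_distrib[where f = "\<lambda>x. _ * x"] sum.delta' power2_eq_square
        sum_distrib_left mult_ac cong: if_cong)
  finally show ?thesis by (simp only: of_real_eq_iff)
qed

text \<open>\<open>z\<close> is evaluated at s - l with l as the free variable, so the sum is a
  correlation. This conjugates the factor of \<open>z\<close> and leaves its modulus
  unchanged.\<close>

lemma dft_correlation:
  assumes "n > 0"
  shows "dft n (\<lambda>l. \<Sum>s<n. z (cyc_diff n s l) * w s) k = dft n w k * cnj (dft n z k)"
proof -
  let ?e = "\<lambda>j. cis (2 * pi * real k * real j / real n)"
  have inner: "(\<Sum>l<n. z (cyc_diff n s l) *\<^sub>R ?e l) = ?e s * cnj (dft n z k)" for s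
  proof -
    have "(\<Sum>l<n. z (cyc_diff n s l) *\<^sub>R ?e l)
        = (\<Sum>l<n. z (cyc_diff n s l) *\<^sub>R (?e s * cnj (?e (cyc_diff n s l))))"
    proof (intro sum.cong refl)
      fix l assume "l \<in> {..<n}"
      have "?e s * cnj (?e (cyc_diff n s l)) = ?e s * cnj (?e s) * ?e l"
        using cis_cyc_diff[OF assms, of k s l] by simp
      then show "z (cyc_diff n s l) *\<^sub>R ?e l = z (cyc_diff n s l) *\<^sub>R (?e s * cnj (?e (cyc_diff n s l)))"
        by (simp add: cis_cnj cis_mult)
    qed
    also have "\<dots> = (\<Sum>j<n. z j *\<^sub>R (?e s * cnj (?e j)))"
      by (rule sum.reindex_bij_betw[OF bij_cyc_diff_right[OF assms]])
    finally show ?thesis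
      by (simp add: dft_def sum_distrib_left scaleR_conv_of_real mult_ac)
  qed
  have "dft n (\<lambda>l. \<Sum>s<n. z (cyc_diff n s l) * w s) k
      = (\<Sum>l<n. \<Sum>s<n. w s *\<^sub>R (z (cyc_diff n s l) *\<^sub>R ?e l))"
    by (simp add: dft_def scaleR_sum_left mult_ac)
  also have "\<dots> = (\<Sum>s<n. w s *\<^sub>R (\<Sum>l<n. z (cyc_diff n s l) *\<^sub>R ?e l))"
    by (subst sum.swap) (simp add: scaleR_sum_right)
  also have "\<dots> = (\<Sum>s<n. w s *\<^sub>R (?e s * cnj (dft n z k)))"
    by (simp only: inner)
  finally show ?thesis
    by (simp add: dft_def sum_distrib_right)
qed

text \<open>Real and imaginary parts of the characters; the boolean selects cosine or sine. Nets and
  tail bounds thereby deal with 2n real functionals.\<close>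

definition trig :: "nat \<Rightarrow> nat \<times> bool \<Rightarrow> nat \<Rightarrow> real" where
  "trig n \<kappa> j = (if snd \<kappa> then cos else sin) (2 * pi * real (fst \<kappa>) * real j / real n)"

definition freqs :: "nat \<Rightarrow> (nat \<times> bool) set" where
  "freqs n = {..<n} \<times> UNIV"

lemma finite_freqs [simp]: "finite (freqs n)"
  by (simp add: freqs_def)

lemma card_freqs: "card (freqs n) = 2 * n"
  by (simp add: freqs_def card_cartesian_product)

lemma trig_sq_le: "(trig n \<kappa> j)\<^sup>2 \<le> 1"
  by (simp add: trig_def abs_square_le_1)

text \<open>The squared modulus is the sum of the squares of two real trigonometric sums, each at
  most c / 2.\<close>

lemma dft_sq_le:
  assumes "\<And>\<kappa>. \<kappa> \<in> freqs n \<Longrightarrow> 2 * (\<Sum>j<n. v j * trig n \<kappa> j)\<^sup>2 \<le> c" "k < n"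
  shows "(cmod (dft n v k))\<^sup>2 \<le> c"
proof -
  have "Re (dft n v k) = (\<Sum>j<n. v j * trig n (k, True) j)"
       "Im (dft n v k) = (\<Sum>j<n. v j * trig n (k, False) j)"
    by (simp_all add: dft_def trig_def)
  moreover have "(k, b) \<in> freqs n" for b using assms(2) by (simp add: freqs_def)
  ultimately show ?thesis
    using assms(1)[of "(k, True)"] assms(1)[of "(k, False)"] by (simp add: cmod_power2)
qed

lemma correlation_norm:
  assumes "n > 0"
  shows "(\<Sum>l<n. (\<Sum>s<n. z (cyc_diff n s l) * w s)\<^sup>2)
       = (\<Sum>k<n. (cmod (dft n w k))\<^sup>2 * (cmod (dft n z k))\<^sup>2) / real n"
proof -
  have "real n * (\<Sum>l<n. (\<Sum>s<n. z (cyc_diff n s l) * w s)\<^sup>2)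
      = (\<Sum>k<n. (cmod (dft n w k))\<^sup>2 * (cmod (dft n z k))\<^sup>2)"
    unfolding dft_parseval[symmetric] dft_correlation[OF assms]
    by (simp add: norm_mult power_mult_distrib)
  then show ?thesis using assms by (simp add: nonzero_eq_divide_eq mult.commute)
qed

text \<open>The singular values of the circulant matrix generated by \<open>z\<close> are the moduli
  of its Fourier coefficients.\<close>

lemma correlation_le_left:
  assumes "n > 0" "\<And>\<kappa>. \<kappa> \<in> freqs n \<Longrightarrow> 2 * (\<Sum>j<n. z j * trig n \<kappa> j)\<^sup>2 \<le> c"
  shows "(\<Sum>l<n. (\<Sum>s<n. z (cyc_diff n s l) * w s)\<^sup>2) \<le> c * (\<Sum>s<n. (w s)\<^sup>2)"
proof -
  have "(\<Sum>k<n. (cmod (dft n w k))\<^sup>2 * (cmod (dft n z k))\<^sup>2) \<le> (\<Sum>k<n. (cmod (dft n w k))\<^sup>2 * c)"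
    using assms by (intro sum_mono mult_left_mono dft_sq_le) auto
  also have "\<dots> = real n * (c * (\<Sum>s<n. (w s)\<^sup>2))"
    by (simp add: dft_parseval flip: sum_distrib_right)
  finally show ?thesis
    unfolding correlation_norm[OF assms(1)] using assms(1) by (simp add: pos_divide_le_eq mult_ac)
qed

text \<open>The same identity with exchanged roles: \<open>w\<close> has small Fourier coefficients
  and \<open>z\<close> enters through its norm. It serves the increments of the test vector in the
  bilinear form.\<close>

lemma correlation_le_right:
  assumes "n > 0" "\<And>\<kappa>. \<kappa> \<in> freqs n \<Longrightarrow> 2 * (\<Sum>j<n. w j * trig n \<kappa> j)\<^sup>2 \<le> c"
  shows "(\<Sum>l<n. (\<Sum>s<n. z (cyc_diff n s l) * w s)\<^sup>2) \<le> c * (\<Sum>s<n. (z s)\<^sup>2)"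
proof -
  have "(\<Sum>k<n. (cmod (dft n w k))\<^sup>2 * (cmod (dft n z k))\<^sup>2) \<le> (\<Sum>k<n. c * (cmod (dft n z k))\<^sup>2)"
    using assms by (intro sum_mono mult_right_mono dft_sq_le) auto
  also have "\<dots> = real n * (c * (\<Sum>s<n. (z s)\<^sup>2))"
    by (simp add: dft_parseval flip: sum_distrib_left)
  finally show ?thesis
    unfolding correlation_norm[OF assms(1)] using assms(1) by (simp add: pos_divide_le_eq mult_ac)
qed

subsection \<open>Nets of the sparse ball\<close>

text \<open>The function t^2 / 2 - ln (cosh t) vanishes at 0 and has derivative t - tanh t, which is
  nonnegative for t >= 0 by the auxiliary bound \<open>h\<close>.\<close>

lemma cosh_le_exp_sq: "cosh (x::real) \<le> exp (x\<^sup>2 / 2)"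
proof -
  have main: "cosh x \<le> exp (x\<^sup>2 / 2)" if "x \<ge> 0" for x :: real
  proof -
    have h: "sinh y \<le> y * cosh y" if "y \<ge> 0" for y :: real
    proof -
      have "(\<lambda>t. t * cosh t - sinh t) 0 \<le> (\<lambda>t. t * cosh t - sinh t) y"
      proof (rule DERIV_nonneg_imp_nondecreasing[OF that])
        fix t :: real assume "0 \<le> t" "t \<le> y"
        moreover have "((\<lambda>t. t * cosh t - sinh t) has_real_derivative t * sinh t) (at t)"
          by (auto intro!: derivative_eq_intros)
        ultimately show "\<exists>d. ((\<lambda>t. t * cosh t - sinh t) has_real_derivative d) (at t) \<and> 0 \<le> d"
          by (intro exI[of _ "t * sinh t"]) auto
      qed
      then show ?thesis by simp
    qed
    have "(\<lambda>t. t\<^sup>2 / 2 - ln (cosh t)) 0 \<le> (\<lambda>t. t\<^sup>2 / 2 - ln (cosh t)) x"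
    proof (rule DERIV_nonneg_imp_nondecreasing[OF that])
      fix t :: real assume t: "0 \<le> t" "t \<le> x"
      have pos: "cosh t > 0" by (rule cosh_real_pos)
      have "((\<lambda>t. t\<^sup>2 / 2 - ln (cosh t)) has_real_derivative t - sinh t / cosh t) (at t)"
        using pos by (auto intro!: derivative_eq_intros)
      moreover have "sinh t / cosh t \<le> t"
        using h[OF t(1)] pos by (simp add: pos_divide_le_eq)
      ultimately show "\<exists>d. ((\<lambda>t. t\<^sup>2 / 2 - ln (cosh t)) has_real_derivative d) (at t) \<and> 0 \<le> d"
        by (intro exI[of _ "t - sinh t / cosh t"]) auto
    qed
    then have "ln (cosh x) \<le> x\<^sup>2 / 2" by simp
    then show ?thesis
      using cosh_real_pos[of x] by (metis exp_le_cancel_iff exp_ln)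
  qed
  show ?thesis using main[of x] main[of "- x"] by (cases "x \<ge> 0") auto
qed

text \<open>Conditional expectations: averaging over the sign of one coordinate turns cosh (s + e b)
  into cosh s cosh b, and the weight exp (- b^2 / 2) pays for cosh b. One of the two signs is no
  worse than the average. The weights \<open>w\<close> and offsets \<open>s\<close> carry the
  coordinates already treated through the induction.\<close>

lemma exists_signs_potential:
  fixes \<beta> :: "'k \<Rightarrow> 'i \<Rightarrow> real"
  assumes "finite S" "\<And>\<kappa>. w \<kappa> \<ge> 0"
  shows "\<exists>\<eta>. (\<forall>i. \<eta> i = 1 \<or> \<eta> i = - 1) \<and>
    (\<Sum>\<kappa>\<in>C. w \<kappa> * exp (- (\<Sum>i\<in>S. (\<beta> \<kappa> i)\<^sup>2) / 2) * cosh (s \<kappa> + (\<Sum>i\<in>S. \<eta> i * \<beta> \<kappa> i)))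
     \<le> (\<Sum>\<kappa>\<in>C. w \<kappa> * cosh (s \<kappa>))"
  using assms
proof (induction S arbitrary: w s)
  case empty
  then show ?case by (intro exI[of _ "\<lambda>_. 1"]) auto
next
  case (insert j S)
  define w' where "w' \<kappa> = w \<kappa> * exp (- (\<beta> \<kappa> j)\<^sup>2 / 2)" for \<kappa>
  have w': "w' \<kappa> \<ge> 0" for \<kappa> using insert.prems by (simp add: w'_def)
  have "(\<Sum>\<kappa>\<in>C. w' \<kappa> * cosh (s \<kappa> + \<beta> \<kappa> j)) + (\<Sum>\<kappa>\<in>C. w' \<kappa> * cosh (s \<kappa> - \<beta> \<kappa> j))
      = (\<Sum>\<kappa>\<in>C. 2 * (w' \<kappa> * cosh (\<beta> \<kappa> j) * cosh (s \<kappa>)))"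
    by (simp add: cosh_add cosh_diff sum.distrib[symmetric] algebra_simps)
  also have "\<dots> \<le> (\<Sum>\<kappa>\<in>C. 2 * (w \<kappa> * cosh (s \<kappa>)))"
  proof (intro sum_mono mult_left_mono mult_right_mono)
    fix \<kappa>
    have "w' \<kappa> * cosh (\<beta> \<kappa> j) \<le> w' \<kappa> * exp ((\<beta> \<kappa> j)\<^sup>2 / 2)"
      using w' cosh_le_exp_sq by (intro mult_left_mono) auto
    also have "\<dots> = w \<kappa>" by (simp add: w'_def mult.assoc flip: exp_add)
    finally show "w' \<kappa> * cosh (\<beta> \<kappa> j) \<le> w \<kappa>" .
  qed (auto simp: cosh_real_nonneg)
  finally have "(\<Sum>\<kappa>\<in>C. w' \<kappa> * cosh (s \<kappa> + \<beta> \<kappa> j)) \<le> (\<Sum>\<kappa>\<in>C. w \<kappa> * cosh (s \<kappa>)) \<or>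
    (\<Sum>\<kappa>\<in>C. w' \<kappa> * cosh (s \<kappa> - \<beta> \<kappa> j)) \<le> (\<Sum>\<kappa>\<in>C. w \<kappa> * cosh (s \<kappa>))"
    by (simp flip: sum_distrib_left) linarith
  then have "\<exists>e::real. (e = 1 \<or> e = - 1) \<and>
      (\<Sum>\<kappa>\<in>C. w' \<kappa> * cosh (s \<kappa> + e * \<beta> \<kappa> j)) \<le> (\<Sum>\<kappa>\<in>C. w \<kappa> * cosh (s \<kappa>))"
  proof
    assume "(\<Sum>\<kappa>\<in>C. w' \<kappa> * cosh (s \<kappa> + \<beta> \<kappa> j)) \<le> (\<Sum>\<kappa>\<in>C. w \<kappa> * cosh (s \<kappa>))"
    then show ?thesis by (intro exI[of _ 1]) simp
  next
    assume "(\<Sum>\<kappa>\<in>C. w' \<kappa> * cosh (s \<kappa> - \<beta> \<kappa> j)) \<le> (\<Sum>\<kappa>\<in>C. w \<kappa> * cosh (s \<kappa>))"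
    then show ?thesis by (intro exI[of _ "- 1"]) simp
  qed
  then obtain e :: real where e: "e = 1 \<or> e = - 1"
    and le: "(\<Sum>\<kappa>\<in>C. w' \<kappa> * cosh (s \<kappa> + e * \<beta> \<kappa> j)) \<le> (\<Sum>\<kappa>\<in>C. w \<kappa> * cosh (s \<kappa>))"
    by blast
  from insert.IH[of w' "\<lambda>\<kappa>. s \<kappa> + e * \<beta> \<kappa> j", OF w'] obtain \<eta> where
    \<eta>: "\<forall>i. \<eta> i = 1 \<or> \<eta> i = - 1" and
    le': "(\<Sum>\<kappa>\<in>C. w' \<kappa> * exp (- (\<Sum>i\<in>S. (\<beta> \<kappa> i)\<^sup>2) / 2) * cosh (s \<kappa> + e * \<beta> \<kappa> j + (\<Sum>i\<in>S. \<eta> i * \<beta> \<kappa> i)))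
      \<le> (\<Sum>\<kappa>\<in>C. w' \<kappa> * cosh (s \<kappa> + e * \<beta> \<kappa> j))" by blast
  have up: "(\<Sum>i\<in>S. (\<eta>(j := e)) i * \<beta> \<kappa> i) = (\<Sum>i\<in>S. \<eta> i * \<beta> \<kappa> i)" for \<kappa>
    using insert.hyps by (intro sum.cong) auto
  have "w \<kappa> * exp (- (\<Sum>i\<in>insert j S. (\<beta> \<kappa> i)\<^sup>2) / 2) * cosh (s \<kappa> + (\<Sum>i\<in>insert j S. (\<eta>(j := e)) i * \<beta> \<kappa> i))
     = w' \<kappa> * exp (- (\<Sum>i\<in>S. (\<beta> \<kappa> i)\<^sup>2) / 2) * cosh (s \<kappa> + e * \<beta> \<kappa> j + (\<Sum>i\<in>S. \<eta> i * \<beta> \<kappa> i))" for \<kappa>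
  proof -
    have "exp (- (\<Sum>i\<in>insert j S. (\<beta> \<kappa> i)\<^sup>2) / 2) = exp (- (\<beta> \<kappa> j)\<^sup>2 / 2) * exp (- (\<Sum>i\<in>S. (\<beta> \<kappa> i)\<^sup>2) / 2)"
      using insert.hyps by (simp add: diff_divide_distrib flip: exp_add)
    then show ?thesis
      using insert.hyps by (simp add: w'_def up add.assoc mult.assoc del: fun_upd_apply) simp
  qed
  then show ?case
    using le le' \<eta> e by (intro exI[of _ "\<eta>(j := e)"]) auto
qed

text \<open>The minimum of the exponential potential over sign choices is at most its average; this replaces
  the sampling argument in the empirical method.\<close>

lemma exists_signs:
  fixes \<beta> :: "'k \<Rightarrow> 'i \<Rightarrow> real"
  assumes "finite S" "finite C" "C \<noteq> {}" "M \<ge> 0"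
    and \<beta>: "\<And>\<kappa>. \<kappa> \<in> C \<Longrightarrow> (\<Sum>i\<in>S. (\<beta> \<kappa> i)\<^sup>2) \<le> M\<^sup>2"
  shows "\<exists>\<eta>. (\<forall>i. \<eta> i = 1 \<or> \<eta> i = - 1) \<and>
    (\<forall>\<kappa>\<in>C. \<bar>\<Sum>i\<in>S. \<eta> i * \<beta> \<kappa> i\<bar> \<le> M * sqrt (2 * ln (2 * real (card C))))"
proof (cases "M = 0")
  case True
  then have "\<beta> \<kappa> i = 0" if "\<kappa> \<in> C" "i \<in> S" for \<kappa> i
    using \<beta>[OF that(1)] that assms(1) sum_nonneg_eq_0_iff[of S "\<lambda>i. (\<beta> \<kappa> i)\<^sup>2"]
    by (auto simp: order_antisym sum_nonneg)
  then show ?thesis using True by (intro exI[of _ "\<lambda>_. 1"]) auto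
next
  case False
  then have M: "M > 0" using assms by simp
  define N where "N = 2 * real (card C)"
  have N: "N \<ge> 2" using assms card_gt_0_iff[of C] by (simp add: N_def)
  define \<mu> where "\<mu> = sqrt (2 * ln N)"
  have \<mu>: "\<mu> > 0" using N by (simp add: \<mu>_def)
  \<comment> \<open>At this scale each weight is at least exp (- \<mu>^2 / 2), and \<mu>^2 / 2 = ln
    N. A potential of at most card C then forces |t v| <= ln N + \<mu>^2 / 2 = \<mu>^2, that is |v|
    <= M \<mu>.\<close>
  define t where "t = \<mu> / M"
  obtain \<eta> where \<eta>: "\<forall>i. \<eta> i = 1 \<or> \<eta> i = - 1" and
    le: "(\<Sum>\<kappa>\<in>C. 1 * exp (- (\<Sum>i\<in>S. (t * \<beta> \<kappa> i)\<^sup>2) / 2) * cosh (0 + (\<Sum>i\<in>S. \<eta> i * (t * \<beta> \<kappa> i))))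
      \<le> (\<Sum>\<kappa>\<in>C. 1 * cosh 0)"
    using exists_signs_potential[OF assms(1), where w = "\<lambda>_. 1" and \<beta> = "\<lambda>\<kappa> i. t * \<beta> \<kappa> i"
        and C = C and s = "\<lambda>_. 0"] by auto
  have "\<bar>\<Sum>i\<in>S. \<eta> i * \<beta> \<kappa> i\<bar> \<le> M * \<mu>" if \<kappa>: "\<kappa> \<in> C" for \<kappa>
  proof -
    define v where "v = (\<Sum>i\<in>S. \<eta> i * \<beta> \<kappa> i)"
    have v: "(\<Sum>i\<in>S. \<eta> i * (t * \<beta> \<kappa> i)) = t * v"
      by (simp add: v_def sum_distrib_left mult_ac)
    have "(\<Sum>i\<in>S. (t * \<beta> \<kappa> i)\<^sup>2) = t\<^sup>2 * (\<Sum>i\<in>S. (\<beta> \<kappa> i)\<^sup>2)"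
      by (simp add: power_mult_distrib sum_distrib_left)
    also have "\<dots> \<le> t\<^sup>2 * M\<^sup>2" using \<beta>[OF \<kappa>] by (intro mult_left_mono) auto
    also have "\<dots> = \<mu>\<^sup>2" using M by (simp add: t_def power_divide)
    finally have s: "(\<Sum>i\<in>S. (t * \<beta> \<kappa> i)\<^sup>2) \<le> \<mu>\<^sup>2" .
    have "exp (- \<mu>\<^sup>2 / 2) * cosh (t * v)
        \<le> exp (- (\<Sum>i\<in>S. (t * \<beta> \<kappa> i)\<^sup>2) / 2) * cosh (\<Sum>i\<in>S. \<eta> i * (t * \<beta> \<kappa> i))"
      unfolding v using s by (intro mult_right_mono) (auto simp: cosh_real_nonneg)
    also have "\<dots> \<le> (\<Sum>\<kappa>\<in>C. exp (- (\<Sum>i\<in>S. (t * \<beta> \<kappa> i)\<^sup>2) / 2) * cosh (\<Sum>i\<in>S. \<eta> i * (t * \<beta> \<kappa> i)))"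
      using \<kappa> assms(2) by (intro member_le_sum) (auto simp: cosh_real_nonneg)
    also have "\<dots> \<le> real (card C)" using le by simp
    finally have 1: "exp (- \<mu>\<^sup>2 / 2) * cosh (t * v) \<le> real (card C)" .
    have "exp \<bar>t * v\<bar> \<le> 2 * cosh (t * v)"
      by (auto simp: cosh_field_def abs_if)
    then have "exp (- \<mu>\<^sup>2 / 2) * exp \<bar>t * v\<bar> \<le> exp (- \<mu>\<^sup>2 / 2) * (2 * cosh (t * v))"
      by (intro mult_left_mono) auto
    also have "\<dots> \<le> N" using 1 by (simp add: N_def)
    finally have "exp (\<bar>t * v\<bar> - \<mu>\<^sup>2 / 2) \<le> exp (ln N)"
      using N by (simp flip: exp_add)
    then have "\<bar>t * v\<bar> - \<mu>\<^sup>2 / 2 \<le> ln N" by simp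
    also have "ln N = \<mu>\<^sup>2 / 2" using N by (simp add: \<mu>_def)
    finally have "\<bar>t * v\<bar> \<le> \<mu>\<^sup>2" by simp
    then have "t * \<bar>v\<bar> \<le> \<mu>\<^sup>2" using M \<mu> by (simp add: abs_mult t_def)
    then have "\<bar>v\<bar> \<le> M * \<mu>" using M \<mu> by (simp add: t_def field_simps power2_eq_square)
    then show ?thesis by (simp add: v_def)
  qed
  then show ?thesis using \<eta> by (auto simp: \<mu>_def N_def)
qed

text \<open>Moving the odd entries of c to even ones by signs \<eta> makes c - 2 c' equal to -
  \<eta> on the odd positions and 0 elsewhere, so balanced signs bound every functional of the
  difference. Each odd position uses up a unit of the l1 norm, so there are at most 2 L of
  them.\<close>

lemma halving:
  fixes c :: "nat \<Rightarrow> int" and \<alpha> :: "'k \<Rightarrow> nat \<Rightarrow> real"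
  assumes "finite C" "C \<noteq> {}" "A \<ge> 0" "q \<ge> 0"
    and \<alpha>: "\<And>\<kappa> S. \<lbrakk>\<kappa> \<in> C; S \<subseteq> {..<n}; card S \<le> r\<rbrakk> \<Longrightarrow> (\<Sum>i\<in>S. (\<alpha> \<kappa> i)\<^sup>2) \<le> A\<^sup>2 * (real (card S) + q)"
    and c: "card {i. i < n \<and> c i \<noteq> 0} \<le> r" "(\<Sum>i<n. \<bar>c i\<bar>) \<le> 2 * int L"
  shows "\<exists>c'. (\<forall>i. c i = 0 \<longrightarrow> c' i = 0) \<and> (\<Sum>i<n. \<bar>c' i\<bar>) \<le> int L \<and>
    (\<forall>\<kappa>\<in>C. \<bar>\<Sum>i<n. \<alpha> \<kappa> i * of_int (c i - 2 * c' i)\<bar>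
       \<le> A * sqrt (2 * real L + q) * sqrt (2 * ln (2 * real (card C))))"
proof -
  define D where "D = {i. i < n \<and> odd (c i)}"
  have D: "finite D" "D \<subseteq> {..<n}" by (auto simp: D_def)
  have "D \<subseteq> {i. i < n \<and> c i \<noteq> 0}" by (auto simp: D_def)
  then have "card D \<le> card {i. i < n \<and> c i \<noteq> 0}" by (intro card_mono) auto
  then have cr: "card D \<le> r" using c by linarith
  have "int (card D) = (\<Sum>i\<in>D. 1)" by simp
  also have "\<dots> \<le> (\<Sum>i\<in>D. \<bar>c i\<bar>)"
  proof (rule sum_mono)
    fix i assume "i \<in> D"
    then have "c i \<noteq> 0" by (auto simp: D_def)
    then show "1 \<le> \<bar>c i\<bar>" by linarith
  qed
  also have "\<dots> \<le> (\<Sum>i<n. \<bar>c i\<bar>)" using D by (intro sum_mono2) auto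
  finally have "int (card D) \<le> 2 * int L" using c by linarith
  then have cL: "real (card D) \<le> 2 * real L" by linarith
  have b: "(\<Sum>i\<in>D. (\<alpha> \<kappa> i)\<^sup>2) \<le> (A * sqrt (2 * real L + q))\<^sup>2" if "\<kappa> \<in> C" for \<kappa>
  proof -
    have "(\<Sum>i\<in>D. (\<alpha> \<kappa> i)\<^sup>2) \<le> A\<^sup>2 * (real (card D) + q)" using \<alpha>[OF that D(2) cr] .
    also have "\<dots> \<le> A\<^sup>2 * (2 * real L + q)" using cL by (intro mult_left_mono) auto
    finally show ?thesis using assms by (simp add: power_mult_distrib)
  qed
  obtain \<eta>0 where \<eta>0: "\<forall>i. \<eta>0 i = 1 \<or> \<eta>0 i = (- 1::real)" and
    bd0: "\<forall>\<kappa>\<in>C. \<bar>\<Sum>i\<in>D. \<eta>0 i * \<alpha> \<kappa> i\<bar> \<le> A * sqrt (2 * real L + q) * sqrt (2 * ln (2 * real (card C)))"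
    using exists_signs[OF D(1) assms(1,2), of "A * sqrt (2 * real L + q)" \<alpha>] b assms(3,4) by auto
  define \<eta>1 :: "nat \<Rightarrow> int" where "\<eta>1 i = (if \<eta>0 i = 1 then 1 else - 1)" for i
  have \<eta>1: "\<eta>0 i = of_int (\<eta>1 i)" for i using \<eta>0[rule_format, of i] by (auto simp: \<eta>1_def)
  \<comment> \<open>The balance bound is invariant under a global change of sign. This freedom is
    spent on keeping the l1 norm from growing, since |c + \<eta>| = |c| + \<eta> sgn c at an odd
    entry.\<close>
  define \<eta> where "\<eta> i = (if (\<Sum>i\<in>D. \<eta>1 i * sgn (c i)) \<le> 0 then \<eta>1 i else - \<eta>1 i)" for i
  have \<eta>pm: "\<eta> i = 1 \<or> \<eta> i = - 1" for i by (auto simp: \<eta>_def \<eta>1_def)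
  have \<eta>neg: "(\<Sum>i\<in>D. \<eta> i * sgn (c i)) \<le> 0"
  proof (cases "(\<Sum>i\<in>D. \<eta>1 i * sgn (c i)) \<le> 0")
    case False
    then have "\<eta> i = - \<eta>1 i" for i by (simp add: \<eta>_def)
    then show ?thesis using False by (simp add: sum_negf)
  qed (simp add: \<eta>_def)
  have bd: "\<bar>\<Sum>i\<in>D. \<eta> i * \<alpha> \<kappa> i\<bar> \<le> A * sqrt (2 * real L + q) * sqrt (2 * ln (2 * real (card C)))"
    if "\<kappa> \<in> C" for \<kappa>
  proof (cases "(\<Sum>i\<in>D. \<eta>1 i * sgn (c i)) \<le> 0")
    case False
    then have "\<eta> i = - \<eta>1 i" for i by (simp add: \<eta>_def)
    then show ?thesis using bd0[rule_format, OF that] by (simp add: sum_negf \<eta>1)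
  next
    case True
    then have "\<eta> i = \<eta>1 i" for i by (simp add: \<eta>_def)
    then show ?thesis using bd0[rule_format, OF that] by (simp add: \<eta>1)
  qed
  define c' where "c' i = (if i \<in> D then (c i + \<eta> i) div 2 else if i < n then c i div 2 else 0)" for i
  have c'2: "2 * c' i = (if i \<in> D then c i + \<eta> i else c i)" if "i < n" for i
  proof (cases "i \<in> D")
    case True
    then have "even (c i + \<eta> i)" using \<eta>pm[of i] by (auto simp: D_def)
    then show ?thesis using True by (simp add: c'_def)
  qed (use that in \<open>auto simp: c'_def D_def\<close>)
  have supp: "c i = 0 \<longrightarrow> c' i = 0" for i by (auto simp: c'_def D_def)
  have "2 * (\<Sum>i<n. \<bar>c' i\<bar>) = (\<Sum>i<n. \<bar>2 * c' i\<bar>)" by (simp add: sum_distrib_left abs_mult)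
  also have "\<dots> = (\<Sum>i<n. \<bar>c i\<bar> + (if i \<in> D then \<eta> i * sgn (c i) else 0))"
  proof (rule sum.cong[OF refl])
    fix i assume i: "i \<in> {..<n}"
    show "\<bar>2 * c' i\<bar> = \<bar>c i\<bar> + (if i \<in> D then \<eta> i * sgn (c i) else 0)"
    proof (cases "i \<in> D")
      case True
      then have "c i \<noteq> 0" by (auto simp: D_def)
      then show ?thesis using True c'2[of i] i \<eta>pm[of i] by (auto simp: sgn_if abs_if)
    qed (use c'2[of i] i in auto)
  qed
  also have "\<dots> = (\<Sum>i<n. \<bar>c i\<bar>) + (\<Sum>i\<in>D. \<eta> i * sgn (c i))"
    using D by (simp add: sum.distrib sum.inter_restrict[symmetric] Int_absorb1)
  also have "\<dots> \<le> 2 * int L" using c(2) \<eta>neg by linarith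
  finally have l1: "(\<Sum>i<n. \<bar>c' i\<bar>) \<le> int L" by linarith
  have "(\<Sum>i<n. \<alpha> \<kappa> i * of_int (c i - 2 * c' i)) = - (\<Sum>i\<in>D. \<eta> i * \<alpha> \<kappa> i)" for \<kappa>
  proof -
    have "(\<Sum>i<n. \<alpha> \<kappa> i * of_int (c i - 2 * c' i)) = (\<Sum>i<n. if i \<in> D then - (\<eta> i * \<alpha> \<kappa> i) else 0)"
      by (rule sum.cong) (auto simp: c'2)
    also have "\<dots> = (\<Sum>i\<in>D. - (\<eta> i * \<alpha> \<kappa> i))"
      using D by (simp add: sum.inter_restrict[symmetric] Int_absorb1)
    finally show ?thesis by (simp add: sum_negf)
  qed
  then show ?thesis using supp l1 bd by (intro exI[of _ c']) auto
qed

section \<open>Integer vectors of bounded l1 norm and truncation to a grid\<close>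

definition int_ball :: "nat \<Rightarrow> nat \<Rightarrow> (nat \<Rightarrow> int) set" where
  "int_ball n L = {c. (\<forall>i\<ge>n. c i = 0) \<and> (\<Sum>i<n. \<bar>c i\<bar>) \<le> int L}"

text \<open>A vector of l1 norm at most L + 1 is one of 2n + 1 steps, zero or a signed unit vector,
  plus a vector of l1 norm at most L. The entropy is thus linear in the l1 norm, up to a
  logarithm.\<close>

lemma int_ball_card: "finite (int_ball n L) \<and> card (int_ball n L) \<le> (2 * n + 1) ^ L"
proof (induction L)
  case 0
  have "int_ball n 0 \<subseteq> {\<lambda>_. 0}"
  proof
    fix c assume "c \<in> int_ball n 0"
    then have c: "\<forall>i\<ge>n. c i = 0" "(\<Sum>i<n. \<bar>c i\<bar>) = 0"
      by (auto simp: int_ball_def order_antisym sum_nonneg)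
    then have "\<forall>i<n. c i = 0" by (simp add: sum_nonneg_eq_0_iff)
    then show "c \<in> {\<lambda>_. 0}" using c(1) by (auto simp: fun_eq_iff) (meson not_le)
  qed
  then have "finite (int_ball n 0)" "card (int_ball n 0) \<le> card {\<lambda>_::nat. 0::int}"
    by (rule finite_subset, simp) (rule card_mono, simp, fact)
  then show ?case by simp
next
  case (Suc L)
  define E where "E = insert (\<lambda>_. 0) ((\<lambda>(i, b). (\<lambda>_. 0::int)(i := (if b then 1 else - 1))) ` ({..<n} \<times> (UNIV::bool set)))"
  have E: "finite E" by (simp add: E_def)
  have "card E \<le> Suc (card ({..<n} \<times> (UNIV::bool set)))"
    unfolding E_def using card_image_le[of "{..<n} \<times> (UNIV::bool set)"]
    by (subst card_insert_if) (auto simp: le_SucI)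
  then have cE: "card E \<le> 2 * n + 1" by (simp add: card_cartesian_product)
  have "int_ball n (Suc L) \<subseteq> (\<lambda>(e, c) i. e i + c i) ` (E \<times> int_ball n L)"
  proof
    fix c assume c: "c \<in> int_ball n (Suc L)"
    show "c \<in> (\<lambda>(e, c) i. e i + c i) ` (E \<times> int_ball n L)"
    proof (cases "\<exists>i<n. c i \<noteq> 0")
      case False
      then have "c \<in> int_ball n L" using c by (auto simp: int_ball_def)
      then show ?thesis by (intro image_eqI[of _ _ "(\<lambda>_. 0, c)"]) (auto simp: E_def)
    next
      case True
      then obtain i where i: "i < n" "c i \<noteq> 0" by blast
      define e where "e = (\<lambda>_. 0::int)(i := sgn (c i))"
      have "e \<in> E"
        unfolding E_def e_def using i
        by (intro insertI2 image_eqI[of _ _ "(i, c i > 0)"]) (auto simp: sgn_if)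
      moreover have "(\<lambda>j. c j - e j) \<in> int_ball n L"
      proof -
        have "(\<Sum>j<n. \<bar>c j - e j\<bar>) = (\<Sum>j<n. \<bar>c j\<bar> - (if j = i then 1 else 0))"
          using i by (intro sum.cong) (auto simp: e_def sgn_if)
        also have "\<dots> = (\<Sum>j<n. \<bar>c j\<bar>) - 1" using i by (simp add: sum_subtractf)
        finally show ?thesis using c i by (auto simp: int_ball_def e_def)
      qed
      ultimately show ?thesis
        by (intro image_eqI[of _ _ "(e, \<lambda>j. c j - e j)"]) auto
    qed
  qed
  moreover have fin: "finite (E \<times> int_ball n L)" using E Suc by auto
  ultimately have "finite (int_ball n (Suc L))"
    "card (int_ball n (Suc L)) \<le> card (E \<times> int_ball n L)"
    using finite_subset surj_card_le[OF fin] by auto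
  moreover have "card (E \<times> int_ball n L) \<le> (2 * n + 1) * (2 * n + 1) ^ L"
    unfolding card_cartesian_product using cE Suc by (intro mult_mono) auto
  ultimately show ?case by simp
qed

text \<open>Total functions vanishing from n on stand for vectors. The ball is used rather than the
  sphere because truncations and rescaled chain remainders have to stay in the family.\<close>

definition sparse_fun :: "nat \<Rightarrow> nat \<Rightarrow> (nat \<Rightarrow> real) set" where
  "sparse_fun n r = {x. (\<forall>i\<ge>n. x i = 0) \<and> card {i. x i \<noteq> 0} \<le> r \<and> (\<Sum>i<n. (x i)\<^sup>2) \<le> 1}"

lemma sparse_fun_supp:
  assumes "x \<in> sparse_fun n r"
  shows "{i. x i \<noteq> 0} \<subseteq> {..<n}" "finite {i. x i \<noteq> 0}" "card {i. x i \<noteq> 0} \<le> r"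
proof -
  show *: "{i. x i \<noteq> 0} \<subseteq> {..<n}" using assms unfolding sparse_fun_def by (auto simp: not_less[symmetric])
  show "finite {i. x i \<noteq> 0}" by (rule finite_subset[OF *]) simp
  show "card {i. x i \<noteq> 0} \<le> r" using assms by (simp add: sparse_fun_def)
qed

lemma sum_abs_sparse_le:
  assumes x: "x \<in> sparse_fun n r"
  shows "(\<Sum>i<n. \<bar>x i\<bar>) \<le> sqrt (real r)"
proof -
  let ?S = "{i. x i \<noteq> 0}"
  note S = sparse_fun_supp[OF x]
  have "(\<Sum>i<n. \<bar>x i\<bar>) = (\<Sum>i\<in>?S. 1 * \<bar>x i\<bar>)"
    using S by (intro sum.mono_neutral_cong_right) auto
  also have "\<dots> \<le> sqrt (\<Sum>i\<in>?S. 1\<^sup>2) * sqrt (\<Sum>i\<in>?S. (\<bar>x i\<bar>)\<^sup>2)"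
    using L2_set_mult_ineq[of "\<lambda>_. 1" "\<lambda>i. \<bar>x i\<bar>" ?S] by (simp add: L2_set_def)
  also have "(\<Sum>i\<in>?S. (\<bar>x i\<bar>)\<^sup>2) = (\<Sum>i<n. (x i)\<^sup>2)"
    using S by (intro sum.mono_neutral_cong_left) auto
  also have "sqrt (\<Sum>i\<in>?S. 1\<^sup>2) * sqrt (\<Sum>i<n. (x i)\<^sup>2) \<le> sqrt (real r) * 1"
    using S x by (intro mult_mono) (auto simp: sparse_fun_def sum_nonneg)
  finally show ?thesis by simp
qed

text \<open>Rounding towards zero, so that neither the support nor the norm grows.\<close>

definition grid_trunc :: "real \<Rightarrow> (nat \<Rightarrow> real) \<Rightarrow> nat \<Rightarrow> int" where
  "grid_trunc h x i = (if x i < 0 then - \<lfloor>- x i / h\<rfloor> else \<lfloor>x i / h\<rfloor>)"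

lemma grid_trunc:
  assumes "h > 0"
  shows "\<bar>h * of_int (grid_trunc h x i)\<bar> \<le> \<bar>x i\<bar>" "\<bar>x i - h * of_int (grid_trunc h x i)\<bar> \<le> h"
    "x i = 0 \<Longrightarrow> grid_trunc h x i = 0"
proof -
  define y where "y = \<bar>x i\<bar>"
  have y: "y \<ge> 0" by (simp add: y_def)
  have f: "of_int \<lfloor>y / h\<rfloor> \<le> y / h" "y / h < of_int \<lfloor>y / h\<rfloor> + 1" "\<lfloor>y / h\<rfloor> \<ge> 0"
    using assms y by simp_all
  have f1: "h * of_int \<lfloor>y / h\<rfloor> \<le> y"
    using mult_left_mono[OF f(1), of h] assms by simp
  have f2: "y \<le> h * of_int \<lfloor>y / h\<rfloor> + h" using f(2) assms by (simp add: pos_divide_less_eq algebra_simps)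
  have f3: "0 \<le> h * of_int \<lfloor>y / h\<rfloor>" using f(3) assms by simp
  have "\<bar>h * of_int (grid_trunc h x i)\<bar> \<le> \<bar>x i\<bar> \<and> \<bar>x i - h * of_int (grid_trunc h x i)\<bar> \<le> h"
  proof (cases "x i < 0")
    case True
    then have "y = - x i" by (simp add: y_def)
    then have "h * of_int (grid_trunc h x i) = - (h * of_int \<lfloor>y / h\<rfloor>)"
      using True by (simp add: grid_trunc_def)
    then show ?thesis using True \<open>y = - x i\<close> f1 f2 f3 y by linarith
  next
    case False
    then have "y = x i" by (simp add: y_def)
    then have "h * of_int (grid_trunc h x i) = h * of_int \<lfloor>y / h\<rfloor>"
      using False by (simp add: grid_trunc_def)
    then show ?thesis using False \<open>y = x i\<close> f1 f2 f3 y by linarith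
  qed
  then show "\<bar>h * of_int (grid_trunc h x i)\<bar> \<le> \<bar>x i\<bar>" "\<bar>x i - h * of_int (grid_trunc h x i)\<bar> \<le> h"
    by blast+
  show "x i = 0 \<Longrightarrow> grid_trunc h x i = 0" by (simp add: grid_trunc_def)
qed

lemma grid_trunc_sparse:
  assumes "h > 0" "x \<in> sparse_fun n r"
  shows "(\<lambda>i. h * of_int (grid_trunc h x i)) \<in> sparse_fun n r"
    "(\<Sum>i<n. (x i - h * of_int (grid_trunc h x i))\<^sup>2) \<le> real r * h\<^sup>2"
    "h * of_int (\<Sum>i<n. \<bar>grid_trunc h x i\<bar>) \<le> sqrt (real r)"
    "card {i. x i - h * of_int (grid_trunc h x i) \<noteq> 0} \<le> r"
proof -
  note g = grid_trunc[OF assms(1)]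
  note S = sparse_fun_supp[OF assms(2)]
  have sub: "{i. h * of_int (grid_trunc h x i) \<noteq> 0} \<subseteq> {i. x i \<noteq> 0}" using g(3) by auto
  have "(\<Sum>i<n. (h * of_int (grid_trunc h x i))\<^sup>2) \<le> (\<Sum>i<n. (x i)\<^sup>2)"
    using g(1) by (intro sum_mono) (metis abs_le_square_iff)
  then show "(\<lambda>i. h * of_int (grid_trunc h x i)) \<in> sparse_fun n r"
    using assms(2) card_mono[OF S(2) sub] g(3) by (auto simp: sparse_fun_def)
  have sub2: "{i. x i - h * of_int (grid_trunc h x i) \<noteq> 0} \<subseteq> {i. x i \<noteq> 0}" using g(3) by auto
  show "card {i. x i - h * of_int (grid_trunc h x i) \<noteq> 0} \<le> r"
    using card_mono[OF S(2) sub2] S(3) by linarith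
  have "(\<Sum>i<n. (x i - h * of_int (grid_trunc h x i))\<^sup>2) = (\<Sum>i\<in>{i. x i \<noteq> 0}. (x i - h * of_int (grid_trunc h x i))\<^sup>2)"
    using S g(3) by (intro sum.mono_neutral_cong_right) auto
  also have "\<dots> \<le> (\<Sum>i\<in>{i. x i \<noteq> 0}. h\<^sup>2)"
    using g(2) assms(1) by (intro sum_mono) (metis abs_le_square_iff abs_of_pos)
  also have "\<dots> \<le> real r * h\<^sup>2" using S(3) by (simp add: mult_right_mono)
  finally show "(\<Sum>i<n. (x i - h * of_int (grid_trunc h x i))\<^sup>2) \<le> real r * h\<^sup>2" .
  have "h * of_int (\<Sum>i<n. \<bar>grid_trunc h x i\<bar>) = (\<Sum>i<n. \<bar>h * of_int (grid_trunc h x i)\<bar>)"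
    using assms(1) by (simp add: sum_distrib_left abs_mult)
  also have "\<dots> \<le> (\<Sum>i<n. \<bar>x i\<bar>)" using g(1) by (intro sum_mono)
  also have "\<dots> \<le> sqrt (real r)" by (rule sum_abs_sparse_le[OF assms(2)])
  finally show "h * of_int (\<Sum>i<n. \<bar>grid_trunc h x i\<bar>) \<le> sqrt (real r)" .
qed

text \<open>A recursion downwards from the truncation at level J: each step halves the coefficients
  while the mesh \<open>h\<close> doubles. The halving that produces level k costs at most (sqrt 6 /
  2) b k, and b (k + 1) = b k / sqrt 2, so the costs form a geometric series; 5 satisfies 5 / sqrt 2
  + sqrt 6 / 2 <= 5. The slack \<open>real L\<close> in the energy never exceeds the l1 budget of a
  level and costs only a constant.\<close>

lemma halving_chain:
  fixes \<alpha> :: "'k \<Rightarrow> nat \<Rightarrow> real" and x :: "nat \<Rightarrow> real" and J :: nat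
  assumes C: "finite C" "C \<noteq> {}" and A: "A \<ge> 0" and L: "L \<ge> 1" and r: "r \<ge> 1"
    and \<alpha>: "\<And>\<kappa> S. \<lbrakk>\<kappa> \<in> C; S \<subseteq> {..<n}; card S \<le> r\<rbrakk> \<Longrightarrow> (\<Sum>i\<in>S. (\<alpha> \<kappa> i)\<^sup>2) \<le> A\<^sup>2 * (real (card S) + real L)"
    and x: "x \<in> sparse_fun n r"
  defines "h \<equiv> \<lambda>k. sqrt (real r) / real (L * 2 ^ k)"
    and "b \<equiv> \<lambda>k. A * sqrt (real r) * sqrt (ln (2 * real (card C)) / real (L * 2 ^ k))"
  defines "x0 \<equiv> \<lambda>i. h J * of_int (grid_trunc (h J) x i)"
  assumes k: "k \<le> J"
  shows "\<exists>c\<in>int_ball n (L * 2 ^ k). (\<forall>i. x i = 0 \<longrightarrow> c i = 0) \<and>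
    (k = J \<longrightarrow> (\<forall>i. h k * of_int (c i) = x0 i)) \<and>
    (\<forall>\<kappa>\<in>C. \<bar>\<Sum>i<n. \<alpha> \<kappa> i * (x0 i - h k * of_int (c i))\<bar> \<le> 5 * b k)"
  using k
proof (induction rule: inc_induct)
  case base
  have h: "h J > 0" using L r by (simp add: h_def)
  have b: "b J \<ge> 0" using A C card_gt_0_iff[of C] by (auto simp: b_def intro!: mult_nonneg_nonneg divide_nonneg_nonneg)
  have "h J * of_int (\<Sum>i<n. \<bar>grid_trunc (h J) x i\<bar>) \<le> h J * real (L * 2 ^ J)"
    using grid_trunc_sparse(3)[OF h x] L r by (simp add: h_def)
  then have "of_int (\<Sum>i<n. \<bar>grid_trunc (h J) x i\<bar>) \<le> real (L * 2 ^ J)"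
    using h by (simp only: mult_le_cancel_left_pos)
  then have "(\<Sum>i<n. \<bar>grid_trunc (h J) x i\<bar>) \<le> int (L * 2 ^ J)"
    by (metis of_int_le_iff of_int_of_nat_eq)
  then have "grid_trunc (h J) x \<in> int_ball n (L * 2 ^ J)"
    using x grid_trunc(3)[OF h] by (auto simp: int_ball_def sparse_fun_def)
  then show ?case
    using grid_trunc(3)[OF h] b by (intro bexI[of _ "grid_trunc (h J) x"]) (auto simp: x0_def)
next
  case (step k)
  then obtain c where c: "c \<in> int_ball n (L * 2 ^ Suc k)" "\<And>i. x i = 0 \<Longrightarrow> c i = 0"
    "\<And>\<kappa>. \<kappa> \<in> C \<Longrightarrow> \<bar>\<Sum>i<n. \<alpha> \<kappa> i * (x0 i - h (Suc k) * of_int (c i))\<bar> \<le> 5 * b (Suc k)"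
    by blast
  note S = sparse_fun_supp[OF x]
  have "{i. i < n \<and> c i \<noteq> 0} \<subseteq> {i. x i \<noteq> 0}" using c(2) by auto
  then have h1: "card {i. i < n \<and> c i \<noteq> 0} \<le> r"
    using card_mono[OF S(2)] S(3) order_trans by blast
  have h2: "(\<Sum>i<n. \<bar>c i\<bar>) \<le> 2 * int (L * 2 ^ k)"
    using c(1) by (simp add: int_ball_def)
  have "\<exists>c'. (\<forall>i. c i = 0 \<longrightarrow> c' i = 0) \<and> (\<Sum>i<n. \<bar>c' i\<bar>) \<le> int (L * 2 ^ k) \<and>
    (\<forall>\<kappa>\<in>C. \<bar>\<Sum>i<n. \<alpha> \<kappa> i * of_int (c i - 2 * c' i)\<bar>
       \<le> A * sqrt (2 * real (L * 2 ^ k) + real L) * sqrt (2 * ln (2 * real (card C))))"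
    by (rule halving[OF C A of_nat_0_le_iff \<alpha> h1 h2])
  then obtain c' where c': "\<And>i. c i = 0 \<Longrightarrow> c' i = 0" "(\<Sum>i<n. \<bar>c' i\<bar>) \<le> int (L * 2 ^ k)"
    and c'3: "\<forall>\<kappa>\<in>C. \<bar>\<Sum>i<n. \<alpha> \<kappa> i * of_int (c i - 2 * c' i)\<bar>
       \<le> A * sqrt (2 * real (L * 2 ^ k) + real L) * sqrt (2 * ln (2 * real (card C)))"
    by (elim exE conjE) blast
  define l where "l = ln (2 * real (card C))"
  have l: "l \<ge> 0" using C card_gt_0_iff[of C] by (simp add: l_def)
  define N where "N = real (L * 2 ^ k)"
  have N: "N > 0" "real L \<le> N" using L by (auto simp: N_def)
  have hk: "h k = 2 * h (Suc k)" by (simp add: h_def)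
  have hS: "h (Suc k) = sqrt (real r) / (2 * N)" by (simp add: h_def N_def mult_ac)
  have bk: "b k = A * sqrt (real r) * sqrt (l / N)" by (simp add: b_def l_def N_def)
  have bS: "b (Suc k) = b k / sqrt 2" by (simp add: b_def l_def N_def real_sqrt_divide real_sqrt_mult)
  have b0: "b k \<ge> 0" using A l N by (simp add: bk)
  have hp: "h (Suc k) \<ge> 0" using N by (simp add: hS)
  have "\<bar>\<Sum>i<n. \<alpha> \<kappa> i * (x0 i - h k * of_int (c' i))\<bar> \<le> 5 * b k" if \<kappa>: "\<kappa> \<in> C" for \<kappa>
  proof -
    have "(\<Sum>i<n. \<alpha> \<kappa> i * (x0 i - h k * of_int (c' i)))
       = (\<Sum>i<n. \<alpha> \<kappa> i * (x0 i - h (Suc k) * of_int (c i))) + h (Suc k) * (\<Sum>i<n. \<alpha> \<kappa> i * of_int (c i - 2 * c' i))"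
      by (simp add: hk sum_distrib_left algebra_simps flip: sum.distrib)
    also have "\<bar>\<dots>\<bar> \<le> \<bar>\<Sum>i<n. \<alpha> \<kappa> i * (x0 i - h (Suc k) * of_int (c i))\<bar>
        + \<bar>h (Suc k) * (\<Sum>i<n. \<alpha> \<kappa> i * of_int (c i - 2 * c' i))\<bar>"
      by (rule abs_triangle_ineq)
    also have "\<bar>h (Suc k) * (\<Sum>i<n. \<alpha> \<kappa> i * of_int (c i - 2 * c' i))\<bar>
        \<le> h (Suc k) * (A * sqrt (2 * N + real L) * sqrt (2 * l))"
      unfolding abs_mult abs_of_nonneg[OF hp] N_def l_def
      by (rule mult_left_mono[OF c'3[rule_format, OF \<kappa>] hp])
    also have "\<dots> \<le> h (Suc k) * (A * sqrt (3 * N) * sqrt (2 * l))"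
      using N A l hp by (intro mult_left_mono mult_right_mono) auto
    also have "\<dots> = (sqrt 6 / 2) * b k"
    proof -
      have "sqrt (3 * N) * sqrt (2 * l) = sqrt (6 * (l / N) * N\<^sup>2)"
        using N by (simp add: power2_eq_square flip: real_sqrt_mult)
      also have "\<dots> = sqrt 6 * sqrt (l / N) * N"
        using N by (simp only: real_sqrt_mult real_sqrt_abs abs_of_pos)
      finally have *: "sqrt (3 * N) * sqrt (2 * l) = sqrt 6 * sqrt (l / N) * N" .
      have "h (Suc k) * (A * sqrt (3 * N) * sqrt (2 * l)) = h (Suc k) * (A * (sqrt (3 * N) * sqrt (2 * l)))"
        by (simp only: mult.assoc)
      also have "\<dots> = (sqrt 6 / 2) * b k"
        unfolding * hS bk using N by simp
      finally show ?thesis .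
    qed
    also have "\<bar>\<Sum>i<n. \<alpha> \<kappa> i * (x0 i - h (Suc k) * of_int (c i))\<bar> \<le> 5 * (b k / sqrt 2)"
      using c(3)[OF \<kappa>] by (simp only: bS)
    also have "5 * (b k / sqrt 2) + sqrt 6 / 2 * b k = (5 / sqrt 2 + sqrt 6 / 2) * b k"
      by (simp add: algebra_simps)
    also have "\<dots> \<le> 5 * b k"
    proof (intro mult_right_mono b0)
      have "sqrt 6 \<le> 5/2" by (rule real_le_lsqrt) (auto simp: power2_eq_square)
      moreover have "5 / sqrt 2 \<le> 5 / (7/5)"
        by (intro divide_left_mono real_le_rsqrt) (auto simp: power2_eq_square)
      ultimately show "5 / sqrt 2 + sqrt 6 / 2 \<le> 5" by simp
    qed
    finally show ?thesis by simp
  qed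
  moreover have "c' \<in> int_ball n (L * 2 ^ k)"
    using c'(1,2) c(1) by (auto simp: int_ball_def)
  ultimately show ?case using c(2) c'(1) step.hyps by (intro bexI[of _ c']) auto
qed

text \<open>A net element is a vector of the sparse ball closest to a grid vector, so that the chain never
  leaves the sparse ball although the grid vectors may have large Euclidean norm.\<close>

lemma sparse_nets:
  fixes \<alpha> :: "'k \<Rightarrow> nat \<Rightarrow> real" and J :: nat
  assumes C: "finite C" "C \<noteq> {}" and A: "A \<ge> 0" and L: "L \<ge> 1" and r: "r \<ge> 1"
    and \<alpha>: "\<And>\<kappa> S. \<lbrakk>\<kappa> \<in> C; S \<subseteq> {..<n}; card S \<le> r\<rbrakk> \<Longrightarrow> (\<Sum>i\<in>S. (\<alpha> \<kappa> i)\<^sup>2) \<le> A\<^sup>2 * (real (card S) + real L)"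
  defines "b \<equiv> \<lambda>k. A * sqrt (real r) * sqrt (ln (2 * real (card C)) / real (L * 2 ^ k))"
  shows "\<exists>P. (\<forall>k. finite (P k) \<and> P k \<subseteq> sparse_fun n r \<and> card (P k) \<le> (2 * n + 1) ^ (L * 2 ^ k)) \<and>
    (\<forall>x\<in>sparse_fun n r. \<exists>\<pi>. (\<forall>k\<le>J. \<pi> k \<in> P k) \<and>
       (\<forall>k<J. \<forall>\<kappa>\<in>C. \<bar>\<Sum>i<n. \<alpha> \<kappa> i * (\<pi> k i - \<pi> (Suc k) i)\<bar> \<le> 20 * b k) \<and>
       (\<forall>i\<ge>n. x i - \<pi> J i = 0) \<and> card {i. x i - \<pi> J i \<noteq> 0} \<le> r \<and>
       (\<Sum>i<n. (x i - \<pi> J i)\<^sup>2) \<le> (real r / real (L * 2 ^ J))\<^sup>2)"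
proof -
  define h where "h k = sqrt (real r) / real (L * 2 ^ k)" for k
  have hpos: "h k > 0" for k using L r by (simp add: h_def)
  \<comment> \<open>At level J closeness is sharpened to equality with the grid vector. Hence
    \<open>\<pi> J\<close> is the truncation itself, and the remainder is supported in the support
    of x.\<close>
  define near where "near k c u \<longleftrightarrow> u \<in> sparse_fun n r \<and>
     (\<forall>\<kappa>\<in>C. \<bar>\<Sum>i<n. \<alpha> \<kappa> i * (u i - h k * of_int (c i))\<bar> \<le> 5 * b k) \<and>
     (k = J \<longrightarrow> u = (\<lambda>i. h k * of_int (c i)))" for k c u
  \<comment> \<open>Grid vectors with no sparse vector nearby receive the default 0; they never
    occur in a chain.\<close>
  define rep where "rep k c = (if \<exists>u. near k c u then SOME u. near k c u else (\<lambda>_. 0))" for k c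
  have zero: "(\<lambda>_. 0) \<in> sparse_fun n r" by (simp add: sparse_fun_def)
  have rep: "rep k c \<in> sparse_fun n r" for k c
  proof (cases "\<exists>u. near k c u")
    case True
    then have "near k c (rep k c)" using someI_ex[OF True] by (simp add: rep_def)
    then show ?thesis by (simp add: near_def)
  qed (simp add: rep_def zero)
  define P where "P k = rep k ` int_ball n (L * 2 ^ k)" for k
  have bmono: "b (Suc k) \<le> b k" for k
    unfolding b_def using A L C card_gt_0_iff[of C]
    by (intro mult_left_mono real_sqrt_le_mono divide_left_mono) auto
  have "\<exists>\<pi>. (\<forall>k\<le>J. \<pi> k \<in> P k) \<and>
       (\<forall>k<J. \<forall>\<kappa>\<in>C. \<bar>\<Sum>i<n. \<alpha> \<kappa> i * (\<pi> k i - \<pi> (Suc k) i)\<bar> \<le> 20 * b k) \<and>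
       (\<forall>i\<ge>n. x i - \<pi> J i = 0) \<and> card {i. x i - \<pi> J i \<noteq> 0} \<le> r \<and>
       (\<Sum>i<n. (x i - \<pi> J i)\<^sup>2) \<le> (real r / real (L * 2 ^ J))\<^sup>2"
    if x: "x \<in> sparse_fun n r" for x
  proof -
    define x0 where "x0 i = h J * of_int (grid_trunc (h J) x i)" for i
    have x0: "x0 \<in> sparse_fun n r" unfolding x0_def by (rule grid_trunc_sparse[OF hpos x])
    define Q where "Q k c \<longleftrightarrow> c \<in> int_ball n (L * 2 ^ k) \<and> (\<forall>i. x i = 0 \<longrightarrow> c i = 0) \<and>
      (k = J \<longrightarrow> (\<forall>i. h k * of_int (c i) = x0 i)) \<and>
      (\<forall>\<kappa>\<in>C. \<bar>\<Sum>i<n. \<alpha> \<kappa> i * (x0 i - h k * of_int (c i))\<bar> \<le> 5 * b k)" for k c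
    have exQ: "\<exists>c. Q k c" if "k \<le> J" for k
      unfolding Q_def h_def b_def x0_def Bex_def[symmetric] by (rule halving_chain[OF C A L r \<alpha> x that])
    define c where "c k = (SOME c. Q k c)" for k
    have Q: "Q k (c k)" if "k \<le> J" for k
      unfolding c_def by (rule someI_ex[OF exQ[OF that]])
    have c: "\<And>k. k \<le> J \<Longrightarrow> c k \<in> int_ball n (L * 2 ^ k)"
      "\<And>k i. k \<le> J \<Longrightarrow> k = J \<Longrightarrow> h k * of_int (c k i) = x0 i"
      "\<And>k \<kappa>. k \<le> J \<Longrightarrow> \<kappa> \<in> C \<Longrightarrow> \<bar>\<Sum>i<n. \<alpha> \<kappa> i * (x0 i - h k * of_int (c k i))\<bar> \<le> 5 * b k"
      using Q unfolding Q_def by blast+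
    define \<pi> where "\<pi> k = rep k (c k)" for k
    have near: "near k (c k) (\<pi> k)" if "k \<le> J" for k
    proof -
      have "near k (c k) x0" using x0 c that by (auto simp: near_def fun_eq_iff)
      then have ex: "\<exists>u. near k (c k) u" by blast
      then show ?thesis using someI_ex[OF ex] by (simp add: \<pi>_def rep_def)
    qed
    have close: "\<bar>\<Sum>i<n. \<alpha> \<kappa> i * (\<pi> k i - x0 i)\<bar> \<le> 10 * b k" if "k \<le> J" "\<kappa> \<in> C" for k \<kappa>
    proof -
      have "(\<Sum>i<n. \<alpha> \<kappa> i * (\<pi> k i - x0 i)) = (\<Sum>i<n. \<alpha> \<kappa> i * (\<pi> k i - h k * of_int (c k i)))
          - (\<Sum>i<n. \<alpha> \<kappa> i * (x0 i - h k * of_int (c k i)))"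
        by (simp add: algebra_simps flip: sum_subtractf)
      moreover have "\<bar>\<Sum>i<n. \<alpha> \<kappa> i * (\<pi> k i - h k * of_int (c k i))\<bar> \<le> 5 * b k"
        using near[OF that(1)] that(2) unfolding near_def by blast
      ultimately show ?thesis using c(3)[OF that] by linarith
    qed
    have "\<pi> J = x0" using near[of J] c(2)[of J] by (auto simp: near_def fun_eq_iff)
    then have f1: "\<forall>i\<ge>n. x i - \<pi> J i = 0" "card {i. x i - \<pi> J i \<noteq> 0} \<le> r"
      and "(\<Sum>i<n. (x i - \<pi> J i)\<^sup>2) \<le> real r * (h J)\<^sup>2"
      using grid_trunc_sparse(2,4)[OF hpos x, of J] x x0 unfolding x0_def sparse_fun_def by simp_all
    moreover have "real r * (h J)\<^sup>2 = (real r / real (L * 2 ^ J))\<^sup>2"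
      unfolding h_def power_divide by (simp add: power2_eq_square)
    ultimately have f2: "(\<Sum>i<n. (x i - \<pi> J i)\<^sup>2) \<le> (real r / real (L * 2 ^ J))\<^sup>2" by simp
    \<comment> \<open>Both points are within 10 b k of \<open>x0\<close>: 5 b k from the net point
      to its grid vector and 5 b k from there to \<open>x0\<close>, with b decreasing in k.\<close>
    have f3: "\<forall>k<J. \<forall>\<kappa>\<in>C. \<bar>\<Sum>i<n. \<alpha> \<kappa> i * (\<pi> k i - \<pi> (Suc k) i)\<bar> \<le> 20 * b k"
    proof (intro allI impI ballI)
      fix k \<kappa> assume that: "k < J" "\<kappa> \<in> C"
      have "(\<Sum>i<n. \<alpha> \<kappa> i * (\<pi> k i - \<pi> (Suc k) i)) = (\<Sum>i<n. \<alpha> \<kappa> i * (\<pi> k i - x0 i))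
          - (\<Sum>i<n. \<alpha> \<kappa> i * (\<pi> (Suc k) i - x0 i))"
        by (simp add: algebra_simps flip: sum_subtractf)
      then show "\<bar>\<Sum>i<n. \<alpha> \<kappa> i * (\<pi> k i - \<pi> (Suc k) i)\<bar> \<le> 20 * b k"
        using close[of k \<kappa>] close[of "Suc k" \<kappa>] that bmono[of k] by linarith
    qed
    have "\<forall>k\<le>J. \<pi> k \<in> P k" using c(1) by (simp add: \<pi>_def P_def)
    then show ?thesis using f1 f2 f3 by blast
  qed
  moreover have "finite (P k) \<and> P k \<subseteq> sparse_fun n r \<and> card (P k) \<le> (2 * n + 1) ^ (L * 2 ^ k)" for k
  proof (intro conjI)
    show "finite (P k)" using int_ball_card[of n "L * 2 ^ k"] by (simp add: P_def)
    show "P k \<subseteq> sparse_fun n r" using rep by (auto simp: P_def)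
    have "card (P k) \<le> card (int_ball n (L * 2 ^ k))"
      unfolding P_def by (rule card_image_le) (use int_ball_card in blast)
    also have "\<dots> \<le> (2 * n + 1) ^ (L * 2 ^ k)" using int_ball_card by blast
    finally show "card (P k) \<le> (2 * n + 1) ^ (L * 2 ^ k)" .
  qed
  ultimately show ?thesis by (intro exI[of _ P]) blast
qed

subsection \<open>Tails of subgaussian linear forms\<close>

text \<open>The failure set only has to lie inside a measurable set of measure at most p. Uniform
  statements over uncountable families can thus be handled before anything is known about their
  measurability.\<close>

definition whp :: "'a measure \<Rightarrow> real \<Rightarrow> ('a \<Rightarrow> bool) \<Rightarrow> bool" where
  "whp M p Q \<longleftrightarrow> (\<exists>E\<in>sets M. emeasure M E \<le> ennreal p \<and> (\<forall>\<omega>\<in>space M - E. Q \<omega>))"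

lemma whp_mono:
  assumes "whp M p Q" "p \<le> p'" "\<And>\<omega>. \<omega> \<in> space M \<Longrightarrow> Q \<omega> \<Longrightarrow> Q' \<omega>"
  shows "whp M p' Q'"
  using assms unfolding whp_def by (meson DiffE ennreal_leI order_trans)

lemma whp_conj:
  assumes "whp M p Q" "whp M q R" "p \<ge> 0" "q \<ge> 0"
  shows "whp M (p + q) (\<lambda>\<omega>. Q \<omega> \<and> R \<omega>)"
proof -
  obtain E F where E: "E \<in> sets M" "emeasure M E \<le> ennreal p" "\<forall>\<omega>\<in>space M - E. Q \<omega>"
    and F: "F \<in> sets M" "emeasure M F \<le> ennreal q" "\<forall>\<omega>\<in>space M - F. R \<omega>"
    using assms unfolding whp_def by auto
  have "emeasure M (E \<union> F) \<le> ennreal p + ennreal q"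
    using emeasure_subadditive[OF E(1) F(1)] add_mono[OF E(2) F(2)] by (rule order_trans)
  then show ?thesis
    unfolding whp_def using E F assms by (intro bexI[of _ "E \<union> F"]) auto
qed

lemma whp_always: "(\<And>\<omega>. \<omega> \<in> space M \<Longrightarrow> Q \<omega>) \<Longrightarrow> whp M 0 Q"
  unfolding whp_def by (intro bexI[of _ "{}"]) auto

lemma whp_ball:
  assumes "finite S" "\<And>i. i \<in> S \<Longrightarrow> whp M p (Q i)" "p \<ge> 0"
  shows "whp M (real (card S) * p) (\<lambda>\<omega>. \<forall>i\<in>S. Q i \<omega>)"
  using assms
proof (induction S)
  case empty
  then show ?case by (simp add: whp_always)
next
  case (insert i S)
  have "whp M (p + real (card S) * p) (\<lambda>\<omega>. Q i \<omega> \<and> (\<forall>i\<in>S. Q i \<omega>))"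
    using insert by (intro whp_conj) auto
  then show ?case using insert by (simp add: algebra_simps)
qed

lemma whp_AE:
  assumes "whp M p Q" "AE \<omega> in M. R \<omega>"
  shows "whp M p (\<lambda>\<omega>. Q \<omega> \<and> R \<omega>)"
proof -
  obtain E where E: "E \<in> sets M" "emeasure M E \<le> ennreal p" "\<forall>\<omega>\<in>space M - E. Q \<omega>"
    using assms unfolding whp_def by auto
  obtain N where N: "N \<in> null_sets M" "{\<omega>\<in>space M. \<not> R \<omega>} \<subseteq> N"
    using assms(2) by (auto simp: eventually_ae_filter)
  have "emeasure M (E \<union> N) = emeasure M E"
    using N E by (simp add: emeasure_Un_null_set)
  then show ?thesis
    unfolding whp_def using E N by (intro bexI[of _ "E \<union> N"]) auto
qed

text \<open>Common interface of the standard normal and the Rademacher law, so that one chaining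
  argument serves both circulant factors. Nonnegative integrals avoid integrability
  conditions.\<close>

locale subgaussian_law =
  fixes N :: "real measure"
  assumes prob: "prob_space N" and space_N: "space N = UNIV"
    and borel: "(\<lambda>x. x) \<in> borel_measurable N"
    and mgf: "\<And>t. (\<integral>\<^sup>+ x. ennreal (exp (t * x)) \<partial>N) \<le> ennreal (exp (t\<^sup>2 / 2))"
begin

abbreviation \<mu> :: "nat \<Rightarrow> (nat \<Rightarrow> real) measure" where
  "\<mu> n \<equiv> (\<Pi>\<^sub>M i\<in>{..<n}. N)"

lemma psf: "product_sigma_finite (\<lambda>_::nat. N)"
  using prob by (simp add: product_sigma_finite_def prob_space_imp_sigma_finite)

lemma prob_\<mu>: "prob_space (\<mu> n)"
  by (rule prob_space_PiM) (rule prob)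

lemma coordinate_measurable: "l < n \<Longrightarrow> (\<lambda>\<omega>. \<omega> l) \<in> borel_measurable (\<mu> n)"
  using measurable_compose[OF measurable_component_singleton[of l "{..<n}" "\<lambda>_. N"] borel] by simp

text \<open>The coefficients may depend on the coordinates outside T. Fubini freezes these, and the
  exponential moment then factors over T.\<close>

lemma exp_linear_form:
  assumes T: "T \<subseteq> {..<n}"
    and meas: "\<And>l. l \<in> T \<Longrightarrow> e l \<in> borel_measurable (\<mu> n)"
    and dep: "\<And>l \<omega> \<omega>'. l \<in> T \<Longrightarrow> (\<And>j. j < n \<Longrightarrow> j \<notin> T \<Longrightarrow> \<omega> j = \<omega>' j) \<Longrightarrow> e l \<omega> = e l \<omega>'"
    and bd: "\<And>\<omega>. (\<Sum>l\<in>T. (e l \<omega>)\<^sup>2) \<le> 1"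
  shows "(\<integral>\<^sup>+ \<omega>. ennreal (exp (t * (\<Sum>l\<in>T. e l \<omega> * \<omega> l))) \<partial>\<mu> n) \<le> ennreal (exp (t\<^sup>2 / 2))"
proof -
  interpret product_sigma_finite "\<lambda>_::nat. N" by (rule psf)
  define I where "I = {..<n} - T"
  have fin: "finite T" "finite I" using T finite_subset by (auto simp: I_def)
  have IT: "I \<inter> T = {}" "{..<n} = I \<union> T" using T by (auto simp: I_def)
  let ?f = "\<lambda>\<omega>. ennreal (exp (t * (\<Sum>l\<in>T. e l \<omega> * \<omega> l)))"
  have m: "?f \<in> borel_measurable (\<mu> n)"
    using T by (intro measurable_compose[OF _ measurable_ennreal] borel_measurable_exp[THEN measurable_compose_rev]
        borel_measurable_times borel_measurable_const borel_measurable_sum meas coordinate_measurable) auto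
  have "integral\<^sup>N (\<mu> n) ?f = (\<integral>\<^sup>+ x. (\<integral>\<^sup>+ y. ?f (merge I T (x, y)) \<partial>Pi\<^sub>M T (\<lambda>_. N)) \<partial>Pi\<^sub>M I (\<lambda>_. N))"
    using product_nn_integral_fold[OF IT(1) fin(2,1)] m IT(2) by simp
  also have "\<dots> \<le> (\<integral>\<^sup>+ x. ennreal (exp (t\<^sup>2 / 2)) \<partial>Pi\<^sub>M I (\<lambda>_. N))"
  proof (rule nn_integral_mono)
    fix x
    \<comment> \<open>The filler 0 is arbitrary, because \<open>e l\<close> ignores the coordinates
      in T.\<close>
    define a where "a l = e l (merge I T (x, \<lambda>_. 0))" for l
    have e: "e l (merge I T (x, y)) = a l" if "l \<in> T" for l y
      unfolding a_def using IT(2) by (intro dep[OF that]) (auto simp: merge_def)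
    have "?f (merge I T (x, y)) = (\<Prod>l\<in>T. ennreal (exp (t * a l * y l)))" for y
    proof -
      have "(\<Sum>l\<in>T. e l (merge I T (x, y)) * merge I T (x, y) l) = (\<Sum>l\<in>T. a l * y l)"
      proof (rule sum.cong[OF refl])
        fix l assume l: "l \<in> T"
        then have "merge I T (x, y) l = y l" using IT(1) by (auto simp: merge_def)
        then show "e l (merge I T (x, y)) * merge I T (x, y) l = a l * y l" using e[OF l] by simp
      qed
      then have "exp (t * (\<Sum>l\<in>T. e l (merge I T (x, y)) * merge I T (x, y) l)) = (\<Prod>l\<in>T. exp (t * a l * y l))"
        by (simp add: sum_distrib_left exp_sum[OF fin(1)] mult.assoc)
      then show ?thesis by (simp add: prod_ennreal)
    qed
    then have "(\<integral>\<^sup>+ y. ?f (merge I T (x, y)) \<partial>Pi\<^sub>M T (\<lambda>_. N))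
       = (\<integral>\<^sup>+ y. (\<Prod>l\<in>T. ennreal (exp (t * a l * y l))) \<partial>Pi\<^sub>M T (\<lambda>_. N))" by simp
    also have "\<dots> = (\<Prod>l\<in>T. \<integral>\<^sup>+ y. ennreal (exp (t * a l * y)) \<partial>N)"
    proof (rule product_nn_integral_prod[OF fin(1)])
      show "(\<lambda>y. ennreal (exp (t * a l * y))) \<in> borel_measurable N" for l
        by (rule measurable_compose[OF borel, where g = "\<lambda>y. ennreal (exp (t * a l * y))"]) simp
    qed
    also have "\<dots> \<le> (\<Prod>l\<in>T. ennreal (exp ((t * a l)\<^sup>2 / 2)))"
      by (intro prod_mono_ennreal mgf)
    also have "\<dots> = ennreal (exp (t\<^sup>2 / 2 * (\<Sum>l\<in>T. (a l)\<^sup>2)))"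
      by (simp add: prod_ennreal sum_distrib_left power_mult_distrib exp_sum[OF fin(1)])
    also have "\<dots> \<le> ennreal (exp (t\<^sup>2 / 2))"
    proof -
      have "t\<^sup>2 / 2 * (\<Sum>l\<in>T. (a l)\<^sup>2) \<le> t\<^sup>2 / 2 * 1"
        unfolding a_def using bd by (intro mult_left_mono) auto
      then show ?thesis by (intro ennreal_leI) simp
    qed
    finally show "(\<integral>\<^sup>+ y. ?f (merge I T (x, y)) \<partial>Pi\<^sub>M T (\<lambda>_. N)) \<le> ennreal (exp (t\<^sup>2 / 2))" .
  qed
  also have "\<dots> = ennreal (exp (t\<^sup>2 / 2))"
  proof -
    have "prob_space (Pi\<^sub>M I (\<lambda>_. N))" by (rule prob_space_PiM) (rule prob)
    then show ?thesis by (simp add: prob_space.emeasure_space_1)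
  qed
  finally show ?thesis .
qed

lemma linear_form_tail:
  assumes T: "T \<subseteq> {..<n}" and t: "t \<ge> 0"
    and meas: "\<And>l. l \<in> T \<Longrightarrow> c l \<in> borel_measurable (\<mu> n)"
    and dep: "\<And>l \<omega> \<omega>'. l \<in> T \<Longrightarrow> (\<And>j. j < n \<Longrightarrow> j \<notin> T \<Longrightarrow> \<omega> j = \<omega>' j) \<Longrightarrow> c l \<omega> = c l \<omega>'"
  shows "whp (\<mu> n) (2 * exp (- t\<^sup>2 / 2))
    (\<lambda>\<omega>. \<bar>\<Sum>l\<in>T. c l \<omega> * \<omega> l\<bar> \<le> t * L2_set (\<lambda>l. c l \<omega>) T)"
proof -
  have fin: "finite T" using T finite_subset by auto
  define s where "s \<omega> = L2_set (\<lambda>l. c l \<omega>) T" for \<omega>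
  have s_meas [measurable]: "s \<in> borel_measurable (\<mu> n)"
    unfolding s_def L2_set_def using meas by measurable
  \<comment> \<open>Where \<open>s\<close> vanishes, division by zero makes \<open>e\<close> vanish
    as well, so \<open>e_bd\<close> holds there too. The sign \<sigma> selects the tail.\<close>
  define e where "e \<sigma> l \<omega> = \<sigma> * c l \<omega> / s \<omega>" for \<sigma> l \<omega>
  have e_meas: "e \<sigma> l \<in> borel_measurable (\<mu> n)" if "l \<in> T" for \<sigma> l
    unfolding e_def using meas[OF that] by measurable
  have e_dep: "e \<sigma> l \<omega> = e \<sigma> l \<omega>'" if "l \<in> T" "\<And>j. j < n \<Longrightarrow> j \<notin> T \<Longrightarrow> \<omega> j = \<omega>' j" for \<sigma> l \<omega> \<omega>'
  proof -
    have "c k \<omega> = c k \<omega>'" if "k \<in> T" for k using dep[OF that] \<open>\<And>j. j < n \<Longrightarrow> j \<notin> T \<Longrightarrow> \<omega> j = \<omega>' j\<close> by blast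
    then show ?thesis using that(1) by (simp add: e_def s_def cong: L2_set_cong)
  qed
  have e_bd: "(\<Sum>l\<in>T. (e \<sigma> l \<omega>)\<^sup>2) \<le> 1" if "\<bar>\<sigma>\<bar> = 1" for \<sigma> \<omega>
  proof -
    have "\<sigma>\<^sup>2 = 1" using that by (metis one_power2 power2_abs)
    then have "(\<Sum>l\<in>T. (e \<sigma> l \<omega>)\<^sup>2) = (\<Sum>l\<in>T. (c l \<omega>)\<^sup>2) / (s \<omega>)\<^sup>2"
      by (simp add: e_def power_divide power_mult_distrib flip: sum_divide_distrib)
    also have "(s \<omega>)\<^sup>2 = (\<Sum>l\<in>T. (c l \<omega>)\<^sup>2)" by (simp add: s_def L2_set_def sum_nonneg)
    finally show ?thesis by simp
  qed
  define G where "G \<sigma> \<omega> = (\<Sum>l\<in>T. e \<sigma> l \<omega> * \<omega> l)" for \<sigma> \<omega>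
  have G_meas [measurable]: "G \<sigma> \<in> borel_measurable (\<mu> n)" for \<sigma>
    unfolding G_def using T by (intro borel_measurable_sum borel_measurable_times e_meas coordinate_measurable) auto
  have one: "emeasure (\<mu> n) {\<omega>\<in>space (\<mu> n). G \<sigma> \<omega> \<ge> t} \<le> ennreal (exp (- t\<^sup>2 / 2))" if "\<bar>\<sigma>\<bar> = 1" for \<sigma>
  proof -
    have "emeasure (\<mu> n) {\<omega>\<in>space (\<mu> n). G \<sigma> \<omega> \<ge> t}
        \<le> emeasure (\<mu> n) {\<omega>\<in>space (\<mu> n). 1 \<le> ennreal (exp (- t\<^sup>2)) * ennreal (exp (t * G \<sigma> \<omega>))}"
    proof (intro emeasure_mono subsetI; clarsimp)
      fix \<omega> assume "t \<le> G \<sigma> \<omega>"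
      then have "t * t \<le> t * G \<sigma> \<omega>" using t by (intro mult_left_mono)
      then have "1 \<le> exp (- t\<^sup>2) * exp (t * G \<sigma> \<omega>)"
        by (simp add: power2_eq_square flip: exp_add)
      then show "1 \<le> ennreal (exp (- t\<^sup>2)) * ennreal (exp (t * G \<sigma> \<omega>))"
        by (simp flip: ennreal_mult)
    qed
    also have "\<dots> \<le> ennreal (exp (- t\<^sup>2)) * (\<integral>\<^sup>+ \<omega>. ennreal (exp (t * G \<sigma> \<omega>)) \<partial>\<mu> n)"
    proof -
      have "emeasure (\<mu> n) {\<omega>\<in>space (\<mu> n). 1 \<le> ennreal (exp (- t\<^sup>2)) * ennreal (exp (t * G \<sigma> \<omega>))}
          \<le> ennreal (exp (- t\<^sup>2)) * (\<integral>\<^sup>+ \<omega>. ennreal (exp (t * G \<sigma> \<omega>)) * indicator (space (\<mu> n)) \<omega> \<partial>\<mu> n)"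
        by (rule nn_integral_Markov_inequality) measurable
      also have "(\<integral>\<^sup>+ \<omega>. ennreal (exp (t * G \<sigma> \<omega>)) * indicator (space (\<mu> n)) \<omega> \<partial>\<mu> n)
          = (\<integral>\<^sup>+ \<omega>. ennreal (exp (t * G \<sigma> \<omega>)) \<partial>\<mu> n)"
        by (rule nn_integral_cong) simp
      finally show ?thesis .
    qed
    also have "\<dots> \<le> ennreal (exp (- t\<^sup>2)) * ennreal (exp (t\<^sup>2 / 2))"
      unfolding G_def by (intro mult_left_mono exp_linear_form[OF T] e_meas e_bd that) (auto intro: e_dep)
    also have "\<dots> = ennreal (exp (- t\<^sup>2 / 2))"
      by (simp flip: ennreal_mult exp_add)
    finally show ?thesis .
  qed
  define E where "E = {\<omega>\<in>space (\<mu> n). G 1 \<omega> \<ge> t} \<union> {\<omega>\<in>space (\<mu> n). G (-1) \<omega> \<ge> t}"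
  have Es: "E \<in> sets (\<mu> n)" unfolding E_def by measurable
  have "emeasure (\<mu> n) E \<le> emeasure (\<mu> n) {\<omega>\<in>space (\<mu> n). G 1 \<omega> \<ge> t} + emeasure (\<mu> n) {\<omega>\<in>space (\<mu> n). G (-1) \<omega> \<ge> t}"
    unfolding E_def by (rule emeasure_subadditive) measurable
  also have "\<dots> \<le> ennreal (exp (- t\<^sup>2 / 2)) + ennreal (exp (- t\<^sup>2 / 2))"
    by (intro add_mono one) auto
  also have "\<dots> = ennreal (2 * exp (- t\<^sup>2 / 2))" by (simp flip: ennreal_plus)
  finally have Ep: "emeasure (\<mu> n) E \<le> ennreal (2 * exp (- t\<^sup>2 / 2))" .
  have "\<bar>\<Sum>l\<in>T. c l \<omega> * \<omega> l\<bar> \<le> t * s \<omega>" if "\<omega> \<in> space (\<mu> n) - E" for \<omega>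
  proof (cases "s \<omega> = 0")
    case True
    then have "\<forall>l\<in>T. c l \<omega> = 0" unfolding s_def using fin by (simp add: L2_set_eq_0_iff)
    then show ?thesis using True by simp
  next
    case False
    then have sp: "s \<omega> > 0" using L2_set_nonneg[of "\<lambda>l. c l \<omega>" T] unfolding s_def by linarith
    have "G \<sigma> \<omega> = \<sigma> * (\<Sum>l\<in>T. c l \<omega> * \<omega> l) / s \<omega>" for \<sigma>
      by (simp add: G_def e_def sum_distrib_left sum_divide_distrib mult_ac)
    then have "(\<Sum>l\<in>T. c l \<omega> * \<omega> l) / s \<omega> < t" "- (\<Sum>l\<in>T. c l \<omega> * \<omega> l) / s \<omega> < t"
      using that by (auto simp: E_def not_le)
    then have "(\<Sum>l\<in>T. c l \<omega> * \<omega> l) < t * s \<omega>" "- (\<Sum>l\<in>T. c l \<omega> * \<omega> l) < t * s \<omega>"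
      by (simp_all only: pos_divide_less_eq[OF sp])
    then show ?thesis by linarith
  qed
  then show ?thesis
    unfolding whp_def using Es Ep by (intro bexI[of _ E]) (auto simp: s_def)
qed

text \<open>Given the coordinates outside T, the second factor is a fixed vector and the sum is a
  linear form in the coordinates of T. Its coefficient vector is the transpose of D applied to that
  factor, hence the scale c times the norm.\<close>

lemma decoupled_tail:
  fixes D U :: "nat \<Rightarrow> nat \<Rightarrow> real"
  assumes T: "T \<subseteq> {..<n}" and t: "t \<ge> 0" and c: "c \<ge> 0" and R: "finite R"
    and op: "\<And>w. (\<Sum>l<n. (\<Sum>s\<in>R. D s l * w s)\<^sup>2) \<le> c\<^sup>2 * (\<Sum>s\<in>R. (w s)\<^sup>2)"
    and \<epsilon>: "\<And>l. \<bar>\<epsilon> l\<bar> = (1::real)"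
  shows "whp (\<mu> n) (2 * exp (- t\<^sup>2 / 2))
    (\<lambda>\<omega>. \<bar>\<Sum>s\<in>R. (\<Sum>l\<in>T. D s l * (\<epsilon> l * \<omega> l)) * (\<Sum>l\<in>{..<n} - T. U s l * (\<epsilon> l * \<omega> l))\<bar>
      \<le> t * c * L2_set (\<lambda>s. \<Sum>l\<in>{..<n} - T. U s l * (\<epsilon> l * \<omega> l)) R)"
proof -
  define w where "w \<omega> s = (\<Sum>l\<in>{..<n} - T. U s l * (\<epsilon> l * \<omega> l))" for \<omega> s
  define a where "a l \<omega> = \<epsilon> l * (\<Sum>s\<in>R. D s l * w \<omega> s)" for l \<omega>
  have "whp (\<mu> n) (2 * exp (- t\<^sup>2 / 2)) (\<lambda>\<omega>. \<bar>\<Sum>l\<in>T. a l \<omega> * \<omega> l\<bar> \<le> t * L2_set (\<lambda>l. a l \<omega>) T)"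
  proof (rule linear_form_tail[OF T t])
    show "a l \<in> borel_measurable (\<mu> n)" for l
      unfolding a_def w_def by (intro borel_measurable_times borel_measurable_sum borel_measurable_const coordinate_measurable) auto
    fix l and \<omega> \<omega>' :: "nat \<Rightarrow> real" assume "\<And>j. j < n \<Longrightarrow> j \<notin> T \<Longrightarrow> \<omega> j = \<omega>' j"
    then have "w \<omega> s = w \<omega>' s" for s unfolding w_def by (intro sum.cong) auto
    then show "a l \<omega> = a l \<omega>'" by (simp add: a_def)
  qed
  then show ?thesis
  proof (rule whp_mono[OF _ order_refl])
    fix \<omega> assume le: "\<bar>\<Sum>l\<in>T. a l \<omega> * \<omega> l\<bar> \<le> t * L2_set (\<lambda>l. a l \<omega>) T"
    have "(\<Sum>s\<in>R. (\<Sum>l\<in>T. D s l * (\<epsilon> l * \<omega> l)) * w \<omega> s) = (\<Sum>l\<in>T. a l \<omega> * \<omega> l)"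
      unfolding a_def sum_distrib_left sum_distrib_right
      by (subst sum.swap) (simp add: mult_ac)
    moreover have "L2_set (\<lambda>l. a l \<omega>) T \<le> c * L2_set (w \<omega>) R"
    proof -
      have "(\<epsilon> l)\<^sup>2 = 1" for l using \<epsilon>[of l] by (metis one_power2 power2_abs)
      then have "(\<Sum>l\<in>T. (a l \<omega>)\<^sup>2) = (\<Sum>l\<in>T. (\<Sum>s\<in>R. D s l * w \<omega> s)\<^sup>2)"
        by (simp only: a_def power_mult_distrib mult_1)
      also have "\<dots> \<le> (\<Sum>l<n. (\<Sum>s\<in>R. D s l * w \<omega> s)\<^sup>2)"
        using T by (intro sum_mono2) auto
      also have "\<dots> \<le> c\<^sup>2 * (\<Sum>s\<in>R. (w \<omega> s)\<^sup>2)" by (rule op)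
      finally have "sqrt (\<Sum>l\<in>T. (a l \<omega>)\<^sup>2) \<le> sqrt (c\<^sup>2 * (\<Sum>s\<in>R. (w \<omega> s)\<^sup>2))" by simp
      then show ?thesis using c by (simp add: L2_set_def real_sqrt_mult)
    qed
    then have "t * L2_set (\<lambda>l. a l \<omega>) T \<le> t * (c * L2_set (w \<omega>) R)" using t by (intro mult_left_mono)
    ultimately show "\<bar>\<Sum>s\<in>R. (\<Sum>l\<in>T. D s l * (\<epsilon> l * \<omega> l)) * (\<Sum>l\<in>{..<n} - T. U s l * (\<epsilon> l * \<omega> l))\<bar>
      \<le> t * c * L2_set (\<lambda>s. \<Sum>l\<in>{..<n} - T. U s l * (\<epsilon> l * \<omega> l)) R"
      using le unfolding w_def[abs_def] by (simp add: mult.assoc)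
  qed
qed

end

subsection \<open>Decoupling and chaining\<close>

lemma L2_set_scale: "L2_set (\<lambda>s. a * f s) R = \<bar>a\<bar> * L2_set f R" for a :: real
proof -
  have "(\<Sum>s\<in>R. (a * f s)\<^sup>2) = a\<^sup>2 * (\<Sum>s\<in>R. (f s)\<^sup>2)"
    by (simp add: power_mult_distrib sum_distrib_left)
  then show ?thesis by (simp add: L2_set_def real_sqrt_mult)
qed

text \<open>The character of (Z/2)^d indexed by A, evaluated at the binary digits of j. On average
  these characters behave like independent signs, but only 2^d of them occur, a number linear in n,
  so union bounds over all patterns are affordable.\<close>

definition walsh :: "nat set \<Rightarrow> nat \<Rightarrow> real" where
  "walsh A j = (\<Prod>i\<in>A. if bit j i then - 1 else 1)"

lemma walsh_empty [simp]: "walsh {} j = 1"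
  by (simp add: walsh_def)

lemma walsh_cases: "walsh A j = 1 \<or> walsh A j = - 1"
  unfolding walsh_def by (induction A rule: infinite_finite_induct) auto

lemma walsh_sq: "walsh A j * walsh A j = 1"
  using walsh_cases[of A j] by auto

lemma walsh_abs: "\<bar>walsh A j\<bar> = 1"
  using walsh_cases[of A j] by auto

lemma walsh_mult:
  assumes "finite A" "finite B"
  shows "walsh A j * walsh B j = walsh ((A - B) \<union> (B - A)) j"
proof -
  let ?g = "\<lambda>i. if bit j i then - 1 else 1 :: real"
  have A: "walsh A j = walsh (A - B) j * walsh (A \<inter> B) j"
    unfolding walsh_def using assms by (subst prod.union_disjoint[symmetric]) (auto intro!: prod.cong)
  have B: "walsh B j = walsh (B - A) j * walsh (A \<inter> B) j"
    unfolding walsh_def using assms by (subst prod.union_disjoint[symmetric]) (auto intro!: prod.cong)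
  have "walsh ((A - B) \<union> (B - A)) j = walsh (A - B) j * walsh (B - A) j"
    unfolding walsh_def using assms by (intro prod.union_disjoint) auto
  then show ?thesis
    unfolding A B using walsh_sq[of "A \<inter> B" j] by (simp add: algebra_simps)
qed

text \<open>The sum over A is the expansion of the product of the factors 1 + g_j g_k over the bits.
  A bit in which j and k differ makes a factor vanish, and such a bit lies below d.\<close>

lemma walsh_orthogonality:
  assumes "j < 2 ^ d" "k < 2 ^ d"
  shows "(\<Sum>A\<in>Pow {..<d}. walsh A j * walsh A k) = (if j = k then 2 ^ d else 0)"
proof -
  let ?g = "\<lambda>j i. if bit j i then - 1 else 1 :: real"
  have "(\<Sum>A\<in>Pow {..<d}. walsh A j * walsh A k) = (\<Sum>A\<in>Pow {..<d}. (\<Prod>i\<in>A. ?g j i * ?g k i) * (\<Prod>i\<in>{..<d} - A. 1))"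
    by (simp add: walsh_def prod.distrib)
  also have "\<dots> = (\<Prod>i<d. ?g j i * ?g k i + 1)"
    by (rule prod_add[symmetric]) simp
  also have "\<dots> = (if j = k then 2 ^ d else 0)"
  proof (cases "j = k")
    case True
    have "(\<Prod>i<d. ?g k i * ?g k i + 1) = (\<Prod>i<d. 2)" by (intro prod.cong) auto
    then show ?thesis using True by simp
  next
    case False
    then obtain i where i: "bit j i \<noteq> bit k i" using bit_eqI by blast
    have "i < d"
    proof (rule ccontr)
      assume "\<not> i < d"
      then have "j < 2 ^ i" "k < 2 ^ i" using assms by (meson less_le_trans not_less one_le_numeral power_increasing)+
      then have "\<not> bit j i" "\<not> bit k i" by (simp_all add: bit_iff_odd)
      then show False using i by simp
    qed
    then have "(\<Prod>i<d. ?g j i * ?g k i + 1) = 0"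
      using i by (intro prod_zero finite_lessThan bexI[of _ i]) auto
    then show ?thesis using False by simp
  qed
  finally show ?thesis .
qed

lemma walsh_average:
  assumes "n \<le> 2 ^ d"
  shows "(\<Sum>A\<in>Pow {..<d}. (\<Sum>l<n. a l * walsh A l)\<^sup>2) = 2 ^ d * (\<Sum>l<n. (a l)\<^sup>2)"
proof -
  have "(\<Sum>A\<in>Pow {..<d}. (\<Sum>l<n. a l * walsh A l)\<^sup>2)
      = (\<Sum>A\<in>Pow {..<d}. \<Sum>j<n. \<Sum>k<n. a j * a k * (walsh A j * walsh A k))"
    by (simp add: power2_eq_square sum_product mult_ac)
  also have "\<dots> = (\<Sum>j<n. \<Sum>k<n. a j * a k * (\<Sum>A\<in>Pow {..<d}. walsh A j * walsh A k))"
    by (subst sum.swap, rule sum.cong[OF refl], subst sum.swap) (simp add: sum_distrib_left)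
  also have "\<dots> = (\<Sum>j<n. \<Sum>k<n. a j * a k * (if j = k then 2 ^ d else 0))"
    using assms by (intro sum.cong refl) (simp add: walsh_orthogonality)
  also have "\<dots> = 2 ^ d * (\<Sum>l<n. (a l)\<^sup>2)"
    by (simp add: if_distrib[where f = "\<lambda>x. _ * x"] sum.delta' power2_eq_square
        sum_distrib_left mult_ac cong: if_cong)
  finally show ?thesis .
qed

text \<open>The rest \<open>x - \<pi> J\<close> at the finest level is \<open>\<theta>\<close> times an element of the same family \<open>X\<close>, so its
  contribution is absorbed by the supremum over \<open>X\<close>.\<close>

definition chain_net :: "(nat \<Rightarrow> real) set \<Rightarrow> (nat \<Rightarrow> (nat \<Rightarrow> real) set) \<Rightarrow> nat
    \<Rightarrow> (nat \<Rightarrow> (nat \<Rightarrow> real) \<Rightarrow> (nat \<Rightarrow> real) \<Rightarrow> bool) \<Rightarrow> real \<Rightarrow> bool" where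
  "chain_net X P J close \<theta> \<longleftrightarrow> (\<forall>k\<le>J. finite (P k) \<and> P k \<subseteq> X) \<and>
    (\<forall>x\<in>X. \<exists>\<pi>. (\<forall>k\<le>J. \<pi> k \<in> P k) \<and> (\<forall>k<J. close k (\<pi> k) (\<pi> (Suc k))) \<and>
      (\<exists>e\<in>X. \<forall>i. x i - \<pi> J i = \<theta> * e i))"

text \<open>D is read as a matrix with rows s in R and columns l < n. Bounding its transpose on all
  w bounds its operator norm.\<close>

definition op_bound :: "nat \<Rightarrow> nat set \<Rightarrow> (nat \<Rightarrow> nat \<Rightarrow> real) \<Rightarrow> real \<Rightarrow> bool" where
  "op_bound n R D c \<longleftrightarrow> (\<forall>w. (\<Sum>l<n. (\<Sum>s\<in>R. D s l * w s)\<^sup>2) \<le> c\<^sup>2 * (\<Sum>s\<in>R. (w s)\<^sup>2))"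

text \<open>Matrices \<open>V x\<close> depending linearly on x; the squared norm of
  \<open>V x\<close> applied to a random vector is the chaos to be estimated.\<close>

locale linear_family =
  fixes n :: nat and R :: "nat set" and V :: "(nat \<Rightarrow> real) \<Rightarrow> nat \<Rightarrow> nat \<Rightarrow> real"
  assumes finite_R: "finite R"
    and V_lin: "\<And>a b x y s l. V (\<lambda>i. a * x i + b * y i) s l = a * V x s l + b * V y s l"
begin

definition app :: "(nat \<Rightarrow> real) \<Rightarrow> (nat \<Rightarrow> real) \<Rightarrow> nat \<Rightarrow> real" where
  "app x \<xi> s = (\<Sum>l<n. V x s l * \<xi> l)"

lemma V_diff: "V (\<lambda>i. x i - y i) s l = V x s l - V y s l"
  using V_lin[of 1 x "- 1" y s l] by simp

lemma V_scale: "V (\<lambda>i. a * x i) s l = a * V x s l"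
  using V_lin[of a x 0 x s l] by simp

lemma app_diff: "app (\<lambda>i. x i - y i) \<xi> s = app x \<xi> s - app y \<xi> s"
  by (simp add: app_def V_diff algebra_simps sum_subtractf)

lemma app_scale: "app (\<lambda>i. a * x i) \<xi> s = a * app x \<xi> s"
  by (simp add: app_def V_scale sum_distrib_left mult.assoc)

text \<open>For \<sigma> = 1 or \<sigma> = - 1 the factor (1 + \<sigma> walsh A l) / 2 is the
  indicator of walsh A l = \<sigma>, so the two values of \<sigma> split the coordinates. B is a
  prior flip of all signs.\<close>

definition half :: "real \<Rightarrow> nat set \<Rightarrow> nat set \<Rightarrow> (nat \<Rightarrow> real) \<Rightarrow> nat \<Rightarrow> real" where
  "half \<sigma> A B \<xi> l = (1 + \<sigma> * walsh A l) / 2 * (walsh B l * \<xi> l)"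

definition decoupled :: "nat set \<Rightarrow> nat set \<Rightarrow> (nat \<Rightarrow> real) \<Rightarrow> (nat \<Rightarrow> real) \<Rightarrow> real" where
  "decoupled A B \<xi> x = (\<Sum>s\<in>R. app x (half 1 A B \<xi>) s * app x (half (- 1) A B \<xi>) s)"

definition diag :: "(nat \<Rightarrow> real) \<Rightarrow> (nat \<Rightarrow> real) \<Rightarrow> real" where
  "diag x \<xi> = (\<Sum>l<n. (\<xi> l)\<^sup>2 * (\<Sum>s\<in>R. (V x s l)\<^sup>2))"

text \<open>Walsh signs do the decoupling: \<open>(p + q) (p - q) = p\<^sup>2 - q\<^sup>2\<close>, and the average of \<open>q\<^sup>2\<close> over all
  sign patterns is the diagonal. The patterns form a group, so the norms of the halves are controlled
  by the norms of the sign-flipped vectors of the same family.\<close>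

lemma decoupling:
  assumes "n \<le> 2 ^ d"
  shows "(\<Sum>s\<in>R. (app x (\<lambda>l. walsh B l * \<xi> l) s)\<^sup>2) - diag x \<xi>
    = 4 / 2 ^ d * (\<Sum>A\<in>Pow {..<d}. decoupled A B \<xi> x)"
proof -
  let ?\<xi> = "\<lambda>l. walsh B l * \<xi> l"
  have pm: "app x (half \<sigma> A B \<xi>) s = (app x ?\<xi> s + \<sigma> * app x (\<lambda>l. walsh A l * ?\<xi> l) s) / 2" for \<sigma> A s
    by (simp add: app_def half_def sum_distrib_left sum_divide_distrib algebra_simps add_divide_distrib sum.distrib)
  have "4 * decoupled A B \<xi> x = (\<Sum>s\<in>R. (app x ?\<xi> s)\<^sup>2 - (app x (\<lambda>l. walsh A l * ?\<xi> l) s)\<^sup>2)" for A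
    unfolding decoupled_def pm sum_distrib_left by (intro sum.cong refl) (simp add: power2_eq_square field_simps)
  then have "4 * (\<Sum>A\<in>Pow {..<d}. decoupled A B \<xi> x)
     = 2 ^ d * (\<Sum>s\<in>R. (app x ?\<xi> s)\<^sup>2) - (\<Sum>A\<in>Pow {..<d}. \<Sum>s\<in>R. (app x (\<lambda>l. walsh A l * ?\<xi> l) s)\<^sup>2)"
    by (simp add: sum_distrib_left sum_subtractf card_Pow)
  also have "(\<Sum>A\<in>Pow {..<d}. \<Sum>s\<in>R. (app x (\<lambda>l. walsh A l * ?\<xi> l) s)\<^sup>2)
     = (\<Sum>s\<in>R. \<Sum>A\<in>Pow {..<d}. (\<Sum>l<n. V x s l * ?\<xi> l * walsh A l)\<^sup>2)"
    by (subst sum.swap) (simp add: app_def mult_ac)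
  also have "\<dots> = 2 ^ d * (\<Sum>s\<in>R. \<Sum>l<n. (V x s l * ?\<xi> l)\<^sup>2)"
    by (simp add: walsh_average[OF assms] sum_distrib_left)
  also have "(\<Sum>s\<in>R. \<Sum>l<n. (V x s l * ?\<xi> l)\<^sup>2) = diag x \<xi>"
  proof -
    have "(V x s l * ?\<xi> l)\<^sup>2 = (\<xi> l)\<^sup>2 * (V x s l)\<^sup>2" for s l
    proof -
      have "(walsh B l)\<^sup>2 = 1" using walsh_sq[of B l] by (simp add: power2_eq_square)
      then show ?thesis by (simp add: power_mult_distrib)
    qed
    then show ?thesis unfolding diag_def by (subst sum.swap) (simp add: sum_distrib_left)
  qed
  finally show ?thesis by (simp add: field_simps)
qed

lemma half_norm:
  assumes "finite A" "finite B" "\<bar>\<sigma>\<bar> = 1"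
    and "L2_set (app x (\<lambda>l. walsh B l * \<xi> l)) R \<le> M"
    and "L2_set (app x (\<lambda>l. walsh ((A - B) \<union> (B - A)) l * \<xi> l)) R \<le> M"
  shows "L2_set (app x (half \<sigma> A B \<xi>)) R \<le> M"
proof -
  let ?a = "app x (\<lambda>l. walsh B l * \<xi> l)" and ?b = "app x (\<lambda>l. walsh ((A - B) \<union> (B - A)) l * \<xi> l)"
  have "app x (half \<sigma> A B \<xi>) = (\<lambda>s. 1/2 * ?a s + \<sigma>/2 * ?b s)"
    unfolding walsh_mult[OF assms(1,2), symmetric]
    by (rule ext) (simp add: app_def half_def sum_distrib_left algebra_simps add_divide_distrib sum.distrib)
  then have "L2_set (app x (half \<sigma> A B \<xi>)) R \<le> L2_set (\<lambda>s. 1/2 * ?a s) R + L2_set (\<lambda>s. \<sigma>/2 * ?b s) R"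
    by (simp only: L2_set_triangle_ineq)
  also have "L2_set (\<lambda>s. 1/2 * ?a s) R = 1/2 * L2_set ?a R" by (subst L2_set_scale) simp
  also have "L2_set (\<lambda>s. \<sigma>/2 * ?b s) R = \<bar>\<sigma>\<bar> / 2 * L2_set ?b R"
    by (subst L2_set_scale) simp
  finally show ?thesis using assms by simp
qed

text \<open>The supremum M of the norms over X and all sign flips occurs on both sides: decoupling
  gives M^2 <= Dg + 4 Kc M + 8 \<theta> M^2. Solving for M^2 produces the expression under the root.
  The bound \<open>bdd\<close> makes M finite.\<close>

lemma decoupled_deviation:
  assumes nd: "n \<le> 2 ^ d" and X: "X \<noteq> {}" and Kc: "Kc \<ge> 0" and \<theta>: "0 \<le> \<theta>" "\<theta> \<le> 1 / 32"
    and bdd: "\<And>B y. B \<subseteq> {..<d} \<Longrightarrow> y \<in> X \<Longrightarrow> L2_set (app y (\<lambda>l. walsh B l * \<xi> l)) R \<le> K"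
    and dec: "\<And>A B x M. \<lbrakk>A \<subseteq> {..<d}; B \<subseteq> {..<d}; x \<in> X; M \<ge> 0;
        \<And>B y. \<lbrakk>B \<subseteq> {..<d}; y \<in> X\<rbrakk> \<Longrightarrow> L2_set (app y (\<lambda>l. walsh B l * \<xi> l)) R \<le> M\<rbrakk>
      \<Longrightarrow> \<bar>decoupled A B \<xi> x\<bar> \<le> Kc * M + 2 * \<theta> * M\<^sup>2"
    and dg: "\<And>x. x \<in> X \<Longrightarrow> diag x \<xi> \<le> Dg"
    and x: "x \<in> X"
  shows "\<bar>(\<Sum>s\<in>R. (app x \<xi> s)\<^sup>2) - diag x \<xi>\<bar> \<le> 4 * Kc * sqrt (2 * Dg + 32 * Kc\<^sup>2) + 8 * \<theta> * (2 * Dg + 32 * Kc\<^sup>2)"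
proof -
  \<comment> \<open>All flips are included, because the halves of a flipped vector are averages of
    two flipped vectors.\<close>
  define Z where "Z = (\<lambda>(B, y). L2_set (app y (\<lambda>l. walsh B l * \<xi> l)) R) ` (Pow {..<d} \<times> X)"
  have Zne: "Z \<noteq> {}" using X by (auto simp: Z_def)
  have Zbdd: "bdd_above Z" unfolding Z_def using bdd by (intro bdd_aboveI[of _ K]) auto
  define M where "M = Sup Z"
  have le_M: "L2_set (app y (\<lambda>l. walsh B l * \<xi> l)) R \<le> M" if "B \<subseteq> {..<d}" "y \<in> X" for B y
    unfolding M_def by (rule cSup_upper[OF _ Zbdd]) (use that in \<open>auto simp: Z_def\<close>)
  have M0: "M \<ge> 0" using le_M[of "{}" x] x L2_set_nonneg order_trans by (metis empty_subsetI)
  have dev: "\<bar>(\<Sum>s\<in>R. (app y (\<lambda>l. walsh B l * \<xi> l) s)\<^sup>2) - diag y \<xi>\<bar> \<le> 4 * Kc * M + 8 * \<theta> * M\<^sup>2"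
    if "B \<subseteq> {..<d}" "y \<in> X" for B y
  proof -
    have "\<bar>\<Sum>A\<in>Pow {..<d}. decoupled A B \<xi> y\<bar> \<le> (\<Sum>A\<in>Pow {..<d}. \<bar>decoupled A B \<xi> y\<bar>)" by (rule sum_abs)
    also have "\<dots> \<le> (\<Sum>A\<in>Pow {..<d}. Kc * M + 2 * \<theta> * M\<^sup>2)"
      by (intro sum_mono dec that M0 le_M) auto
    also have "\<dots> = 2 ^ d * (Kc * M + 2 * \<theta> * M\<^sup>2)" by (simp add: card_Pow)
    finally have "4 / 2 ^ d * \<bar>\<Sum>A\<in>Pow {..<d}. decoupled A B \<xi> y\<bar> \<le> 4 / 2 ^ d * (2 ^ d * (Kc * M + 2 * \<theta> * M\<^sup>2))"
      by (intro mult_left_mono) auto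
    then show ?thesis unfolding decoupling[OF nd] abs_mult by simp
  qed
  have "m\<^sup>2 \<le> Dg + 4 * Kc * M + 8 * \<theta> * M\<^sup>2" if m: "m \<in> Z" for m
  proof -
    obtain B y where By: "B \<subseteq> {..<d}" "y \<in> X" "m = L2_set (app y (\<lambda>l. walsh B l * \<xi> l)) R"
      using m by (auto simp: Z_def)
    have "m\<^sup>2 = (\<Sum>s\<in>R. (app y (\<lambda>l. walsh B l * \<xi> l) s)\<^sup>2)" by (simp add: By L2_set_def sum_nonneg)
    then show ?thesis using dev[OF By(1,2)] dg[OF By(2)] by linarith
  qed
  then have "m \<le> sqrt (Dg + 4 * Kc * M + 8 * \<theta> * M\<^sup>2)" if "m \<in> Z" for m
    using that real_le_rsqrt by blast
  then have "M \<le> sqrt (Dg + 4 * Kc * M + 8 * \<theta> * M\<^sup>2)"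
    unfolding M_def using cSup_least[OF Zne] by blast
  then have Dpos: "M\<^sup>2 \<le> Dg + 4 * Kc * M + 8 * \<theta> * M\<^sup>2"
    using M0 by (metis abs_of_nonneg order_trans real_sqrt_ge_0_iff real_sqrt_le_iff real_sqrt_abs)
  \<comment> \<open>By \<theta> <= 1/32 and by completing a square, each of the two terms costs one
    quarter of M^2, so that M^2 / 2 remains on the left.\<close>
  have "8 * \<theta> * M\<^sup>2 \<le> 1/4 * M\<^sup>2" using \<theta> by (intro mult_right_mono) auto
  moreover have "4 * Kc * M \<le> 1/4 * M\<^sup>2 + 16 * Kc\<^sup>2"
    using zero_le_power2[of "M / 2 - 4 * Kc"] by (simp add: power2_eq_square algebra_simps)
  ultimately have M2: "M\<^sup>2 \<le> 2 * Dg + 32 * Kc\<^sup>2" using Dpos by linarith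
  then have "M \<le> sqrt (2 * Dg + 32 * Kc\<^sup>2)" by (rule real_le_rsqrt)
  then have "4 * Kc * M + 8 * \<theta> * M\<^sup>2 \<le> 4 * Kc * sqrt (2 * Dg + 32 * Kc\<^sup>2) + 8 * \<theta> * (2 * Dg + 32 * Kc\<^sup>2)"
    using M2 Kc \<theta> by (intro add_mono mult_left_mono) auto
  then show ?thesis using dev[of "{}" x] x by simp
qed

text \<open>The decoupled form telescopes along the chain. A link splits into a term with the
  increment in the first half and one with the increment in the second; conditionally on the other
  half each is a linear form, hence the factor 2. The remainder contributes two terms of size
  \<theta> M^2.\<close>

lemma chain_decoupled:
  fixes c t :: "nat \<Rightarrow> real"
  assumes net: "chain_net X P J (\<lambda>k u u'. op_bound n R (V (\<lambda>i. u i - u' i)) (c k)) \<theta>"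
    and \<theta>: "\<theta> \<ge> 0" and c: "\<And>k. c k \<ge> 0" and t: "\<And>k. t k \<ge> 0" and c0: "c0 \<ge> 0" and t0: "t0 \<ge> 0"
    and AB: "A \<subseteq> {..<d}" "B \<subseteq> {..<d}"
    and top: "\<And>u. u \<in> P 0 \<Longrightarrow>
        \<bar>\<Sum>s\<in>R. app u (half 1 A B \<xi>) s * app u (half (- 1) A B \<xi>) s\<bar> \<le> t0 * c0 * L2_set (app u (half (- 1) A B \<xi>)) R"
    and step1: "\<And>k u u'. \<lbrakk>k < J; u \<in> P k; u' \<in> P (Suc k); op_bound n R (V (\<lambda>i. u i - u' i)) (c k)\<rbrakk> \<Longrightarrow>
        \<bar>\<Sum>s\<in>R. app (\<lambda>i. u i - u' i) (half 1 A B \<xi>) s * app u (half (- 1) A B \<xi>) s\<bar>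
          \<le> t k * c k * L2_set (app u (half (- 1) A B \<xi>)) R"
    and step2: "\<And>k u u'. \<lbrakk>k < J; u \<in> P k; u' \<in> P (Suc k); op_bound n R (V (\<lambda>i. u i - u' i)) (c k)\<rbrakk> \<Longrightarrow>
        \<bar>\<Sum>s\<in>R. app (\<lambda>i. u i - u' i) (half (- 1) A B \<xi>) s * app u' (half 1 A B \<xi>) s\<bar>
          \<le> t k * c k * L2_set (app u' (half 1 A B \<xi>)) R"
    and M: "\<And>B y. \<lbrakk>B \<subseteq> {..<d}; y \<in> X\<rbrakk> \<Longrightarrow> L2_set (app y (\<lambda>l. walsh B l * \<xi> l)) R \<le> M"
    and x: "x \<in> X"
  shows "\<bar>decoupled A B \<xi> x\<bar> \<le> (t0 * c0 + (\<Sum>k<J. 2 * (t k * c k))) * M + 2 * \<theta> * M\<^sup>2"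
proof -
  let ?f = "\<lambda>y. app y (half 1 A B \<xi>)" and ?g = "\<lambda>y. app y (half (- 1) A B \<xi>)"
  let ?ip = "\<lambda>a b. \<Sum>s\<in>R. a s * b s :: real"
  have fin: "finite A" "finite B" using AB finite_subset by auto
  have hM: "L2_set (app y (half \<sigma> A B \<xi>)) R \<le> M" if "y \<in> X" "\<bar>\<sigma>\<bar> = 1" for y \<sigma>
    using AB that by (intro half_norm fin M) auto
  have M0: "M \<ge> 0" using M[of "{}" x] x L2_set_nonneg order_trans by (metis empty_subsetI)
  obtain \<pi> e where \<pi>: "\<And>k. k \<le> J \<Longrightarrow> \<pi> k \<in> P k"
    "\<And>k. k < J \<Longrightarrow> op_bound n R (V (\<lambda>i. \<pi> k i - \<pi> (Suc k) i)) (c k)"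
    and e: "e \<in> X" "\<And>i. x i - \<pi> J i = \<theta> * e i"
  proof -
    have "\<exists>\<pi>. (\<forall>k\<le>J. \<pi> k \<in> P k) \<and> (\<forall>k<J. op_bound n R (V (\<lambda>i. \<pi> k i - \<pi> (Suc k) i)) (c k)) \<and>
      (\<exists>e\<in>X. \<forall>i. x i - \<pi> J i = \<theta> * e i)"
      using net x unfolding chain_net_def by blast
    then show ?thesis using that by blast
  qed
  have \<pi>X: "\<pi> k \<in> X" if "k \<le> J" for k using net \<pi>(1)[OF that] that unfolding chain_net_def by blast
  have diff: "?ip (?f u) (?g u) - ?ip (?f u') (?g u')
      = ?ip (?f (\<lambda>i. u i - u' i)) (?g u) + ?ip (?g (\<lambda>i. u i - u' i)) (?f u')" for u u'
    unfolding app_diff sum_subtractf[symmetric] sum.distrib[symmetric]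
    by (intro sum.cong refl) (simp add: algebra_simps)
  have "\<bar>decoupled A B \<xi> (\<pi> k)\<bar> \<le> (t0 * c0 + (\<Sum>j<k. 2 * (t j * c j))) * M" if "k \<le> J" for k
    using that
  proof (induction k)
    case 0
    have "\<bar>decoupled A B \<xi> (\<pi> 0)\<bar> \<le> t0 * c0 * L2_set (?g (\<pi> 0)) R"
      unfolding decoupled_def using \<pi>(1)[of 0] by (intro top) auto
    also have "\<dots> \<le> t0 * c0 * M" using t0 c0 \<pi>X[of 0] by (intro mult_left_mono hM) auto
    finally show ?case by simp
  next
    case (Suc k)
    have tc: "t k * c k \<ge> 0" using t c by simp
    have "\<bar>?ip (?f (\<lambda>i. \<pi> k i - \<pi> (Suc k) i)) (?g (\<pi> k))\<bar> \<le> t k * c k * L2_set (?g (\<pi> k)) R"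
      using \<pi> Suc.prems by (intro step1) auto
    also have "\<dots> \<le> t k * c k * M" using tc \<pi>X[of k] Suc.prems by (intro mult_left_mono hM) auto
    finally have 1: "\<bar>?ip (?f (\<lambda>i. \<pi> k i - \<pi> (Suc k) i)) (?g (\<pi> k))\<bar> \<le> t k * c k * M" .
    have "\<bar>?ip (?g (\<lambda>i. \<pi> k i - \<pi> (Suc k) i)) (?f (\<pi> (Suc k)))\<bar> \<le> t k * c k * L2_set (?f (\<pi> (Suc k))) R"
      using \<pi> Suc.prems by (intro step2) auto
    also have "\<dots> \<le> t k * c k * M" using tc \<pi>X[of "Suc k"] Suc.prems by (intro mult_left_mono hM) auto
    finally have 2: "\<bar>?ip (?g (\<lambda>i. \<pi> k i - \<pi> (Suc k) i)) (?f (\<pi> (Suc k)))\<bar> \<le> t k * c k * M" .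
    have 3: "\<bar>decoupled A B \<xi> (\<pi> k)\<bar> \<le> (t0 * c0 + (\<Sum>j<k. 2 * (t j * c j))) * M"
      using Suc by simp
    have "(t0 * c0 + (\<Sum>j<Suc k. 2 * (t j * c j))) * M
      = (t0 * c0 + (\<Sum>j<k. 2 * (t j * c j))) * M + t k * c k * M + t k * c k * M"
      by (simp add: algebra_simps)
    then show ?case using 1 2 3 diff[of "\<pi> k" "\<pi> (Suc k)"] unfolding decoupled_def by linarith
  qed
  from this[of J] have main: "\<bar>decoupled A B \<xi> (\<pi> J)\<bar> \<le> (t0 * c0 + (\<Sum>j<J. 2 * (t j * c j))) * M" by simp
  have CS: "\<bar>?ip a b\<bar> \<le> L2_set a R * L2_set b R" for a b
  proof -
    have "\<bar>?ip a b\<bar> \<le> (\<Sum>s\<in>R. \<bar>a s\<bar> * \<bar>b s\<bar>)"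
      by (rule order_trans[OF sum_abs]) (simp add: abs_mult)
    then show ?thesis using L2_set_mult_ineq order_trans by blast
  qed
  have eq: "app (\<lambda>i. x i - \<pi> J i) \<zeta> s = \<theta> * app e \<zeta> s" for \<zeta> s
    by (simp only: e(2) app_scale)
  have a: "\<bar>?ip (?f (\<lambda>i. x i - \<pi> J i)) (?g x)\<bar> \<le> \<theta> * (M * M)"
  proof -
    have "\<bar>?ip (?f (\<lambda>i. x i - \<pi> J i)) (?g x)\<bar> = \<theta> * \<bar>?ip (?f e) (?g x)\<bar>"
      using \<theta> by (simp add: eq mult.assoc abs_mult flip: sum_distrib_left)
    also have "\<dots> \<le> \<theta> * (L2_set (?f e) R * L2_set (?g x) R)" using \<theta> by (intro mult_left_mono CS) auto
    also have "\<dots> \<le> \<theta> * (M * M)" using \<theta> M0 e x by (intro mult_left_mono mult_mono hM) auto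
    finally show ?thesis .
  qed
  have b: "\<bar>?ip (?g (\<lambda>i. x i - \<pi> J i)) (?f (\<pi> J))\<bar> \<le> \<theta> * (M * M)"
  proof -
    have "\<bar>?ip (?g (\<lambda>i. x i - \<pi> J i)) (?f (\<pi> J))\<bar> = \<theta> * \<bar>?ip (?g e) (?f (\<pi> J))\<bar>"
      using \<theta> by (simp add: eq mult.assoc abs_mult flip: sum_distrib_left)
    also have "\<dots> \<le> \<theta> * (L2_set (?g e) R * L2_set (?f (\<pi> J)) R)" using \<theta> by (intro mult_left_mono CS) auto
    also have "\<dots> \<le> \<theta> * (M * M)" using \<theta> M0 e \<pi>X[of J] by (intro mult_left_mono mult_mono hM) auto
    finally show ?thesis .
  qed
  have "2 * \<theta> * M\<^sup>2 = \<theta> * (M * M) + \<theta> * (M * M)" by (simp add: power2_eq_square)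
  then show ?thesis using main a b diff[of x "\<pi> J"] unfolding decoupled_def by linarith
qed

end

locale linear_process = linear_family n R V + subgaussian_law N
  for n R V N
begin

lemma half_split:
  assumes "\<bar>\<sigma>\<bar> = 1"
  shows "app x (half \<sigma> A B \<xi>) s = (\<Sum>l\<in>{l. l < n \<and> walsh A l = \<sigma>}. V x s l * (walsh B l * \<xi> l))"
proof -
  have "app x (half \<sigma> A B \<xi>) s = (\<Sum>l<n. if walsh A l = \<sigma> then V x s l * (walsh B l * \<xi> l) else 0)"
    unfolding app_def half_def
  proof (intro sum.cong refl)
    fix l
    have "\<sigma> = 1 \<or> \<sigma> = - 1" using assms by linarith
    then show "V x s l * ((1 + \<sigma> * walsh A l) / 2 * (walsh B l * \<xi> l))
        = (if walsh A l = \<sigma> then V x s l * (walsh B l * \<xi> l) else 0)"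
      using walsh_cases[of A l] by auto
  qed
  also have "\<dots> = (\<Sum>l\<in>{l\<in>{..<n}. walsh A l = \<sigma>}. V x s l * (walsh B l * \<xi> l))"
    by (rule sum.inter_filter[symmetric]) simp
  also have "{l\<in>{..<n}. walsh A l = \<sigma>} = {l. l < n \<and> walsh A l = \<sigma>}" by auto
  finally show ?thesis .
qed

lemma half_tail:
  assumes \<sigma>: "\<bar>\<sigma>\<bar> = 1" and t: "t \<ge> 0" and c: "c \<ge> 0" and op: "op_bound n R (V y) c"
  shows "whp (\<mu> n) (2 * exp (- t\<^sup>2 / 2))
    (\<lambda>\<xi>. \<bar>\<Sum>s\<in>R. app y (half \<sigma> A B \<xi>) s * app u (half (- \<sigma>) A B \<xi>) s\<bar>
      \<le> t * c * L2_set (app u (half (- \<sigma>) A B \<xi>)) R)"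
proof -
  let ?T = "{l. l < n \<and> walsh A l = \<sigma>}"
  have T: "?T \<subseteq> {..<n}" by auto
  have compl: "{l. l < n \<and> walsh A l = - \<sigma>} = {..<n} - ?T"
    using \<sigma> walsh_cases[of A] by (auto simp: abs_if split: if_splits)
  have 1: "app y (half \<sigma> A B \<xi>) s = (\<Sum>l\<in>?T. V y s l * (walsh B l * \<xi> l))" for \<xi> s
    by (rule half_split[OF \<sigma>])
  have 2: "app u (half (- \<sigma>) A B \<xi>) = (\<lambda>s. \<Sum>l\<in>{..<n} - ?T. V u s l * (walsh B l * \<xi> l))" for \<xi>
    using half_split[of "- \<sigma>" u A B \<xi>] \<sigma> unfolding compl by auto
  show ?thesis
    unfolding 1 2
    by (rule decoupled_tail[OF T t c finite_R]) (use op in \<open>auto simp: op_bound_def walsh_abs\<close>)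
qed

text \<open>A union bound over pairs of sign patterns, levels and links. The exceptional event does
  not involve Dg, so Dg may be chosen afterwards and may depend on \<xi>.\<close>

lemma chaos_deviation_whp:
  fixes c t :: "nat \<Rightarrow> real"
  assumes nd: "n \<le> 2 ^ d"
    and net: "chain_net X P J (\<lambda>k u u'. op_bound n R (V (\<lambda>i. u i - u' i)) (c k)) \<theta>"
    and \<theta>: "0 \<le> \<theta>" "\<theta> \<le> 1 / 32"
    and c: "\<And>k. c k \<ge> 0" and t: "\<And>k. t k \<ge> 0" and c0: "c0 \<ge> 0" and t0: "t0 \<ge> 0"
    and op0: "\<And>u. u \<in> P 0 \<Longrightarrow> op_bound n R (V u) c0"
    and bdd: "\<And>x s l. x \<in> X \<Longrightarrow> s \<in> R \<Longrightarrow> l < n \<Longrightarrow> \<bar>V x s l\<bar> \<le> K"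
    and Kc: "t0 * c0 + (\<Sum>k<J. 2 * (t k * c k)) \<le> Kc"
    and p0: "real (card (P 0)) * (2 * exp (- t0\<^sup>2 / 2)) \<le> p"
    and p1: "\<And>k. k < J \<Longrightarrow> real (card (P k)) * real (card (P (Suc k))) * (4 * exp (- (t k)\<^sup>2 / 2)) \<le> p"
  shows "whp (\<mu> n) ((2 ^ d)\<^sup>2 * (real (Suc J) * p))
    (\<lambda>\<xi>. \<forall>Dg. (\<forall>x\<in>X. diag x \<xi> \<le> Dg) \<longrightarrow> (\<forall>x\<in>X. \<bar>(\<Sum>s\<in>R. (app x \<xi> s)\<^sup>2) - diag x \<xi>\<bar>
       \<le> 4 * Kc * sqrt (2 * Dg + 32 * Kc\<^sup>2) + 8 * \<theta> * (2 * Dg + 32 * Kc\<^sup>2)))"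
proof -
  have finP: "finite (P k)" "P k \<subseteq> X" if "k \<le> J" for k using net that unfolding chain_net_def by blast+
  have p_nonneg: "p \<ge> 0" by (rule order_trans[OF _ p0]) simp
  define top where "top A B \<xi> \<longleftrightarrow> (\<forall>u\<in>P 0.
     \<bar>\<Sum>s\<in>R. app u (half 1 A B \<xi>) s * app u (half (- 1) A B \<xi>) s\<bar> \<le> t0 * c0 * L2_set (app u (half (- 1) A B \<xi>)) R)" for A B \<xi>
  \<comment> \<open>The tail is claimed for close pairs only. Other pairs of net points satisfy the
    implication trivially and never form a link.\<close>
  define stp where "stp k A B u u' \<xi> \<longleftrightarrow> (op_bound n R (V (\<lambda>i. u i - u' i)) (c k) \<longrightarrow>
        \<bar>\<Sum>s\<in>R. app (\<lambda>i. u i - u' i) (half 1 A B \<xi>) s * app u (half (- 1) A B \<xi>) s\<bar>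
          \<le> t k * c k * L2_set (app u (half (- 1) A B \<xi>)) R \<and>
        \<bar>\<Sum>s\<in>R. app (\<lambda>i. u i - u' i) (half (- 1) A B \<xi>) s * app u' (half 1 A B \<xi>) s\<bar>
          \<le> t k * c k * L2_set (app u' (half 1 A B \<xi>)) R)" for k A B u u' \<xi>
  have wtop: "whp (\<mu> n) p (top A B)" for A B
  proof -
    have "whp (\<mu> n) (real (card (P 0)) * (2 * exp (- t0\<^sup>2 / 2))) (top A B)"
      unfolding top_def using half_tail[of 1] finP t0 c0 op0 by (intro whp_ball) auto
    then show ?thesis using p0 by (rule whp_mono)
  qed
  have wstp: "whp (\<mu> n) (4 * exp (- (t k)\<^sup>2 / 2)) (stp k A B u u')" for k A B u u'
  proof (cases "op_bound n R (V (\<lambda>i. u i - u' i)) (c k)")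
    case True
    have "whp (\<mu> n) (2 * exp (- (t k)\<^sup>2 / 2) + 2 * exp (- (t k)\<^sup>2 / 2)) (stp k A B u u')"
      unfolding stp_def
      by (rule whp_mono[OF whp_conj[OF half_tail[of 1 "t k" "c k" "\<lambda>i. u i - u' i" A B u]
            half_tail[of "- 1" "t k" "c k" "\<lambda>i. u i - u' i" A B u']]])
        (use True t c in auto)
    then show ?thesis by simp
  next
    case False
    then show ?thesis by (intro whp_mono[OF whp_always]) (auto simp: stp_def)
  qed
  have wstps: "whp (\<mu> n) p (\<lambda>\<xi>. \<forall>uu\<in>P k \<times> P (Suc k). stp k A B (fst uu) (snd uu) \<xi>)" if "k < J" for k A B
  proof -
    have "whp (\<mu> n) (real (card (P k \<times> P (Suc k))) * (4 * exp (- (t k)\<^sup>2 / 2)))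
      (\<lambda>\<xi>. \<forall>uu\<in>P k \<times> P (Suc k). stp k A B (fst uu) (snd uu) \<xi>)"
      using finP that wstp by (intro whp_ball) auto
    then show ?thesis by (rule whp_mono) (use p1[OF that] in \<open>auto simp: card_cartesian_product\<close>)
  qed
  have "whp (\<mu> n) (p + real (card {..<J}) * p)
     (\<lambda>\<xi>. top A B \<xi> \<and> (\<forall>k\<in>{..<J}. \<forall>uu\<in>P k \<times> P (Suc k). stp k A B (fst uu) (snd uu) \<xi>))" for A B
    using wtop wstps p_nonneg by (intro whp_conj whp_ball) auto
  then have wAB: "whp (\<mu> n) (real (Suc J) * p)
     (\<lambda>\<xi>. top A B \<xi> \<and> (\<forall>k\<in>{..<J}. \<forall>uu\<in>P k \<times> P (Suc k). stp k A B (fst uu) (snd uu) \<xi>))" for A B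
    by (rule whp_mono) (auto simp: algebra_simps)
  define Ev where "Ev \<xi> \<longleftrightarrow> (\<forall>AB\<in>Pow {..<d} \<times> Pow {..<d}. top (fst AB) (snd AB) \<xi> \<and>
     (\<forall>k\<in>{..<J}. \<forall>uu\<in>P k \<times> P (Suc k). stp k (fst AB) (snd AB) (fst uu) (snd uu) \<xi>))" for \<xi>
  have "whp (\<mu> n) (real (card (Pow {..<d} \<times> Pow {..<d})) * (real (Suc J) * p)) Ev"
    unfolding Ev_def using wAB p_nonneg by (intro whp_ball) auto
  moreover have "real (card (Pow {..<d} \<times> Pow {..<d})) = (2 ^ d)\<^sup>2"
    by (simp add: card_cartesian_product card_Pow power2_eq_square)
  ultimately have "whp (\<mu> n) ((2 ^ d)\<^sup>2 * (real (Suc J) * p)) Ev" by simp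
  then show ?thesis
  proof (rule whp_mono[OF _ order_refl], intro allI impI ballI)
    fix \<xi> Dg x assume Ev: "Ev \<xi>" and dg: "\<forall>x\<in>X. diag x \<xi> \<le> Dg" and x: "x \<in> X"
    have Kc0: "Kc \<ge> 0" by (rule order_trans[OF _ Kc]) (simp add: c t c0 t0 sum_nonneg)
    show "\<bar>(\<Sum>s\<in>R. (app x \<xi> s)\<^sup>2) - diag x \<xi>\<bar>
       \<le> 4 * Kc * sqrt (2 * Dg + 32 * Kc\<^sup>2) + 8 * \<theta> * (2 * Dg + 32 * Kc\<^sup>2)"
    proof (rule decoupled_deviation[OF nd _ Kc0 \<theta>, where X = X])
      show "X \<noteq> {}" using x by auto
      show "x \<in> X" by fact
      show "diag y \<xi> \<le> Dg" if "y \<in> X" for y using dg that by blast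
      show "L2_set (app y (\<lambda>l. walsh B l * \<xi> l)) R \<le> (\<Sum>s\<in>R. \<Sum>l<n. K * \<bar>\<xi> l\<bar>)" if y: "y \<in> X" for B y
      proof -
        have "L2_set (app y (\<lambda>l. walsh B l * \<xi> l)) R \<le> (\<Sum>s\<in>R. \<bar>app y (\<lambda>l. walsh B l * \<xi> l) s\<bar>)"
          by (rule L2_set_le_sum_abs)
        also have "\<dots> \<le> (\<Sum>s\<in>R. \<Sum>l<n. K * \<bar>\<xi> l\<bar>)"
        proof (intro sum_mono)
          fix s assume s: "s \<in> R"
          have "\<bar>app y (\<lambda>l. walsh B l * \<xi> l) s\<bar> \<le> (\<Sum>l<n. \<bar>V y s l * (walsh B l * \<xi> l)\<bar>)"
            unfolding app_def by (rule sum_abs)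
          also have "\<dots> \<le> (\<Sum>l<n. K * \<bar>\<xi> l\<bar>)"
            by (intro sum_mono) (auto simp: abs_mult walsh_abs intro!: mult_right_mono bdd[OF y s])
          finally show "\<bar>app y (\<lambda>l. walsh B l * \<xi> l) s\<bar> \<le> (\<Sum>l<n. K * \<bar>\<xi> l\<bar>)" .
        qed
        finally show ?thesis .
      qed
      show "\<bar>decoupled A B \<xi> y\<bar> \<le> Kc * M + 2 * \<theta> * M\<^sup>2"
        if AB: "A \<subseteq> {..<d}" "B \<subseteq> {..<d}" and y: "y \<in> X" and M: "M \<ge> 0"
          "\<And>B y. \<lbrakk>B \<subseteq> {..<d}; y \<in> X\<rbrakk> \<Longrightarrow> L2_set (app y (\<lambda>l. walsh B l * \<xi> l)) R \<le> M" for A B y M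
      proof -
        have tp: "top A B \<xi>" and st: "\<And>k u u'. k < J \<Longrightarrow> u \<in> P k \<Longrightarrow> u' \<in> P (Suc k) \<Longrightarrow> stp k A B u u' \<xi>"
          using Ev AB unfolding Ev_def by auto
        have "\<bar>decoupled A B \<xi> y\<bar> \<le> (t0 * c0 + (\<Sum>k<J. 2 * (t k * c k))) * M + 2 * \<theta> * M\<^sup>2"
          by (rule chain_decoupled[OF net \<theta>(1) c t c0 t0 AB])
            (use tp st M y in \<open>auto simp: top_def stp_def\<close>)
        also have "\<dots> \<le> Kc * M + 2 * \<theta> * M\<^sup>2" using Kc M by (intro add_mono mult_right_mono order_refl) auto
        finally show ?thesis .
      qed
    qed
  qed
qed

text \<open>The form is linear in \<xi>, so its tails are unconditional. Each link changes x first
  and y afterwards. The two remainders cost \<theta> M each, together at most M / 2, and are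
  absorbed by the supremum M over X \<times> Y.\<close>

lemma bilinear_whp:
  fixes c t :: "nat \<Rightarrow> real"
  assumes netX: "chain_net X P J (\<lambda>k u u'. op_bound n R (V (\<lambda>i. u i - u' i)) (c k)) \<theta>"
    and netY: "chain_net Y Q J (\<lambda>k v v'. \<forall>u\<in>X. (\<Sum>l<n. (\<Sum>s\<in>R. V u s l * (v s - v' s))\<^sup>2) \<le> (c k)\<^sup>2) \<theta>"
    and \<theta>: "0 \<le> \<theta>" "\<theta> \<le> 1 / 4"
    and c: "\<And>k. c k \<ge> 0" and t: "\<And>k. t k \<ge> 0" and c0: "c0 \<ge> 0" and t0: "t0 \<ge> 0"
    and op0: "\<And>u. u \<in> P 0 \<Longrightarrow> op_bound n R (V u) c0"
    and Y: "\<And>y. y \<in> Y \<Longrightarrow> (\<Sum>s\<in>R. (y s)\<^sup>2) \<le> 1"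
    and bdd: "\<And>x s l. x \<in> X \<Longrightarrow> s \<in> R \<Longrightarrow> l < n \<Longrightarrow> \<bar>V x s l\<bar> \<le> K"
    and Kc: "t0 * c0 + (\<Sum>k<J. 2 * (t k * c k)) \<le> Kc"
    and p0: "real (card (P 0)) * real (card (Q 0)) * (2 * exp (- t0\<^sup>2 / 2)) \<le> p"
    and p1: "\<And>k. k < J \<Longrightarrow> real (card (P k)) * real (card (P (Suc k))) * (real (card (Q k)) * real (card (Q (Suc k))))
        * (4 * exp (- (t k)\<^sup>2 / 2)) \<le> p"
  shows "whp (\<mu> n) (real (Suc J) * p)
    (\<lambda>\<xi>. \<forall>x\<in>X. \<forall>y\<in>Y. \<bar>\<Sum>s\<in>R. y s * app x \<xi> s\<bar> \<le> 2 * Kc)"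
proof -
  have finP: "finite (P k)" "P k \<subseteq> X" if "k \<le> J" for k using netX that unfolding chain_net_def by blast+
  have finQ: "finite (Q k)" "Q k \<subseteq> Y" if "k \<le> J" for k using netY that unfolding chain_net_def by blast+
  have p_nonneg: "p \<ge> 0" by (rule order_trans[OF _ p0]) simp
  define W where "W x y \<xi> = (\<Sum>s\<in>R. y s * app x \<xi> s)" for x y \<xi>
  have W_tail: "whp (\<mu> n) (2 * exp (- \<tau>\<^sup>2 / 2)) (\<lambda>\<xi>. \<bar>W x y \<xi>\<bar> \<le> \<tau> * b)"
    if "\<tau> \<ge> 0" "b \<ge> 0" "(\<Sum>l<n. (\<Sum>s\<in>R. V x s l * y s)\<^sup>2) \<le> b\<^sup>2" for \<tau> b x y
  proof -
    have "whp (\<mu> n) (2 * exp (- \<tau>\<^sup>2 / 2)) (\<lambda>\<xi>. \<bar>\<Sum>l\<in>{..<n}. (\<Sum>s\<in>R. V x s l * y s) * \<xi> l\<bar>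
        \<le> \<tau> * L2_set (\<lambda>l. \<Sum>s\<in>R. V x s l * y s) {..<n})"
      by (rule linear_form_tail) (use that in auto)
    then show ?thesis
    proof (rule whp_mono[OF _ order_refl])
      fix \<xi> assume le: "\<bar>\<Sum>l\<in>{..<n}. (\<Sum>s\<in>R. V x s l * y s) * \<xi> l\<bar>
        \<le> \<tau> * L2_set (\<lambda>l. \<Sum>s\<in>R. V x s l * y s) {..<n}"
      have "L2_set (\<lambda>l. \<Sum>s\<in>R. V x s l * y s) {..<n} \<le> b"
        using that unfolding L2_set_def by (intro real_le_lsqrt) (auto simp: sum_nonneg)
      then have "\<tau> * L2_set (\<lambda>l. \<Sum>s\<in>R. V x s l * y s) {..<n} \<le> \<tau> * b" using that by (intro mult_left_mono)
      moreover have "W x y \<xi> = (\<Sum>l\<in>{..<n}. (\<Sum>s\<in>R. V x s l * y s) * \<xi> l)"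
        unfolding W_def app_def sum_distrib_left sum_distrib_right
        by (subst sum.swap) (simp add: mult_ac)
      ultimately show "\<bar>W x y \<xi>\<bar> \<le> \<tau> * b" using le by linarith
    qed
  qed
  have opY: "(\<Sum>l<n. (\<Sum>s\<in>R. V x s l * y s)\<^sup>2) \<le> b\<^sup>2" if "op_bound n R (V x) b" "y \<in> Y" for x y b
  proof -
    have "(\<Sum>l<n. (\<Sum>s\<in>R. V x s l * y s)\<^sup>2) \<le> b\<^sup>2 * (\<Sum>s\<in>R. (y s)\<^sup>2)" using that by (simp add: op_bound_def)
    also have "\<dots> \<le> b\<^sup>2 * 1" using Y[OF that(2)] by (intro mult_left_mono) auto
    finally show ?thesis by simp
  qed
  define stp where "stp k u u' v v' \<xi> \<longleftrightarrow>
     (op_bound n R (V (\<lambda>i. u i - u' i)) (c k) \<longrightarrow> \<bar>W (\<lambda>i. u i - u' i) v \<xi>\<bar> \<le> t k * c k) \<and>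
     ((\<Sum>l<n. (\<Sum>s\<in>R. V u' s l * (v s - v' s))\<^sup>2) \<le> (c k)\<^sup>2 \<longrightarrow> \<bar>W u' (\<lambda>s. v s - v' s) \<xi>\<bar> \<le> t k * c k)"
    for k u u' v v' \<xi>
  have wtop: "whp (\<mu> n) p (\<lambda>\<xi>. \<forall>uv\<in>P 0 \<times> Q 0. \<bar>W (fst uv) (snd uv) \<xi>\<bar> \<le> t0 * c0)"
  proof -
    have "whp (\<mu> n) (real (card (P 0 \<times> Q 0)) * (2 * exp (- t0\<^sup>2 / 2))) (\<lambda>\<xi>. \<forall>uv\<in>P 0 \<times> Q 0. \<bar>W (fst uv) (snd uv) \<xi>\<bar> \<le> t0 * c0)"
    proof (rule whp_ball)
      fix uv assume "uv \<in> P 0 \<times> Q 0"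
      then show "whp (\<mu> n) (2 * exp (- t0\<^sup>2 / 2)) (\<lambda>\<xi>. \<bar>W (fst uv) (snd uv) \<xi>\<bar> \<le> t0 * c0)"
        using finQ(2)[of 0] by (intro W_tail t0 c0 opY op0) auto
    qed (use finP finQ in auto)
    then show ?thesis by (rule whp_mono) (use p0 in \<open>auto simp: card_cartesian_product\<close>)
  qed
  have wstp: "whp (\<mu> n) (4 * exp (- (t k)\<^sup>2 / 2)) (stp k u u' v v')" if v: "v \<in> Y" for k u u' v v'
  proof -
    have 1: "whp (\<mu> n) (2 * exp (- (t k)\<^sup>2 / 2))
       (\<lambda>\<xi>. op_bound n R (V (\<lambda>i. u i - u' i)) (c k) \<longrightarrow> \<bar>W (\<lambda>i. u i - u' i) v \<xi>\<bar> \<le> t k * c k)"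
    proof (cases "op_bound n R (V (\<lambda>i. u i - u' i)) (c k)")
      case True
      then show ?thesis using W_tail[OF t c opY[OF True v]] by simp
    next
      case False
      then show ?thesis by (intro whp_mono[OF whp_always]) auto
    qed
    have 2: "whp (\<mu> n) (2 * exp (- (t k)\<^sup>2 / 2))
       (\<lambda>\<xi>. (\<Sum>l<n. (\<Sum>s\<in>R. V u' s l * (v s - v' s))\<^sup>2) \<le> (c k)\<^sup>2 \<longrightarrow> \<bar>W u' (\<lambda>s. v s - v' s) \<xi>\<bar> \<le> t k * c k)"
    proof (cases "(\<Sum>l<n. (\<Sum>s\<in>R. V u' s l * (v s - v' s))\<^sup>2) \<le> (c k)\<^sup>2")
      case True
      then show ?thesis using W_tail[OF t c True] by simp
    next
      case False
      then show ?thesis by (intro whp_mono[OF whp_always]) auto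
    qed
    have "whp (\<mu> n) (2 * exp (- (t k)\<^sup>2 / 2) + 2 * exp (- (t k)\<^sup>2 / 2)) (stp k u u' v v')"
      unfolding stp_def by (rule whp_conj[OF 1 2]) auto
    then show ?thesis by simp
  qed
  have wstps: "whp (\<mu> n) p (\<lambda>\<xi>. \<forall>(u, u', v, v')\<in>P k \<times> P (Suc k) \<times> Q k \<times> Q (Suc k). stp k u u' v v' \<xi>)" if "k < J" for k
  proof -
    have "whp (\<mu> n) (real (card (P k \<times> P (Suc k) \<times> Q k \<times> Q (Suc k))) * (4 * exp (- (t k)\<^sup>2 / 2)))
      (\<lambda>\<xi>. \<forall>q\<in>P k \<times> P (Suc k) \<times> Q k \<times> Q (Suc k). (case q of (u, u', v, v') \<Rightarrow> stp k u u' v v' \<xi>))"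
    proof (rule whp_ball)
      fix q assume "q \<in> P k \<times> P (Suc k) \<times> Q k \<times> Q (Suc k)"
      then obtain u u' v v' where q: "q = (u, u', v, v')" "v \<in> Q k" by auto
      then have "v \<in> Y" using finQ(2)[of k] that by auto
      then show "whp (\<mu> n) (4 * exp (- (t k)\<^sup>2 / 2)) (\<lambda>\<xi>. case q of (u, u', v, v') \<Rightarrow> stp k u u' v v' \<xi>)"
        using wstp by (simp add: q)
    qed (use finP finQ that in auto)
    then show ?thesis by (rule whp_mono) (use p1[OF that] in \<open>auto simp: card_cartesian_product mult_ac\<close>)
  qed
  have "whp (\<mu> n) (p + real (card {..<J}) * p) (\<lambda>\<xi>. (\<forall>uv\<in>P 0 \<times> Q 0. \<bar>W (fst uv) (snd uv) \<xi>\<bar> \<le> t0 * c0) \<and>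
      (\<forall>k\<in>{..<J}. \<forall>(u, u', v, v')\<in>P k \<times> P (Suc k) \<times> Q k \<times> Q (Suc k). stp k u u' v v' \<xi>))"
    using wtop wstps p_nonneg by (intro whp_conj whp_ball) auto
  then show ?thesis
  proof (rule whp_mono)
    show "p + real (card {..<J}) * p \<le> real (Suc J) * p" by (simp add: algebra_simps)
    fix \<xi> assume ev: "(\<forall>uv\<in>P 0 \<times> Q 0. \<bar>W (fst uv) (snd uv) \<xi>\<bar> \<le> t0 * c0) \<and>
      (\<forall>k\<in>{..<J}. \<forall>(u, u', v, v')\<in>P k \<times> P (Suc k) \<times> Q k \<times> Q (Suc k). stp k u u' v v' \<xi>)"
    have W_diff_x: "W u v \<xi> - W u' v \<xi> = W (\<lambda>i. u i - u' i) v \<xi>" for u u' v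
      unfolding W_def app_diff by (simp add: algebra_simps sum_subtractf)
    have W_diff_y: "W u v \<xi> - W u v' \<xi> = W u (\<lambda>s. v s - v' s) \<xi>" for u v v'
      unfolding W_def by (simp add: algebra_simps sum_subtractf)
    have W_scale_x: "W (\<lambda>i. a * u i) v \<xi> = a * W u v \<xi>" for a u v
      unfolding W_def app_scale by (simp add: sum_distrib_left mult_ac)
    have W_scale_y: "W u (\<lambda>s. a * v s) \<xi> = a * W u v \<xi>" for a u v
      unfolding W_def by (simp add: sum_distrib_left mult_ac)
    have chain: "\<exists>x' y' e f. x' \<in> X \<and> y' \<in> Y \<and> e \<in> X \<and> f \<in> Y \<and> (\<forall>i. x i - x' i = \<theta> * e i) \<and> (\<forall>i. y i - y' i = \<theta> * f i)
        \<and> \<bar>W x' y' \<xi>\<bar> \<le> Kc" if x: "x \<in> X" and y: "y \<in> Y" for x y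
    proof -
      obtain \<pi> e where \<pi>: "\<And>k. k \<le> J \<Longrightarrow> \<pi> k \<in> P k" "\<And>k. k < J \<Longrightarrow> op_bound n R (V (\<lambda>i. \<pi> k i - \<pi> (Suc k) i)) (c k)"
        and e: "e \<in> X" "\<forall>i. x i - \<pi> J i = \<theta> * e i"
      proof -
        have "\<exists>\<pi>. (\<forall>k\<le>J. \<pi> k \<in> P k) \<and> (\<forall>k<J. op_bound n R (V (\<lambda>i. \<pi> k i - \<pi> (Suc k) i)) (c k)) \<and>
          (\<exists>e\<in>X. \<forall>i. x i - \<pi> J i = \<theta> * e i)"
          using netX x unfolding chain_net_def by blast
        then show ?thesis using that by blast
      qed
      obtain \<rho> f where \<rho>: "\<And>k. k \<le> J \<Longrightarrow> \<rho> k \<in> Q k"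
        "\<And>k u. k < J \<Longrightarrow> u \<in> X \<Longrightarrow> (\<Sum>l<n. (\<Sum>s\<in>R. V u s l * (\<rho> k s - \<rho> (Suc k) s))\<^sup>2) \<le> (c k)\<^sup>2"
        and f: "f \<in> Y" "\<forall>i. y i - \<rho> J i = \<theta> * f i"
      proof -
        have "\<exists>\<rho>. (\<forall>k\<le>J. \<rho> k \<in> Q k) \<and> (\<forall>k<J. \<forall>u\<in>X. (\<Sum>l<n. (\<Sum>s\<in>R. V u s l * (\<rho> k s - \<rho> (Suc k) s))\<^sup>2) \<le> (c k)\<^sup>2) \<and>
          (\<exists>e\<in>Y. \<forall>i. y i - \<rho> J i = \<theta> * e i)"
          using netY y unfolding chain_net_def by blast
        then show ?thesis using that by blast
      qed
      have "\<bar>W (\<pi> k) (\<rho> k) \<xi>\<bar> \<le> t0 * c0 + (\<Sum>j<k. 2 * (t j * c j))" if "k \<le> J" for k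
        using that
      proof (induction k)
        case 0
        have "(\<pi> 0, \<rho> 0) \<in> P 0 \<times> Q 0" using \<pi>(1)[of 0] \<rho>(1)[of 0] by simp
        then show ?case using ev by fastforce
      next
        case (Suc k)
        have "(\<pi> k, \<pi> (Suc k), \<rho> k, \<rho> (Suc k)) \<in> P k \<times> P (Suc k) \<times> Q k \<times> Q (Suc k)"
          using \<pi>(1) \<rho>(1) Suc.prems by simp
        then have "stp k (\<pi> k) (\<pi> (Suc k)) (\<rho> k) (\<rho> (Suc k)) \<xi>" using ev Suc.prems by fastforce
        moreover have "\<pi> (Suc k) \<in> X" using \<pi>(1) finP(2) Suc.prems by blast
        ultimately have "\<bar>W (\<lambda>i. \<pi> k i - \<pi> (Suc k) i) (\<rho> k) \<xi>\<bar> \<le> t k * c k"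
          "\<bar>W (\<pi> (Suc k)) (\<lambda>s. \<rho> k s - \<rho> (Suc k) s) \<xi>\<bar> \<le> t k * c k"
          using \<pi>(2)[of k] \<rho>(2)[of k "\<pi> (Suc k)"] Suc.prems unfolding stp_def by auto
        then show ?case
          using Suc W_diff_x[of "\<pi> k" "\<rho> k" "\<pi> (Suc k)"] W_diff_y[of "\<pi> (Suc k)" "\<rho> k" "\<rho> (Suc k)"] by simp
      qed
      from this[of J] have "\<bar>W (\<pi> J) (\<rho> J) \<xi>\<bar> \<le> Kc" using Kc by simp
      moreover have "\<pi> J \<in> X" "\<rho> J \<in> Y" using \<pi>(1)[of J] \<rho>(1)[of J] finP(2)[of J] finQ(2)[of J] by auto
      ultimately show ?thesis using e f by blast
    qed
    show "\<forall>x\<in>X. \<forall>y\<in>Y. \<bar>\<Sum>s\<in>R. y s * app x \<xi> s\<bar> \<le> 2 * Kc"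
    proof (intro ballI)
      fix x y assume x: "x \<in> X" and y: "y \<in> Y"
      define Z where "Z = (\<lambda>(x, y). \<bar>W x y \<xi>\<bar>) ` (X \<times> Y)"
      have Zne: "Z \<noteq> {}" using x y by (auto simp: Z_def)
      have "\<bar>W x y \<xi>\<bar> \<le> (\<Sum>s\<in>R. \<Sum>l<n. K * \<bar>\<xi> l\<bar>)" if x: "x \<in> X" and y: "y \<in> Y" for x y
      proof -
        have ys: "\<bar>y s\<bar> \<le> 1" if "s \<in> R" for s
        proof -
          have "(y s)\<^sup>2 \<le> (\<Sum>s\<in>R. (y s)\<^sup>2)" using that finite_R by (intro member_le_sum) auto
          then show ?thesis using Y[OF y] abs_square_le_1 by force
        qed
        have "\<bar>W x y \<xi>\<bar> \<le> (\<Sum>s\<in>R. \<bar>y s * app x \<xi> s\<bar>)" unfolding W_def by (rule sum_abs)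
        also have "\<dots> \<le> (\<Sum>s\<in>R. \<Sum>l<n. K * \<bar>\<xi> l\<bar>)"
        proof (intro sum_mono)
          fix s assume s: "s \<in> R"
          have "\<bar>y s * app x \<xi> s\<bar> \<le> 1 * \<bar>app x \<xi> s\<bar>"
            unfolding abs_mult using ys[OF s] by (intro mult_right_mono) auto
          also have "\<dots> \<le> (\<Sum>l<n. \<bar>V x s l * \<xi> l\<bar>)" unfolding app_def by simp
          also have "\<dots> \<le> (\<Sum>l<n. K * \<bar>\<xi> l\<bar>)"
            by (intro sum_mono) (auto simp: abs_mult intro!: mult_right_mono bdd[OF x s])
          finally show "\<bar>y s * app x \<xi> s\<bar> \<le> (\<Sum>l<n. K * \<bar>\<xi> l\<bar>)" .
        qed
        finally show ?thesis .
      qed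
      then have Zbdd: "bdd_above Z" unfolding Z_def by (intro bdd_aboveI) auto
      define M where "M = Sup Z"
      have le_M: "\<bar>W x y \<xi>\<bar> \<le> M" if "x \<in> X" "y \<in> Y" for x y
        unfolding M_def by (rule cSup_upper[OF _ Zbdd]) (use that in \<open>auto simp: Z_def\<close>)
      have "z \<le> Kc + M / 2" if z: "z \<in> Z" for z
      proof -
        obtain x y where xy: "x \<in> X" "y \<in> Y" "z = \<bar>W x y \<xi>\<bar>" using z by (auto simp: Z_def)
        obtain x' y' e f where a: "x' \<in> X" "y' \<in> Y" "e \<in> X" "f \<in> Y" "\<And>i. x i - x' i = \<theta> * e i" "\<And>i. y i - y' i = \<theta> * f i"
          "\<bar>W x' y' \<xi>\<bar> \<le> Kc" using chain[OF xy(1,2)] by blast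
        have 1: "W x y \<xi> - W x' y \<xi> = \<theta> * W e y \<xi>" unfolding W_diff_x a(5) W_scale_x ..
        have 2: "W x' y \<xi> - W x' y' \<xi> = \<theta> * W x' f \<xi>" unfolding W_diff_y a(6) W_scale_y ..
        have M0: "M \<ge> 0" using le_M[OF a(1,2)] by linarith
        have small: "\<bar>\<theta> * b\<bar> \<le> M / 4" if "\<bar>b\<bar> \<le> M" for b
        proof -
          have "\<bar>\<theta> * b\<bar> \<le> 1/4 * M" unfolding abs_mult using that \<theta> by (intro mult_mono) auto
          then show ?thesis by simp
        qed
        show ?thesis
          using 1 2 a(7) small[OF le_M[OF a(3) xy(2)]] small[OF le_M[OF a(1,4)]] xy(3) by linarith
      qed
      then have "M \<le> Kc + M / 2" unfolding M_def by (intro cSup_least[OF Zne]) auto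
      then show "\<bar>\<Sum>s\<in>R. y s * app x \<xi> s\<bar> \<le> 2 * Kc" using le_M[OF x y] unfolding W_def by linarith
    qed
  qed
qed

end

subsection \<open>Gaussian and Rademacher coordinates\<close>

lemma std_normal_mgf: "(\<integral>\<^sup>+ x. ennreal (exp (t * x)) \<partial>std_normal_distribution) = ennreal (exp (t\<^sup>2 / 2))"
proof -
  have "(\<integral>\<^sup>+ x. ennreal (exp (t * x)) \<partial>std_normal_distribution)
      = (\<integral>\<^sup>+ x. ennreal (normal_density 0 1 x) * ennreal (exp (t * x)) \<partial>lborel)"
    by (subst nn_integral_density) auto
  also have "\<dots> = (\<integral>\<^sup>+ x. ennreal (exp (t\<^sup>2 / 2)) * ennreal (normal_density t 1 x) \<partial>lborel)"
  proof (rule nn_integral_cong)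
    fix x
    have "normal_density 0 1 x * exp (t * x) = exp (t\<^sup>2 / 2) * normal_density t 1 x"
      by (simp add: normal_density_def power2_eq_square field_simps flip: exp_add)
    then show "ennreal (normal_density 0 1 x) * ennreal (exp (t * x))
        = ennreal (exp (t\<^sup>2 / 2)) * ennreal (normal_density t 1 x)"
      by (simp flip: ennreal_mult)
  qed
  also have "\<dots> = ennreal (exp (t\<^sup>2 / 2)) * (\<integral>\<^sup>+ x. ennreal (normal_density t 1 x) \<partial>lborel)"
    by (rule nn_integral_cmult) auto
  also have "(\<integral>\<^sup>+ x. ennreal (normal_density t 1 x) \<partial>lborel) = 1"
    by (simp add: nn_integral_eq_integral integral_normal_density)
  finally show ?thesis by simp
qed

interpretation gauss: subgaussian_law std_normal_distribution
  by (rule subgaussian_law.intro) (auto simp: std_normal_mgf intro: prob_space_normal_density)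

lemma rademacher_mgf:
  "(\<integral>\<^sup>+ x. ennreal (exp (t * x)) \<partial>measure_pmf (pmf_of_set {- 1, 1 :: real})) \<le> ennreal (exp (t\<^sup>2 / 2))"
proof -
  have "(\<integral>\<^sup>+ x. ennreal (exp (t * x)) \<partial>measure_pmf (pmf_of_set {- 1, 1 :: real}))
      = (ennreal (exp (- t)) + ennreal (exp t)) / ennreal 2"
    by (subst nn_integral_pmf_of_set) auto
  also have "\<dots> = ennreal (exp (- t) + exp t) / ennreal 2" by simp
  also have "\<dots> = ennreal ((exp (- t) + exp t) / 2)"
    by (rule divide_ennreal) auto
  also have "(exp (- t) + exp t) / 2 = cosh t" by (simp add: cosh_field_def)
  also have "ennreal (cosh t) \<le> ennreal (exp (t\<^sup>2 / 2))" by (intro ennreal_leI cosh_le_exp_sq)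
  finally show ?thesis .
qed

interpretation rademacher: subgaussian_law "measure_pmf (pmf_of_set {- 1, 1 :: real})"
  by (rule subgaussian_law.intro) (auto intro: rademacher_mgf prob_space_measure_pmf)

text \<open>Tilting turns the density into that of a centred normal law of variance 1 / (1 - 2 c),
  with total mass exp (- c) / sqrt (1 - 2 c). A quadratic lower bound for ln (1 - 2 c)
  finishes.\<close>

lemma std_normal_square_mgf:
  assumes "\<bar>c\<bar> \<le> 1 / 4"
  shows "(\<integral>\<^sup>+ x. ennreal (exp (c * (x\<^sup>2 - 1))) \<partial>std_normal_distribution) \<le> ennreal (exp (4 * c\<^sup>2))"
proof -
  define v where "v = 1 - 2 * c"
  have v: "v > 0" using assms by (auto simp: v_def)
  define \<sigma> where "\<sigma> = 1 / sqrt v"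
  have \<sigma>: "\<sigma> > 0" "\<sigma>\<^sup>2 = 1 / v" using v by (auto simp: \<sigma>_def power_divide)
  have "(\<integral>\<^sup>+ x. ennreal (exp (c * (x\<^sup>2 - 1))) \<partial>std_normal_distribution)
      = (\<integral>\<^sup>+ x. ennreal (normal_density 0 1 x) * ennreal (exp (c * (x\<^sup>2 - 1))) \<partial>lborel)"
    by (subst nn_integral_density) auto
  also have "\<dots> = (\<integral>\<^sup>+ x. ennreal (exp (- c) * \<sigma>) * ennreal (normal_density 0 \<sigma> x) \<partial>lborel)"
  proof (rule nn_integral_cong)
    fix x
    have "normal_density 0 1 x * exp (c * (x\<^sup>2 - 1)) = exp (- c) * \<sigma> * normal_density 0 \<sigma> x"
    proof -
      have "exp (- (x\<^sup>2 / 2)) * exp (c * (x\<^sup>2 - 1)) = exp (- c) * exp (- (x\<^sup>2 * v / 2))"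
        by (simp add: v_def flip: exp_add) (simp add: field_simps)
      moreover have "sqrt (2 * pi * (1 / v)) = sqrt (2 * pi) * \<sigma>"
        by (simp only: \<sigma>_def real_sqrt_mult real_sqrt_divide real_sqrt_one)
      ultimately show ?thesis
        using v \<sigma>(1) by (simp add: normal_density_def \<sigma>(2) field_simps)
    qed
    then show "ennreal (normal_density 0 1 x) * ennreal (exp (c * (x\<^sup>2 - 1)))
        = ennreal (exp (- c) * \<sigma>) * ennreal (normal_density 0 \<sigma> x)"
      using \<sigma> by (simp flip: ennreal_mult)
  qed
  also have "\<dots> = ennreal (exp (- c) * \<sigma>) * (\<integral>\<^sup>+ x. ennreal (normal_density 0 \<sigma> x) \<partial>lborel)"
    by (rule nn_integral_cmult) auto
  also have "(\<integral>\<^sup>+ x. ennreal (normal_density 0 \<sigma> x) \<partial>lborel) = 1"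
    using \<sigma> by (simp add: nn_integral_eq_integral integral_normal_density)
  also have "ennreal (exp (- c) * \<sigma>) * 1 \<le> ennreal (exp (4 * c\<^sup>2))"
  proof -
    have "- (2 * c) - 2 * (2 * c)\<^sup>2 \<le> ln (1 - 2 * c)"
    proof (cases "c \<ge> 0")
      case True
      then show ?thesis using ln_one_minus_pos_lower_bound[of "2 * c"] assms by auto
    next
      case False
      then have "(- 2 * c) - (- 2 * c)\<^sup>2 \<le> ln (1 + (- 2 * c))"
        using ln_one_plus_pos_lower_bound[of "- 2 * c"] assms by auto
      then show ?thesis using False by (simp add: power2_eq_square)
        (smt (verit) mult_nonneg_nonneg mult_minus_left mult_minus_right)
    qed
    then have "- c - ln v / 2 \<le> 4 * c\<^sup>2" by (simp add: v_def power_mult_distrib)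
    moreover have "\<sigma> = exp (- (ln v / 2))"
      using v by (simp add: \<sigma>_def exp_minus ln_sqrt[symmetric] inverse_eq_divide)
    ultimately have "exp (- c) * \<sigma> \<le> exp (4 * c\<^sup>2)" by (simp flip: exp_add)
    then show ?thesis by (simp add: ennreal_leI)
  qed
  finally show ?thesis .
qed

text \<open>Exponential Markov inequality with parameter c, whose sign selects the upper or the
  lower tail.\<close>

lemma chi_square_upper:
  assumes S: "S \<subseteq> {..<n}" and l: "\<bar>c\<bar> \<le> 1 / 4" and a: "\<tau> + 4 * real (card S) * c\<^sup>2 \<le> \<bar>c\<bar> * a" and l0: "c \<noteq> 0"
  shows "whp (gauss.\<mu> n) (exp (- \<tau>)) (\<lambda>\<omega>. sgn c * (\<Sum>s\<in>S. ((\<omega> s)\<^sup>2 - 1)) \<le> a)"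
proof -
  interpret product_sigma_finite "\<lambda>_::nat. std_normal_distribution" by (rule gauss.psf)
  have fin: "finite S" using S finite_subset by auto
  define G where "G \<omega> = (\<Sum>s\<in>S. ((\<omega> s)\<^sup>2 - 1))" for \<omega> :: "nat \<Rightarrow> real"
  have G [measurable]: "G \<in> borel_measurable (gauss.\<mu> n)"
    unfolding G_def using S by (intro borel_measurable_sum borel_measurable_diff borel_measurable_power gauss.coordinate_measurable) auto
  define h where "h l x = (if l \<in> S then ennreal (exp (c * (x\<^sup>2 - 1))) else 1)" for l and x :: real
  have "(\<integral>\<^sup>+ \<omega>. ennreal (exp (c * G \<omega>)) \<partial>gauss.\<mu> n) = (\<integral>\<^sup>+ \<omega>. (\<Prod>l\<in>{..<n}. h l (\<omega> l)) \<partial>gauss.\<mu> n)"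
  proof (rule nn_integral_cong)
    fix \<omega>
    have "(\<Prod>l\<in>{..<n}. h l (\<omega> l)) = (\<Prod>l\<in>S. ennreal (exp (c * ((\<omega> l)\<^sup>2 - 1))))"
      using S by (intro prod.mono_neutral_cong_right) (auto simp: h_def)
    also have "\<dots> = ennreal (exp (c * G \<omega>))"
      by (simp add: prod_ennreal G_def sum_distrib_left exp_sum[OF fin])
    finally show "ennreal (exp (c * G \<omega>)) = (\<Prod>l\<in>{..<n}. h l (\<omega> l))" by simp
  qed
  also have "\<dots> = (\<Prod>l\<in>{..<n}. \<integral>\<^sup>+ x. h l x \<partial>std_normal_distribution)"
    by (rule product_nn_integral_prod) (auto simp: h_def)
  also have "\<dots> \<le> (\<Prod>l\<in>{..<n}. if l \<in> S then ennreal (exp (4 * c\<^sup>2)) else 1)"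
    using std_normal_square_mgf[OF l] prob_space.emeasure_space_1[OF gauss.prob]
    by (intro prod_mono_ennreal) (auto simp: h_def)
  also have "\<dots> = (\<Prod>l\<in>S. ennreal (exp (4 * c\<^sup>2)))"
    using S by (intro prod.mono_neutral_cong_right) auto
  also have "\<dots> = ennreal (exp (4 * real (card S) * c\<^sup>2))"
    by (simp add: ennreal_power mult_ac flip: exp_of_nat_mult)
  finally have I: "(\<integral>\<^sup>+ \<omega>. ennreal (exp (c * G \<omega>)) \<partial>gauss.\<mu> n) \<le> ennreal (exp (4 * real (card S) * c\<^sup>2))" .
  define E where "E = {\<omega>\<in>space (gauss.\<mu> n). 1 \<le> ennreal (exp (- (\<bar>c\<bar> * a))) * ennreal (exp (c * G \<omega>))}"
  have E: "E \<in> sets (gauss.\<mu> n)" unfolding E_def by measurable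
  have "emeasure (gauss.\<mu> n) E \<le> ennreal (exp (- (\<bar>c\<bar> * a))) * (\<integral>\<^sup>+ \<omega>. ennreal (exp (c * G \<omega>)) * indicator (space (gauss.\<mu> n)) \<omega> \<partial>gauss.\<mu> n)"
    unfolding E_def by (rule nn_integral_Markov_inequality) measurable
  also have "(\<integral>\<^sup>+ \<omega>. ennreal (exp (c * G \<omega>)) * indicator (space (gauss.\<mu> n)) \<omega> \<partial>gauss.\<mu> n) = (\<integral>\<^sup>+ \<omega>. ennreal (exp (c * G \<omega>)) \<partial>gauss.\<mu> n)"
    by (rule nn_integral_cong) simp
  also have "ennreal (exp (- (\<bar>c\<bar> * a))) * \<dots> \<le> ennreal (exp (- (\<bar>c\<bar> * a))) * ennreal (exp (4 * real (card S) * c\<^sup>2))"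
    by (intro mult_left_mono I) auto
  also have "\<dots> \<le> ennreal (exp (- \<tau>))"
    using a by (simp flip: ennreal_mult exp_add)
  finally have Ep: "emeasure (gauss.\<mu> n) E \<le> ennreal (exp (- \<tau>))" .
  have "sgn c * G \<omega> \<le> a" if "\<omega> \<in> space (gauss.\<mu> n) - E" for \<omega>
  proof (rule ccontr)
    assume "\<not> sgn c * G \<omega> \<le> a"
    then have "\<bar>c\<bar> * a \<le> \<bar>c\<bar> * (sgn c * G \<omega>)" by (intro mult_left_mono) auto
    also have "\<dots> = c * G \<omega>" by (simp add: mult.assoc[symmetric] abs_mult_sgn)
    finally have "1 \<le> exp (- (\<bar>c\<bar> * a)) * exp (c * G \<omega>)" by (simp flip: exp_add)
    then have "\<omega> \<in> E" using that by (simp add: E_def flip: ennreal_mult)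
    then show False using that by simp
  qed
  then show ?thesis unfolding whp_def using E Ep by (intro bexI[of _ E]) (auto simp: G_def)
qed

lemma chi_square_tail:
  assumes S: "S \<subseteq> {..<n}" and \<tau>: "\<tau> > 0"
  shows "whp (gauss.\<mu> n) (2 * exp (- \<tau>))
    (\<lambda>\<omega>. \<bar>\<Sum>s\<in>S. ((\<omega> s)\<^sup>2 - 1)\<bar> \<le> 4 * sqrt (real (card S) * \<tau>) + 8 * \<tau>)"
proof -
  define m where "m = real (card S)"
  define a where "a = 4 * sqrt (m * \<tau>) + 8 * \<tau>"
  have m: "m \<ge> 0" by (simp add: m_def)
  \<comment> \<open>The minimiser of \<tau> / c + 4 m c is sqrt (\<tau> / m) / 2. It is capped at
    1/4, where the available exponential moment bound ends.\<close>
  obtain c where c: "0 < c" "c \<le> 1 / 4" "\<tau> + 4 * m * c\<^sup>2 \<le> c * a"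
  proof (cases "4 * \<tau> \<le> m")
    case True
    then have mp: "m > 0" using \<tau> by linarith
    define c where "c = sqrt (\<tau> / m) / 2"
    have "\<tau> / m \<le> (1/2)\<^sup>2" using True mp by (simp add: power2_eq_square field_simps)
    then have "sqrt (\<tau> / m) \<le> 1/2" by (rule real_le_lsqrt[rotated 1]) auto
    moreover have "4 * m * c\<^sup>2 = \<tau>" using mp \<tau> by (simp add: c_def power_divide)
    moreover have "c * a \<ge> 2 * \<tau>"
    proof -
      have "c * (4 * sqrt (m * \<tau>)) = 2 * (sqrt (\<tau> / m) * sqrt (m * \<tau>))"
        by (simp add: c_def)
      also have "\<dots> = 2 * sqrt (\<tau> / m * (m * \<tau>))"
        by (simp only: real_sqrt_mult)
      also have "\<tau> / m * (m * \<tau>) = \<tau>\<^sup>2" using mp by (simp add: power2_eq_square)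
      finally have "c * (4 * sqrt (m * \<tau>)) = 2 * \<tau>" using \<tau> by simp
      moreover have "c * (8 * \<tau>) \<ge> 0" using \<tau> mp by (simp add: c_def)
      ultimately show ?thesis unfolding a_def distrib_left by linarith
    qed
    moreover have "c > 0" using \<tau> mp by (simp add: c_def)
    ultimately show ?thesis by (intro that[of c]) (auto simp: c_def)
  next
    case False
    have "sqrt (m * \<tau>) \<ge> 0" using m \<tau> by simp
    moreover have "1 / 4 * a = sqrt (m * \<tau>) + 2 * \<tau>" by (simp add: a_def)
    moreover have "4 * m * (1 / 4)\<^sup>2 = m / 4" by (simp add: power2_eq_square)
    ultimately have "\<tau> + 4 * m * (1 / 4)\<^sup>2 \<le> 1 / 4 * a" using False by linarith
    then show ?thesis by (intro that[of "1/4"]) auto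
  qed
  have "whp (gauss.\<mu> n) (exp (- \<tau>)) (\<lambda>\<omega>. sgn c * (\<Sum>s\<in>S. ((\<omega> s)\<^sup>2 - 1)) \<le> a)"
    using c by (intro chi_square_upper[OF S]) (auto simp: m_def)
  moreover have "whp (gauss.\<mu> n) (exp (- \<tau>)) (\<lambda>\<omega>. sgn (- c) * (\<Sum>s\<in>S. ((\<omega> s)\<^sup>2 - 1)) \<le> a)"
    using c by (intro chi_square_upper[OF S]) (auto simp: m_def)
  ultimately have "whp (gauss.\<mu> n) (exp (- \<tau>) + exp (- \<tau>))
     (\<lambda>\<omega>. sgn c * (\<Sum>s\<in>S. ((\<omega> s)\<^sup>2 - 1)) \<le> a \<and> sgn (- c) * (\<Sum>s\<in>S. ((\<omega> s)\<^sup>2 - 1)) \<le> a)"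
    by (rule whp_conj) auto
  then show ?thesis
    by (rule whp_mono) (use c in \<open>auto simp: a_def m_def abs_le_iff\<close>)
qed

lemma rademacher_AE: "AE \<omega> in rademacher.\<mu> n. \<forall>l<n. \<omega> l = 1 \<or> \<omega> l = - 1"
proof -
  have "AE \<omega> in rademacher.\<mu> n. \<omega> l = 1 \<or> \<omega> l = - 1" if "l < n" for l
  proof (rule AE_PiM_component)
    show "prob_space (measure_pmf (pmf_of_set {- 1, 1 :: real}))" by (rule prob_space_measure_pmf)
    show "l \<in> {..<n}" using that by simp
    show "AE x in measure_pmf (pmf_of_set {- 1, 1 :: real}). x = 1 \<or> x = - 1"
      by (auto simp: AE_measure_pmf_iff)
  qed
  then have "AE \<omega> in rademacher.\<mu> n. \<forall>l\<in>{..<n}. \<omega> l = 1 \<or> \<omega> l = - 1"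
    by (intro AE_finite_allI) auto
  then show ?thesis by eventually_elim auto
qed

subsection \<open>Numerical scales\<close>

lemma chain_net_mono:
  assumes "chain_net X P J close \<theta>"
    and "\<And>k u u'. k < J \<Longrightarrow> u \<in> X \<Longrightarrow> u' \<in> X \<Longrightarrow> close k u u' \<Longrightarrow> close' k u u'"
  shows "chain_net X P J close' \<theta>"
  unfolding chain_net_def
proof (intro conjI ballI)
  show P: "\<forall>k\<le>J. finite (P k) \<and> P k \<subseteq> X" using assms(1) by (simp add: chain_net_def)
  fix x assume "x \<in> X"
  then obtain \<pi> where \<pi>: "\<forall>k\<le>J. \<pi> k \<in> P k" "\<forall>k<J. close k (\<pi> k) (\<pi> (Suc k))" "\<exists>e\<in>X. \<forall>i. x i - \<pi> J i = \<theta> * e i"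
    using assms(1) unfolding chain_net_def by blast
  have "close' k (\<pi> k) (\<pi> (Suc k))" if "k < J" for k
  proof (rule assms(2)[OF that])
    show "\<pi> k \<in> X" "\<pi> (Suc k) \<in> X" using \<pi>(1) P that by (meson Suc_leI less_imp_le subsetD)+
    show "close k (\<pi> k) (\<pi> (Suc k))" using \<pi>(2) that by blast
  qed
  then show "\<exists>\<pi>. (\<forall>k\<le>J. \<pi> k \<in> P k) \<and> (\<forall>k<J. close' k (\<pi> k) (\<pi> (Suc k))) \<and> (\<exists>e\<in>X. \<forall>i. x i - \<pi> J i = \<theta> * e i)"
    using \<pi> by blast
qed

lemma ln_ge_1: "n \<ge> 32 \<Longrightarrow> ln (real n) \<ge> 1"
proof -
  assume n: "n \<ge> 32"
  have "exp 1 \<le> real n" using n exp_le by linarith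
  then have "ln (exp 1) \<le> ln (real n)" using n by (subst ln_le_cancel_iff) auto
  then show ?thesis by simp
qed

text \<open>The net of level \<open>k\<close> has grid vectors of \<open>\<ell>\<^sub>1\<close> norm at most \<open>L * 2 ^ k\<close>, the chain stops at
  level \<open>J\<close>, and \<open>d\<close> is the number of bits of a coordinate, on which the Walsh signs act.\<close>

locale scales =
  fixes n :: nat and \<Gamma> l :: real and L J d :: nat
  assumes n: "n \<ge> 32" and \<Gamma>: "\<Gamma> \<ge> 1" and l_def: "l = ln (real n)"
    and L: "\<Gamma> * l \<le> real L" "real L \<le> 2 * \<Gamma> * l"
    and J: "real n ^ 2 \<le> 2 ^ J" "real J \<le> 4 * l"
    and d: "n \<le> 2 ^ d" "2 ^ d \<le> 2 * n"
begin

lemma l_ge: "l \<ge> 1"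
  unfolding l_def by (rule ln_ge_1[OF n])

lemma exp_l: "exp l = real n"
  using n by (simp add: l_def)

lemma L_ge: "L \<ge> 1" "real L \<ge> 1"
proof -
  have "1 * 1 \<le> \<Gamma> * l" using \<Gamma> l_ge by (intro mult_mono) auto
  then show "real L \<ge> 1" using L by linarith
  then show "L \<ge> 1" by linarith
qed

text \<open>Every failure probability will be polynomial in n times exp (- \<tau>).\<close>

definition \<tau> :: real where "\<tau> = \<Gamma> * l\<^sup>2"

lemma \<tau>_nonneg: "\<tau> \<ge> 0" using \<Gamma> by (simp add: \<tau>_def)

lemma ln_4n: "ln (2 * real (card (freqs n))) \<le> 2 * l"
proof -
  have "2 * real (card (freqs n)) \<le> real n * real n" using n by (simp add: card_freqs)
  then have "ln (2 * real (card (freqs n))) \<le> ln (real n * real n)"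
    using n by (subst ln_le_cancel_iff) (auto simp: card_freqs)
  then show ?thesis using n by (simp add: ln_mult l_def)
qed

lemma pow_le_exp: "real ((2 * n + 1) ^ N) \<le> exp (2 * l * real N)"
proof -
  have "2 * real n + 1 \<le> 3 * real n" using n by simp
  also have "\<dots> \<le> real n * real n" using n by (intro mult_right_mono) auto
  finally have "real (2 * n + 1) \<le> exp l * exp l" by (simp add: exp_l)
  also have "\<dots> = exp (2 * l)" by (simp flip: exp_add)
  finally have "real (2 * n + 1) ^ N \<le> exp (2 * l) ^ N" by (intro power_mono) auto
  then show ?thesis by (simp add: exp_of_nat_mult[symmetric] mult_ac)
qed

text \<open>A tail at \<open>t k\<close> survives the union bound over the chain links of level \<open>k\<close> with an
  additional failure probability \<open>exp (- \<tau>)\<close>.\<close>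

definition t :: "nat \<Rightarrow> real" where
  "t k = sqrt (2 * (12 * real (L * 2 ^ k) * l + \<tau>))"

lemma t_nonneg: "t k \<ge> 0"
  using l_ge \<tau>_nonneg by (simp add: t_def)

lemma exp_t: "exp (- (t k)\<^sup>2 / 2) = exp (- (12 * real (L * 2 ^ k) * l)) * exp (- \<tau>)"
proof -
  have "(t k)\<^sup>2 = 2 * (12 * real (L * 2 ^ k) * l + \<tau>)"
    unfolding t_def using l_ge \<tau>_nonneg by (intro real_sqrt_pow2) auto
  then show ?thesis by (simp flip: exp_add)
qed

text \<open>The increment bound 20 b of the nets, with the logarithm ln (4 n) replaced by 2
  l.\<close>

definition step_radius :: "real \<Rightarrow> nat \<Rightarrow> nat \<Rightarrow> real" where
  "step_radius A r k = 20 * (A * sqrt (real r) * sqrt (2 * l / real (L * 2 ^ k)))"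

text \<open>The Cauchy-Schwarz bound of a functional on the sparse ball, with r + L <= 2 r
  L.\<close>

definition top_radius :: "real \<Rightarrow> nat \<Rightarrow> real" where
  "top_radius A r = A * sqrt (real r) * sqrt (2 * real L)"

definition chain_bound :: "real \<Rightarrow> nat \<Rightarrow> real" where
  "chain_bound A r = 1200 * \<Gamma> * A * sqrt (real r) * l\<^sup>2"

text \<open>The growth of \<open>t k\<close> like sqrt (L 2^k l) cancels the decay of the radius, so
  all levels contribute equally. \<Gamma> l <= L keeps \<tau> below L 2^k l. The squared product
  without the factor 20 A sqrt r is at most 52 l^2, whence 145 = 20 * 29 / 4.\<close>

lemma step_sum:
  assumes "A \<ge> 0"
  shows "t k * step_radius A r k \<le> 145 * A * sqrt (real r) * l"
proof -
  define N where "N = real (L * 2 ^ k)"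
  have N: "N \<ge> real L" "N > 0" using L_ge by (auto simp: N_def)
  have "\<tau> / N \<le> l"
  proof -
    have "\<tau> = \<Gamma> * l * l" by (simp add: \<tau>_def power2_eq_square)
    also have "\<dots> \<le> N * l" using L N l_ge by (intro mult_right_mono) auto
    finally show ?thesis using N by (simp add: pos_divide_le_eq mult.commute)
  qed
  then have le: "2 * (12 * N * l + \<tau>) * (2 * l / N) \<le> (29/4 * l)\<^sup>2"
  proof -
    have "2 * (12 * N * l + \<tau>) * (2 * l / N) = 48 * l\<^sup>2 + 4 * l * (\<tau> / N)"
      using N by (simp add: field_simps power2_eq_square)
    also have "4 * l * (\<tau> / N) \<le> 4 * l * l" using \<open>\<tau> / N \<le> l\<close> l_ge by (intro mult_left_mono) auto
    also have "48 * l\<^sup>2 + 4 * l * l \<le> (29/4 * l)\<^sup>2" by (simp add: power2_eq_square)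
    finally show ?thesis by simp
  qed
  have "t k * sqrt (2 * l / N) = sqrt (2 * (12 * N * l + \<tau>) * (2 * l / N))"
    by (simp only: t_def N_def real_sqrt_mult)
  also have "\<dots> \<le> 29/4 * l" using le l_ge by (intro real_le_lsqrt) auto
  finally have "20 * (A * sqrt (real r)) * (t k * sqrt (2 * l / N)) \<le> 20 * (A * sqrt (real r)) * (29/4 * l)"
    using assms by (intro mult_left_mono) auto
  then show ?thesis by (simp add: step_radius_def N_def mult_ac)
qed

text \<open>In units of \<Gamma> A sqrt r l^2, the at most 4 l links give 4 * 290 = 1160 and the top
  level gives 29 / 2, together below 1200. In the top term \<Gamma> arises from L <= 2 \<Gamma>
  l.\<close>

lemma chain_bound:
  assumes A: "A \<ge> 0"
  shows "t 0 * top_radius A r + (\<Sum>k<J. 2 * (t k * step_radius A r k)) \<le> chain_bound A r"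
proof -
  have l: "l \<ge> 1" by (rule l_ge)
  define a where "a = A * sqrt (real r)"
  have a: "a \<ge> 0" using A by (simp add: a_def)
  have "(\<Sum>k<J. 2 * (t k * step_radius A r k)) \<le> (\<Sum>k<J. 2 * (145 * A * sqrt (real r) * l))"
    using step_sum[OF A] by (intro sum_mono mult_left_mono) auto
  also have "\<dots> = real J * (290 * (a * l))" by (simp add: a_def)
  also have "\<dots> \<le> (4 * l) * (290 * (a * l))" using J a l by (intro mult_right_mono) auto
  also have "\<dots> = 1160 * (a * l\<^sup>2)" by (simp add: power2_eq_square)
  also have "\<dots> \<le> 1160 * (\<Gamma> * (a * l\<^sup>2))"
    using \<Gamma> a mult_right_mono[OF \<Gamma>, of "a * l\<^sup>2"] by simp
  finally have 1: "(\<Sum>k<J. 2 * (t k * step_radius A r k)) \<le> 1160 * (\<Gamma> * (a * l\<^sup>2))" .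
  have "t 0 * sqrt (2 * real L) = sqrt (2 * (12 * real L * l + \<tau>) * (2 * real L))"
    by (simp only: t_def real_sqrt_mult) simp
  also have "\<dots> \<le> 29/4 * l * real L"
  proof (rule real_le_lsqrt)
    have "\<tau> = \<Gamma> * l * l" by (simp add: \<tau>_def power2_eq_square)
    also have "\<dots> \<le> real L * l" using L l by (intro mult_right_mono) auto
    finally have "2 * (12 * real L * l + \<tau>) * (2 * real L) \<le> 2 * (12 * real L * l + real L * l) * (2 * real L)"
      by (intro mult_right_mono mult_left_mono add_left_mono) auto
    also have "\<dots> = 52 * ((real L)\<^sup>2 * l)" by (simp add: power2_eq_square)
    also have "\<dots> \<le> 52 * ((real L)\<^sup>2 * l\<^sup>2)"
      using l self_le_power[of l 2] by (intro mult_left_mono) auto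
    also have "\<dots> \<le> (29/4 * l * real L)\<^sup>2" using l by (simp add: power2_eq_square)
    finally show "2 * (12 * real L * l + \<tau>) * (2 * real L) \<le> (29/4 * l * real L)\<^sup>2" .
  qed (use l in auto)
  also have "\<dots> \<le> 29/4 * l * (2 * \<Gamma> * l)" using L l by (intro mult_left_mono) auto
  finally have "a * (t 0 * sqrt (2 * real L)) \<le> a * (29/4 * l * (2 * \<Gamma> * l))" using a by (intro mult_left_mono)
  then have 2: "t 0 * top_radius A r \<le> 29/2 * (\<Gamma> * (a * l\<^sup>2))"
    by (simp add: top_radius_def a_def power2_eq_square mult_ac)
  have "\<Gamma> * (a * l\<^sup>2) \<ge> 0" using \<Gamma> a by simp
  then show ?thesis using 1 2 by (simp add: chain_bound_def a_def mult_ac)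
qed

text \<open>Since L 2^J >= n^2 and r <= n, the remainder has norm at most r / (L 2^J) <= 1 / n.
  Hence n times the remainder lies in the sparse ball again, and \<theta> = 1 / n.\<close>

lemma sparse_chain_net:
  fixes \<alpha> :: "nat \<times> bool \<Rightarrow> nat \<Rightarrow> real"
  assumes A: "A \<ge> 0" and r: "1 \<le> r" "r \<le> n"
    and \<alpha>: "\<And>\<kappa> S. \<lbrakk>\<kappa> \<in> freqs n; S \<subseteq> {..<n}; card S \<le> r\<rbrakk> \<Longrightarrow> (\<Sum>i\<in>S. (\<alpha> \<kappa> i)\<^sup>2) \<le> A\<^sup>2 * (real (card S) + real L)"
  shows "\<exists>P. (\<forall>k. finite (P k) \<and> P k \<subseteq> sparse_fun n r \<and> real (card (P k)) \<le> exp (2 * l * real (L * 2 ^ k))) \<and>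
    chain_net (sparse_fun n r) P J
      (\<lambda>k u u'. \<forall>\<kappa>\<in>freqs n. \<bar>\<Sum>i<n. \<alpha> \<kappa> i * (u i - u' i)\<bar> \<le> step_radius A r k) (1 / real n)"
proof -
  define b where "b k = A * sqrt (real r) * sqrt (ln (2 * real (card (freqs n))) / real (L * 2 ^ k))" for k
  have "(0, True) \<in> freqs n" using n by (simp add: freqs_def)
  then have ne: "freqs n \<noteq> {}" by blast
  have "\<exists>P. (\<forall>k. finite (P k) \<and> P k \<subseteq> sparse_fun n r \<and> card (P k) \<le> (2 * n + 1) ^ (L * 2 ^ k)) \<and>
    (\<forall>x\<in>sparse_fun n r. \<exists>\<pi>. (\<forall>k\<le>J. \<pi> k \<in> P k) \<and>
       (\<forall>k<J. \<forall>\<kappa>\<in>freqs n. \<bar>\<Sum>i<n. \<alpha> \<kappa> i * (\<pi> k i - \<pi> (Suc k) i)\<bar> \<le> 20 * b k) \<and>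
       (\<forall>i\<ge>n. x i - \<pi> J i = 0) \<and> card {i. x i - \<pi> J i \<noteq> 0} \<le> r \<and>
       (\<Sum>i<n. (x i - \<pi> J i)\<^sup>2) \<le> (real r / real (L * 2 ^ J))\<^sup>2)"
    unfolding b_def by (rule sparse_nets[OF finite_freqs ne A L_ge(1) r(1) \<alpha>])
  then obtain P where P: "\<forall>k. finite (P k) \<and> P k \<subseteq> sparse_fun n r \<and> card (P k) \<le> (2 * n + 1) ^ (L * 2 ^ k)"
    and net: "\<forall>x\<in>sparse_fun n r. \<exists>\<pi>. (\<forall>k\<le>J. \<pi> k \<in> P k) \<and>
       (\<forall>k<J. \<forall>\<kappa>\<in>freqs n. \<bar>\<Sum>i<n. \<alpha> \<kappa> i * (\<pi> k i - \<pi> (Suc k) i)\<bar> \<le> 20 * b k) \<and>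
       (\<forall>i\<ge>n. x i - \<pi> J i = 0) \<and> card {i. x i - \<pi> J i \<noteq> 0} \<le> r \<and>
       (\<Sum>i<n. (x i - \<pi> J i)\<^sup>2) \<le> (real r / real (L * 2 ^ J))\<^sup>2"
    by (elim exE conjE) (rule that; assumption)
  have b: "20 * b k \<le> step_radius A r k" for k
    unfolding b_def step_radius_def using A ln_4n
    by (intro mult_left_mono real_sqrt_le_mono divide_right_mono) auto
  have \<theta>: "real r / real (L * 2 ^ J) \<le> 1 / real n"
  proof -
    have "real n * real n \<le> 1 * 2 ^ J" using J(1) by (simp add: power2_eq_square)
    also have "\<dots> \<le> real L * 2 ^ J" using L_ge by (intro mult_right_mono) auto
    finally have "real n * real n \<le> real (L * 2 ^ J)" by simp
    moreover have "real r * real n \<le> real n * real n" using r by (intro mult_right_mono) auto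
    ultimately have "real r * real n \<le> real (L * 2 ^ J)" by linarith
    then show ?thesis using n L_ge by (simp add: pos_divide_le_eq le_divide_eq)
  qed
  have "chain_net (sparse_fun n r) P J
      (\<lambda>k u u'. \<forall>\<kappa>\<in>freqs n. \<bar>\<Sum>i<n. \<alpha> \<kappa> i * (u i - u' i)\<bar> \<le> step_radius A r k) (1 / real n)"
    unfolding chain_net_def
  proof (intro conjI ballI)
    show "\<forall>k\<le>J. finite (P k) \<and> P k \<subseteq> sparse_fun n r" using P by blast
    fix x assume "x \<in> sparse_fun n r"
    from net[rule_format, OF this] obtain \<pi> where \<pi>: "\<forall>k\<le>J. \<pi> k \<in> P k"
      "\<forall>k<J. \<forall>\<kappa>\<in>freqs n. \<bar>\<Sum>i<n. \<alpha> \<kappa> i * (\<pi> k i - \<pi> (Suc k) i)\<bar> \<le> 20 * b k"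
      "\<forall>i\<ge>n. x i - \<pi> J i = 0" "card {i. x i - \<pi> J i \<noteq> 0} \<le> r"
      "(\<Sum>i<n. (x i - \<pi> J i)\<^sup>2) \<le> (real r / real (L * 2 ^ J))\<^sup>2" by blast
    define e where "e i = real n * (x i - \<pi> J i)" for i
    have "(\<Sum>i<n. (e i)\<^sup>2) = (real n)\<^sup>2 * (\<Sum>i<n. (x i - \<pi> J i)\<^sup>2)"
      by (simp add: e_def power_mult_distrib sum_distrib_left)
    also have "\<dots> \<le> (real n)\<^sup>2 * (1 / real n)\<^sup>2"
      by (intro mult_left_mono order_trans[OF \<pi>(5)] power_mono[OF \<theta>]) auto
    also have "\<dots> = 1" using n by (simp add: power_divide)
    finally have "e \<in> sparse_fun n r" using \<pi>(3,4) n by (auto simp: sparse_fun_def e_def)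
    moreover have "\<forall>i. x i - \<pi> J i = 1 / real n * e i" using n by (simp add: e_def)
    moreover have "\<forall>k<J. \<forall>\<kappa>\<in>freqs n. \<bar>\<Sum>i<n. \<alpha> \<kappa> i * (\<pi> k i - \<pi> (Suc k) i)\<bar> \<le> step_radius A r k"
      using \<pi>(2) b order_trans by blast
    ultimately show "\<exists>\<pi>. (\<forall>k\<le>J. \<pi> k \<in> P k) \<and>
       (\<forall>k<J. \<forall>\<kappa>\<in>freqs n. \<bar>\<Sum>i<n. \<alpha> \<kappa> i * (\<pi> k i - \<pi> (Suc k) i)\<bar> \<le> step_radius A r k) \<and>
       (\<exists>e\<in>sparse_fun n r. \<forall>i. x i - \<pi> J i = 1 / real n * e i)"
      using \<pi>(1) by blast
  qed
  moreover have "real (card (P k)) \<le> exp (2 * l * real (L * 2 ^ k))" for k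
  proof -
    have "real (card (P k)) \<le> real ((2 * n + 1) ^ (L * 2 ^ k))" using P[rule_format, of k] by (simp only: of_nat_le_iff)
    then show ?thesis using pow_le_exp order_trans by blast
  qed
  ultimately show ?thesis using P by blast
qed

lemma linear_functional_sparse:
  assumes x: "x \<in> sparse_fun n r" and A: "A \<ge> 0" and r: "1 \<le> r"
    and \<alpha>: "\<And>S. \<lbrakk>S \<subseteq> {..<n}; card S \<le> r\<rbrakk> \<Longrightarrow> (\<Sum>i\<in>S. (\<alpha> i)\<^sup>2) \<le> A\<^sup>2 * (real (card S) + real L)"
  shows "\<bar>\<Sum>i<n. \<alpha> i * x i\<bar> \<le> top_radius A r"
proof -
  let ?S = "{i. x i \<noteq> 0}"
  note S = sparse_fun_supp[OF x]
  have "\<bar>\<Sum>i<n. \<alpha> i * x i\<bar> = \<bar>\<Sum>i\<in>?S. \<alpha> i * x i\<bar>"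
    using S by (intro arg_cong[where f = abs] sum.mono_neutral_cong_right) auto
  also have "\<dots> \<le> (\<Sum>i\<in>?S. \<bar>\<alpha> i\<bar> * \<bar>x i\<bar>)" by (rule order_trans[OF sum_abs]) (simp add: abs_mult)
  also have "\<dots> \<le> L2_set \<alpha> ?S * L2_set x ?S" by (rule L2_set_mult_ineq)
  also have "\<dots> \<le> (A * sqrt (2 * real r * real L)) * 1"
  proof (intro mult_mono)
    have "(\<Sum>i\<in>?S. (\<alpha> i)\<^sup>2) \<le> A\<^sup>2 * (real (card ?S) + real L)" using S by (intro \<alpha>) auto
    also have "\<dots> \<le> A\<^sup>2 * (2 * real r * real L)"
    proof (intro mult_left_mono)
      have "1 * real L \<le> real r * real L" "real r * 1 \<le> real r * real L" using r L_ge by (intro mult_mono; simp)+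
      then show "real (card ?S) + real L \<le> 2 * real r * real L" using S(3) by linarith
    qed simp
    finally have "sqrt (\<Sum>i\<in>?S. (\<alpha> i)\<^sup>2) \<le> sqrt (A\<^sup>2 * (2 * real r * real L))" by simp
    then show "L2_set \<alpha> ?S \<le> A * sqrt (2 * real r * real L)"
      using A by (simp only: L2_set_def real_sqrt_mult real_sqrt_abs abs_of_nonneg)
    have "(\<Sum>i\<in>?S. (x i)\<^sup>2) = (\<Sum>i<n. (x i)\<^sup>2)" using S by (intro sum.mono_neutral_cong_left) auto
    then show "L2_set x ?S \<le> 1" using x by (simp add: L2_set_def sparse_fun_def)
  qed (use A in auto)
  finally show ?thesis by (simp add: top_radius_def real_sqrt_mult mult_ac)
qed

section \<open>Chaos and bilinear forms over sparse vectors\<close>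

lemma J_le: "real (Suc J) \<le> 5 * real n"
proof -
  have "l \<le> real n" using n ln_le_minus_one[of "real n"] by (simp add: l_def)
  then show ?thesis using J(2) n by simp
qed

text \<open>80 = 4 * 5 * 4 collects the 4 n^2 pairs of sign patterns, the 5 n levels and the failure
  probability 4 exp (- \<tau>) of a level.\<close>

lemma n_pow: "80 * real n ^ 3 \<le> real n ^ 7"
proof -
  have "80 \<le> real n ^ 4"
  proof -
    have "32 ^ 4 \<le> real n ^ 4" using n by (intro power_mono) auto
    then show ?thesis by simp
  qed
  then have "80 * real n ^ 3 \<le> real n ^ 4 * real n ^ 3" by (intro mult_right_mono) auto
  then show ?thesis by (simp flip: power_add)
qed

lemma d_sq: "((2::real) ^ d)\<^sup>2 \<le> 4 * (real n)\<^sup>2"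
proof -
  have "(2::real) ^ d \<le> 2 * real n" using d(2) by (metis of_nat_le_iff of_nat_mult of_nat_numeral of_nat_power)
  then have "((2::real) ^ d)\<^sup>2 \<le> (2 * real n)\<^sup>2" by (intro power_mono) auto
  then show ?thesis by (simp add: power_mult_distrib)
qed

text \<open>The functionals \<alpha> are the interface to the application: by \<open>op\<close>
  their maximum dominates the operator norm of \<open>V x\<close>, and their small energy on small
  sets provides the nets.\<close>

lemma chaos_sparse:
  fixes \<alpha> :: "nat \<times> bool \<Rightarrow> nat \<Rightarrow> real"
  assumes lp: "linear_process R V N" and A: "A \<ge> 0" and r: "1 \<le> r" "r \<le> n"
    and \<alpha>: "\<And>\<kappa> S. \<lbrakk>\<kappa> \<in> freqs n; S \<subseteq> {..<n}; card S \<le> r\<rbrakk> \<Longrightarrow> (\<Sum>i\<in>S. (\<alpha> \<kappa> i)\<^sup>2) \<le> A\<^sup>2 * (real (card S) + real L)"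
    and op: "\<And>x c. \<lbrakk>c \<ge> 0; \<And>\<kappa>. \<kappa> \<in> freqs n \<Longrightarrow> \<bar>\<Sum>i<n. \<alpha> \<kappa> i * x i\<bar> \<le> c\<rbrakk> \<Longrightarrow> op_bound n R (V x) c"
    and bdd: "\<And>x s l. \<lbrakk>x \<in> sparse_fun n r; s \<in> R; l < n\<rbrakk> \<Longrightarrow> \<bar>V x s l\<bar> \<le> K"
  defines "Kc \<equiv> chain_bound A r"
  shows "whp (\<Pi>\<^sub>M i\<in>{..<n}. N) (real n ^ 7 * exp (- \<tau>))
    (\<lambda>\<xi>. \<forall>Dg. (\<forall>x\<in>sparse_fun n r. (\<Sum>l<n. (\<xi> l)\<^sup>2 * (\<Sum>s\<in>R. (V x s l)\<^sup>2)) \<le> Dg) \<longrightarrow>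
      (\<forall>x\<in>sparse_fun n r. \<bar>(\<Sum>s\<in>R. (\<Sum>l<n. V x s l * \<xi> l)\<^sup>2) - (\<Sum>l<n. (\<xi> l)\<^sup>2 * (\<Sum>s\<in>R. (V x s l)\<^sup>2))\<bar>
       \<le> 4 * Kc * sqrt (2 * Dg + 32 * Kc\<^sup>2) + 8 * (1 / real n) * (2 * Dg + 32 * Kc\<^sup>2)))"
proof -
  interpret linear_process n R V N by (rule lp)
  have "\<exists>P. (\<forall>k. finite (P k) \<and> P k \<subseteq> sparse_fun n r \<and> real (card (P k)) \<le> exp (2 * l * real (L * 2 ^ k))) \<and>
    chain_net (sparse_fun n r) P J
      (\<lambda>k u u'. \<forall>\<kappa>\<in>freqs n. \<bar>\<Sum>i<n. \<alpha> \<kappa> i * (u i - u' i)\<bar> \<le> step_radius A r k) (1 / real n)"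
    by (rule sparse_chain_net[OF A r \<alpha>])
  then obtain P where P: "\<forall>k. finite (P k) \<and> P k \<subseteq> sparse_fun n r \<and> real (card (P k)) \<le> exp (2 * l * real (L * 2 ^ k))"
    and net: "chain_net (sparse_fun n r) P J
      (\<lambda>k u u'. \<forall>\<kappa>\<in>freqs n. \<bar>\<Sum>i<n. \<alpha> \<kappa> i * (u i - u' i)\<bar> \<le> step_radius A r k) (1 / real n)"
    by (elim exE conjE) (rule that; assumption)
  have sr: "step_radius A r k \<ge> 0" for k using A l_ge by (simp add: step_radius_def)
  have tr: "top_radius A r \<ge> 0" using A by (simp add: top_radius_def)
  have net': "chain_net (sparse_fun n r) P J (\<lambda>k u u'. op_bound n R (V (\<lambda>i. u i - u' i)) (step_radius A r k)) (1 / real n)"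
    by (rule chain_net_mono[OF net]) (intro op sr, blast)
  have "whp (\<mu> n) ((2 ^ d)\<^sup>2 * (real (Suc J) * (4 * exp (- \<tau>))))
    (\<lambda>\<xi>. \<forall>Dg. (\<forall>x\<in>sparse_fun n r. diag x \<xi> \<le> Dg) \<longrightarrow> (\<forall>x\<in>sparse_fun n r. \<bar>(\<Sum>s\<in>R. (app x \<xi> s)\<^sup>2) - diag x \<xi>\<bar>
       \<le> 4 * Kc * sqrt (2 * Dg + 32 * Kc\<^sup>2) + 8 * (1 / real n) * (2 * Dg + 32 * Kc\<^sup>2)))"
  proof (rule chaos_deviation_whp[OF d(1) net' _ _ sr t_nonneg tr t_nonneg])
    show "1 / real n \<le> 1 / 32" using n by simp
    show "op_bound n R (V u) (top_radius A r)" if "u \<in> P 0" for u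
      using P[rule_format, of 0] that by (intro op tr linear_functional_sparse[OF _ A r(1) \<alpha>]) auto
    show "t 0 * top_radius A r + (\<Sum>k<J. 2 * (t k * step_radius A r k)) \<le> Kc"
      unfolding Kc_def by (rule chain_bound[OF A])
    have "real (card (P 0)) * (2 * exp (- (t 0)\<^sup>2 / 2)) \<le> exp (2 * l * real (L * 2 ^ 0)) * (2 * exp (- (t 0)\<^sup>2 / 2))"
      using P[rule_format, of 0] by (intro mult_right_mono) auto
    also have "\<dots> = 2 * exp (- (10 * l * real L)) * exp (- \<tau>)"
      unfolding exp_t by (simp add: algebra_simps flip: exp_add)
    also have "\<dots> \<le> 2 * 1 * exp (- \<tau>)" using l_ge by (intro mult_right_mono mult_left_mono) auto
    also have "2 * 1 * exp (- \<tau>) \<le> 4 * exp (- \<tau>)" by simp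
    finally show "real (card (P 0)) * (2 * exp (- (t 0)\<^sup>2 / 2)) \<le> 4 * exp (- \<tau>)" .
    fix k
    have "real (card (P k)) * real (card (P (Suc k))) * (4 * exp (- (t k)\<^sup>2 / 2))
      \<le> exp (2 * l * real (L * 2 ^ k)) * exp (2 * l * real (L * 2 ^ Suc k)) * (4 * exp (- (t k)\<^sup>2 / 2))"
      using P[rule_format, of k] P[rule_format, of "Suc k"] by (intro mult_right_mono mult_mono) auto
    also have "\<dots> = 4 * exp (- (6 * l * real (L * 2 ^ k))) * exp (- \<tau>)"
      unfolding exp_t by (simp add: algebra_simps flip: exp_add)
    also have "\<dots> \<le> 4 * 1 * exp (- \<tau>)" using l_ge by (intro mult_right_mono mult_left_mono) auto
    finally show "real (card (P k)) * real (card (P (Suc k))) * (4 * exp (- (t k)\<^sup>2 / 2)) \<le> 4 * exp (- \<tau>)" by simp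
  qed (use bdd in auto)
  moreover have "(2 ^ d)\<^sup>2 * (real (Suc J) * (4 * exp (- \<tau>))) \<le> real n ^ 7 * exp (- \<tau>)"
  proof -
    have "(2 ^ d)\<^sup>2 * (real (Suc J) * (4 * exp (- \<tau>))) \<le> (4 * (real n)\<^sup>2) * ((5 * real n) * (4 * exp (- \<tau>)))"
      using J_le d_sq by (intro mult_mono) auto
    also have "\<dots> = 80 * real n ^ 3 * exp (- \<tau>)" by (simp add: power2_eq_square power3_eq_cube)
    also have "\<dots> \<le> real n ^ 7 * exp (- \<tau>)" using n_pow by (intro mult_right_mono) auto
    finally show ?thesis .
  qed
  ultimately show ?thesis by (rule whp_mono) (simp only: app_def diag_def)
qed

text \<open>A chain without links: X is its own net and the remainder is zero. The bound involves
  the operator norm c0 and sqrt \<tau> but no sum over levels.\<close>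

lemma chaos_points:
  assumes lp: "linear_process R V N" and X: "finite X" "card X \<le> n"
    and op: "\<And>x. x \<in> X \<Longrightarrow> op_bound n R (V x) c0" and c0: "c0 \<ge> 0"
    and bdd: "\<And>x s l. \<lbrakk>x \<in> X; s \<in> R; l < n\<rbrakk> \<Longrightarrow> \<bar>V x s l\<bar> \<le> K"
  defines "Kc \<equiv> sqrt (2 * \<tau>) * c0"
  shows "whp (\<Pi>\<^sub>M i\<in>{..<n}. N) (real n ^ 7 * exp (- \<tau>))
    (\<lambda>\<xi>. \<forall>Dg. (\<forall>x\<in>X. (\<Sum>l<n. (\<xi> l)\<^sup>2 * (\<Sum>s\<in>R. (V x s l)\<^sup>2)) \<le> Dg) \<longrightarrow>
      (\<forall>x\<in>X. \<bar>(\<Sum>s\<in>R. (\<Sum>l<n. V x s l * \<xi> l)\<^sup>2) - (\<Sum>l<n. (\<xi> l)\<^sup>2 * (\<Sum>s\<in>R. (V x s l)\<^sup>2))\<bar>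
       \<le> 4 * Kc * sqrt (2 * Dg + 32 * Kc\<^sup>2)))"
proof -
  interpret linear_process n R V N by (rule lp)
  have net: "chain_net X (\<lambda>_. X) 0 (\<lambda>k u u'. op_bound n R (V (\<lambda>i. u i - u' i)) 0) 0"
    using X by (auto simp: chain_net_def)
  have e: "exp (- (sqrt (2 * \<tau>))\<^sup>2 / 2) = exp (- \<tau>)" using \<tau>_nonneg by simp
  have "whp (\<mu> n) ((2 ^ d)\<^sup>2 * (real (Suc 0) * (2 * real n * exp (- \<tau>))))
    (\<lambda>\<xi>. \<forall>Dg. (\<forall>x\<in>X. diag x \<xi> \<le> Dg) \<longrightarrow> (\<forall>x\<in>X. \<bar>(\<Sum>s\<in>R. (app x \<xi> s)\<^sup>2) - diag x \<xi>\<bar>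
       \<le> 4 * Kc * sqrt (2 * Dg + 32 * Kc\<^sup>2) + 8 * 0 * (2 * Dg + 32 * Kc\<^sup>2)))"
    by (rule chaos_deviation_whp[OF d(1) net, where ?t0.0 = "sqrt (2 * \<tau>)" and ?c0.0 = c0 and t = "\<lambda>_. 0" and K = K])
      (use c0 \<tau>_nonneg op bdd X in \<open>auto simp: Kc_def e intro!: mult_right_mono\<close>)
  moreover have "(2 ^ d)\<^sup>2 * (real (Suc 0) * (2 * real n * exp (- \<tau>))) \<le> real n ^ 7 * exp (- \<tau>)"
  proof -
    have "(2 ^ d)\<^sup>2 * (real (Suc 0) * (2 * real n * exp (- \<tau>))) \<le> (4 * (real n)\<^sup>2) * (2 * real n * exp (- \<tau>))"
      using mult_right_mono[OF d_sq, of "2 * real n * exp (- \<tau>)"] by simp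
    also have "\<dots> \<le> 80 * real n ^ 3 * exp (- \<tau>)" by (simp add: power2_eq_square power3_eq_cube)
    also have "\<dots> \<le> real n ^ 7 * exp (- \<tau>)" using n_pow by (intro mult_right_mono) auto
    finally show ?thesis .
  qed
  ultimately show ?thesis by (rule whp_mono) (simp add: app_def diag_def)
qed

text \<open>Two nets of the same ball are used, one adapted to the increments of x through \<alpha>,
  one to the increments of y through \<beta>. The estimate \<open>op'\<close> for y is uniform over
  the sparse u.\<close>

lemma bilinear_sparse:
  fixes \<alpha> \<beta> :: "nat \<times> bool \<Rightarrow> nat \<Rightarrow> real"
  assumes lp: "linear_process {..<n} V N" and A: "A \<ge> 0" and r: "1 \<le> r" "r \<le> n"
    and \<alpha>: "\<And>\<kappa> S. \<lbrakk>\<kappa> \<in> freqs n; S \<subseteq> {..<n}; card S \<le> r\<rbrakk> \<Longrightarrow> (\<Sum>i\<in>S. (\<alpha> \<kappa> i)\<^sup>2) \<le> A\<^sup>2 * (real (card S) + real L)"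
    and \<beta>: "\<And>\<kappa> S. \<lbrakk>\<kappa> \<in> freqs n; S \<subseteq> {..<n}; card S \<le> r\<rbrakk> \<Longrightarrow> (\<Sum>i\<in>S. (\<beta> \<kappa> i)\<^sup>2) \<le> A\<^sup>2 * (real (card S) + real L)"
    and op: "\<And>x c. \<lbrakk>c \<ge> 0; \<And>\<kappa>. \<kappa> \<in> freqs n \<Longrightarrow> \<bar>\<Sum>i<n. \<alpha> \<kappa> i * x i\<bar> \<le> c\<rbrakk> \<Longrightarrow> op_bound n {..<n} (V x) c"
    and op': "\<And>u y c. \<lbrakk>u \<in> sparse_fun n r; c \<ge> 0; \<And>\<kappa>. \<kappa> \<in> freqs n \<Longrightarrow> \<bar>\<Sum>i<n. \<beta> \<kappa> i * y i\<bar> \<le> c\<rbrakk>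
      \<Longrightarrow> (\<Sum>l<n. (\<Sum>s<n. V u s l * y s)\<^sup>2) \<le> c\<^sup>2"
    and bdd: "\<And>x s l. \<lbrakk>x \<in> sparse_fun n r; s < n; l < n\<rbrakk> \<Longrightarrow> \<bar>V x s l\<bar> \<le> K"
  shows "whp (\<Pi>\<^sub>M i\<in>{..<n}. N) (real n ^ 7 * exp (- \<tau>))
    (\<lambda>\<xi>. \<forall>x\<in>sparse_fun n r. \<forall>y\<in>sparse_fun n r. \<bar>\<Sum>s<n. y s * (\<Sum>l<n. V x s l * \<xi> l)\<bar> \<le> 2 * chain_bound A r)"
proof -
  interpret linear_process n "{..<n}" V N by (rule lp)
  have "\<exists>P. (\<forall>k. finite (P k) \<and> P k \<subseteq> sparse_fun n r \<and> real (card (P k)) \<le> exp (2 * l * real (L * 2 ^ k))) \<and>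
    chain_net (sparse_fun n r) P J
      (\<lambda>k u u'. \<forall>\<kappa>\<in>freqs n. \<bar>\<Sum>i<n. \<alpha> \<kappa> i * (u i - u' i)\<bar> \<le> step_radius A r k) (1 / real n)"
    by (rule sparse_chain_net[OF A r \<alpha>])
  then obtain P where P: "\<forall>k. finite (P k) \<and> P k \<subseteq> sparse_fun n r \<and> real (card (P k)) \<le> exp (2 * l * real (L * 2 ^ k))"
    and net: "chain_net (sparse_fun n r) P J
      (\<lambda>k u u'. \<forall>\<kappa>\<in>freqs n. \<bar>\<Sum>i<n. \<alpha> \<kappa> i * (u i - u' i)\<bar> \<le> step_radius A r k) (1 / real n)"
    by (elim exE conjE) (rule that; assumption)
  have "\<exists>P. (\<forall>k. finite (P k) \<and> P k \<subseteq> sparse_fun n r \<and> real (card (P k)) \<le> exp (2 * l * real (L * 2 ^ k))) \<and>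
    chain_net (sparse_fun n r) P J
      (\<lambda>k u u'. \<forall>\<kappa>\<in>freqs n. \<bar>\<Sum>i<n. \<beta> \<kappa> i * (u i - u' i)\<bar> \<le> step_radius A r k) (1 / real n)"
    by (rule sparse_chain_net[OF A r \<beta>])
  then obtain Q where Q: "\<forall>k. finite (Q k) \<and> Q k \<subseteq> sparse_fun n r \<and> real (card (Q k)) \<le> exp (2 * l * real (L * 2 ^ k))"
    and netQ: "chain_net (sparse_fun n r) Q J
      (\<lambda>k u u'. \<forall>\<kappa>\<in>freqs n. \<bar>\<Sum>i<n. \<beta> \<kappa> i * (u i - u' i)\<bar> \<le> step_radius A r k) (1 / real n)"
    by (elim exE conjE) (rule that; assumption)
  have sr: "step_radius A r k \<ge> 0" for k using A l_ge by (simp add: step_radius_def)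
  have tr: "top_radius A r \<ge> 0" using A by (simp add: top_radius_def)
  have net': "chain_net (sparse_fun n r) P J (\<lambda>k u u'. op_bound n {..<n} (V (\<lambda>i. u i - u' i)) (step_radius A r k)) (1 / real n)"
    by (rule chain_net_mono[OF net]) (intro op sr, blast)
  have netQ': "chain_net (sparse_fun n r) Q J (\<lambda>k v v'. \<forall>u\<in>sparse_fun n r.
      (\<Sum>l<n. (\<Sum>s<n. V u s l * (v s - v' s))\<^sup>2) \<le> (step_radius A r k)\<^sup>2) (1 / real n)"
    by (rule chain_net_mono[OF netQ]) (intro ballI op' sr, auto)
  have "whp (\<mu> n) (real (Suc J) * (4 * exp (- \<tau>)))
    (\<lambda>\<xi>. \<forall>x\<in>sparse_fun n r. \<forall>y\<in>sparse_fun n r. \<bar>\<Sum>s<n. y s * app x \<xi> s\<bar> \<le> 2 * chain_bound A r)"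
  proof (rule bilinear_whp[OF net' netQ' _ _ sr t_nonneg tr t_nonneg])
    show "1 / real n \<le> 1 / 4" using n by simp
    show "op_bound n {..<n} (V u) (top_radius A r)" if "u \<in> P 0" for u
      using P[rule_format, of 0] that by (intro op tr linear_functional_sparse[OF _ A r(1) \<alpha>]) auto
    show "t 0 * top_radius A r + (\<Sum>k<J. 2 * (t k * step_radius A r k)) \<le> chain_bound A r"
      by (rule chain_bound[OF A])
    have "real (card (P 0)) * real (card (Q 0)) * (2 * exp (- (t 0)\<^sup>2 / 2))
      \<le> exp (2 * l * real (L * 2 ^ 0)) * exp (2 * l * real (L * 2 ^ 0)) * (2 * exp (- (t 0)\<^sup>2 / 2))"
      using P[rule_format, of 0] Q[rule_format, of 0] by (intro mult_right_mono mult_mono) auto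
    also have "\<dots> = 2 * exp (- (8 * l * real L)) * exp (- \<tau>)"
      unfolding exp_t by (simp add: algebra_simps flip: exp_add)
    also have "\<dots> \<le> 2 * 1 * exp (- \<tau>)" using l_ge by (intro mult_right_mono mult_left_mono) auto
    also have "2 * 1 * exp (- \<tau>) \<le> 4 * exp (- \<tau>)" by simp
    finally show "real (card (P 0)) * real (card (Q 0)) * (2 * exp (- (t 0)\<^sup>2 / 2)) \<le> 4 * exp (- \<tau>)" .
    fix k
    have "real (card (P k)) * real (card (P (Suc k))) * (real (card (Q k)) * real (card (Q (Suc k)))) * (4 * exp (- (t k)\<^sup>2 / 2))
      \<le> exp (2 * l * real (L * 2 ^ k)) * exp (2 * l * real (L * 2 ^ Suc k)) *
        (exp (2 * l * real (L * 2 ^ k)) * exp (2 * l * real (L * 2 ^ Suc k))) * (4 * exp (- (t k)\<^sup>2 / 2))"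
      using P[rule_format, of k] P[rule_format, of "Suc k"] Q[rule_format, of k] Q[rule_format, of "Suc k"] by (intro mult_right_mono mult_mono) auto
    \<comment> \<open>The four nets of a link have entropies 2, 4, 2 and 4 in units of l L 2^k.
      Their sum is the 12 in the definition of \<open>t\<close>.\<close>
    also have "\<dots> = 4 * exp (- \<tau>)"
      unfolding exp_t by (simp add: algebra_simps flip: exp_add)
    finally show "real (card (P k)) * real (card (P (Suc k))) * (real (card (Q k)) * real (card (Q (Suc k)))) * (4 * exp (- (t k)\<^sup>2 / 2))
      \<le> 4 * exp (- \<tau>)" .
  qed (use bdd in \<open>auto simp: sparse_fun_def\<close>)
  moreover have "real (Suc J) * (4 * exp (- \<tau>)) \<le> real n ^ 7 * exp (- \<tau>)"
  proof -
    have "real (Suc J) * (4 * exp (- \<tau>)) \<le> 5 * real n * (4 * exp (- \<tau>))"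
      using J_le by (intro mult_right_mono) auto
    also have "\<dots> \<le> 80 * real n ^ 3 * exp (- \<tau>)"
    proof -
      have "real n \<le> real n ^ 3" using n by (intro self_le_power) auto
      moreover have "0 \<le> real n ^ 3" by simp
      ultimately have "5 * real n * 4 \<le> 80 * real n ^ 3" by linarith
      from mult_right_mono[OF this, of "exp (- \<tau>)"] show ?thesis by (simp add: mult.assoc)
    qed
    also have "\<dots> \<le> real n ^ 7 * exp (- \<tau>)" using n_pow by (intro mult_right_mono) auto
    finally show ?thesis .
  qed
  ultimately show ?thesis by (rule whp_mono) (simp only: app_def)
qed

end

subsection \<open>The two circulant factors\<close>

lemma sparse_fun_abs_le_1: "x \<in> sparse_fun n r \<Longrightarrow> \<bar>x i\<bar> \<le> 1"
proof (cases "i < n")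
  case True
  assume x: "x \<in> sparse_fun n r"
  have "(x i)\<^sup>2 \<le> (\<Sum>i<n. (x i)\<^sup>2)" using True by (intro member_le_sum) auto
  then have "(x i)\<^sup>2 \<le> 1" using x by (simp add: sparse_fun_def)
  then show ?thesis by (simp add: abs_square_le_1)
qed (simp add: sparse_fun_def)

lemma rademacher_linear_process:
  assumes "finite R" "\<And>a b x y s l. V (\<lambda>i. a * x i + b * y i) s l = a * V x s l + b * V y s l"
  shows "linear_process R V (measure_pmf (pmf_of_set {- 1, 1 :: real}))"
  using assms by (intro linear_process.intro linear_family.intro rademacher.subgaussian_law_axioms)

lemma gauss_linear_process:
  assumes "finite R" "\<And>a b x y s l. V (\<lambda>i. a * x i + b * y i) s l = a * V x s l + b * V y s l"
  shows "linear_process R V std_normal_distribution"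
  using assms by (intro linear_process.intro linear_family.intro gauss.subgaussian_law_axioms)

context scales
begin

lemma n_pos: "n > 0" using n by simp

text \<open>\<open>K\<close> bounds the chain sum; the supremum \<open>M\<close> over sparse vectors satisfies
  \<open>M\<^sup>2 \<le> 1 + 4 * K * M + 8 * M\<^sup>2 / n\<close>, hence \<open>M\<^sup>2 \<le> 2 + 32 * K\<^sup>2\<close>.\<close>

definition circ_dev :: "nat \<Rightarrow> real" where
  "circ_dev r = (let K = chain_bound (sqrt (2 / real n)) r in
     4 * K * sqrt (2 * 1 + 32 * K\<^sup>2) + 8 * (1 / real n) * (2 * 1 + 32 * K\<^sup>2))"

text \<open>The chaos has a circulant matrix in x whose columns carry fixed signs \<sigma>. With
  \<sigma> = 1 it treats the convolution by a Rademacher vector; with \<sigma> a shift of the first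
  sign vector and \<xi> the second, it yields autocorrelations of modulated columns.\<close>

lemma circulant_deviation:
  assumes \<sigma>: "\<And>l. \<bar>\<sigma> l\<bar> = (1::real)" and r: "1 \<le> r" "r \<le> n"
  shows "whp (rademacher.\<mu> n) (real n ^ 7 * exp (- \<tau>))
    (\<lambda>\<xi>. (\<forall>l<n. \<xi> l = 1 \<or> \<xi> l = - 1) \<and> (\<forall>x\<in>sparse_fun n r.
      \<bar>(\<Sum>s<n. (\<Sum>l<n. x (cyc_diff n s l) * (\<sigma> l * \<xi> l))\<^sup>2) / real n - (\<Sum>i<n. (x i)\<^sup>2)\<bar> \<le> circ_dev r))"
proof -
  define V where "V x s l = x (cyc_diff n s l) * \<sigma> l / sqrt (real n)" for x :: "nat \<Rightarrow> real" and s l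
  define \<alpha> where "\<alpha> \<kappa> i = sqrt (2 / real n) * trig n \<kappa> i" for \<kappa> i
  define K where "K = chain_bound (sqrt (2 / real n)) r"
  have \<sigma>2: "(\<sigma> l)\<^sup>2 = 1" for l using \<sigma>[of l] by (metis one_power2 power2_abs)
  have lp: "linear_process {..<n} V (measure_pmf (pmf_of_set {- 1, 1 :: real}))"
    by (rule rademacher_linear_process) (auto simp: V_def add_divide_distrib algebra_simps)
  have "whp (rademacher.\<mu> n) (real n ^ 7 * exp (- \<tau>))
    (\<lambda>\<xi>. \<forall>Dg. (\<forall>x\<in>sparse_fun n r. (\<Sum>l<n. (\<xi> l)\<^sup>2 * (\<Sum>s<n. (V x s l)\<^sup>2)) \<le> Dg) \<longrightarrow>
      (\<forall>x\<in>sparse_fun n r. \<bar>(\<Sum>s<n. (\<Sum>l<n. V x s l * \<xi> l)\<^sup>2) - (\<Sum>l<n. (\<xi> l)\<^sup>2 * (\<Sum>s<n. (V x s l)\<^sup>2))\<bar>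
       \<le> 4 * K * sqrt (2 * Dg + 32 * K\<^sup>2) + 8 * (1 / real n) * (2 * Dg + 32 * K\<^sup>2)))"
    unfolding K_def
  proof (rule chaos_sparse[OF lp _ r])
    show "(\<Sum>i\<in>S. (\<alpha> \<kappa> i)\<^sup>2) \<le> (sqrt (2 / real n))\<^sup>2 * (real (card S) + real L)" if "card S \<le> r" for \<kappa> S
    proof -
      have "(\<Sum>i\<in>S. (\<alpha> \<kappa> i)\<^sup>2) = (sqrt (2 / real n))\<^sup>2 * (\<Sum>i\<in>S. (trig n \<kappa> i)\<^sup>2)"
        by (simp add: \<alpha>_def power_mult_distrib sum_distrib_left)
      also have "\<dots> \<le> (sqrt (2 / real n))\<^sup>2 * (\<Sum>i\<in>S. 1)"
        by (intro mult_left_mono sum_mono trig_sq_le) auto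
      also have "\<dots> \<le> (sqrt (2 / real n))\<^sup>2 * (real (card S) + real L)"
        by (intro mult_left_mono) auto
      finally show ?thesis .
    qed
    show "op_bound n {..<n} (V x) c" if c: "c \<ge> 0" and bd: "\<And>\<kappa>. \<kappa> \<in> freqs n \<Longrightarrow> \<bar>\<Sum>i<n. \<alpha> \<kappa> i * x i\<bar> \<le> c" for x c
      unfolding op_bound_def
    proof
      fix w :: "nat \<Rightarrow> real"
      have "2 * (\<Sum>j<n. x j * trig n \<kappa> j)\<^sup>2 \<le> real n * c\<^sup>2" if "\<kappa> \<in> freqs n" for \<kappa>
      proof -
        have "(\<Sum>i<n. \<alpha> \<kappa> i * x i)\<^sup>2 \<le> c\<^sup>2" using bd[OF that] c by (metis abs_le_square_iff abs_of_nonneg)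
        moreover have "(\<Sum>i<n. \<alpha> \<kappa> i * x i) = sqrt (2 / real n) * (\<Sum>j<n. x j * trig n \<kappa> j)"
          by (simp add: \<alpha>_def sum_distrib_left mult_ac)
        ultimately have "2 / real n * (\<Sum>j<n. x j * trig n \<kappa> j)\<^sup>2 \<le> c\<^sup>2"
          by (simp add: power_mult_distrib)
        then show ?thesis using n_pos by (simp add: field_simps)
      qed
      from correlation_le_left[OF n_pos this]
      have le: "(\<Sum>l<n. (\<Sum>s<n. x (cyc_diff n s l) * w s)\<^sup>2) \<le> real n * c\<^sup>2 * (\<Sum>s<n. (w s)\<^sup>2)" .
      have "(\<Sum>s<n. V x s l * w s)\<^sup>2 = (\<Sum>s<n. x (cyc_diff n s l) * w s)\<^sup>2 / real n" for l
      proof -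
        have "(\<Sum>s<n. V x s l * w s) = \<sigma> l / sqrt (real n) * (\<Sum>s<n. x (cyc_diff n s l) * w s)"
          by (simp add: V_def sum_distrib_left mult_ac)
        then show ?thesis by (simp add: power_mult_distrib power_divide \<sigma>2)
      qed
      then have "(\<Sum>l<n. (\<Sum>s<n. V x s l * w s)\<^sup>2) = (\<Sum>l<n. (\<Sum>s<n. x (cyc_diff n s l) * w s)\<^sup>2) / real n"
        by (simp add: sum_divide_distrib)
      then show "(\<Sum>l<n. (\<Sum>s<n. V x s l * w s)\<^sup>2) \<le> c\<^sup>2 * (\<Sum>s<n. (w s)\<^sup>2)"
        using le n_pos by (simp add: pos_divide_le_eq mult_ac)
    qed
    show "\<bar>V x s l\<bar> \<le> 1" if "x \<in> sparse_fun n r" for x s l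
    proof -
      have "\<bar>V x s l\<bar> = \<bar>x (cyc_diff n s l)\<bar> / sqrt (real n)" by (simp add: V_def abs_mult \<sigma>)
      also have "\<dots> \<le> 1 / 1" using sparse_fun_abs_le_1[OF that] n by (intro frac_le) auto
      finally show ?thesis by simp
    qed
  qed simp
  from whp_AE[OF this rademacher_AE] show ?thesis
  proof (rule whp_mono[OF _ order_refl], intro conjI ballI)
    fix \<xi> assume "(\<forall>Dg. (\<forall>x\<in>sparse_fun n r. (\<Sum>l<n. (\<xi> l)\<^sup>2 * (\<Sum>s<n. (V x s l)\<^sup>2)) \<le> Dg) \<longrightarrow>
      (\<forall>x\<in>sparse_fun n r. \<bar>(\<Sum>s<n. (\<Sum>l<n. V x s l * \<xi> l)\<^sup>2) - (\<Sum>l<n. (\<xi> l)\<^sup>2 * (\<Sum>s<n. (V x s l)\<^sup>2))\<bar>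
       \<le> 4 * K * sqrt (2 * Dg + 32 * K\<^sup>2) + 8 * (1 / real n) * (2 * Dg + 32 * K\<^sup>2))) \<and> (\<forall>l<n. \<xi> l = 1 \<or> \<xi> l = - 1)"
    then have dev: "(\<forall>x\<in>sparse_fun n r. (\<Sum>l<n. (\<xi> l)\<^sup>2 * (\<Sum>s<n. (V x s l)\<^sup>2)) \<le> 1) \<longrightarrow>
      (\<forall>x\<in>sparse_fun n r. \<bar>(\<Sum>s<n. (\<Sum>l<n. V x s l * \<xi> l)\<^sup>2) - (\<Sum>l<n. (\<xi> l)\<^sup>2 * (\<Sum>s<n. (V x s l)\<^sup>2))\<bar>
       \<le> 4 * K * sqrt (2 * 1 + 32 * K\<^sup>2) + 8 * (1 / real n) * (2 * 1 + 32 * K\<^sup>2))"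
      and \<xi>: "\<forall>l<n. \<xi> l = 1 \<or> \<xi> l = - 1" by blast+
    show "\<forall>l<n. \<xi> l = 1 \<or> \<xi> l = - 1" by fact
    \<comment> \<open>The squares of the signs are 1 and each column of \<open>V x\<close> is a
      permutation of x / sqrt n up to sign, so the diagonal equals the squared norm and Dg = 1 is
      admissible.\<close>
    have diag: "(\<Sum>l<n. (\<xi> l)\<^sup>2 * (\<Sum>s<n. (V x s l)\<^sup>2)) = (\<Sum>i<n. (x i)\<^sup>2)" for x
    proof -
      have "(\<xi> l)\<^sup>2 * (\<Sum>s<n. (V x s l)\<^sup>2) = (\<Sum>i<n. (x i)\<^sup>2) / real n" if "l < n" for l
      proof -
        have "(\<Sum>s<n. (V x s l)\<^sup>2) = (\<Sum>s<n. (x (cyc_diff n s l))\<^sup>2) / real n"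
          by (simp add: V_def power_mult_distrib power_divide \<sigma>2 sum_divide_distrib)
        also have "(\<Sum>s<n. (x (cyc_diff n s l))\<^sup>2) = (\<Sum>i<n. (x i)\<^sup>2)"
          by (rule sum.reindex_bij_betw[OF bij_cyc_diff_left[OF n_pos]])
        finally show ?thesis using \<xi> that by auto
      qed
      then show ?thesis using n_pos by simp
    qed
    fix x assume x: "x \<in> sparse_fun n r"
    have "(\<Sum>l<n. V x s l * \<xi> l)\<^sup>2 = (\<Sum>l<n. x (cyc_diff n s l) * (\<sigma> l * \<xi> l))\<^sup>2 / real n" for s
    proof -
      have "(\<Sum>l<n. V x s l * \<xi> l) = (\<Sum>l<n. x (cyc_diff n s l) * (\<sigma> l * \<xi> l)) / sqrt (real n)"
        by (simp add: V_def sum_divide_distrib mult_ac)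
      then show ?thesis by (simp add: power_divide)
    qed
    then have "(\<Sum>s<n. (\<Sum>l<n. V x s l * \<xi> l)\<^sup>2) = (\<Sum>s<n. (\<Sum>l<n. x (cyc_diff n s l) * (\<sigma> l * \<xi> l))\<^sup>2) / real n"
      by (simp add: sum_divide_distrib)
    moreover have "\<bar>(\<Sum>s<n. (\<Sum>l<n. V x s l * \<xi> l)\<^sup>2) - (\<Sum>i<n. (x i)\<^sup>2)\<bar> \<le> circ_dev r"
      using dev x unfolding diag circ_dev_def Let_def K_def[symmetric] by (simp add: sparse_fun_def)
    ultimately show "\<bar>(\<Sum>s<n. (\<Sum>l<n. x (cyc_diff n s l) * (\<sigma> l * \<xi> l))\<^sup>2) / real n - (\<Sum>i<n. (x i)\<^sup>2)\<bar> \<le> circ_dev r"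
      by simp
  qed
qed

text \<open>The autocorrelation at lag \<open>q\<close> is read off the deviation at the two-sparse vector
  \<open>(e\<^sub>0 + e\<^sub>q) / \<surd>2\<close>.\<close>

lemma autocorrelation:
  assumes a: "\<And>l. l < n \<Longrightarrow> (a l)\<^sup>2 = (1::real)" and q: "0 < q" "q < n"
    and dev: "\<And>x. x \<in> sparse_fun n 2 \<Longrightarrow>
      \<bar>(\<Sum>s<n. (\<Sum>l<n. x (cyc_diff n s l) * a l)\<^sup>2) / real n - (\<Sum>i<n. (x i)\<^sup>2)\<bar> \<le> D"
  shows "\<bar>\<Sum>s<n. a s * a (cyc_diff n s q)\<bar> \<le> real n * D"
proof -
  define x :: "nat \<Rightarrow> real" where "x i = (if i = 0 \<or> i = q then 1 / sqrt 2 else 0)" for i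
  have x1: "(\<Sum>i<n. (x i)\<^sup>2) = 1"
  proof -
    have "(\<Sum>i<n. (x i)\<^sup>2) = (\<Sum>i\<in>{0, q}. (x i)\<^sup>2)"
      using q by (intro sum.mono_neutral_right) (auto simp: x_def)
    also have "\<dots> = 1" using q by (simp add: x_def power_divide)
    finally show ?thesis .
  qed
  have "{i. x i \<noteq> 0} = {0, q}" by (auto simp: x_def)
  then have "x \<in> sparse_fun n 2" using x1 q by (auto simp: sparse_fun_def x_def)
  note D = dev[OF this, unfolded x1]
  have inner: "(\<Sum>l<n. x (cyc_diff n s l) * a l) = (a s + a (cyc_diff n s q)) / sqrt 2" if s: "s < n" for s
  proof -
    have "(\<Sum>l<n. x (cyc_diff n s l) * a l) = (\<Sum>l<n. x (cyc_diff n s l) * a (cyc_diff n s (cyc_diff n s l)))"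
      by (intro sum.cong) (auto simp: cyc_diff_invol)
    also have "\<dots> = (\<Sum>j<n. x j * a (cyc_diff n s j))"
      by (rule sum.reindex_bij_betw[OF bij_cyc_diff_right[OF n_pos]])
    also have "\<dots> = (\<Sum>j\<in>{0, q}. x j * a (cyc_diff n s j))"
      using q by (intro sum.mono_neutral_right) (auto simp: x_def)
    also have "\<dots> = (a (cyc_diff n s 0) + a (cyc_diff n s q)) / sqrt 2"
      using q by (simp add: x_def add_divide_distrib)
    also have "cyc_diff n s 0 = s" using s by (simp add: cyc_diff_def)
    finally show ?thesis .
  qed
  have "(\<Sum>s<n. (\<Sum>l<n. x (cyc_diff n s l) * a l)\<^sup>2) = (\<Sum>s<n. 1 + a s * a (cyc_diff n s q))"
  proof (rule sum.cong[OF refl])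
    fix s assume "s \<in> {..<n}"
    then have s: "s < n" by simp
    have "(\<Sum>l<n. x (cyc_diff n s l) * a l)\<^sup>2 = ((a s)\<^sup>2 + (a (cyc_diff n s q))\<^sup>2) / 2 + a s * a (cyc_diff n s q)"
      unfolding inner[OF s] by (simp add: power_divide power2_sum add_divide_distrib)
    then show "(\<Sum>l<n. x (cyc_diff n s l) * a l)\<^sup>2 = 1 + a s * a (cyc_diff n s q)"
      by (simp add: a[OF s] a[OF cyc_diff_less[OF n_pos]])
  qed
  also have "\<dots> = real n + (\<Sum>s<n. a s * a (cyc_diff n s q))" by (simp add: sum.distrib)
  finally have "\<bar>(\<Sum>s<n. a s * a (cyc_diff n s q)) / real n\<bar> \<le> D"
    using D n_pos by (simp add: add_divide_distrib)
  then show ?thesis using n_pos by (simp add: pos_divide_le_eq mult.commute)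
qed

text \<open>Before normalisation, the Gram matrix of the rows in I has diagonal n and off-diagonal
  entries at most n D in modulus. Cauchy-Schwarz bounds its norm by n (1 + m D) <= 2 n.\<close>

lemma autocorrelation_op_bound:
  assumes ac: "\<And>q. 0 < q \<Longrightarrow> q < n \<Longrightarrow> \<bar>\<Sum>s<n. a s * a (cyc_diff n s q)\<bar> \<le> real n * D"
    and a: "\<And>l. l < n \<Longrightarrow> (a l)\<^sup>2 = (1::real)"
    and I: "I \<subseteq> {..<n}" and D: "D \<ge> 0" "real (card I) * D \<le> 1" and m: "card I > 0"
  shows "op_bound n I (\<lambda>s l. a (cyc_diff n s l) / sqrt (real n) / sqrt (real (card I))) (sqrt (2 / real (card I)))"
  unfolding op_bound_def
proof
  fix w :: "nat \<Rightarrow> real"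
  let ?m = "real (card I)"
  have fin: "finite I" using I finite_subset by auto
  define C where "C s s' = (\<Sum>l<n. a (cyc_diff n s l) * a (cyc_diff n s' l))" for s s'
  have C_eq: "C s s = real n" for s
    using a[OF cyc_diff_less[OF n_pos]] by (simp add: C_def flip: power2_eq_square)
  have C_le: "\<bar>C s s'\<bar> \<le> real n * D" if "s \<in> I" "s' \<in> I" "s \<noteq> s'" for s s'
  proof -
    have lt: "s < n" "s' < n" using that I by auto
    \<comment> \<open>As (s - l) - (s - s') = s' - l, the inner product of two rows is the
      autocorrelation at lag s - s'.\<close>
    have shift: "cyc_diff n s' l = cyc_diff n (cyc_diff n s l) (cyc_diff n s s')" for l
    proof -
      have "((int s - int l) mod int n - (int s - int s') mod int n) mod int n = (int s' - int l) mod int n"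
        by (simp add: mod_simps)
      then show ?thesis using n_pos by (simp add: cyc_diff_def)
    qed
    have "C s s' = (\<Sum>l<n. a (cyc_diff n s l) * a (cyc_diff n (cyc_diff n s l) (cyc_diff n s s')))"
      by (simp add: C_def shift[symmetric])
    also have "\<dots> = (\<Sum>j<n. a j * a (cyc_diff n j (cyc_diff n s s')))"
      by (rule sum.reindex_bij_betw[OF bij_cyc_diff_right[OF n_pos]])
    finally have "C s s' = (\<Sum>j<n. a j * a (cyc_diff n j (cyc_diff n s s')))" .
    moreover have "cyc_diff n s s' \<noteq> 0"
    proof
      assume "cyc_diff n s s' = 0"
      then have "cyc_diff n s 0 = s'" using cyc_diff_invol[OF lt(2), of s] by simp
      then show False using that lt by (simp add: cyc_diff_def)
    qed
    ultimately show ?thesis using ac[of "cyc_diff n s s'"] cyc_diff_less[OF n_pos] by simp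
  qed
  have "(\<Sum>l<n. (\<Sum>s\<in>I. a (cyc_diff n s l) * w s)\<^sup>2) = (\<Sum>l<n. \<Sum>s\<in>I. \<Sum>s'\<in>I. (a (cyc_diff n s l) * a (cyc_diff n s' l)) * (w s * w s'))"
    by (simp add: power2_eq_square sum_product mult_ac)
  also have "\<dots> = (\<Sum>s\<in>I. \<Sum>s'\<in>I. C s s' * (w s * w s'))"
    by (subst sum.swap, rule sum.cong[OF refl], subst sum.swap) (simp add: C_def sum_distrib_right)
  also have "\<dots> \<le> (\<Sum>s\<in>I. \<Sum>s'\<in>I. (if s = s' then real n * (w s)\<^sup>2 else 0) + real n * D * (\<bar>w s\<bar> * \<bar>w s'\<bar>))"
  proof (intro sum_mono)
    fix s s' assume s: "s \<in> I" "s' \<in> I"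
    show "C s s' * (w s * w s') \<le> (if s = s' then real n * (w s)\<^sup>2 else 0) + real n * D * (\<bar>w s\<bar> * \<bar>w s'\<bar>)"
    proof (cases "s = s'")
      case True
      have "0 \<le> real n * D * (\<bar>w s\<bar> * \<bar>w s'\<bar>)" using D by simp
      then show ?thesis using True by (simp add: C_eq power2_eq_square)
    next
      case False
      have "C s s' * (w s * w s') \<le> \<bar>C s s'\<bar> * (\<bar>w s\<bar> * \<bar>w s'\<bar>)"
        by (metis abs_ge_self abs_mult)
      also have "\<dots> \<le> real n * D * (\<bar>w s\<bar> * \<bar>w s'\<bar>)" using C_le[OF s False] by (intro mult_right_mono) auto
      finally show ?thesis using False by simp
    qed
  qed
  also have "\<dots> = real n * (\<Sum>s\<in>I. (w s)\<^sup>2) + real n * D * (\<Sum>s\<in>I. \<bar>w s\<bar>)\<^sup>2"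
    using fin by (simp add: sum.distrib sum.delta power2_eq_square sum_product sum_distrib_left mult_ac)
  also have "\<dots> \<le> real n * (\<Sum>s\<in>I. (w s)\<^sup>2) + real n * D * (?m * (\<Sum>s\<in>I. (w s)\<^sup>2))"
  proof (intro add_left_mono mult_left_mono)
    have "(\<Sum>s\<in>I. \<bar>w s\<bar>)\<^sup>2 = (\<Sum>s\<in>I. 1 * \<bar>w s\<bar>)\<^sup>2" by simp
    also have "\<dots> \<le> (\<Sum>s\<in>I. 1\<^sup>2) * (\<Sum>s\<in>I. \<bar>w s\<bar>\<^sup>2)" by (rule Cauchy_Schwarz_ineq_sum)
    finally show "(\<Sum>s\<in>I. \<bar>w s\<bar>)\<^sup>2 \<le> ?m * (\<Sum>s\<in>I. (w s)\<^sup>2)" by simp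
  qed (use D in auto)
  also have "\<dots> = real n * (1 + ?m * D) * (\<Sum>s\<in>I. (w s)\<^sup>2)" by (simp add: algebra_simps)
  also have "\<dots> \<le> real n * 2 * (\<Sum>s\<in>I. (w s)\<^sup>2)" using D by (intro mult_right_mono mult_left_mono) (auto simp: sum_nonneg)
  finally have le: "(\<Sum>l<n. (\<Sum>s\<in>I. a (cyc_diff n s l) * w s)\<^sup>2) \<le> real n * 2 * (\<Sum>s\<in>I. (w s)\<^sup>2)" .
  have "(\<Sum>s\<in>I. a (cyc_diff n s l) / sqrt (real n) / sqrt ?m * w s)\<^sup>2
      = (\<Sum>s\<in>I. a (cyc_diff n s l) * w s)\<^sup>2 / (real n * ?m)" for l
  proof -
    have "(\<Sum>s\<in>I. a (cyc_diff n s l) / sqrt (real n) / sqrt ?m * w s)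
        = (\<Sum>s\<in>I. a (cyc_diff n s l) * w s) / (sqrt (real n) * sqrt ?m)"
      by (simp add: sum_divide_distrib)
    then show ?thesis by (simp add: power_divide power_mult_distrib)
  qed
  then have "(\<Sum>l<n. (\<Sum>s\<in>I. a (cyc_diff n s l) / sqrt (real n) / sqrt ?m * w s)\<^sup>2)
      = (\<Sum>l<n. (\<Sum>s\<in>I. a (cyc_diff n s l) * w s)\<^sup>2) / (real n * ?m)"
    by (simp add: sum_divide_distrib)
  also have "\<dots> \<le> real n * 2 * (\<Sum>s\<in>I. (w s)\<^sup>2) / (real n * ?m)" using le by (intro divide_right_mono) auto
  also have "\<dots> = (sqrt (2 / ?m))\<^sup>2 * (\<Sum>s\<in>I. (w s)\<^sup>2)" using n_pos by simp
  finally show "(\<Sum>l<n. (\<Sum>s\<in>I. a (cyc_diff n s l) / sqrt (real n) / sqrt ?m * w s)\<^sup>2)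
      \<le> (sqrt (2 / ?m))\<^sup>2 * (\<Sum>s\<in>I. (w s)\<^sup>2)" .
qed

section \<open>The Rademacher factor and its Fourier functionals\<close>

definition conv :: "(nat \<Rightarrow> real) \<Rightarrow> (nat \<Rightarrow> real) \<Rightarrow> nat \<Rightarrow> real" where
  "conv u x j = (\<Sum>i<n. u (cyc_diff n j i) * x i) / sqrt (real n)"

lemma conv_linear: "conv u (\<lambda>i. a * x i + b * y i) j = a * conv u x j + b * conv u y j"
  by (simp add: conv_def algebra_simps sum.distrib sum_distrib_left add_divide_distrib)

text \<open>Commutativity of the convolution: what is linear in x becomes a linear form in the signs
  u with coefficients taken from x, the shape required by the chaos bound.\<close>

lemma conv_commute: "(\<Sum>l<n. x (cyc_diff n s l) * u l) = sqrt (real n) * conv u x s"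
proof -
  have "(\<Sum>l<n. x (cyc_diff n s l) * u l) = (\<Sum>l<n. x (cyc_diff n s l) * u (cyc_diff n s (cyc_diff n s l)))"
    by (intro sum.cong) (auto simp: cyc_diff_invol)
  also have "\<dots> = (\<Sum>j<n. x j * u (cyc_diff n s j))"
    by (rule sum.reindex_bij_betw[OF bij_cyc_diff_right[OF n_pos]])
  finally show ?thesis using n_pos by (simp add: conv_def mult.commute)
qed

lemma conv_deviation:
  assumes "1 \<le> r" "r \<le> n"
  shows "whp (rademacher.\<mu> n) (real n ^ 7 * exp (- \<tau>))
    (\<lambda>u. \<forall>x\<in>sparse_fun n r. \<bar>(\<Sum>j<n. (conv u x j)\<^sup>2) - (\<Sum>i<n. (x i)\<^sup>2)\<bar> \<le> circ_dev r)"
proof (rule whp_mono[OF circulant_deviation[of "\<lambda>_. 1", OF _ assms] order_refl])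
  fix u
  assume "(\<forall>l<n. u l = 1 \<or> u l = - 1) \<and> (\<forall>x\<in>sparse_fun n r.
      \<bar>(\<Sum>s<n. (\<Sum>l<n. x (cyc_diff n s l) * (1 * u l))\<^sup>2) / real n - (\<Sum>i<n. (x i)\<^sup>2)\<bar> \<le> circ_dev r)"
  moreover have "(\<Sum>s<n. (\<Sum>l<n. x (cyc_diff n s l) * (1 * u l))\<^sup>2) / real n = (\<Sum>j<n. (conv u x j)\<^sup>2)" for x
    using n_pos by (simp add: conv_commute power_mult_distrib flip: sum_distrib_left)
  ultimately show "\<forall>x\<in>sparse_fun n r. \<bar>(\<Sum>j<n. (conv u x j)\<^sup>2) - (\<Sum>i<n. (x i)\<^sup>2)\<bar> \<le> circ_dev r" by simp
qed simp

text \<open>The coefficients, as linear functionals of \<open>x\<close>, of the trigonometric sums of the modulated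
  convolution. These sums dominate the operator norm of the circulant matrix it generates.\<close>

definition freq_coeff :: "nat \<Rightarrow> (nat \<Rightarrow> real) \<Rightarrow> (nat \<Rightarrow> real) \<Rightarrow> nat \<times> bool \<Rightarrow> nat \<Rightarrow> real" where
  "freq_coeff m u v \<kappa> i = sqrt (2 / real m) * (\<Sum>j<n. v j * (u (cyc_diff n j i) / sqrt (real n)) * trig n \<kappa> j)"

lemma freq_coeff_sum:
  "(\<Sum>i<n. freq_coeff m u v \<kappa> i * x i) = sqrt (2 / real m) * (\<Sum>j<n. (v j * conv u x j) * trig n \<kappa> j)"
proof -
  have "(\<Sum>i<n. freq_coeff m u v \<kappa> i * x i)
    = sqrt (2 / real m) * (\<Sum>i<n. \<Sum>j<n. v j * (u (cyc_diff n j i) / sqrt (real n)) * trig n \<kappa> j * x i)"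
    by (simp add: freq_coeff_def sum_distrib_left sum_distrib_right mult.assoc)
  also have "(\<Sum>i<n. \<Sum>j<n. v j * (u (cyc_diff n j i) / sqrt (real n)) * trig n \<kappa> j * x i)
    = (\<Sum>j<n. (v j * conv u x j) * trig n \<kappa> j)"
    by (subst sum.swap) (simp add: conv_def sum_distrib_left sum_distrib_right sum_divide_distrib mult_ac)
  finally show ?thesis .
qed

text \<open>The energy of the coefficients on a set \<open>S\<close> is tested against the grid truncation of the
  normalised coefficient vector itself, so that a net of the sphere of \<open>\<real>\<^sup>S\<close> is not needed.\<close>

lemma freq_coeff_energy:
  assumes u: "\<And>q x. \<lbrakk>1 \<le> q; q \<le> r0; x \<in> sparse_fun n q\<rbrakk> \<Longrightarrow> (\<Sum>j<n. (conv u x j)\<^sup>2) \<le> 2"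
    and r0: "r0 \<le> n" and m: "m > 0"
  shows "whp (rademacher.\<mu> n) (real n ^ 7 * exp (- \<tau>))
    (\<lambda>v. \<forall>\<kappa>\<in>freqs n. \<forall>S. S \<subseteq> {..<n} \<longrightarrow> card S \<le> r0 \<longrightarrow>
      (\<Sum>i\<in>S. (freq_coeff m u v \<kappa> i)\<^sup>2) \<le> (sqrt (128 * l / real m))\<^sup>2 * (real (card S) + real L))"
proof -
  \<comment> \<open>The summand 4 l q pays for the at most exp (4 l q) elements of
    \<open>int_ball n (2 * q)\<close>, and \<tau> for the failure probability.\<close>
  define T where "T q = sqrt (2 * (4 * l * real q + \<tau>))" for q :: nat
  \<comment> \<open>This mesh makes the truncation error at most sqrt q h = 1/2 and bounds the l1
    norm of the coefficients by sqrt q / h = 2 q.\<close>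
  define h where "h q = 1 / (2 * sqrt (real q))" for q :: nat
  define y where "y q c i = h q * of_int (c i)" for q and c :: "nat \<Rightarrow> int" and i :: nat
  have T0: "T q \<ge> 0" for q using l_ge \<tau>_nonneg by (simp add: T_def)
  have T2: "(T q)\<^sup>2 = 2 * (4 * l * real q + \<tau>)" for q
    unfolding T_def using l_ge \<tau>_nonneg by (intro real_sqrt_pow2) auto
  \<comment> \<open>Only grid vectors in the sparse ball are tested, since for these the assumption
    on u bounds the norm of the convolution by sqrt 2.\<close>
  define Ev where "Ev \<kappa> q c v \<longleftrightarrow> (y q c \<in> sparse_fun n q \<longrightarrow>
     \<bar>\<Sum>j<n. (conv u (y q c) j * trig n \<kappa> j) * v j\<bar> \<le> T q * sqrt 2)" for \<kappa> q c v
  have w1: "whp (rademacher.\<mu> n) (2 * exp (- (T q)\<^sup>2 / 2)) (Ev \<kappa> q c)" if q: "q \<in> {1..r0}" for \<kappa> q c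
  proof (cases "y q c \<in> sparse_fun n q")
    case True
    have "whp (rademacher.\<mu> n) (2 * exp (- (T q)\<^sup>2 / 2)) (\<lambda>v. \<bar>\<Sum>j\<in>{..<n}. (conv u (y q c) j * trig n \<kappa> j) * v j\<bar>
        \<le> T q * L2_set (\<lambda>j. conv u (y q c) j * trig n \<kappa> j) {..<n})"
      by (rule rademacher.linear_form_tail) (auto simp: T0)
    moreover have "L2_set (\<lambda>j. conv u (y q c) j * trig n \<kappa> j) {..<n} \<le> sqrt 2"
    proof -
      have "(\<Sum>j<n. (conv u (y q c) j * trig n \<kappa> j)\<^sup>2) \<le> (\<Sum>j<n. (conv u (y q c) j)\<^sup>2 * 1)"
        unfolding power_mult_distrib by (intro sum_mono mult_left_mono trig_sq_le) auto
      also have "\<dots> \<le> 2" using u[OF _ _ True] q by simp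
      finally show ?thesis by (simp add: L2_set_def)
    qed
    then have "T q * L2_set (\<lambda>j. conv u (y q c) j * trig n \<kappa> j) {..<n} \<le> T q * sqrt 2" using T0 by (intro mult_left_mono)
    ultimately show ?thesis unfolding Ev_def by (elim whp_mono) auto
  next
    case False
    then show ?thesis by (intro whp_mono[OF whp_always]) (auto simp: Ev_def)
  qed
  have w2: "whp (rademacher.\<mu> n) (2 * exp (- \<tau>)) (\<lambda>v. \<forall>c\<in>int_ball n (2 * q). Ev \<kappa> q c v)" if q: "q \<in> {1..r0}" for \<kappa> q
  proof -
    have "whp (rademacher.\<mu> n) (real (card (int_ball n (2 * q))) * (2 * exp (- (T q)\<^sup>2 / 2))) (\<lambda>v. \<forall>c\<in>int_ball n (2 * q). Ev \<kappa> q c v)"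
      using int_ball_card w1[OF q] by (intro whp_ball) auto
    moreover have "real (card (int_ball n (2 * q))) * (2 * exp (- (T q)\<^sup>2 / 2)) \<le> 2 * exp (- \<tau>)"
    proof -
      have "real (card (int_ball n (2 * q))) \<le> real ((2 * n + 1) ^ (2 * q))"
        using int_ball_card[of n "2 * q"] by (simp only: of_nat_le_iff)
      also have "\<dots> \<le> exp (2 * l * real (2 * q))" by (rule pow_le_exp)
      finally have "real (card (int_ball n (2 * q))) * (2 * exp (- (T q)\<^sup>2 / 2))
          \<le> exp (2 * l * real (2 * q)) * (2 * exp (- (T q)\<^sup>2 / 2))" by (intro mult_right_mono) auto
      also have "\<dots> = 2 * exp (- \<tau>)" unfolding T2 by (simp flip: exp_add) (simp add: field_simps)
      finally show ?thesis .
    qed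
    ultimately show ?thesis by (rule whp_mono)
  qed
  have "whp (rademacher.\<mu> n) (real (card (freqs n)) * (real (card {1..r0}) * (2 * exp (- \<tau>))))
    (\<lambda>v. \<forall>\<kappa>\<in>freqs n. \<forall>q\<in>{1..r0}. \<forall>c\<in>int_ball n (2 * q). Ev \<kappa> q c v)"
    by (intro whp_ball w2) auto
  then show ?thesis
  proof (rule whp_mono)
    have "real (card (freqs n)) * (real (card {1..r0}) * (2 * exp (- \<tau>))) \<le> (2 * real n) * (real n * (2 * exp (- \<tau>)))"
      using r0 by (intro mult_mono) (auto simp: card_freqs)
    also have "\<dots> = 4 * (real n)\<^sup>2 * exp (- \<tau>)" by (simp add: power2_eq_square)
    also have "\<dots> \<le> real n ^ 7 * exp (- \<tau>)"
    proof (rule mult_right_mono)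
      have "real n ^ 2 \<le> real n ^ 3" using n by (intro power_increasing) auto
      moreover have "0 \<le> real n ^ 3" by simp
      ultimately show "4 * (real n)\<^sup>2 \<le> real n ^ 7" using n_pow by linarith
    qed simp
    finally show "real (card (freqs n)) * (real (card {1..r0}) * (2 * exp (- \<tau>))) \<le> real n ^ 7 * exp (- \<tau>)" .
    fix v assume ev: "\<forall>\<kappa>\<in>freqs n. \<forall>q\<in>{1..r0}. \<forall>c\<in>int_ball n (2 * q). Ev \<kappa> q c v"
    show "\<forall>\<kappa>\<in>freqs n. \<forall>S. S \<subseteq> {..<n} \<longrightarrow> card S \<le> r0 \<longrightarrow>
      (\<Sum>i\<in>S. (freq_coeff m u v \<kappa> i)\<^sup>2) \<le> (sqrt (128 * l / real m))\<^sup>2 * (real (card S) + real L)"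
    proof (intro ballI allI impI)
      fix \<kappa> S assume \<kappa>: "\<kappa> \<in> freqs n" and S: "S \<subseteq> {..<n}" "card S \<le> r0"
      define q where "q = card S"
      define a where "a = freq_coeff m u v \<kappa>"
      define M where "M = L2_set a S"
      have fin: "finite S" using S finite_subset by auto
      have M2: "M\<^sup>2 = (\<Sum>i\<in>S. (a i)\<^sup>2)" by (simp add: M_def L2_set_def sum_nonneg)
      have M0: "M \<ge> 0" by (simp add: M_def L2_set_nonneg)
      have A2: "(sqrt (128 * l / real m))\<^sup>2 = 128 * l / real m" using l_ge by simp
      show "(\<Sum>i\<in>S. (freq_coeff m u v \<kappa> i)\<^sup>2) \<le> (sqrt (128 * l / real m))\<^sup>2 * (real (card S) + real L)"
      proof (cases "M = 0")
        case True
        then have "(\<Sum>i\<in>S. (freq_coeff m u v \<kappa> i)\<^sup>2) = 0" using M2 by (simp add: a_def)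
        then show ?thesis by simp
      next
        case False
        then have Mp: "M > 0" using M0 by simp
        have "S \<noteq> {}" using False by (auto simp: M_def)
        then have q: "q \<ge> 1" "q \<in> {1..r0}" using S fin card_gt_0_iff[of S] by (auto simp: q_def)
        have hp: "h q > 0" using q by (simp add: h_def)
        define x where "x i = (if i \<in> S then a i / M else 0)" for i
        have xS: "(\<Sum>i<n. (x i)\<^sup>2) = (\<Sum>i\<in>S. (a i / M)\<^sup>2)"
          using S by (intro sum.mono_neutral_cong_right) (auto simp: x_def)
        also have "\<dots> = 1" using False by (simp add: power_divide M2[symmetric] flip: sum_divide_distrib)
        finally have x1: "(\<Sum>i<n. (x i)\<^sup>2) = 1" .
        have "card {i. x i \<noteq> 0} \<le> q" unfolding q_def by (intro card_mono fin) (auto simp: x_def)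
        then have x: "x \<in> sparse_fun n q" using x1 S by (auto simp: sparse_fun_def x_def)
        define c where "c = grid_trunc (h q) x"
        have yq: "y q c \<in> sparse_fun n q"
          unfolding y_def c_def by (rule grid_trunc_sparse(1)[OF hp x])
        have "h q * of_int (\<Sum>i<n. \<bar>c i\<bar>) \<le> sqrt (real q)" unfolding c_def by (rule grid_trunc_sparse(3)[OF hp x])
        also have "\<dots> = h q * (2 * real q)" using q by (simp add: h_def real_div_sqrt)
        finally have "of_int (\<Sum>i<n. \<bar>c i\<bar>) \<le> 2 * real q" using hp by (simp only: mult_le_cancel_left_pos)
        then have "(\<Sum>i<n. \<bar>c i\<bar>) \<le> int (2 * q)" by linarith
        moreover have "c i = 0" if "i \<ge> n" for i
          unfolding c_def using x that by (intro grid_trunc(3)[OF hp]) (simp add: sparse_fun_def)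
        ultimately have "c \<in> int_ball n (2 * q)" by (simp add: int_ball_def)
        then have "Ev \<kappa> q c v" using ev \<kappa> q by blast
        then have tail: "\<bar>\<Sum>j<n. (conv u (y q c) j * trig n \<kappa> j) * v j\<bar> \<le> T q * sqrt 2" using yq by (simp add: Ev_def)
        have "(\<Sum>i<n. a i * y q c i) = sqrt (2 / real m) * (\<Sum>j<n. (conv u (y q c) j * trig n \<kappa> j) * v j)"
          unfolding a_def freq_coeff_sum by (simp add: mult_ac)
        then have "\<bar>\<Sum>i<n. a i * y q c i\<bar> \<le> sqrt (2 / real m) * (T q * sqrt 2)"
          using mult_left_mono[OF tail, of "sqrt (2 / real m)"] by (simp add: abs_mult)
        also have "\<dots> = 2 * T q / sqrt (real m)" by (simp add: real_sqrt_divide)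
        finally have up: "(\<Sum>i<n. a i * y q c i) \<le> 2 * T q / sqrt (real m)" by linarith
        have "y q c i = 0" if "i \<notin> S" for i
        proof -
          have "x i = 0" using that by (simp add: x_def)
          then show ?thesis using grid_trunc(3)[OF hp, of x i] by (simp add: y_def c_def)
        qed
        then have sub: "{i. y q c i \<noteq> 0} \<subseteq> S" by blast
        have "(\<Sum>i<n. a i * y q c i) = (\<Sum>i\<in>S. a i * y q c i)"
          using S sub by (intro sum.mono_neutral_right) auto
        also have "\<dots> = (\<Sum>i\<in>S. a i * x i) - (\<Sum>i\<in>S. a i * (x i - y q c i))"
          by (simp add: algebra_simps flip: sum_subtractf)
        also have "(\<Sum>i\<in>S. a i * x i) = M"
        proof -
          have "(\<Sum>i\<in>S. a i * x i) = (\<Sum>i\<in>S. (a i)\<^sup>2) / M"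
            by (simp add: x_def power2_eq_square sum_divide_distrib)
          then show ?thesis using Mp M2[symmetric] by (simp add: power2_eq_square)
        qed
        finally have eq: "(\<Sum>i<n. a i * y q c i) = M - (\<Sum>i\<in>S. a i * (x i - y q c i))" .
        have "(\<Sum>i\<in>S. a i * (x i - y q c i)) \<le> (\<Sum>i\<in>S. \<bar>a i\<bar> * \<bar>x i - y q c i\<bar>)"
          by (intro sum_mono) (metis abs_ge_self abs_mult)
        also have "\<dots> \<le> M * L2_set (\<lambda>i. x i - y q c i) S"
          unfolding M_def by (rule L2_set_mult_ineq)
        \<comment> \<open>The truncation loses at most half of M, so M is at most twice its value on
          the grid vector.\<close>
        also have "\<dots> \<le> M * (1/2)"
        proof (intro mult_left_mono M0)
          have "(\<Sum>i\<in>S. (x i - y q c i)\<^sup>2) \<le> (\<Sum>i<n. (x i - y q c i)\<^sup>2)"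
            using S by (intro sum_mono2) auto
          also have "\<dots> \<le> real q * (h q)\<^sup>2" unfolding y_def c_def by (rule grid_trunc_sparse(2)[OF hp x])
          also have "\<dots> = (1/2)\<^sup>2" using q by (simp add: h_def power_divide power_mult_distrib)
          finally show "L2_set (\<lambda>i. x i - y q c i) S \<le> 1/2" unfolding L2_set_def by (intro real_le_lsqrt) (auto simp: sum_nonneg)
        qed
        finally have "M / 2 \<le> 2 * T q / sqrt (real m)" using up eq by linarith
        then have "M \<le> 4 * T q / sqrt (real m)" by simp
        then have "M\<^sup>2 \<le> (4 * T q / sqrt (real m))\<^sup>2" using M0 by (intro power_mono)
        also have "\<dots> = 16 * (2 * (4 * l * real q + \<tau>)) / real m" by (simp add: power_divide power_mult_distrib T2)
        \<comment> \<open>128 = 16 * 2 * 4 is the coefficient of l q; the remaining 32 \<tau> is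
          covered because \<tau> <= l L.\<close>
        also have "\<dots> \<le> 128 * l * (real q + real L) / real m"
        proof (rule divide_right_mono)
          have "\<tau> = \<Gamma> * l * l" by (simp add: \<tau>_def power2_eq_square)
          also have "\<dots> \<le> real L * l" using L l_ge by (intro mult_right_mono) auto
          finally have "\<tau> \<le> l * real L" by (simp add: mult.commute)
          moreover have "0 \<le> l * real L" using l_ge by simp
          ultimately show "16 * (2 * (4 * l * real q + \<tau>)) \<le> 128 * l * (real q + real L)" by (simp add: algebra_simps)
        qed simp
        finally show ?thesis unfolding M2 A2 a_def q_def by simp
      qed
    qed
  qed
qed

text \<open>The coefficient of \<open>g k\<close> in coordinate s of B x, without the restriction to
  I. By commutativity the modulated convolution generates the circulant matrix, and g is the vector
  on which it acts.\<close>

definition modulated :: "(nat \<Rightarrow> real) \<Rightarrow> (nat \<Rightarrow> real) \<Rightarrow> nat \<Rightarrow> (nat \<Rightarrow> real) \<Rightarrow> nat \<Rightarrow> nat \<Rightarrow> real" where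
  "modulated u v m x s k = v (cyc_diff n s k) * conv u x (cyc_diff n s k) / sqrt (real m)"

lemma modulated_linear_process:
  assumes "finite R"
  shows "linear_process R (modulated u v m) std_normal_distribution"
  using assms by (intro gauss_linear_process) (auto simp: modulated_def conv_linear algebra_simps add_divide_distrib)

text \<open>A vector on R is extended by zero to Z/n, where the Fourier coefficients of the
  generator bound the norm. \<open>freq_coeff\<close> is normalised so that its sums are the
  trigonometric sums times sqrt (2 / m).\<close>

lemma modulated_op_bound:
  assumes R: "R \<subseteq> {..<n}" and m: "m > 0" and c: "c \<ge> 0"
    and bd: "\<And>\<kappa>. \<kappa> \<in> freqs n \<Longrightarrow> \<bar>\<Sum>i<n. freq_coeff m u v \<kappa> i * x i\<bar> \<le> c"
  shows "op_bound n R (modulated u v m x) c"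
  unfolding op_bound_def
proof
  fix w :: "nat \<Rightarrow> real"
  define z where "z j = v j * conv u x j" for j
  define w' where "w' s = (if s \<in> R then w s else 0)" for s
  have "2 * (\<Sum>j<n. z j * trig n \<kappa> j)\<^sup>2 \<le> real m * c\<^sup>2" if "\<kappa> \<in> freqs n" for \<kappa>
  proof -
    have "(\<Sum>i<n. freq_coeff m u v \<kappa> i * x i)\<^sup>2 \<le> c\<^sup>2"
      using bd[OF that] c by (metis abs_le_square_iff abs_of_nonneg)
    then have "2 / real m * (\<Sum>j<n. z j * trig n \<kappa> j)\<^sup>2 \<le> c\<^sup>2"
      by (simp add: freq_coeff_sum z_def power_mult_distrib)
    then show ?thesis using m by (simp add: field_simps)
  qed
  from correlation_le_left[OF n_pos this]
  have le: "(\<Sum>l<n. (\<Sum>s<n. z (cyc_diff n s l) * w' s)\<^sup>2) \<le> real m * c\<^sup>2 * (\<Sum>s<n. (w' s)\<^sup>2)" .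
  have w2: "(\<Sum>s<n. (w' s)\<^sup>2) = (\<Sum>s\<in>R. (w s)\<^sup>2)"
    using R by (intro sum.mono_neutral_cong_right) (auto simp: w'_def)
  have "(\<Sum>s\<in>R. modulated u v m x s l * w s)\<^sup>2 = (\<Sum>s<n. z (cyc_diff n s l) * w' s)\<^sup>2 / real m" for l
  proof -
    have "(\<Sum>s<n. z (cyc_diff n s l) * w' s) = (\<Sum>s\<in>R. z (cyc_diff n s l) * w s)"
      using R by (intro sum.mono_neutral_cong_right) (auto simp: w'_def)
    then have "(\<Sum>s\<in>R. modulated u v m x s l * w s) = (\<Sum>s<n. z (cyc_diff n s l) * w' s) / sqrt (real m)"
      by (simp add: modulated_def z_def sum_divide_distrib)
    then show ?thesis by (simp add: power_divide)
  qed
  then have "(\<Sum>l<n. (\<Sum>s\<in>R. modulated u v m x s l * w s)\<^sup>2) = (\<Sum>l<n. (\<Sum>s<n. z (cyc_diff n s l) * w' s)\<^sup>2) / real m"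
    by (simp add: sum_divide_distrib)
  then show "(\<Sum>l<n. (\<Sum>s\<in>R. modulated u v m x s l * w s)\<^sup>2) \<le> c\<^sup>2 * (\<Sum>s\<in>R. (w s)\<^sup>2)"
    using le m by (simp add: w2 pos_divide_le_eq mult_ac)
qed

text \<open>The test vector y now supplies the Fourier coefficients, while the modulated convolution
  enters through its energy. The 4 is 2 for the pair of cosine and sine times 2 for that
  energy.\<close>

lemma modulated_op_bound_dual:
  assumes m: "m > 0" and v: "\<And>l. l < n \<Longrightarrow> (v l)\<^sup>2 = 1" and x: "(\<Sum>j<n. (conv u x j)\<^sup>2) \<le> 2"
    and bd: "\<And>\<kappa>. \<kappa> \<in> freqs n \<Longrightarrow> \<bar>\<Sum>i<n. (sqrt (4 / real m) * trig n \<kappa> i) * y i\<bar> \<le> c" and c: "c \<ge> 0"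
  shows "(\<Sum>l<n. (\<Sum>s<n. modulated u v m x s l * y s)\<^sup>2) \<le> c\<^sup>2"
proof -
  define z where "z j = v j * conv u x j" for j
  have z2: "(\<Sum>j<n. (z j)\<^sup>2) \<le> 2" using x v by (simp add: z_def power_mult_distrib)
  have "2 * (\<Sum>j<n. y j * trig n \<kappa> j)\<^sup>2 \<le> real m * c\<^sup>2 / 2" if "\<kappa> \<in> freqs n" for \<kappa>
  proof -
    have "(\<Sum>i<n. (sqrt (4 / real m) * trig n \<kappa> i) * y i)\<^sup>2 \<le> c\<^sup>2"
      using bd[OF that] c by (metis abs_le_square_iff abs_of_nonneg)
    moreover have "(\<Sum>i<n. (sqrt (4 / real m) * trig n \<kappa> i) * y i) = sqrt (4 / real m) * (\<Sum>j<n. y j * trig n \<kappa> j)"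
      by (simp add: sum_distrib_left mult_ac)
    ultimately have "4 / real m * (\<Sum>j<n. y j * trig n \<kappa> j)\<^sup>2 \<le> c\<^sup>2" by (simp add: power_mult_distrib)
    then show ?thesis using m by (simp add: field_simps)
  qed
  from correlation_le_right[OF n_pos this, of z]
  have "(\<Sum>l<n. (\<Sum>s<n. z (cyc_diff n s l) * y s)\<^sup>2) \<le> real m * c\<^sup>2 / 2 * (\<Sum>s<n. (z s)\<^sup>2)" .
  also have "\<dots> \<le> real m * c\<^sup>2 / 2 * 2" using z2 by (intro mult_left_mono) auto
  finally have le: "(\<Sum>l<n. (\<Sum>s<n. z (cyc_diff n s l) * y s)\<^sup>2) \<le> real m * c\<^sup>2" by simp
  have "(\<Sum>s<n. modulated u v m x s l * y s)\<^sup>2 = (\<Sum>s<n. z (cyc_diff n s l) * y s)\<^sup>2 / real m" for l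
  proof -
    have "(\<Sum>s<n. modulated u v m x s l * y s) = (\<Sum>s<n. z (cyc_diff n s l) * y s) / sqrt (real m)"
      by (simp add: modulated_def z_def sum_divide_distrib)
    then show ?thesis by (simp add: power_divide)
  qed
  then have "(\<Sum>l<n. (\<Sum>s<n. modulated u v m x s l * y s)\<^sup>2) = (\<Sum>l<n. (\<Sum>s<n. z (cyc_diff n s l) * y s)\<^sup>2) / real m"
    by (simp add: sum_divide_distrib)
  then show ?thesis using le m by (simp add: pos_divide_le_eq mult_ac)
qed

text \<open>Serves the finiteness of the suprema in the chaining arguments.\<close>

lemma modulated_bounded:
  assumes m: "m > 0" and v: "\<And>l. l < n \<Longrightarrow> (v l)\<^sup>2 = 1" and x: "(\<Sum>j<n. (conv u x j)\<^sup>2) \<le> 2"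
  shows "\<bar>modulated u v m x s k\<bar> \<le> 2"
proof -
  define j where "j = cyc_diff n s k"
  have j: "j < n" by (simp add: j_def cyc_diff_less[OF n_pos])
  have "(conv u x j)\<^sup>2 \<le> (\<Sum>j<n. (conv u x j)\<^sup>2)" using j by (intro member_le_sum) auto
  then have "(conv u x j)\<^sup>2 \<le> 2\<^sup>2" using x by simp
  then have c: "\<bar>conv u x j\<bar> \<le> 2" using abs_le_square_iff[of "conv u x j" 2] by simp
  have "\<bar>v j\<bar> = 1" using v[OF j] by (metis abs_1 power2_eq_1_iff abs_minus_cancel)
  then have "\<bar>modulated u v m x s k\<bar> = \<bar>conv u x j\<bar> / sqrt (real m)"
    by (simp add: modulated_def j_def[symmetric] abs_mult)
  also have "\<dots> \<le> 2 / 1" using c m by (intro frac_le) auto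
  finally show ?thesis by simp
qed

text \<open>The radius of \<open>chi_square_tail\<close> for m squares, divided by m.\<close>

definition diag_rad :: "nat \<Rightarrow> real" where
  "diag_rad m = 4 * sqrt (\<tau> / real m) + 8 * (\<tau> / real m)"

text \<open>After exchanging the sums, the square of coordinate j of the convolution is weighted by
  the mean of squared Gaussians over the translate of I by - j. By assumption this mean is within
  \<eta> of 1 for every j.\<close>

lemma modulated_diag:
  assumes I: "I \<subseteq> {..<n}" and m: "m = card I" "m > 0" and v: "\<And>l. l < n \<Longrightarrow> (v l)\<^sup>2 = 1"
    and g: "\<And>j. j < n \<Longrightarrow> \<bar>\<Sum>s\<in>I. ((g (cyc_diff n s j))\<^sup>2 - 1)\<bar> \<le> real m * \<eta>"
  shows "\<bar>(\<Sum>l<n. (g l)\<^sup>2 * (\<Sum>s\<in>I. (modulated u v m x s l)\<^sup>2)) - (\<Sum>j<n. (conv u x j)\<^sup>2)\<bar> \<le> \<eta> * (\<Sum>j<n. (conv u x j)\<^sup>2)"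
proof -
  define c where "c j = (conv u x j)\<^sup>2" for j
  have mod2: "(modulated u v m x s l)\<^sup>2 = c (cyc_diff n s l) / real m" for s l
    using v[OF cyc_diff_less[OF n_pos]] by (simp add: modulated_def c_def power_divide power_mult_distrib)
  have "(\<Sum>l<n. (g l)\<^sup>2 * (\<Sum>s\<in>I. (modulated u v m x s l)\<^sup>2))
      = (\<Sum>s\<in>I. \<Sum>l<n. (g l)\<^sup>2 * (c (cyc_diff n s l) / real m))"
    by (subst sum.swap) (simp add: mod2 sum_distrib_left)
  also have "\<dots> = (\<Sum>s\<in>I. \<Sum>j<n. (g (cyc_diff n s j))\<^sup>2 * (c j / real m))"
  proof (rule sum.cong[OF refl])
    fix s
    have "(\<Sum>l<n. (g l)\<^sup>2 * (c (cyc_diff n s l) / real m))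
       = (\<Sum>l<n. (g (cyc_diff n s (cyc_diff n s l)))\<^sup>2 * (c (cyc_diff n s l) / real m))"
      by (intro sum.cong) (auto simp: cyc_diff_invol)
    also have "\<dots> = (\<Sum>j<n. (g (cyc_diff n s j))\<^sup>2 * (c j / real m))"
      by (rule sum.reindex_bij_betw[OF bij_cyc_diff_right[OF n_pos]])
    finally show "(\<Sum>l<n. (g l)\<^sup>2 * (c (cyc_diff n s l) / real m)) = (\<Sum>j<n. (g (cyc_diff n s j))\<^sup>2 * (c j / real m))" .
  qed
  also have "\<dots> = (\<Sum>j<n. c j / real m * (\<Sum>s\<in>I. (g (cyc_diff n s j))\<^sup>2))"
    by (subst sum.swap) (simp add: sum_distrib_left mult_ac)
  finally have "(\<Sum>l<n. (g l)\<^sup>2 * (\<Sum>s\<in>I. (modulated u v m x s l)\<^sup>2)) - (\<Sum>j<n. c j)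
     = (\<Sum>j<n. c j / real m * (\<Sum>s\<in>I. ((g (cyc_diff n s j))\<^sup>2 - 1)))"
    using m by (simp add: sum_subtractf right_diff_distrib)
  also have "\<bar>\<dots>\<bar> \<le> (\<Sum>j<n. \<bar>c j / real m * (\<Sum>s\<in>I. ((g (cyc_diff n s j))\<^sup>2 - 1))\<bar>)" by (rule sum_abs)
  also have "\<dots> \<le> (\<Sum>j<n. c j / real m * (real m * \<eta>))"
    unfolding abs_mult by (intro sum_mono mult_mono g) (auto simp: c_def)
  also have "\<dots> = \<eta> * (\<Sum>j<n. c j)" using m by (simp add: sum_distrib_left mult_ac)
  finally show ?thesis by (simp add: c_def)
qed

lemma gauss_diag_whp:
  assumes I: "I \<subseteq> {..<n}" and m: "m = card I" "m > 0"
  shows "whp (gauss.\<mu> n) (real n * (2 * exp (- \<tau>)))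
    (\<lambda>g. \<forall>j\<in>{..<n}. \<bar>\<Sum>s\<in>I. ((g (cyc_diff n s j))\<^sup>2 - 1)\<bar> \<le> real m * diag_rad m)"
proof -
  have \<tau>: "\<tau> > 0" using \<Gamma> l_ge by (simp add: \<tau>_def)
  have "whp (gauss.\<mu> n) (2 * exp (- \<tau>)) (\<lambda>g. \<bar>\<Sum>s\<in>I. ((g (cyc_diff n s j))\<^sup>2 - 1)\<bar> \<le> real m * diag_rad m)" for j
  proof -
    define S where "S = (\<lambda>s. cyc_diff n s j) ` I"
    have inj: "inj_on (\<lambda>s. cyc_diff n s j) I"
      using bij_cyc_diff_left[OF n_pos, of j] I by (meson bij_betw_def inj_on_subset)
    have S: "S \<subseteq> {..<n}" "card S = m" using inj by (auto simp: S_def cyc_diff_less[OF n_pos] card_image m)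
    have "real m * diag_rad m = 4 * sqrt (real (card S) * \<tau>) + 8 * \<tau>"
    proof -
      have "real m * sqrt (\<tau> / real m) = sqrt (real m * \<tau>)"
      proof -
        have "sqrt (real m * \<tau>) = sqrt ((real m)\<^sup>2 * (\<tau> / real m))"
          using m by (simp add: power2_eq_square)
        then show ?thesis by (simp only: real_sqrt_mult real_sqrt_abs abs_of_nat)
      qed
      then show ?thesis using m S by (simp add: diag_rad_def distrib_left)
    qed
    moreover have "(\<Sum>s\<in>S. ((g s)\<^sup>2 - 1)) = (\<Sum>s\<in>I. ((g (cyc_diff n s j))\<^sup>2 - 1))" for g :: "nat \<Rightarrow> real"
      unfolding S_def using inj by (simp add: sum.reindex)
    ultimately show ?thesis using chi_square_tail[OF S(1) \<tau>] by simp
  qed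
  then have "whp (gauss.\<mu> n) (real (card {..<n}) * (2 * exp (- \<tau>)))
    (\<lambda>g. \<forall>j\<in>{..<n}. \<bar>\<Sum>s\<in>I. ((g (cyc_diff n s j))\<^sup>2 - 1)\<bar> \<le> real m * diag_rad m)"
    by (intro whp_ball) auto
  then show ?thesis by simp
qed

text \<open>Coordinate s of B x before the restriction to I. Letting s run over all of Z/n keeps I
  out of the bilinear form.\<close>

definition matrix_row :: "(nat \<Rightarrow> real) \<Rightarrow> (nat \<Rightarrow> real) \<Rightarrow> nat \<Rightarrow> (nat \<Rightarrow> real) \<Rightarrow> (nat \<Rightarrow> real) \<Rightarrow> nat \<Rightarrow> real" where
  "matrix_row u v m g x s = (\<Sum>l<n. modulated u v m x s l * g l)"

text \<open>The functionals \<open>freq_coeff\<close> supply the nets for x in both parts. The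
  bilinear part keeps all n rows and chains its test vector with plain trigonometric
  functionals.\<close>

lemma gauss_chaos_whp:
  assumes I: "I \<subseteq> {..<n}" and m: "m = card I" "m > 0" and v: "\<And>l. l < n \<Longrightarrow> (v l)\<^sup>2 = 1"
    and r: "1 \<le> r" "r \<le> n"
    and E: "\<And>\<kappa> S. \<lbrakk>\<kappa> \<in> freqs n; S \<subseteq> {..<n}; card S \<le> r\<rbrakk> \<Longrightarrow>
      (\<Sum>i\<in>S. (freq_coeff m u v \<kappa> i)\<^sup>2) \<le> (sqrt (128 * l / real m))\<^sup>2 * (real (card S) + real L)"
    and U: "\<And>x. x \<in> sparse_fun n r \<Longrightarrow> (\<Sum>j<n. (conv u x j)\<^sup>2) \<le> 2"
  defines "K \<equiv> chain_bound (sqrt (128 * l / real m)) r"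
  shows "whp (gauss.\<mu> n) (real n ^ 7 * exp (- \<tau>))
    (\<lambda>g. \<forall>Dg. (\<forall>x\<in>sparse_fun n r. (\<Sum>l<n. (g l)\<^sup>2 * (\<Sum>s\<in>I. (modulated u v m x s l)\<^sup>2)) \<le> Dg) \<longrightarrow>
      (\<forall>x\<in>sparse_fun n r. \<bar>(\<Sum>s\<in>I. (matrix_row u v m g x s)\<^sup>2) - (\<Sum>l<n. (g l)\<^sup>2 * (\<Sum>s\<in>I. (modulated u v m x s l)\<^sup>2))\<bar>
       \<le> 4 * K * sqrt (2 * Dg + 32 * K\<^sup>2) + 8 * (1 / real n) * (2 * Dg + 32 * K\<^sup>2)))"
    "whp (gauss.\<mu> n) (real n ^ 7 * exp (- \<tau>))
      (\<lambda>g. \<forall>x\<in>sparse_fun n r. \<forall>y\<in>sparse_fun n r. \<bar>\<Sum>s<n. y s * matrix_row u v m g x s\<bar> \<le> 2 * K)"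
proof -
  have fin: "finite I" using I finite_subset by auto
  have A: "sqrt (128 * l / real m) \<ge> 0" using l_ge by simp
  have bdd: "\<bar>modulated u v m x s l\<bar> \<le> 2" if "x \<in> sparse_fun n r" for x s l
    using m v U[OF that] by (intro modulated_bounded) auto
  show "whp (gauss.\<mu> n) (real n ^ 7 * exp (- \<tau>))
    (\<lambda>g. \<forall>Dg. (\<forall>x\<in>sparse_fun n r. (\<Sum>l<n. (g l)\<^sup>2 * (\<Sum>s\<in>I. (modulated u v m x s l)\<^sup>2)) \<le> Dg) \<longrightarrow>
      (\<forall>x\<in>sparse_fun n r. \<bar>(\<Sum>s\<in>I. (matrix_row u v m g x s)\<^sup>2) - (\<Sum>l<n. (g l)\<^sup>2 * (\<Sum>s\<in>I. (modulated u v m x s l)\<^sup>2))\<bar>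
       \<le> 4 * K * sqrt (2 * Dg + 32 * K\<^sup>2) + 8 * (1 / real n) * (2 * Dg + 32 * K\<^sup>2)))"
    unfolding K_def matrix_row_def
    by (rule chaos_sparse[OF modulated_linear_process[OF fin] A r E]) (auto intro: modulated_op_bound[OF I m(2)] bdd)
  \<comment> \<open>These coefficients are at most sqrt (4 / m) in modulus, so their energy on S is
    at most 4 card S / m.\<close>
  have \<beta>: "(\<Sum>i\<in>S. (sqrt (4 / real m) * trig n \<kappa> i)\<^sup>2) \<le> (sqrt (128 * l / real m))\<^sup>2 * (real (card S) + real L)" for \<kappa> S
  proof -
    have "(\<Sum>i\<in>S. (sqrt (4 / real m) * trig n \<kappa> i)\<^sup>2) = 4 / real m * (\<Sum>i\<in>S. (trig n \<kappa> i)\<^sup>2)"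
      by (simp add: power_mult_distrib sum_distrib_left)
    also have "\<dots> \<le> 4 / real m * (\<Sum>i\<in>S. 1)" by (intro mult_left_mono sum_mono trig_sq_le) auto
    also have "\<dots> \<le> 128 * l / real m * (real (card S) + real L)"
      using l_ge by (intro mult_mono divide_right_mono) auto
    finally show ?thesis using l_ge by simp
  qed
  show "whp (gauss.\<mu> n) (real n ^ 7 * exp (- \<tau>))
      (\<lambda>g. \<forall>x\<in>sparse_fun n r. \<forall>y\<in>sparse_fun n r. \<bar>\<Sum>s<n. y s * matrix_row u v m g x s\<bar> \<le> 2 * K)"
    unfolding K_def matrix_row_def
    by (rule bilinear_sparse[where \<beta> = "\<lambda>\<kappa> i. sqrt (4 / real m) * trig n \<kappa> i", OF modulated_linear_process A r E \<beta>])
      (auto intro: modulated_op_bound[OF _ m(2)] modulated_op_bound_dual[OF m(2) v U] bdd)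
qed

text \<open>For a unit coordinate vector the generator is a modulated column. Its nearly orthogonal
  rows give the operator norm sqrt (2 / m), free of the logarithms in the bound by Fourier
  functionals.\<close>

lemma gauss_points_whp:
  assumes I: "I \<subseteq> {..<n}" and m: "m = card I" "m > 0"
    and u: "\<And>l. l < n \<Longrightarrow> (u l)\<^sup>2 = 1" and v: "\<And>l. l < n \<Longrightarrow> (v l)\<^sup>2 = 1"
    and ac: "\<And>i q. \<lbrakk>i < n; 0 < q; q < n\<rbrakk> \<Longrightarrow>
      \<bar>\<Sum>s<n. (u (cyc_diff n s i) * v s) * (u (cyc_diff n (cyc_diff n s q) i) * v (cyc_diff n s q))\<bar> \<le> real n * D"
    and D: "D \<ge> 0" "real m * D \<le> 1"
  defines "X \<equiv> (\<lambda>i j. if j = i then 1 else 0 :: real) ` {..<n}"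
    and "K \<equiv> sqrt (2 * \<tau>) * sqrt (2 / real m)"
  shows "whp (gauss.\<mu> n) (real n ^ 7 * exp (- \<tau>))
    (\<lambda>g. \<forall>Dg. (\<forall>x\<in>X. (\<Sum>l<n. (g l)\<^sup>2 * (\<Sum>s\<in>I. (modulated u v m x s l)\<^sup>2)) \<le> Dg) \<longrightarrow>
      (\<forall>x\<in>X. \<bar>(\<Sum>s\<in>I. (matrix_row u v m g x s)\<^sup>2) - (\<Sum>l<n. (g l)\<^sup>2 * (\<Sum>s\<in>I. (modulated u v m x s l)\<^sup>2))\<bar>
       \<le> 4 * K * sqrt (2 * Dg + 32 * K\<^sup>2)))"
proof -
  have fin: "finite I" using I finite_subset by auto
  have cX: "card X \<le> n" unfolding X_def using card_image_le[of "{..<n}"] by simp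
  have conv_e: "conv u (\<lambda>j. if j = i then 1 else 0) j = u (cyc_diff n j i) / sqrt (real n)" if "i < n" for i j
  proof -
    have "(\<Sum>k<n. u (cyc_diff n j k) * (if k = i then 1 else 0)) = (\<Sum>k\<in>{i}. u (cyc_diff n j k) * (if k = i then 1 else 0))"
      using that by (intro sum.mono_neutral_right) auto
    then show ?thesis by (simp add: conv_def)
  qed
  have op: "op_bound n I (modulated u v m x) (sqrt (2 / real m))" if x: "x \<in> X" for x
  proof -
    obtain i where i: "i < n" "x = (\<lambda>j. if j = i then 1 else 0)" using x by (auto simp: X_def)
    define a where "a j = u (cyc_diff n j i) * v j" for j
    have "op_bound n I (\<lambda>s l. a (cyc_diff n s l) / sqrt (real n) / sqrt (real (card I))) (sqrt (2 / real (card I)))"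
    proof (rule autocorrelation_op_bound[OF _ _ I D(1)])
      show "\<bar>\<Sum>s<n. a s * a (cyc_diff n s q)\<bar> \<le> real n * D" if "0 < q" "q < n" for q
        using ac[OF i(1) that] by (simp add: a_def)
      show "(a j)\<^sup>2 = 1" if "j < n" for j
        using u[OF cyc_diff_less[OF n_pos]] v[OF that] by (simp add: a_def power_mult_distrib)
    qed (use m D in auto)
    moreover have "modulated u v m x = (\<lambda>s l. a (cyc_diff n s l) / sqrt (real n) / sqrt (real (card I)))"
      by (intro ext) (simp add: modulated_def i(2) conv_e[OF i(1)] a_def m mult.commute)
    ultimately show ?thesis by (simp add: m)
  qed
  have bdd: "\<bar>modulated u v m x s l\<bar> \<le> 2" if x: "x \<in> X" for x s l
  proof (rule modulated_bounded[OF m(2) v])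
    obtain i where i: "i < n" "x = (\<lambda>j. if j = i then 1 else 0)" using x by (auto simp: X_def)
    have "(\<Sum>j<n. (conv u x j)\<^sup>2) = (\<Sum>j<n. 1 / real n)"
      unfolding i(2) conv_e[OF i(1)] power_divide u[OF cyc_diff_less[OF n_pos]] by simp
    then show "(\<Sum>j<n. (conv u x j)\<^sup>2) \<le> 2" using n_pos by simp
  qed
  show ?thesis
    unfolding K_def matrix_row_def
    by (rule chaos_points[OF modulated_linear_process[OF fin] _ cX op _ bdd]) (auto simp: X_def)
qed

subsection \<open>The favourable events\<close>

definition \<phi> :: "nat \<Rightarrow> real" where
  "\<phi> m = l powr (5 / 2) / sqrt (real m)"

lemma l_powr: "l\<^sup>2 * sqrt l = l powr (5 / 2)"
proof -
  have "l powr (5 / 2) = l powr (2 + 1 / 2)" by simp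
  also have "\<dots> = l powr 2 * l powr (1 / 2)" by (rule powr_add)
  finally show ?thesis using l_ge by (simp add: powr_half_sqrt)
qed

lemma \<phi>_eq: "\<phi> m = l\<^sup>2 * sqrt l / sqrt (real m)"
  by (simp add: \<phi>_def l_powr)

lemma sqrt_l_ge: "sqrt l \<ge> 1"
  using l_ge by simp

lemma \<phi>_nonneg: "\<phi> m \<ge> 0"
  by (simp add: \<phi>_def)

lemma le_\<phi>:
  assumes "a \<le> l\<^sup>2"
  shows "a / sqrt (real m) \<le> \<phi> m"
proof -
  have "a \<le> l\<^sup>2 * sqrt l" using mult_left_mono[OF sqrt_l_ge, of "l\<^sup>2"] assms by simp
  then show ?thesis unfolding \<phi>_eq by (intro divide_right_mono) auto
qed

text \<open>The chain contributes l^2, and the energy constant sqrt (128 l / m) contributes the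
  remaining sqrt l / sqrt m of \<phi>. The constant is 1200 * 34 / 3, with 34 / 3 just above sqrt
  128.\<close>

lemma chain_bound_gauss: "chain_bound (sqrt (128 * l / real m)) r \<le> 13600 * \<Gamma> * (\<phi> m * sqrt (real r))"
proof -
  have "sqrt 128 \<le> 34 / 3" by (rule real_le_lsqrt) (auto simp: power2_eq_square)
  then have "1200 * \<Gamma> * sqrt 128 * (\<phi> m * sqrt (real r)) \<le> 1200 * \<Gamma> * (34 / 3) * (\<phi> m * sqrt (real r))"
    using \<Gamma> \<phi>_nonneg by (intro mult_right_mono mult_left_mono) auto
  moreover have "chain_bound (sqrt (128 * l / real m)) r = 1200 * \<Gamma> * sqrt 128 * (\<phi> m * sqrt (real r))"
    unfolding chain_bound_def \<phi>_eq real_sqrt_divide real_sqrt_mult by (simp add: mult_ac)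
  ultimately show ?thesis by simp
qed

text \<open>Here the functionals are bounded trigonometric ones, so the energy constant carries no
  logarithm. The constant is 1200 * 17 / 12.\<close>

lemma chain_bound_circ:
  "chain_bound (sqrt (2 / real n)) r \<le> 1700 * \<Gamma> * (l\<^sup>2 / sqrt (real n) * sqrt (real r))"
  "chain_bound (sqrt (2 / real n)) r \<ge> 0"
proof -
  have "sqrt 2 \<le> 17 / 12" by (rule real_le_lsqrt) (auto simp: power2_eq_square)
  then have "1200 * \<Gamma> * sqrt 2 * (l\<^sup>2 / sqrt (real n) * sqrt (real r)) \<le> 1200 * \<Gamma> * (17 / 12) * (l\<^sup>2 / sqrt (real n) * sqrt (real r))"
    using \<Gamma> by (intro mult_right_mono mult_left_mono) auto
  moreover have "chain_bound (sqrt (2 / real n)) r = 1200 * \<Gamma> * sqrt 2 * (l\<^sup>2 / sqrt (real n) * sqrt (real r))"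
    unfolding chain_bound_def real_sqrt_divide by (simp add: mult_ac)
  ultimately show "chain_bound (sqrt (2 / real n)) r \<le> 1700 * \<Gamma> * (l\<^sup>2 / sqrt (real n) * sqrt (real r))" by simp
  show "chain_bound (sqrt (2 / real n)) r \<ge> 0" using \<Gamma> by (simp add: chain_bound_def)
qed

text \<open>For K <= 1/10 the root is at most 2, so the deviation becomes linear in K.\<close>

lemma circ_dev_le:
  assumes "chain_bound (sqrt (2 / real n)) r \<le> 1 / 10"
  shows "circ_dev r \<le> 8 * chain_bound (sqrt (2 / real n)) r + 24 / real n" "circ_dev r \<ge> 0"
proof -
  define K where "K = chain_bound (sqrt (2 / real n)) r"
  have K: "K \<ge> 0" "K \<le> 1 / 10" using assms chain_bound_circ(2) by (auto simp: K_def)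
  have "K\<^sup>2 \<le> (1 / 10)\<^sup>2" using K by (intro power_mono)
  then have K2: "2 * 1 + 32 * K\<^sup>2 \<le> 3" by (simp add: power2_eq_square)
  then have "sqrt (2 * 1 + 32 * K\<^sup>2) \<le> 2" by (intro real_le_lsqrt) auto
  then have "4 * K * sqrt (2 * 1 + 32 * K\<^sup>2) \<le> 4 * K * 2" using K by (intro mult_left_mono) auto
  moreover have "8 * (1 / real n) * (2 * 1 + 32 * K\<^sup>2) \<le> 8 * (1 / real n) * 3" using K2 by (intro mult_left_mono) auto
  ultimately show "circ_dev r \<le> 8 * chain_bound (sqrt (2 / real n)) r + 24 / real n"
    unfolding circ_dev_def Let_def K_def[symmetric] by simp
  show "circ_dev r \<ge> 0" unfolding circ_dev_def Let_def K_def[symmetric] using K by simp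
qed

text \<open>The bounds in l / sqrt m are meant for the case \<rho> m > 1, the one in \<phi> m for
  the other case. The quadratic term is tamed by l^2 / m <= l^2 / sqrt m.\<close>

lemma diag_rad_le:
  assumes "m > 0"
  shows "diag_rad m \<le> 4 * (\<Gamma> * (l / sqrt (real m))) + 8 * (\<Gamma> * (l / sqrt (real m)))\<^sup>2"
    "diag_rad m \<le> 12 * \<Gamma> * \<phi> m" "diag_rad m \<ge> 0" "sqrt (\<tau> / real m) \<le> \<Gamma> * (l / sqrt (real m))"
proof -
  define a where "a = l / sqrt (real m)"
  have a: "a \<ge> 0" using l_ge by (simp add: a_def)
  have t: "\<tau> / real m = \<Gamma> * a\<^sup>2" by (simp add: \<tau>_def a_def power_divide)
  have "\<Gamma> * a\<^sup>2 \<le> \<Gamma>\<^sup>2 * a\<^sup>2" using \<Gamma> self_le_power[of \<Gamma> 2] by (intro mult_right_mono) auto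
  then have t2: "\<tau> / real m \<le> (\<Gamma> * a)\<^sup>2" unfolding t by (simp add: power_mult_distrib)
  then have s: "sqrt (\<tau> / real m) \<le> \<Gamma> * a" using \<Gamma> a by (intro real_le_lsqrt) auto
  then show "sqrt (\<tau> / real m) \<le> \<Gamma> * (l / sqrt (real m))" by (simp only: a_def)
  show "diag_rad m \<le> 4 * (\<Gamma> * (l / sqrt (real m))) + 8 * (\<Gamma> * (l / sqrt (real m)))\<^sup>2"
    using s t2 unfolding diag_rad_def a_def[symmetric] by linarith
  have "a \<le> \<phi> m" unfolding a_def using l_ge self_le_power[of l 2] by (intro le_\<phi>) auto
  then have 1: "\<Gamma> * a \<le> \<Gamma> * \<phi> m" using \<Gamma> by (intro mult_left_mono) auto
  have "a\<^sup>2 \<le> l\<^sup>2 / sqrt (real m)"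
  proof -
    have "a\<^sup>2 = l\<^sup>2 / real m" by (simp add: a_def power_divide)
    also have "\<dots> \<le> l\<^sup>2 / sqrt (real m)"
    proof (rule divide_left_mono)
      have "real m \<le> (real m)\<^sup>2" using assms by (intro self_le_power) auto
      then show "sqrt (real m) \<le> real m" by (intro real_le_lsqrt) auto
    qed (use assms in auto)
    finally show ?thesis .
  qed
  then have "a\<^sup>2 \<le> \<phi> m" using le_\<phi>[of "l\<^sup>2" m] by linarith
  then have 2: "\<Gamma> * a\<^sup>2 \<le> \<Gamma> * \<phi> m" using \<Gamma> by (intro mult_left_mono) auto
  show "diag_rad m \<le> 12 * \<Gamma> * \<phi> m"
    using s 1 2 unfolding diag_rad_def t by linarith
  show "diag_rad m \<ge> 0" using \<tau>_nonneg by (simp add: diag_rad_def)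
qed

text \<open>In the chaining regime the deviations sum to 176920 \<Gamma> \<phi> sqrt r, for which
  10^6 leaves room. The square of \<Gamma> also covers the quadratic terms arising when \<rho> m >
  1.\<close>

definition c2 :: real where "c2 = 10 ^ 6 * \<Gamma>\<^sup>2"

definition \<rho> :: "nat \<Rightarrow> real" where "\<rho> m = c2 * \<phi> m"

definition first_good :: "nat \<Rightarrow> (nat \<Rightarrow> real) \<Rightarrow> bool" where
  "first_good r0 u \<longleftrightarrow> (\<forall>k<n. u k = 1 \<or> u k = - 1) \<and>
    (\<forall>r\<in>{1..r0}. \<forall>x\<in>sparse_fun n r. \<bar>(\<Sum>j<n. (conv u x j)\<^sup>2) - (\<Sum>i<n. (x i)\<^sup>2)\<bar> \<le> circ_dev r)"

text \<open>In the last clause i is a column of the modulated circulant matrix and q the lag of its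
  autocorrelation.\<close>

definition second_good :: "nat \<Rightarrow> nat \<Rightarrow> (nat \<Rightarrow> real) \<Rightarrow> (nat \<Rightarrow> real) \<Rightarrow> bool" where
  "second_good m r0 u v \<longleftrightarrow> (\<forall>k<n. v k = 1 \<or> v k = - 1) \<and>
    (\<forall>\<kappa>\<in>freqs n. \<forall>S. S \<subseteq> {..<n} \<longrightarrow> card S \<le> r0 \<longrightarrow>
      (\<Sum>i\<in>S. (freq_coeff m u v \<kappa> i)\<^sup>2) \<le> (sqrt (128 * l / real m))\<^sup>2 * (real (card S) + real L)) \<and>
    (\<forall>i\<in>{..<n}. \<forall>q. 0 < q \<longrightarrow> q < n \<longrightarrow>
      \<bar>\<Sum>s<n. (u (cyc_diff n s i) * v s) * (u (cyc_diff n (cyc_diff n s q) i) * v (cyc_diff n s q))\<bar> \<le> real n * circ_dev 2)"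

text \<open>The bilinear part is the bound on the top-\<open>r\<close> norm in dual form.\<close>

definition third_good :: "nat set \<Rightarrow> nat \<Rightarrow> (nat \<Rightarrow> real) \<Rightarrow> (nat \<Rightarrow> real) \<Rightarrow> (nat \<Rightarrow> real) \<Rightarrow> bool" where
  "third_good I r0 u v g \<longleftrightarrow> (\<forall>r\<in>{1..r0}.
    (\<forall>x\<in>sparse_fun n r. (\<Sum>i<n. (x i)\<^sup>2) = 1 \<longrightarrow>
      \<bar>(\<Sum>s\<in>I. (matrix_row u v (card I) g x s)\<^sup>2) - 1\<bar> \<le> \<rho> (card I) * sqrt (real r)) \<and>
    (\<forall>x\<in>sparse_fun n r. \<forall>y\<in>sparse_fun n r.
      \<bar>\<Sum>s<n. y s * matrix_row u v (card I) g x s\<bar> \<le> \<rho> (card I) * sqrt (real r)))"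

lemma signs_sq: "(\<forall>k<n. u k = 1 \<or> u k = - 1) \<Longrightarrow> k < n \<Longrightarrow> (u k)\<^sup>2 = (1::real)"
  by (metis power2_eq_1_iff)

section \<open>Probabilities of the favourable events\<close>

lemma first_good_whp:
  assumes "r0 \<le> n"
  shows "whp (rademacher.\<mu> n) (real n * (real n ^ 7 * exp (- \<tau>))) (first_good r0)"
proof -
  have "whp (rademacher.\<mu> n) (real (card {1..r0}) * (real n ^ 7 * exp (- \<tau>)))
    (\<lambda>u. \<forall>r\<in>{1..r0}. \<forall>x\<in>sparse_fun n r. \<bar>(\<Sum>j<n. (conv u x j)\<^sup>2) - (\<Sum>i<n. (x i)\<^sup>2)\<bar> \<le> circ_dev r)"
    using assms by (intro whp_ball conv_deviation) auto
  from whp_AE[OF this rademacher_AE] show ?thesis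
    by (rule whp_mono) (use assms in \<open>auto simp: first_good_def intro!: mult_right_mono\<close>)
qed

text \<open>For fixed u, column i of the modulated matrix is v multiplied by the fixed signs u (s -
  i), so a circulant deviation with prescribed signs controls its autocorrelations. The n columns
  and one energy estimate account for the factor 2 n.\<close>

lemma second_good_whp:
  assumes r0: "r0 \<le> n" and m: "m > 0" and u: "first_good r0 u"
    and cd: "\<And>r. r \<in> {1..r0} \<Longrightarrow> circ_dev r \<le> 1"
  shows "whp (rademacher.\<mu> n) (2 * real n * (real n ^ 7 * exp (- \<tau>))) (second_good m r0 u)"
proof -
  have us: "\<And>k. k < n \<Longrightarrow> u k = 1 \<or> u k = - 1" using u by (simp add: first_good_def)
  have 1: "whp (rademacher.\<mu> n) (real n ^ 7 * exp (- \<tau>))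
    (\<lambda>v. \<forall>\<kappa>\<in>freqs n. \<forall>S. S \<subseteq> {..<n} \<longrightarrow> card S \<le> r0 \<longrightarrow>
      (\<Sum>i\<in>S. (freq_coeff m u v \<kappa> i)\<^sup>2) \<le> (sqrt (128 * l / real m))\<^sup>2 * (real (card S) + real L))"
  proof (rule freq_coeff_energy[OF _ r0 m])
    fix q x assume q: "1 \<le> q" "q \<le> r0" and x: "x \<in> sparse_fun n q"
    have "\<bar>(\<Sum>j<n. (conv u x j)\<^sup>2) - (\<Sum>i<n. (x i)\<^sup>2)\<bar> \<le> circ_dev q"
      using u q x by (simp add: first_good_def)
    moreover have "circ_dev q \<le> 1" using cd q by simp
    moreover have "(\<Sum>i<n. (x i)\<^sup>2) \<le> 1" using x by (simp add: sparse_fun_def)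
    ultimately show "(\<Sum>j<n. (conv u x j)\<^sup>2) \<le> 2" by linarith
  qed
  have 2: "whp (rademacher.\<mu> n) (real n ^ 7 * exp (- \<tau>)) (\<lambda>v. (\<forall>k<n. v k = 1 \<or> v k = - 1) \<and>
      (\<forall>q. 0 < q \<longrightarrow> q < n \<longrightarrow>
      \<bar>\<Sum>s<n. (u (cyc_diff n s i) * v s) * (u (cyc_diff n (cyc_diff n s q) i) * v (cyc_diff n s q))\<bar> \<le> real n * circ_dev 2))"
    if "i \<in> {..<n}" for i
  proof -
    define \<sigma> where "\<sigma> k = u (cyc_diff n k i)" for k
    have \<sigma>: "\<bar>\<sigma> k\<bar> = 1" for k using us[OF cyc_diff_less[OF n_pos, of k i]] by (auto simp: \<sigma>_def)
    have "whp (rademacher.\<mu> n) (real n ^ 7 * exp (- \<tau>))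
      (\<lambda>\<xi>. (\<forall>l<n. \<xi> l = 1 \<or> \<xi> l = - 1) \<and> (\<forall>x\<in>sparse_fun n 2.
        \<bar>(\<Sum>s<n. (\<Sum>l<n. x (cyc_diff n s l) * (\<sigma> l * \<xi> l))\<^sup>2) / real n - (\<Sum>i<n. (x i)\<^sup>2)\<bar> \<le> circ_dev 2))"
      using n by (intro circulant_deviation \<sigma>) auto
    then show ?thesis
    proof (rule whp_mono[OF _ order_refl], intro conjI allI impI)
      fix v q assume v: "(\<forall>l<n. v l = 1 \<or> v l = - 1) \<and> (\<forall>x\<in>sparse_fun n 2.
        \<bar>(\<Sum>s<n. (\<Sum>l<n. x (cyc_diff n s l) * (\<sigma> l * v l))\<^sup>2) / real n - (\<Sum>i<n. (x i)\<^sup>2)\<bar> \<le> circ_dev 2)"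
        and q: "0 < q" "q < n"
      have "\<bar>\<Sum>s<n. (\<lambda>k. \<sigma> k * v k) s * (\<lambda>k. \<sigma> k * v k) (cyc_diff n s q)\<bar> \<le> real n * circ_dev 2"
      proof (rule autocorrelation[OF _ q])
        show "(\<sigma> k * v k)\<^sup>2 = 1" if "k < n" for k
        proof -
          have "(\<sigma> k)\<^sup>2 = 1" using \<sigma>[of k] by (metis one_power2 power2_abs)
          then show ?thesis using signs_sq[of v k] v that by (simp add: power_mult_distrib)
        qed
      qed (use v in blast)
      then show "\<bar>\<Sum>s<n. (u (cyc_diff n s i) * v s) * (u (cyc_diff n (cyc_diff n s q) i) * v (cyc_diff n s q))\<bar> \<le> real n * circ_dev 2"
        by (simp add: \<sigma>_def)
    qed auto
  qed
  have 3: "whp (rademacher.\<mu> n) (real (card {..<n}) * (real n ^ 7 * exp (- \<tau>))) (\<lambda>v. \<forall>i\<in>{..<n}. (\<forall>k<n. v k = 1 \<or> v k = - 1) \<and>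
      (\<forall>q. 0 < q \<longrightarrow> q < n \<longrightarrow>
      \<bar>\<Sum>s<n. (u (cyc_diff n s i) * v s) * (u (cyc_diff n (cyc_diff n s q) i) * v (cyc_diff n s q))\<bar> \<le> real n * circ_dev 2))"
    using 2 by (intro whp_ball) auto
  from whp_conj[OF 1 3] have "whp (rademacher.\<mu> n) (real n ^ 7 * exp (- \<tau>) + real (card {..<n}) * (real n ^ 7 * exp (- \<tau>))) (second_good m r0 u)"
    by (rule whp_mono) (use n_pos in \<open>auto simp: second_good_def\<close>)
  then show ?thesis
  proof (rule whp_mono)
    have "1 * (real n ^ 7 * exp (- \<tau>)) \<le> real n * (real n ^ 7 * exp (- \<tau>))" using n by (intro mult_right_mono) auto
    then show "real n ^ 7 * exp (- \<tau>) + real (card {..<n}) * (real n ^ 7 * exp (- \<tau>)) \<le> 2 * real n * (real n ^ 7 * exp (- \<tau>))"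
      by (simp add: mult_ac)
  qed
qed

lemma unit_one_sparse:
  assumes x: "x \<in> sparse_fun n 1" and x1: "(\<Sum>i<n. (x i)\<^sup>2) = 1"
  obtains i c where "i < n" "c\<^sup>2 = 1" "x = (\<lambda>j. c * (if j = i then 1 else 0))"
proof -
  note S = sparse_fun_supp[OF x]
  have "{i. x i \<noteq> 0} \<noteq> {}" using x1 by (metis (mono_tags, lifting) mem_Collect_eq empty_iff power_zero_numeral sum.neutral zero_neq_one)
  then have "card {i. x i \<noteq> 0} = 1" using S card_gt_0_iff[of "{i. x i \<noteq> 0}"] by linarith
  then obtain i where i: "{i. x i \<noteq> 0} = {i}" by (auto simp: card_1_singleton_iff)
  have "i < n" using i S(1) by blast
  have z: "x j = 0" if "j \<noteq> i" for j using i that by blast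
  have "(\<Sum>j<n. (x j)\<^sup>2) = (\<Sum>j\<in>{i}. (x j)\<^sup>2)"
    using \<open>i < n\<close> z by (intro sum.mono_neutral_right) auto
  then have "(x i)\<^sup>2 = 1" using x1 by simp
  moreover have "x = (\<lambda>j. x i * (if j = i then 1 else 0))" using z by auto
  ultimately show ?thesis using that \<open>i < n\<close> by blast
qed

text \<open>When \<open>\<rho> m > 1\<close> only sparsity one occurs. There the chaining bound is too weak, and the
  autocorrelations of the columns are used instead.\<close>

definition regime :: "nat \<Rightarrow> nat \<Rightarrow> bool" where
  "regime m r0 \<longleftrightarrow> 3 * 10 ^ 16 * \<Gamma> ^ 5 * l ^ 7 \<le> sqrt (real n) \<and> 0 < m \<and> m \<le> n \<and> r0 \<le> n \<and>
     (r0 = 1 \<and> \<rho> m > 1 \<or> (\<forall>r\<in>{1..r0}. \<rho> m * sqrt (real r) \<le> 3 / 2))"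

text \<open>If \<rho> m sqrt r <= 3/2, then m <= n and the size of \<open>c2\<close> make the chain
  bound over n small. At sparsity one with \<rho> m > 1, the lower bound on sqrt n does.\<close>

lemma regime_bounds:
  assumes reg: "regime m r0" and r: "r \<in> {1..r0}"
  shows "chain_bound (sqrt (2 / real n)) r \<le> 1 / 100" "circ_dev r \<le> 1"
proof -
  have m: "0 < m" "m \<le> n" using reg by (auto simp: regime_def)
  show "chain_bound (sqrt (2 / real n)) r \<le> 1 / 100"
  proof (cases "\<forall>r\<in>{1..r0}. \<rho> m * sqrt (real r) \<le> 3 / 2")
    case True
    have "l\<^sup>2 / sqrt (real n) \<le> l\<^sup>2 / sqrt (real m)" using m by (intro divide_left_mono) auto
    also have "\<dots> \<le> \<phi> m" by (rule le_\<phi>) simp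
    finally have "1700 * \<Gamma> * (l\<^sup>2 / sqrt (real n) * sqrt (real r)) \<le> 1700 * \<Gamma> * (\<phi> m * sqrt (real r))"
      using \<Gamma> by (intro mult_left_mono mult_right_mono) auto
    moreover have "10 ^ 6 * \<Gamma> * (\<phi> m * sqrt (real r)) \<le> 3 / 2"
    proof -
      have "10 ^ 6 * \<Gamma> * (\<phi> m * sqrt (real r)) \<le> 10 ^ 6 * \<Gamma>\<^sup>2 * (\<phi> m * sqrt (real r))"
        using \<Gamma> self_le_power[of \<Gamma> 2] \<phi>_nonneg by (intro mult_right_mono mult_left_mono) auto
      also have "\<dots> = \<rho> m * sqrt (real r)" by (simp add: \<rho>_def c2_def mult_ac)
      also have "\<dots> \<le> 3 / 2" using True r by blast
      finally show ?thesis .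
    qed
    ultimately show ?thesis using chain_bound_circ(1)[of r] by simp
  next
    case False
    then have "r = 1" using reg r by (auto simp: regime_def)
    have "3 * 10 ^ 16 * (\<Gamma> * l\<^sup>2) \<le> 3 * 10 ^ 16 * (\<Gamma> ^ 5 * l ^ 7)"
      using \<Gamma> l_ge self_le_power[of \<Gamma> 5] power_increasing[of 2 7 l] by (intro mult_left_mono mult_mono) auto
    also have "\<dots> \<le> sqrt (real n)" using reg by (simp add: regime_def mult.assoc)
    finally have "3 * 10 ^ 16 * (\<Gamma> * l\<^sup>2) \<le> sqrt (real n)" .
    moreover have "170000 * (\<Gamma> * l\<^sup>2) \<le> 3 * 10 ^ 16 * (\<Gamma> * l\<^sup>2)"
      using \<Gamma> by (intro mult_right_mono) auto
    ultimately have "170000 * (\<Gamma> * l\<^sup>2) \<le> sqrt (real n)" by linarith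
    then have "1700 * \<Gamma> * (l\<^sup>2 / sqrt (real n) * sqrt (real 1)) \<le> 1 / 100"
      using n_pos by (simp add: pos_divide_le_eq mult_ac)
    then show ?thesis using chain_bound_circ(1)[of r] \<open>r = 1\<close> by simp
  qed
  then have "circ_dev r \<le> 8 * (1 / 100) + 24 / real n" using circ_dev_le(1)[of r] by linarith
  moreover have "24 / real n \<le> 24 / 32" using n by (intro divide_left_mono) auto
  ultimately show "circ_dev r \<le> 1" by simp
qed

text \<open>\<rho> m > 1 forces m <= 10^12 \<Gamma>^4 l^5, while the deviation at sparsity 2 is of
  order \<Gamma> l^2 / sqrt n. Smallness of the product of the two is the origin of the condition on
  sqrt n in \<open>regime\<close>, with 3 * 10^16 = 10^12 * 30000.\<close>

lemma regime_autocorrelation: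
  assumes reg: "regime m r0" and \<rho>: "\<rho> m > 1"
  shows "circ_dev 2 \<ge> 0" "real m * circ_dev 2 \<le> 1"
proof -
  have m: "0 < m" "m \<le> n" and star: "3 * 10 ^ 16 * \<Gamma> ^ 5 * l ^ 7 \<le> sqrt (real n)" using reg by (auto simp: regime_def)
  define y where "y = \<Gamma> * (l\<^sup>2 / sqrt (real n))"
  have y0: "y \<ge> 0" using \<Gamma> by (simp add: y_def)
  have "sqrt 2 \<le> 17 / 12" by (rule real_le_lsqrt) (auto simp: power2_eq_square)
  then have "y * sqrt 2 \<le> y * (17 / 12)" using y0 by (intro mult_left_mono)
  then have cb: "chain_bound (sqrt (2 / real n)) 2 \<le> 2409 * y"
  proof -
    have "chain_bound (sqrt (2 / real n)) 2 \<le> 1700 * (y * sqrt 2)"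
      using chain_bound_circ(1)[of 2] by (simp add: y_def mult_ac)
    also have "\<dots> \<le> 1700 * (y * (17 / 12))" using \<open>y * sqrt 2 \<le> y * (17 / 12)\<close> by linarith
    also have "\<dots> \<le> 2409 * y" using y0 by simp
    finally show ?thesis .
  qed
  have "real m * y \<le> 1 / 30000"
  proof -
    have "\<rho> m * sqrt (real m) = 10 ^ 6 * \<Gamma>\<^sup>2 * (l\<^sup>2 * sqrt l)" using m by (simp add: \<rho>_def c2_def \<phi>_eq)
    then have "sqrt (real m) \<le> 10 ^ 6 * \<Gamma>\<^sup>2 * (l\<^sup>2 * sqrt l)"
      using \<rho> m mult_right_mono[of 1 "\<rho> m" "sqrt (real m)"] by simp
    then have "(sqrt (real m))\<^sup>2 \<le> (10 ^ 6 * \<Gamma>\<^sup>2 * (l\<^sup>2 * sqrt l))\<^sup>2" by (intro power_mono) auto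
    also have "\<dots> = 10 ^ 12 * (\<Gamma> ^ 4 * l ^ 5)"
      using l_ge by (simp add: power_mult_distrib flip: power_mult) (simp add: power_add[symmetric] power_Suc2[symmetric])
    finally have "real m \<le> 10 ^ 12 * (\<Gamma> ^ 4 * l ^ 5)" by simp
    then have "real m * y \<le> 10 ^ 12 * (\<Gamma> ^ 4 * l ^ 5) * y" using y0 by (intro mult_right_mono)
    also have "\<dots> = 10 ^ 12 * (\<Gamma> ^ 5 * l ^ 7) / sqrt (real n)"
      by (simp add: y_def power_add[symmetric] mult_ac eval_nat_numeral)
    also have "\<dots> \<le> 1 / 30000" using star n_pos by (simp add: pos_divide_le_eq)
    finally show ?thesis .
  qed
  moreover have "1 * y \<le> real m * y" using m y0 by (intro mult_right_mono) auto
  ultimately have ysmall: "y \<le> 1 / 30000" by linarith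
  have n1: "1 / real n \<le> y"
  proof -
    have "1 / real n \<le> 1 / sqrt (real n)" using n by (intro divide_left_mono real_le_lsqrt) (auto simp: power2_eq_square)
    also have "\<dots> \<le> l\<^sup>2 / sqrt (real n)" using l_ge by (intro divide_right_mono) auto
    also have "\<dots> \<le> \<Gamma> * (l\<^sup>2 / sqrt (real n))" using mult_right_mono[OF \<Gamma>, of "l\<^sup>2 / sqrt (real n)"] by simp
    finally show ?thesis by (simp only: y_def)
  qed
  have cb': "chain_bound (sqrt (2 / real n)) 2 \<le> 1 / 10" using cb ysmall by linarith
  show "circ_dev 2 \<ge> 0" by (rule circ_dev_le(2)[OF cb'])
  have "circ_dev 2 \<le> 8 * (2409 * y) + 24 * y" using circ_dev_le(1)[OF cb'] cb n1 by simp
  then have "real m * circ_dev 2 \<le> real m * (19296 * y)" using m by (intro mult_left_mono) auto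
  also have "\<dots> = 19296 * (real m * y)" by simp
  also have "\<dots> \<le> 1" using \<open>real m * y \<le> 1 / 30000\<close> by linarith
  finally show "real m * circ_dev 2 \<le> 1" .
qed

text \<open>The deviation of the squared norm from 1 splits into that of the chaos from its
  diagonal, that of the diagonal from the energy of the convolution, and that of this energy from
  1.\<close>

lemma third_good_whp:
  assumes reg: "regime m r0" and I: "I \<subseteq> {..<n}" and m: "m = card I"
    and u: "first_good r0 u" and v: "second_good m r0 u v"
  shows "whp (gauss.\<mu> n) (4 * real n * (real n ^ 7 * exp (- \<tau>))) (third_good I r0 u v)"
proof -
  define e where "e = exp (- \<tau>)"
  have e: "e \<ge> 0" by (simp add: e_def)
  have m0: "m > 0" "m \<le> n" and r0: "r0 \<le> n" using reg by (auto simp: regime_def)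
  have fin: "finite I" using I finite_subset by auto
  have us: "\<And>k. k < n \<Longrightarrow> (u k)\<^sup>2 = 1" using u signs_sq[of u] by (simp add: first_good_def)
  have vs: "\<And>k. k < n \<Longrightarrow> (v k)\<^sup>2 = 1" using v signs_sq[of v] by (simp add: second_good_def)
  have dev1: "\<bar>(\<Sum>j<n. (conv u x j)\<^sup>2) - (\<Sum>i<n. (x i)\<^sup>2)\<bar> \<le> circ_dev r"
    if "r \<in> {1..r0}" "x \<in> sparse_fun n r" for r x
    using u that by (simp add: first_good_def)
  have U: "(\<Sum>j<n. (conv u x j)\<^sup>2) \<le> 2" if "r \<in> {1..r0}" "x \<in> sparse_fun n r" for r x
  proof -
    have "(\<Sum>i<n. (x i)\<^sup>2) \<le> 1" using that by (simp add: sparse_fun_def)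
    then show ?thesis using dev1[OF that] regime_bounds(2)[OF reg that(1)] by linarith
  qed
  define K where "K r = chain_bound (sqrt (128 * l / real m)) r" for r
  define dg where "dg x g = (\<Sum>l<n. (g l)\<^sup>2 * (\<Sum>s\<in>I. (modulated u v m x s l)\<^sup>2))" for x g
  define X where "X = (\<lambda>i j. if j = i then 1 else 0 :: real) ` {..<n}"
  define K' where "K' = sqrt (2 * \<tau>) * sqrt (2 / real m)"
  define E1 where "E1 g \<longleftrightarrow> (\<forall>j\<in>{..<n}. \<bar>\<Sum>s\<in>I. ((g (cyc_diff n s j))\<^sup>2 - 1)\<bar> \<le> real m * diag_rad m)" for g
  define E2 where "E2 r g \<longleftrightarrow> (\<forall>Dg. (\<forall>x\<in>sparse_fun n r. dg x g \<le> Dg) \<longrightarrow>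
      (\<forall>x\<in>sparse_fun n r. \<bar>(\<Sum>s\<in>I. (matrix_row u v m g x s)\<^sup>2) - dg x g\<bar>
       \<le> 4 * K r * sqrt (2 * Dg + 32 * (K r)\<^sup>2) + 8 * (1 / real n) * (2 * Dg + 32 * (K r)\<^sup>2)))" for r g
  define E3 where "E3 r g \<longleftrightarrow> (\<forall>x\<in>sparse_fun n r. \<forall>y\<in>sparse_fun n r. \<bar>\<Sum>s<n. y s * matrix_row u v m g x s\<bar> \<le> 2 * K r)" for r g
  define E4 where "E4 g \<longleftrightarrow> (\<rho> m > 1 \<longrightarrow> (\<forall>Dg. (\<forall>x\<in>X. dg x g \<le> Dg) \<longrightarrow>
      (\<forall>x\<in>X. \<bar>(\<Sum>s\<in>I. (matrix_row u v m g x s)\<^sup>2) - dg x g\<bar> \<le> 4 * K' * sqrt (2 * Dg + 32 * K'\<^sup>2))))" for g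
  have w1: "whp (gauss.\<mu> n) (real n * (2 * e)) E1"
    unfolding E1_def e_def by (rule gauss_diag_whp[OF I m m0(1)])
  have w23: "whp (gauss.\<mu> n) (real n ^ 7 * e + real n ^ 7 * e) (\<lambda>g. E2 r g \<and> E3 r g)" if r: "r \<in> {1..r0}" for r
  proof -
    have r': "1 \<le> r" "r \<le> n" using r r0 by auto
    have En: "(\<Sum>i\<in>S. (freq_coeff m u v \<kappa> i)\<^sup>2) \<le> (sqrt (128 * l / real m))\<^sup>2 * (real (card S) + real L)"
      if "\<kappa> \<in> freqs n" "S \<subseteq> {..<n}" "card S \<le> r" for \<kappa> S
      using v that r unfolding second_good_def by auto
    note g = gauss_chaos_whp[OF I m m0(1) vs r' En U[OF r]]
    have a: "whp (gauss.\<mu> n) (real n ^ 7 * e) (E2 r)"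
      unfolding E2_def dg_def K_def e_def by (rule g(1))
    have b: "whp (gauss.\<mu> n) (real n ^ 7 * e) (E3 r)"
      unfolding E3_def K_def e_def by (rule g(2))
    show ?thesis using whp_conj[OF a b] e by simp
  qed
  have w4: "whp (gauss.\<mu> n) (real n ^ 7 * e) E4"
  proof (cases "\<rho> m > 1")
    case True
    have "whp (gauss.\<mu> n) (real n ^ 7 * exp (- \<tau>))
    (\<lambda>g. \<forall>Dg. (\<forall>x\<in>X. dg x g \<le> Dg) \<longrightarrow>
      (\<forall>x\<in>X. \<bar>(\<Sum>s\<in>I. (matrix_row u v m g x s)\<^sup>2) - dg x g\<bar> \<le> 4 * K' * sqrt (2 * Dg + 32 * K'\<^sup>2)))"
      unfolding X_def dg_def K'_def
    proof (rule gauss_points_whp[OF I m m0(1) us vs _ regime_autocorrelation[OF reg True]])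
      show "\<bar>\<Sum>s<n. (u (cyc_diff n s i) * v s) * (u (cyc_diff n (cyc_diff n s q) i) * v (cyc_diff n s q))\<bar> \<le> real n * circ_dev 2"
        if "i < n" "0 < q" "q < n" for i q
        using v that unfolding second_good_def by blast
    qed auto
    then show ?thesis unfolding E4_def e_def using True by simp
  next
    case False
    then show ?thesis by (intro whp_mono[OF whp_always]) (auto simp: E4_def e)
  qed
  have w23': "whp (gauss.\<mu> n) (real (card {1..r0}) * (real n ^ 7 * e + real n ^ 7 * e)) (\<lambda>g. \<forall>r\<in>{1..r0}. E2 r g \<and> E3 r g)"
    using e by (intro whp_ball w23) auto
  have "whp (gauss.\<mu> n) (real n * (2 * e) + (real (card {1..r0}) * (real n ^ 7 * e + real n ^ 7 * e) + real n ^ 7 * e))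
    (\<lambda>g. E1 g \<and> ((\<forall>r\<in>{1..r0}. E2 r g \<and> E3 r g) \<and> E4 g))"
    using e by (intro whp_conj w1 w23' w4) auto
  then show ?thesis
  proof (rule whp_mono)
    have a: "real (card {1..r0}) * (real n ^ 7 * e + real n ^ 7 * e) \<le> real n * (real n ^ 7 * e + real n ^ 7 * e)"
      using r0 e by (intro mult_right_mono) auto
    have b: "1 * (real n ^ 7 * e) \<le> real n * (real n ^ 7 * e)" using n e by (intro mult_right_mono) auto
    have c: "real n * (2 * e) \<le> real n * (real n ^ 7 * e)"
    proof (intro mult_left_mono mult_right_mono e)
      have "real n \<le> real n ^ 7" using n by (intro self_le_power) auto
      then show "2 \<le> real n ^ 7" using n by linarith
    qed simp
    have "real n * (2 * e) + (real (card {1..r0}) * (real n ^ 7 * e + real n ^ 7 * e) + real n ^ 7 * e)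
      \<le> real n * (real n ^ 7 * e) + (real n * (real n ^ 7 * e + real n ^ 7 * e) + real n * (real n ^ 7 * e))"
      using a b c by linarith
    also have "\<dots> = 4 * real n * (real n ^ 7 * e)" by (simp add: distrib_left)
    finally show "real n * (2 * e) + (real (card {1..r0}) * (real n ^ 7 * e + real n ^ 7 * e) + real n ^ 7 * e)
      \<le> 4 * real n * (real n ^ 7 * exp (- \<tau>))" by (simp only: e_def)
    fix g assume ev: "E1 g \<and> ((\<forall>r\<in>{1..r0}. E2 r g \<and> E3 r g) \<and> E4 g)"
    define \<eta> where "\<eta> = diag_rad m"
    have \<eta>: "\<eta> \<ge> 0" "\<eta> \<le> 12 * \<Gamma> * \<phi> m"
      "\<eta> \<le> 4 * (\<Gamma> * (l / sqrt (real m))) + 8 * (\<Gamma> * (l / sqrt (real m)))\<^sup>2"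
      using diag_rad_le[OF m0(1)] by (auto simp: \<eta>_def)
    have dg: "\<bar>dg x g - (\<Sum>j<n. (conv u x j)\<^sup>2)\<bar> \<le> \<eta> * (\<Sum>j<n. (conv u x j)\<^sup>2)" for x
      unfolding dg_def \<eta>_def using ev by (intro modulated_diag[OF I m m0(1) vs]) (auto simp: E1_def)
    have "\<bar>(\<Sum>s\<in>I. (matrix_row u v m g x s)\<^sup>2) - 1\<bar> \<le> \<rho> m * sqrt (real r)"
      if r: "r \<in> {1..r0}" and x: "x \<in> sparse_fun n r" and x1: "(\<Sum>i<n. (x i)\<^sup>2) = 1" for r x
    proof (cases "\<forall>r\<in>{1..r0}. \<rho> m * sqrt (real r) \<le> 3 / 2")
      case True
      define q where "q = \<Gamma> * (\<phi> m * sqrt (real r))"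
      have sr: "sqrt (real r) \<ge> 1" using r by simp
      have \<phi>r: "\<phi> m \<le> \<phi> m * sqrt (real r)" using mult_left_mono[OF sr \<phi>_nonneg[of m]] by simp
      have \<phi>r0: "\<phi> m * sqrt (real r) \<ge> 0" using \<phi>_nonneg by simp
      have q\<phi>: "\<phi> m * sqrt (real r) \<le> q" using mult_right_mono[OF \<Gamma> \<phi>r0] by (simp add: q_def)
      have q0: "q \<ge> 0" using \<phi>r0 q\<phi> by linarith
      have q\<rho>: "10 ^ 6 * q \<le> \<rho> m * sqrt (real r)"
      proof -
        have "10 ^ 6 * q \<le> 10 ^ 6 * (\<Gamma> * q)" using mult_right_mono[OF \<Gamma> q0] by simp
        also have "\<dots> = \<rho> m * sqrt (real r)" by (simp add: \<rho>_def c2_def q_def power2_eq_square mult_ac)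
        finally show ?thesis .
      qed
      then have qs: "q \<le> 3 / 2000000" using True r by fastforce
      have K: "K r \<le> 13600 * q" "K r \<ge> 0"
        using chain_bound_gauss[of m r] \<Gamma> l_ge by (auto simp: K_def q_def mult.assoc chain_bound_def)
      have K1: "K r \<le> 1 / 10" using K qs by linarith
      have \<eta>q: "\<eta> \<le> 12 * q"
      proof -
        have "\<Gamma> * \<phi> m \<le> q" unfolding q_def using \<Gamma> by (intro mult_left_mono \<phi>r) auto
        then show ?thesis using \<eta>(2) by linarith
      qed
      have \<eta>1: "\<eta> \<le> 1" using \<eta>q qs by linarith
      have nq: "1 / real n \<le> q"
      proof -
        have "1 / real n \<le> 1 / sqrt (real n)" using n by (intro divide_left_mono real_le_lsqrt) (auto simp: power2_eq_square)
        also have "\<dots> \<le> 1 / sqrt (real m)" using m0 by (intro divide_left_mono) auto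
        also have "\<dots> \<le> \<phi> m" using l_ge by (intro le_\<phi>) auto
        finally show ?thesis using \<phi>r q\<phi> by linarith
      qed
      \<comment> \<open>Dg = 4 is admissible: the convolution has energy at most 2, and the diagonal
        exceeds it at most by the factor 1 + \<eta> <= 2.\<close>
      have "dg y g \<le> 4" if y: "y \<in> sparse_fun n r" for y
      proof -
        have "\<eta> * (\<Sum>j<n. (conv u y j)\<^sup>2) \<le> 1 * 2" using \<eta> \<eta>1 U[OF r y] by (intro mult_mono) (auto simp: sum_nonneg)
        then show ?thesis using dg[of y] U[OF r y] by linarith
      qed
      then have "\<bar>(\<Sum>s\<in>I. (matrix_row u v m g x s)\<^sup>2) - dg x g\<bar>
         \<le> 4 * K r * sqrt (2 * 4 + 32 * (K r)\<^sup>2) + 8 * (1 / real n) * (2 * 4 + 32 * (K r)\<^sup>2)"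
        using ev r x unfolding E2_def by blast
      also have "\<dots> \<le> 4 * K r * 3 + 8 * (1 / real n) * 9"
      proof -
        have "(K r)\<^sup>2 \<le> (1 / 10)\<^sup>2" using K K1 by (intro power_mono)
        then have "2 * 4 + 32 * (K r)\<^sup>2 \<le> 9" by (simp add: power2_eq_square)
        moreover from this have "sqrt (2 * 4 + 32 * (K r)\<^sup>2) \<le> 3" by (intro real_le_lsqrt) auto
        ultimately show ?thesis using K by (intro add_mono mult_left_mono) auto
      qed
      also have "\<dots> \<le> 163272 * q" using K nq by linarith
      finally have 1: "\<bar>(\<Sum>s\<in>I. (matrix_row u v m g x s)\<^sup>2) - dg x g\<bar> \<le> 163272 * q" .
      have "\<eta> * (\<Sum>j<n. (conv u x j)\<^sup>2) \<le> 12 * q * 2" using \<eta> \<eta>q U[OF r x] q0 by (intro mult_mono) (auto simp: sum_nonneg)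
      then have 2: "\<bar>dg x g - (\<Sum>j<n. (conv u x j)\<^sup>2)\<bar> \<le> 24 * q" using dg[of x] by linarith
      have "chain_bound (sqrt (2 / real n)) r \<le> 1700 * q"
      proof -
        have "l\<^sup>2 / sqrt (real n) \<le> l\<^sup>2 / sqrt (real m)" using m0 by (intro divide_left_mono) auto
        also have "\<dots> \<le> \<phi> m" by (rule le_\<phi>) simp
        finally have "1700 * \<Gamma> * (l\<^sup>2 / sqrt (real n) * sqrt (real r)) \<le> 1700 * \<Gamma> * (\<phi> m * sqrt (real r))"
          using \<Gamma> by (intro mult_left_mono mult_right_mono) auto
        then show ?thesis using chain_bound_circ(1)[of r] by (simp add: q_def mult.assoc)
      qed
      then have "circ_dev r \<le> 13624 * q" using circ_dev_le(1)[of r] regime_bounds(1)[OF reg r] nq by linarith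
      then have 3: "\<bar>(\<Sum>j<n. (conv u x j)\<^sup>2) - 1\<bar> \<le> 13624 * q" using dev1[OF r x] x1 by linarith
      \<comment> \<open>163272 + 24 + 13624, from the chaos, its diagonal and the
        convolution.\<close>
      have "176920 * q \<le> \<rho> m * sqrt (real r)" using q\<rho> q0 by simp
      then show ?thesis using 1 2 3 by linarith
    next
      case False
      then have big: "\<rho> m > 1" and "r0 = 1" using reg by (auto simp: regime_def)
      then have r1: "r = 1" using r by simp
      \<comment> \<open>A one-sparse unit vector is a unit coordinate vector up to sign, and the
        sign drops out of the squares. The n points of \<open>X\<close> therefore suffice.\<close>
      obtain i c where ic: "i < n" "c\<^sup>2 = 1" "x = (\<lambda>j. c * (if j = i then 1 else 0))"
        using unit_one_sparse x x1 unfolding r1 by blast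
      define y where "y j = (if j = i then 1 else 0 :: real)" for j
      have "y = (\<lambda>j. if j = i then 1 else 0)" by (rule ext) (simp add: y_def)
      then have yX: "y \<in> X" unfolding X_def using ic(1) by blast
      have conv_y: "(\<Sum>j<n. (conv u z j)\<^sup>2) = 1" if z: "z \<in> X" for z
      proof -
        obtain k where k: "k < n" "z = (\<lambda>j. if j = k then 1 else 0)" using z by (auto simp: X_def)
        have "conv u z j = u (cyc_diff n j k) / sqrt (real n)" for j
        proof -
          have "(\<Sum>i<n. u (cyc_diff n j i) * z i) = (\<Sum>i\<in>{k}. u (cyc_diff n j i) * z i)"
            using k by (intro sum.mono_neutral_right) auto
          then show ?thesis using k by (simp add: conv_def)
        qed
        then have "(\<Sum>j<n. (conv u z j)\<^sup>2) = (\<Sum>j<n. 1 / real n)"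
          by (simp add: power_divide us[OF cyc_diff_less[OF n_pos]])
        then show ?thesis using n_pos by simp
      qed
      have row: "matrix_row u v m g x s = c * matrix_row u v m g y s" for s
      proof -
        have "conv u x k = c * conv u y k" for k
          unfolding ic(3) y_def[abs_def] using conv_linear[of u c "\<lambda>j. if j = i then 1 else 0" 0 "\<lambda>_. 0" k] by simp
        then show ?thesis by (simp add: matrix_row_def modulated_def sum_distrib_left mult_ac)
      qed
      have rows: "(\<Sum>s\<in>I. (matrix_row u v m g x s)\<^sup>2) = (\<Sum>s\<in>I. (matrix_row u v m g y s)\<^sup>2)"
        by (simp add: row power_mult_distrib ic(2))
      define a where "a = \<Gamma> * (l / sqrt (real m))"
      have a0: "a \<ge> 0" using \<Gamma> l_ge by (simp add: a_def)
      have K': "0 \<le> K'" "K' \<le> 2 * a"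
      proof -
        have "K' = 2 * sqrt (\<tau> / real m)"
          unfolding K'_def by (simp add: real_sqrt_mult real_sqrt_divide)
        then show "0 \<le> K'" "K' \<le> 2 * a" using diag_rad_le(4)[OF m0(1)] \<tau>_nonneg by (auto simp: a_def)
      qed
      have \<eta>a: "\<eta> \<le> 4 * a + 8 * a\<^sup>2" using \<eta>(3) by (simp only: a_def)
      have "dg z g \<le> 1 + \<eta>" if "z \<in> X" for z using dg[of z] conv_y[OF that] by simp
      then have "\<bar>(\<Sum>s\<in>I. (matrix_row u v m g y s)\<^sup>2) - dg y g\<bar> \<le> 4 * K' * sqrt (2 * (1 + \<eta>) + 32 * K'\<^sup>2)"
        using ev big yX unfolding E4_def by blast
      also have "\<dots> \<le> 4 * (2 * a) * (2 + 12 * a)"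
      proof (intro mult_mono mult_left_mono K')
        have "K'\<^sup>2 \<le> (2 * a)\<^sup>2" using K' by (intro power_mono)
        then have "2 * (1 + \<eta>) + 32 * K'\<^sup>2 \<le> 2 + 8 * a + 144 * a\<^sup>2" using \<eta>a by (simp add: power2_eq_square)
        also have "\<dots> \<le> (2 + 12 * a)\<^sup>2" using a0 by (simp add: power2_eq_square algebra_simps)
        finally show "sqrt (2 * (1 + \<eta>) + 32 * K'\<^sup>2) \<le> 2 + 12 * a" using a0 by (intro real_le_lsqrt) auto
      qed (use K' a0 \<eta> in auto)
      also have "\<dots> = 16 * a + 96 * a\<^sup>2" by (simp add: power2_eq_square algebra_simps)
      finally have 1: "\<bar>(\<Sum>s\<in>I. (matrix_row u v m g y s)\<^sup>2) - dg y g\<bar> \<le> 16 * a + 96 * a\<^sup>2" .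
      have 2: "\<bar>dg y g - 1\<bar> \<le> 4 * a + 8 * a\<^sup>2" using dg[of y] conv_y[OF yX] \<eta>a by simp
      have a\<phi>: "a \<le> \<Gamma>\<^sup>2 * \<phi> m"
      proof -
        have "l / sqrt (real m) \<le> \<phi> m" using l_ge self_le_power[of l 2] by (intro le_\<phi>) auto
        then have "a \<le> \<Gamma> * \<phi> m" unfolding a_def using \<Gamma> by (intro mult_left_mono) auto
        also have "\<dots> \<le> \<Gamma>\<^sup>2 * \<phi> m" using \<Gamma> self_le_power[of \<Gamma> 2] \<phi>_nonneg by (intro mult_right_mono) auto
        finally show ?thesis .
      qed
      \<comment> \<open>Although a may exceed 1 here, its square has the full power of m in the
        denominator, and l^2 / m <= l^2 / sqrt m <= \<phi> m.\<close>
      have a2\<phi>: "a\<^sup>2 \<le> \<Gamma>\<^sup>2 * \<phi> m"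
      proof -
        have "a\<^sup>2 = \<Gamma>\<^sup>2 * (l\<^sup>2 / real m)" by (simp add: a_def power_mult_distrib power_divide)
        also have "\<dots> \<le> \<Gamma>\<^sup>2 * (l\<^sup>2 / sqrt (real m))"
        proof (intro mult_left_mono divide_left_mono)
          have "real m \<le> (real m)\<^sup>2" using m0 by (intro self_le_power) auto
          then show "sqrt (real m) \<le> real m" by (intro real_le_lsqrt) auto
        qed (use m0 in auto)
        also have "\<dots> \<le> \<Gamma>\<^sup>2 * \<phi> m" using le_\<phi>[of "l\<^sup>2" m] by (intro mult_left_mono) auto
        finally show ?thesis .
      qed
      have "\<rho> m * sqrt (real r) = 10 ^ 6 * (\<Gamma>\<^sup>2 * \<phi> m)" by (simp add: r1 \<rho>_def c2_def)
      moreover have "0 \<le> \<Gamma>\<^sup>2 * \<phi> m" using \<phi>_nonneg by simp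
      moreover from this have "124 * (\<Gamma>\<^sup>2 * \<phi> m) \<le> 10 ^ 6 * (\<Gamma>\<^sup>2 * \<phi> m)" by (intro mult_right_mono) auto
      ultimately have "124 * (\<Gamma>\<^sup>2 * \<phi> m) \<le> \<rho> m * sqrt (real r)" by (simp only:)
      then show ?thesis unfolding rows using 1 2 a\<phi> a2\<phi> by linarith
    qed
    moreover have "\<bar>\<Sum>s<n. y s * matrix_row u v m g x s\<bar> \<le> \<rho> m * sqrt (real r)"
      if r: "r \<in> {1..r0}" and x: "x \<in> sparse_fun n r" and y: "y \<in> sparse_fun n r" for r x y
    proof -
      have q0: "\<Gamma> * (\<phi> m * sqrt (real r)) \<ge> 0" using \<Gamma> \<phi>_nonneg by simp
      have "\<bar>\<Sum>s<n. y s * matrix_row u v m g x s\<bar> \<le> 2 * K r" using ev r x y unfolding E3_def by blast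
      also have "\<dots> \<le> 27200 * (\<Gamma> * (\<phi> m * sqrt (real r)))"
      proof -
        have "K r \<le> 13600 * (\<Gamma> * (\<phi> m * sqrt (real r)))"
          using chain_bound_gauss[of m r] by (simp only: K_def mult.assoc)
        then show ?thesis by linarith
      qed
      also have "\<dots> \<le> 10 ^ 6 * (\<Gamma> * (\<Gamma> * (\<phi> m * sqrt (real r))))"
      proof -
        have "\<Gamma> * (\<phi> m * sqrt (real r)) \<le> \<Gamma> * (\<Gamma> * (\<phi> m * sqrt (real r)))"
          using mult_right_mono[OF \<Gamma> q0] by (simp only: mult_1)
        then have "27200 * (\<Gamma> * (\<phi> m * sqrt (real r))) \<le> 1000000 * (\<Gamma> * (\<Gamma> * (\<phi> m * sqrt (real r))))"
          using q0 by linarith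
        then show ?thesis by simp
      qed
      also have "\<dots> = \<rho> m * sqrt (real r)" by (simp add: \<rho>_def c2_def power2_eq_square mult_ac)
      finally show ?thesis .
    qed
    ultimately show "third_good I r0 u v g" by (simp add: third_good_def m)
  qed
qed

end

subsection \<open>Strong regularity in coordinates\<close>

lemma sorted_nth_bij:
  assumes "finite I"
  shows "bij_betw (\<lambda>k. sorted_list_of_set I ! k) {..<card I} I"
  using bij_betw_nth[of "sorted_list_of_set I" "{..<card I}" I] assms by simp

lemma sparse_fun_of_vec:
  assumes "x \<in> carrier_vec n" "card (vec_support x) \<le> r" "l2norm x \<le> 1"
  defines "f \<equiv> \<lambda>i. if i < n then x $ i else 0"
  shows "f \<in> sparse_fun n r" "(\<Sum>i<n. (f i)\<^sup>2) = (l2norm x)\<^sup>2"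
proof -
  have "(\<Sum>i<n. (f i)\<^sup>2) = scalar_prod x x"
    using assms by (simp add: scalar_prod_def lessThan_atLeast0 power2_eq_square)
  moreover have nn: "0 \<le> scalar_prod x x" by (simp add: scalar_prod_def sum_nonneg)
  ultimately show s: "(\<Sum>i<n. (f i)\<^sup>2) = (l2norm x)\<^sup>2" by (simp add: l2norm_def)
  have "l2norm x \<ge> 0" using nn by (simp add: l2norm_def)
  then have "(l2norm x)\<^sup>2 \<le> 1" using assms by (simp add: power_le_one)
  moreover have "{i. f i \<noteq> 0} = vec_support x" using assms by (auto simp: vec_support_def)
  ultimately show "f \<in> sparse_fun n r" using assms s by (auto simp: sparse_fun_def)
qed

lemma vec_of_sparse_fun:
  assumes "f \<in> sparse_fun n r"
  defines "x \<equiv> Matrix.vec n f"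
  shows "x \<in> carrier_vec n" "card (vec_support x) \<le> r" "(l2norm x)\<^sup>2 = (\<Sum>i<n. (f i)\<^sup>2)" "l2norm x \<le> 1"
    "(\<lambda>i. if i < n then x $ i else 0) = f"
proof -
  have z: "f i = 0" if "\<not> i < n" for i using assms that by (simp add: sparse_fun_def)
  show "x \<in> carrier_vec n" by (simp add: x_def)
  show "(\<lambda>i. if i < n then x $ i else 0) = f" using z by (auto simp: x_def)
  have "i \<in> vec_support x \<longleftrightarrow> f i \<noteq> 0" for i
    by (cases "i < n") (simp_all add: vec_support_def x_def z)
  then have "vec_support x = {i. f i \<noteq> 0}" by blast
  then show "card (vec_support x) \<le> r" using assms by (simp add: sparse_fun_def)
  have sp: "scalar_prod x x = (\<Sum>i<n. (f i)\<^sup>2)"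
    by (simp add: x_def scalar_prod_def lessThan_atLeast0 power2_eq_square)
  then show "(l2norm x)\<^sup>2 = (\<Sum>i<n. (f i)\<^sup>2)" by (simp add: l2norm_def sum_nonneg)
  show "l2norm x \<le> 1" unfolding l2norm_def sp using assms(1) by (simp add: sparse_fun_def)
qed

lemma smult_mat_mult_vec:
  fixes A :: "real mat"
  assumes "A \<in> carrier_mat p q" "x \<in> carrier_vec q"
  shows "(c \<cdot>\<^sub>m A) *\<^sub>v x = c \<cdot>\<^sub>v (A *\<^sub>v x)"
proof (rule eq_vecI)
  fix i assume "i < dim_vec (c \<cdot>\<^sub>v (A *\<^sub>v x))"
  then have i: "i < dim_row A" by simp
  have "row A i \<in> carrier_vec q" using assms i by auto
  then show "((c \<cdot>\<^sub>m A) *\<^sub>v x) $ i = (c \<cdot>\<^sub>v (A *\<^sub>v x)) $ i"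
    using i assms(2) by simp
qed simp

context scales
begin

text \<open>Associativity carries the vector through the factors, and the final substitution l -> s
  - l exchanges g with the modulated convolution.\<close>

lemma B_mat_mult_vec:
  assumes I: "I \<subseteq> {..<n}" and x: "x \<in> carrier_vec n" and k: "k < card I"
  shows "(B_mat n I (Matrix.vec n g) (Matrix.vec n u) (Matrix.vec n v) *\<^sub>v x) $ k
    = matrix_row u v (card I) g (\<lambda>i. if i < n then x $ i else 0) (sorted_list_of_set I ! k)"
proof -
  let ?f = "\<lambda>i. if i < n then x $ i else 0"
  let ?s = "sorted_list_of_set I ! k"
  define y1 where "y1 = (1 / sqrt (real n)) \<cdot>\<^sub>v circ_conv n (Matrix.vec n u) x"
  define y2 where "y2 = mat_diag n (\<lambda>i. Matrix.vec n v $ i) *\<^sub>v y1"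
  have fin: "finite I" using I finite_subset by auto
  have s: "?s < n" using sorted_nth_bij[OF fin] k I by (auto simp: bij_betw_def)
  have c1: "y1 \<in> carrier_vec n" by (simp add: y1_def circ_conv_def)
  have c2: "y2 \<in> carrier_vec n"
    unfolding y2_def by (rule mult_mat_vec_carrier[OF _ c1]) simp
  have y1: "y1 $ j = conv u ?f j" if "j < n" for j
    using that cyc_diff_less[OF n_pos]
    by (simp add: y1_def circ_conv_def conv_def cyc_diff_def[symmetric])
  have y2: "y2 $ j = v j * conv u ?f j" if "j < n" for j
  proof -
    have "y2 $ j = (\<Sum>i\<in>{0..<n}. (if j = i then Matrix.vec n v $ i else 0) * y1 $ i)"
      using that c1 unfolding y2_def by (simp add: mat_diag_def scalar_prod_def)
    also have "\<dots> = (\<Sum>i\<in>{0..<n}. (if j = i then v j * y1 $ i else 0))"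
      using that by (intro sum.cong refl) auto
    finally show ?thesis using that y1[OF that] by simp
  qed
  have R: "restrict_mat n I \<in> carrier_mat (card I) n" by (simp add: restrict_mat_def)
  have G: "circ_mat n a \<in> carrier_mat n n" for a by (simp add: circ_mat_def)
  have D: "mat_diag n a \<in> carrier_mat n n" for a :: "nat \<Rightarrow> real" by simp
  have E: "((1 / sqrt (real n)) \<cdot>\<^sub>m circ_mat n (Matrix.vec n u)) *\<^sub>v x = y1"
    unfolding y1_def circ_mat_mult_vec[OF x, symmetric]
    by (rule smult_mat_mult_vec[OF G x])
  let ?M = "restrict_mat n I * circ_mat n (Matrix.vec n g) * mat_diag n (\<lambda>i. Matrix.vec n v $ i) *
         ((1 / sqrt (real n)) \<cdot>\<^sub>m circ_mat n (Matrix.vec n u))"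
  have RG: "restrict_mat n I * circ_mat n (Matrix.vec n g) \<in> carrier_mat (card I) n"
    by (rule mult_carrier_mat[OF R G])
  have RGD: "restrict_mat n I * circ_mat n (Matrix.vec n g) * mat_diag n (\<lambda>i. Matrix.vec n v $ i) \<in> carrier_mat (card I) n"
    by (rule mult_carrier_mat[OF RG D])
  have "?M *\<^sub>v x = restrict_mat n I * circ_mat n (Matrix.vec n g) * mat_diag n (\<lambda>i. Matrix.vec n v $ i) *\<^sub>v y1"
    unfolding E[symmetric] by (rule assoc_mult_mat_vec[OF RGD smult_carrier_mat[OF G] x])
  also have "\<dots> = restrict_mat n I * circ_mat n (Matrix.vec n g) *\<^sub>v y2"
    unfolding y2_def by (rule assoc_mult_mat_vec[OF RG D c1])
  also have "\<dots> = restrict_mat n I *\<^sub>v (circ_mat n (Matrix.vec n g) *\<^sub>v y2)"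
    by (rule assoc_mult_mat_vec[OF R G c2])
  also have "\<dots> = restrict_mat n I *\<^sub>v circ_conv n (Matrix.vec n g) y2"
    by (simp only: circ_mat_mult_vec[OF c2])
  also have "\<dots> = Matrix.vec (card I) (\<lambda>k. circ_conv n (Matrix.vec n g) y2 $ (sorted_list_of_set I ! k))"
    by (rule restrict_mat_mult_vec[OF I]) (simp add: circ_conv_def)
  finally have Mx: "(?M *\<^sub>v x) $ k = circ_conv n (Matrix.vec n g) y2 $ ?s" using k by simp
  have dM: "?M \<in> carrier_mat (card I) n" by (rule mult_carrier_mat[OF RGD smult_carrier_mat[OF G]])
  have "(B_mat n I (Matrix.vec n g) (Matrix.vec n u) (Matrix.vec n v) *\<^sub>v x) $ k = 1 / sqrt (real (card I)) * (?M *\<^sub>v x) $ k"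
  proof -
    have "k < dim_vec (?M *\<^sub>v x)" using mult_mat_vec_carrier[OF dM x] k unfolding carrier_vec_def by simp
    then show ?thesis unfolding B_mat_def smult_mat_mult_vec[OF dM x] by (rule index_smult_vec(1))
  qed
  also have "\<dots> = 1 / sqrt (real (card I)) * (\<Sum>j<n. g (cyc_diff n ?s j) * (v j * conv u ?f j))"
    unfolding Mx using s cyc_diff_less[OF n_pos] by (simp add: circ_conv_def cyc_diff_def[symmetric] y2)
  also have "(\<Sum>j<n. g (cyc_diff n ?s j) * (v j * conv u ?f j))
     = (\<Sum>l<n. g (cyc_diff n ?s (cyc_diff n ?s l)) * (v (cyc_diff n ?s l) * conv u ?f (cyc_diff n ?s l)))"
    by (rule sum.reindex_bij_betw[OF bij_cyc_diff_right[OF n_pos], symmetric])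
  also have "1 / sqrt (real (card I)) * \<dots> = matrix_row u v (card I) g ?f ?s"
    unfolding matrix_row_def modulated_def sum_distrib_left
    by (intro sum.cong refl) (simp add: cyc_diff_invol)
  finally show ?thesis .
qed

lemma B_mat_dims:
  "dim_col (B_mat n I g u v) = n" "dim_row (B_mat n I g u v) = card I"
  by (auto simp: B_mat_def restrict_mat_def circ_mat_def)

text \<open>A real supremum bounds its elements only if the set is bounded above. With g, u and v
  fixed, this bound lets the suprema in the definitions be read as universal statements.\<close>

lemma row_bounded: "\<exists>C. \<forall>x\<in>sparse_fun n r. \<forall>s. \<bar>matrix_row u v m g x s\<bar> \<le> C"
proof -
  define C1 where "C1 j = (\<Sum>i<n. \<bar>u (cyc_diff n j i)\<bar>) / sqrt (real n)" for j
  define C2 where "C2 = (\<Sum>j<n. \<bar>v j\<bar> * C1 j)"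
  have C1: "\<bar>conv u x j\<bar> \<le> C1 j" if x: "x \<in> sparse_fun n r" for x j
  proof -
    have "\<bar>\<Sum>i<n. u (cyc_diff n j i) * x i\<bar> \<le> (\<Sum>i<n. \<bar>u (cyc_diff n j i) * x i\<bar>)" by (rule sum_abs)
    also have "\<dots> \<le> (\<Sum>i<n. \<bar>u (cyc_diff n j i)\<bar> * 1)"
      unfolding abs_mult using sparse_fun_abs_le_1[OF x] by (intro sum_mono mult_left_mono) auto
    finally show ?thesis unfolding conv_def C1_def by (simp add: divide_right_mono)
  qed
  have "\<bar>matrix_row u v m g x s\<bar> \<le> (\<Sum>l<n. C2 / sqrt (real m) * \<bar>g l\<bar>)" if x: "x \<in> sparse_fun n r" for x s
  proof -
    have "\<bar>matrix_row u v m g x s\<bar> \<le> (\<Sum>l<n. \<bar>modulated u v m x s l * g l\<bar>)"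
      unfolding matrix_row_def by (rule sum_abs)
    also have "\<dots> \<le> (\<Sum>l<n. C2 / sqrt (real m) * \<bar>g l\<bar>)"
      unfolding abs_mult
    proof (intro sum_mono mult_right_mono)
      fix k
      let ?j = "cyc_diff n s k"
      have "\<bar>v ?j * conv u x ?j\<bar> \<le> \<bar>v ?j\<bar> * C1 ?j" unfolding abs_mult using C1[OF x] by (intro mult_left_mono) auto
      also have "\<dots> \<le> C2"
        unfolding C2_def using cyc_diff_less[OF n_pos, of s k]
        by (intro member_le_sum) (auto simp: C1_def intro!: mult_nonneg_nonneg divide_nonneg_nonneg sum_nonneg)
      finally show "\<bar>modulated u v m x s k\<bar> \<le> C2 / sqrt (real m)"
        unfolding modulated_def abs_divide by (simp add: divide_right_mono)
    qed auto
    finally show ?thesis .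
  qed
  then show ?thesis by blast
qed

lemma unit_sparse_fun: "1 \<le> r \<Longrightarrow> (\<lambda>i. if i = 0 then 1 else 0) \<in> sparse_fun n r \<and> (\<Sum>i<n. (if i = 0 then 1 else 0 :: real)\<^sup>2) = 1"
proof -
  assume r: "1 \<le> r"
  have "(\<Sum>i<n. (if i = 0 then 1 else 0 :: real)\<^sup>2) = (\<Sum>i\<in>{0::nat}. (if i = 0 then 1 else 0 :: real)\<^sup>2)"
    using n_pos by (intro sum.mono_neutral_right) auto
  then show ?thesis using r n_pos by (auto simp: sparse_fun_def)
qed

lemma RIP_iff:
  assumes I: "I \<subseteq> {..<n}" and r: "1 \<le> r"
  shows "RIP (B_mat n I (Matrix.vec n g) (Matrix.vec n u) (Matrix.vec n v)) r \<delta> \<longleftrightarrow>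
    (\<forall>f\<in>{f\<in>sparse_fun n r. (\<Sum>i<n. (f i)\<^sup>2) = 1}. \<bar>(\<Sum>s\<in>I. (matrix_row u v (card I) g f s)\<^sup>2) - 1\<bar> \<le> \<delta>)"
proof -
  let ?B = "B_mat n I (Matrix.vec n g) (Matrix.vec n u) (Matrix.vec n v)"
  let ?F = "{f\<in>sparse_fun n r. (\<Sum>i<n. (f i)\<^sup>2) = 1}"
  let ?h = "\<lambda>f. \<bar>(\<Sum>s\<in>I. (matrix_row u v (card I) g f s)\<^sup>2) - 1\<bar>"
  have fin: "finite I" using I finite_subset by auto
  have "(\<lambda>x. \<bar>(l2norm (?B *\<^sub>v x))\<^sup>2 - (l2norm x)\<^sup>2\<bar>) ` sparse_sphere n r = ?h ` ?F"
  proof -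
    have val: "\<bar>(l2norm (?B *\<^sub>v x))\<^sup>2 - (l2norm x)\<^sup>2\<bar> = ?h (\<lambda>i. if i < n then x $ i else 0)"
      if x: "x \<in> carrier_vec n" "l2norm x = 1" for x
    proof -
      let ?f = "\<lambda>i. if i < n then x $ i else 0"
      have "(l2norm (?B *\<^sub>v x))\<^sup>2 = (\<Sum>k<card I. ((?B *\<^sub>v x) $ k)\<^sup>2)"
        by (simp add: l2norm_def scalar_prod_def sum_nonneg lessThan_atLeast0 power2_eq_square B_mat_dims)
      also have "\<dots> = (\<Sum>k<card I. (matrix_row u v (card I) g ?f (sorted_list_of_set I ! k))\<^sup>2)"
        by (intro sum.cong refl) (simp only: B_mat_mult_vec[OF I x(1)] lessThan_iff)
      also have "\<dots> = (\<Sum>s\<in>I. (matrix_row u v (card I) g ?f s)\<^sup>2)"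
        by (rule sum.reindex_bij_betw[OF sorted_nth_bij[OF fin]])
      finally show ?thesis using x by simp
    qed
    show ?thesis
    proof (intro equalityI image_subsetI)
      fix x assume "x \<in> sparse_sphere n r"
      then have x: "x \<in> carrier_vec n" "l2norm x = 1" "card (vec_support x) \<le> r" by (auto simp: sparse_sphere_def)
      show "\<bar>(l2norm (?B *\<^sub>v x))\<^sup>2 - (l2norm x)\<^sup>2\<bar> \<in> ?h ` ?F"
        unfolding val[OF x(1,2)] using sparse_fun_of_vec[OF x(1,3)] x(2) by (intro imageI) simp
    next
      fix f assume f: "f \<in> ?F"
      then have f': "f \<in> sparse_fun n r" by simp
      note v = vec_of_sparse_fun[OF f']
      have "l2norm (Matrix.vec n f) \<ge> 0" by (simp add: l2norm_def scalar_prod_def sum_nonneg)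
      moreover have "(l2norm (Matrix.vec n f))\<^sup>2 = 1" using v(3) f by simp
      ultimately have n1: "l2norm (Matrix.vec n f) = 1" by (simp add: power2_eq_1_iff)
      then have "Matrix.vec n f \<in> sparse_sphere n r" using v by (simp add: sparse_sphere_def)
      moreover have "?h f = \<bar>(l2norm (?B *\<^sub>v Matrix.vec n f))\<^sup>2 - (l2norm (Matrix.vec n f))\<^sup>2\<bar>"
        unfolding val[OF v(1) n1] v(5) ..
      ultimately show "?h f \<in> (\<lambda>x. \<bar>(l2norm (?B *\<^sub>v x))\<^sup>2 - (l2norm x)\<^sup>2\<bar>) ` sparse_sphere n r" by blast
    qed
  qed
  then have "RIP ?B r \<delta> \<longleftrightarrow> Sup (?h ` ?F) \<le> \<delta>" by (simp only: RIP_def B_mat_dims)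
  also have "\<dots> \<longleftrightarrow> (\<forall>f\<in>?F. ?h f \<le> \<delta>)"
  proof (rule cSUP_le_iff)
    show "?F \<noteq> {}" using unit_sparse_fun[OF r] by blast
    obtain C where C: "\<And>x s. x \<in> sparse_fun n r \<Longrightarrow> \<bar>matrix_row u v (card I) g x s\<bar> \<le> C" using row_bounded[of r u v "card I" g] by blast
    have "?h f \<le> (\<Sum>s\<in>I. C\<^sup>2) + 1" if f: "f \<in> ?F" for f
    proof -
      have "(\<Sum>s\<in>I. (matrix_row u v (card I) g f s)\<^sup>2) \<le> (\<Sum>s\<in>I. C\<^sup>2)"
      proof (rule sum_mono)
        fix s
        have "\<bar>matrix_row u v (card I) g f s\<bar>\<^sup>2 \<le> C\<^sup>2" using C[of f s] f by (intro power_mono) auto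
        then show "(matrix_row u v (card I) g f s)\<^sup>2 \<le> C\<^sup>2" by simp
      qed
      moreover have "0 \<le> (\<Sum>s\<in>I. (matrix_row u v (card I) g f s)\<^sup>2)" by (simp add: sum_nonneg)
      ultimately show ?thesis by linarith
    qed
    then show "bdd_above (?h ` ?F)" by (intro bdd_aboveI) auto
  qed
  finally show ?thesis .
qed

lemma topk_iff:
  assumes I: "I \<subseteq> {..<n}" and r: "1 \<le> r"
  shows "(SUP x \<in> sparse_ball (dim_col (B_mat n I (Matrix.vec n g) (Matrix.vec n u) (Matrix.vec n v))) r.
      topk_norm r (B_mat n I (Matrix.vec n g) (Matrix.vec n u) (Matrix.vec n v) *\<^sub>v x)) \<le> \<delta> \<longleftrightarrow>
    (\<forall>f\<in>sparse_fun n r. \<forall>J\<in>{J. J \<subseteq> {..<card I} \<and> card J = min r (card I)}.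
       L2_set (\<lambda>k. matrix_row u v (card I) g f (sorted_list_of_set I ! k)) J \<le> \<delta>)"
proof -
  let ?B = "B_mat n I (Matrix.vec n g) (Matrix.vec n u) (Matrix.vec n v)"
  let ?J = "{J. J \<subseteq> {..<card I} \<and> card J = min r (card I)}"
  let ?row = "\<lambda>f k. matrix_row u v (card I) g f (sorted_list_of_set I ! k)"
  let ?t = "\<lambda>f. SUP J\<in>?J. L2_set (?row f) J"
  have finJ: "finite ?J" by (rule finite_subset[of _ "Pow {..<card I}"]) auto
  have neJ: "?J \<noteq> {}"
  proof -
    have "{..<min r (card I)} \<in> ?J" by auto
    then show ?thesis by blast
  qed
  have t_le: "?t f \<le> b \<longleftrightarrow> (\<forall>J\<in>?J. L2_set (?row f) J \<le> b)" for f b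
    using finJ neJ by (intro cSUP_le_iff) auto
  have val: "topk_norm r (?B *\<^sub>v x) = ?t (\<lambda>i. if i < n then x $ i else 0)" if x: "x \<in> carrier_vec n" for x
  proof -
    have "sqrt (\<Sum>i\<in>J. ((?B *\<^sub>v x) $ i)\<^sup>2) = L2_set (?row (\<lambda>i. if i < n then x $ i else 0)) J" if "J \<in> ?J" for J
      unfolding L2_set_def using that
      by (intro arg_cong[where f = sqrt] sum.cong refl) (auto simp: B_mat_mult_vec[OF I x])
    then show ?thesis unfolding topk_norm_def by (simp add: B_mat_dims)
  qed
  have "(\<lambda>x. topk_norm r (?B *\<^sub>v x)) ` sparse_ball n r = ?t ` sparse_fun n r"
  proof (intro equalityI image_subsetI)
    fix x assume "x \<in> sparse_ball n r"
    then have x: "x \<in> carrier_vec n" "card (vec_support x) \<le> r" "l2norm x \<le> 1" by (auto simp: sparse_ball_def)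
    show "topk_norm r (?B *\<^sub>v x) \<in> ?t ` sparse_fun n r"
      unfolding val[OF x(1)] using sparse_fun_of_vec(1)[OF x] by (rule imageI)
  next
    fix f assume f: "f \<in> sparse_fun n r"
    note v = vec_of_sparse_fun[OF f]
    have "Matrix.vec n f \<in> sparse_ball n r" using v by (simp add: sparse_ball_def)
    moreover have "?t f = topk_norm r (?B *\<^sub>v Matrix.vec n f)" unfolding val[OF v(1)] v(5) ..
    ultimately show "?t f \<in> (\<lambda>x. topk_norm r (?B *\<^sub>v x)) ` sparse_ball n r" by blast
  qed
  then have eq1: "(SUP x \<in> sparse_ball (dim_col ?B) r. topk_norm r (?B *\<^sub>v x)) = Sup (?t ` sparse_fun n r)"
    by (simp only: B_mat_dims)
  have eq2: "Sup (?t ` sparse_fun n r) \<le> \<delta> \<longleftrightarrow> (\<forall>f\<in>sparse_fun n r. ?t f \<le> \<delta>)"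
  proof (rule cSUP_le_iff)
    show "sparse_fun n r \<noteq> {}" using unit_sparse_fun[OF r] by blast
    obtain C where C: "\<And>x s. x \<in> sparse_fun n r \<Longrightarrow> \<bar>matrix_row u v (card I) g x s\<bar> \<le> C" using row_bounded[of r u v "card I" g] by blast
    have "?t f \<le> (\<Sum>k<card I. C)" if f: "f \<in> sparse_fun n r" for f
      unfolding t_le
    proof
      fix J assume J: "J \<in> ?J"
      have C0: "C \<ge> 0" using C[OF f, of 0] by linarith
      have "L2_set (?row f) J \<le> (\<Sum>k\<in>J. \<bar>?row f k\<bar>)" by (rule L2_set_le_sum_abs)
      also have "\<dots> \<le> (\<Sum>k\<in>J. C)" by (intro sum_mono C[OF f])
      also have "\<dots> \<le> (\<Sum>k<card I. C)" using J C0 by (intro sum_mono2) auto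
      finally show "L2_set (?row f) J \<le> (\<Sum>k<card I. C)" .
    qed
    then show "bdd_above (?t ` sparse_fun n r)" by (intro bdd_aboveI) blast
  qed
  show ?thesis unfolding eq1 eq2 by (intro ball_cong refl t_le)
qed

lemma strongly_regular_iff:
  assumes I: "I \<subseteq> {..<n}"
  shows "rho_strongly_regular p (B_mat n I (Matrix.vec n g) (Matrix.vec n u) (Matrix.vec n v)) \<longleftrightarrow>
    (\<forall>r\<in>{1..s_level p}.
      (\<forall>f\<in>{f\<in>sparse_fun n r. (\<Sum>i<n. (f i)\<^sup>2) = 1}. \<bar>(\<Sum>s\<in>I. (matrix_row u v (card I) g f s)\<^sup>2) - 1\<bar> \<le> p * sqrt (real r)) \<and>
      (\<forall>f\<in>sparse_fun n r. \<forall>J\<in>{J. J \<subseteq> {..<card I} \<and> card J = min r (card I)}.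
       L2_set (\<lambda>k. matrix_row u v (card I) g f (sorted_list_of_set I ! k)) J \<le> p * sqrt (real r)))"
proof -
  let ?B = "B_mat n I (Matrix.vec n g) (Matrix.vec n u) (Matrix.vec n v)"
  have "rho_strongly_regular p ?B \<longleftrightarrow> (\<forall>r\<in>{1..s_level p}. RIP ?B r (p * sqrt (real r)) \<and>
      (SUP x \<in> sparse_ball (dim_col ?B) r. topk_norm r (?B *\<^sub>v x)) \<le> p * sqrt (real r))"
    unfolding rho_strongly_regular_def rho_regular_def Ball_def atLeastAtMost_iff by blast
  then show ?thesis
    by (rule trans) (intro ball_cong refl conj_cong RIP_iff[OF I] topk_iff[OF I]; simp)
qed

text \<open>The norm over J is attained by testing against the normalised restriction of B x to the
  corresponding rows. This test vector has norm 1 and at most r nonzero coordinates.\<close>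

lemma third_good_strongly_regular:
  assumes I: "I \<subseteq> {..<n}" and g: "third_good I (s_level (\<rho> (card I))) u v g"
  shows "rho_strongly_regular (\<rho> (card I)) (B_mat n I (Matrix.vec n g) (Matrix.vec n u) (Matrix.vec n v))"
  unfolding strongly_regular_iff[OF I]
proof (intro ballI conjI)
  fix r assume r: "r \<in> {1..s_level (\<rho> (card I))}"
  have fin: "finite I" using I finite_subset by auto
  show "\<bar>(\<Sum>s\<in>I. (matrix_row u v (card I) g f s)\<^sup>2) - 1\<bar> \<le> \<rho> (card I) * sqrt (real r)"
    if "f \<in> {f\<in>sparse_fun n r. (\<Sum>i<n. (f i)\<^sup>2) = 1}" for f
    using g r that by (auto simp: third_good_def)
  fix f J assume f: "f \<in> sparse_fun n r" and "J \<in> {J. J \<subseteq> {..<card I} \<and> card J = min r (card I)}"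
  then have J: "J \<subseteq> {..<card I}" "card J \<le> r" by auto
  have finJ: "finite J" using J finite_subset by auto
  let ?s = "\<lambda>k. sorted_list_of_set I ! k"
  let ?row = "\<lambda>s. matrix_row u v (card I) g f s"
  define M where "M = L2_set (\<lambda>k. ?row (?s k)) J"
  have M2: "M\<^sup>2 = (\<Sum>k\<in>J. (?row (?s k))\<^sup>2)" by (simp add: M_def L2_set_def sum_nonneg)
  show "L2_set (\<lambda>k. ?row (?s k)) J \<le> \<rho> (card I) * sqrt (real r)"
  proof (cases "M = 0")
    case True
    then show ?thesis using \<phi>_nonneg by (simp add: M_def \<rho>_def c2_def)
  next
    case False
    define S where "S = ?s ` J"
    have inj: "inj_on ?s J" using sorted_nth_bij[OF fin] J by (meson bij_betw_def inj_on_subset)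
    have S: "S \<subseteq> {..<n}" using sorted_nth_bij[OF fin] J I by (auto simp: S_def bij_betw_def)
    have cS: "card S \<le> r" "finite S" using J finJ card_image[OF inj] by (auto simp: S_def)
    have S2: "(\<Sum>s\<in>S. (?row s)\<^sup>2) = M\<^sup>2" unfolding M2 S_def using inj by (simp add: sum.reindex)
    define y where "y s = (if s \<in> S then ?row s / M else 0)" for s
    have "(\<Sum>s<n. (y s)\<^sup>2) = (\<Sum>s\<in>S. (?row s / M)\<^sup>2)"
      using S by (intro sum.mono_neutral_cong_right) (auto simp: y_def)
    also have "\<dots> = 1" using False by (simp add: power_divide S2 flip: sum_divide_distrib)
    finally have y1: "(\<Sum>s<n. (y s)\<^sup>2) = 1" .
    have "card {s. y s \<noteq> 0} \<le> card S" using cS by (intro card_mono) (auto simp: y_def)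
    then have y: "y \<in> sparse_fun n r" using y1 cS S by (auto simp: sparse_fun_def y_def)
    have "(\<Sum>s<n. y s * ?row s) = (\<Sum>s\<in>S. ?row s / M * ?row s)"
      using S by (intro sum.mono_neutral_cong_right) (auto simp: y_def)
    also have "\<dots> = (\<Sum>s\<in>S. (?row s)\<^sup>2) / M" by (simp add: power2_eq_square sum_divide_distrib)
    also have "\<dots> = M" unfolding S2 using False by (simp add: power2_eq_square)
    finally have "M = (\<Sum>s<n. y s * ?row s)" by simp
    also have "\<dots> \<le> \<rho> (card I) * sqrt (real r)" using g r f y unfolding third_good_def by (meson abs_le_D1)
    finally show ?thesis by (simp only: M_def)
  qed
qed

end

subsection \<open>Probability of strong regularity\<close>

text \<open>The function space is separable, so S has a countable dense subset, and continuity in x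
  extends the bound from it to S.\<close>

lemma measurable_ball_le:
  fixes S :: "(nat \<Rightarrow> real) set"
  assumes meas: "\<And>x. x \<in> S \<Longrightarrow> H x \<in> borel_measurable M"
    and cont: "\<And>\<omega>. continuous_on UNIV (\<lambda>x. H x \<omega>)"
  shows "{\<omega>\<in>space M. \<forall>x\<in>S. H x \<omega> \<le> (c::real)} \<in> sets M"
proof -
  obtain T where T: "countable T" "T \<subseteq> S" "S \<subseteq> closure T" using separable by blast
  have "(\<forall>x\<in>S. H x \<omega> \<le> c) \<longleftrightarrow> (\<forall>x\<in>T. H x \<omega> \<le> c)" for \<omega>
  proof
    assume a: "\<forall>x\<in>T. H x \<omega> \<le> c"
    have "closed {x. H x \<omega> \<le> c}" by (rule closed_Collect_le[OF cont continuous_on_const])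
    then have "closure T \<subseteq> {x. H x \<omega> \<le> c}" using a by (intro closure_minimal) auto
    then show "\<forall>x\<in>S. H x \<omega> \<le> c" using T(3) by blast
  qed (use T(2) in blast)
  moreover have "{\<omega>\<in>space M. \<forall>x\<in>T. H x \<omega> \<le> c} \<in> sets M"
  proof (rule sets.sets_Collect_countable_All'[OF _ T(1)])
    fix x assume "x \<in> T"
    then have [measurable]: "H x \<in> borel_measurable M" using T(2) meas by blast
    show "{\<omega>\<in>space M. H x \<omega> \<le> c} \<in> sets M" by measurable
  qed
  ultimately show ?thesis by simp
qed

text \<open>Fubini: sections over good points have measure at most p2, and over the exceptional set
  supplied by \<open>whp\<close> the trivial bound 1 is used.\<close>

lemma emeasure_pair_le_left:
  assumes "prob_space M1" "prob_space M2" and A: "A \<in> sets (M1 \<Otimes>\<^sub>M M2)"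
    and good: "whp M1 p1 Good" and p: "p1 \<ge> 0" "p2 \<ge> 0"
    and sec: "\<And>x. x \<in> space M1 \<Longrightarrow> Good x \<Longrightarrow> emeasure M2 (Pair x -` A) \<le> ennreal p2"
  shows "emeasure (M1 \<Otimes>\<^sub>M M2) A \<le> ennreal (p1 + p2)"
proof -
  interpret M1: prob_space M1 by fact
  interpret M2: prob_space M2 by fact
  obtain E where E: "E \<in> sets M1" "emeasure M1 E \<le> ennreal p1" "\<forall>x\<in>space M1 - E. Good x"
    using good unfolding whp_def by blast
  have "emeasure (M1 \<Otimes>\<^sub>M M2) A = (\<integral>\<^sup>+ x. emeasure M2 (Pair x -` A) \<partial>M1)"
    by (rule M2.emeasure_pair_measure_alt[OF A])
  also have "\<dots> \<le> (\<integral>\<^sup>+ x. indicator E x + ennreal p2 \<partial>M1)"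
  proof (rule nn_integral_mono)
    fix x assume x: "x \<in> space M1"
    show "emeasure M2 (Pair x -` A) \<le> indicator E x + ennreal p2"
    proof (cases "x \<in> E")
      case True
      have "emeasure M2 (Pair x -` A) \<le> 1" by (rule M2.emeasure_le_1)
      also have "\<dots> \<le> 1 + ennreal p2" by simp
      finally show ?thesis using True by simp
    next
      case False
      then show ?thesis using sec[OF x] E x by simp
    qed
  qed
  also have "\<dots> = emeasure M1 E + ennreal p2"
    using E by (simp add: nn_integral_add M1.emeasure_space_1)
  also have "\<dots> \<le> ennreal p1 + ennreal p2" using E by (intro add_mono) auto
  finally show ?thesis using p by simp
qed

lemma emeasure_pair_le_right:
  assumes "prob_space M1" "prob_space M2" and A: "A \<in> sets (M1 \<Otimes>\<^sub>M M2)"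
    and good: "whp M2 p1 Good" and p: "p1 \<ge> 0" "p2 \<ge> 0"
    and sec: "\<And>y. y \<in> space M2 \<Longrightarrow> Good y \<Longrightarrow> emeasure M1 ((\<lambda>x. (x, y)) -` A) \<le> ennreal p2"
  shows "emeasure (M1 \<Otimes>\<^sub>M M2) A \<le> ennreal (p1 + p2)"
proof -
  interpret M1: prob_space M1 by fact
  interpret M2: prob_space M2 by fact
  interpret pair_sigma_finite M1 M2 ..
  obtain E where E: "E \<in> sets M2" "emeasure M2 E \<le> ennreal p1" "\<forall>x\<in>space M2 - E. Good x"
    using good unfolding whp_def by blast
  have "emeasure (M1 \<Otimes>\<^sub>M M2) A = (\<integral>\<^sup>+ y. emeasure M1 ((\<lambda>x. (x, y)) -` A) \<partial>M2)"
    by (rule emeasure_pair_measure_alt2[OF A])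
  also have "\<dots> \<le> (\<integral>\<^sup>+ y. indicator E y + ennreal p2 \<partial>M2)"
  proof (rule nn_integral_mono)
    fix y assume y: "y \<in> space M2"
    show "emeasure M1 ((\<lambda>x. (x, y)) -` A) \<le> indicator E y + ennreal p2"
    proof (cases "y \<in> E")
      case True
      have "emeasure M1 ((\<lambda>x. (x, y)) -` A) \<le> 1" by (rule M1.emeasure_le_1)
      also have "\<dots> \<le> 1 + ennreal p2" by simp
      finally show ?thesis using True by simp
    next
      case False
      then show ?thesis using sec[OF y] E y by simp
    qed
  qed
  also have "\<dots> = emeasure M2 E + ennreal p2"
    using E by (simp add: nn_integral_add M2.emeasure_space_1)
  also have "\<dots> \<le> ennreal p1 + ennreal p2" using E by (intro add_mono) auto
  finally show ?thesis using p by simp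
qed

section \<open>Measurability of the events\<close>

definition sign_vectors :: "nat \<Rightarrow> (nat \<Rightarrow> real) set" where
  "sign_vectors n = PiE {..<n} (\<lambda>_. {- 1, 1})"

lemma rademacher_space: "space (rademacher.\<mu> n) = PiE {..<n} (\<lambda>_. UNIV)"
  by (simp add: space_PiM)

text \<open>There are finitely many sign vectors and their singletons are measurable. Hence every
  event within them is measurable, whatever suprema define it.\<close>

lemma sign_vectors_pair_sets:
  assumes "G \<subseteq> sign_vectors n \<times> sign_vectors n"
  shows "G \<in> sets (rademacher.\<mu> n \<Otimes>\<^sub>M rademacher.\<mu> n)"
proof -
  have fin: "finite G"
    by (rule finite_subset[OF assms]) (auto simp: sign_vectors_def intro!: finite_PiE)
  have single: "{u} \<in> sets (rademacher.\<mu> n)" if "u \<in> sign_vectors n" for u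
  proof -
    have "{u} = PiE {..<n} (\<lambda>i. {u i})"
      using that by (intro PiE_singleton[symmetric]) (simp add: sign_vectors_def PiE_def)
    moreover have "PiE {..<n} (\<lambda>i. {u i}) \<in> sets (rademacher.\<mu> n)"
      by (rule sets_PiM_I_finite) auto
    ultimately show ?thesis by simp
  qed
  have "{w} \<in> sets (rademacher.\<mu> n \<Otimes>\<^sub>M rademacher.\<mu> n)" if "w \<in> G" for w
  proof -
    have "{w} = {fst w} \<times> {snd w}" by auto
    moreover have "fst w \<in> sign_vectors n" "snd w \<in> sign_vectors n" using assms that by auto
    ultimately show ?thesis using pair_measureI[OF single single] by metis
  qed
  then have "(\<Union>w\<in>G. {w}) \<in> sets (rademacher.\<mu> n \<Otimes>\<^sub>M rademacher.\<mu> n)" using fin by (intro sets.finite_UN) auto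
  then show ?thesis by simp
qed

lemma joint_law_eq: "joint_law n = gauss.\<mu> n \<Otimes>\<^sub>M (rademacher.\<mu> n \<Otimes>\<^sub>M rademacher.\<mu> n)"
  by (simp add: joint_law_def gaussian_law_def rademacher_law_def)

context scales
begin

lemma row_measurable:
  "(\<lambda>\<omega>. matrix_row (fst (snd \<omega>)) (snd (snd \<omega>)) m (fst \<omega>) x s) \<in> borel_measurable (joint_law n)"
proof -
  have g: "(\<lambda>\<omega>. fst \<omega> k) \<in> borel_measurable (joint_law n)" if "k < n" for k
    unfolding joint_law_eq by (rule measurable_compose[OF measurable_fst gauss.coordinate_measurable[OF that]])
  have u: "(\<lambda>\<omega>. fst (snd \<omega>) k) \<in> borel_measurable (joint_law n)" if "k < n" for k
    unfolding joint_law_eq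
    by (rule measurable_compose[OF measurable_snd measurable_compose[OF measurable_fst rademacher.coordinate_measurable[OF that]]])
  have v: "(\<lambda>\<omega>. snd (snd \<omega>) k) \<in> borel_measurable (joint_law n)" if "k < n" for k
    unfolding joint_law_eq
    by (rule measurable_compose[OF measurable_snd measurable_compose[OF measurable_snd rademacher.coordinate_measurable[OF that]]])
  show ?thesis
    unfolding matrix_row_def modulated_def conv_def
    by (intro borel_measurable_sum borel_measurable_times borel_measurable_divide borel_measurable_const g u v cyc_diff_less n_pos)
      auto
qed

lemma row_continuous: "continuous_on UNIV (\<lambda>x. matrix_row u v m g x s)"
  unfolding matrix_row_def modulated_def conv_def divide_inverse
  by (intro continuous_on_sum continuous_on_mult continuous_on_const continuous_on_product_coordinates)

text \<open>Nonmeasurable sets are given measure 0, so a lower bound on the probability requires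
  this. J is quantified outside f, so that for each J a bound over a continuous family
  remains.\<close>

lemma strongly_regular_measurable:
  assumes I: "I \<subseteq> {..<n}"
  shows "{\<omega>\<in>space (joint_law n). rho_strongly_regular p (B_mat n I (Matrix.vec n (fst \<omega>)) (Matrix.vec n (fst (snd \<omega>))) (Matrix.vec n (snd (snd \<omega>))))}
    \<in> sets (joint_law n)"
proof -
  let ?M = "joint_law n"
  let ?row = "\<lambda>x s \<omega>. matrix_row (fst (snd \<omega>)) (snd (snd \<omega>)) (card I) (fst \<omega>) x s"
  let ?J = "\<lambda>r. {J. J \<subseteq> {..<card I} \<and> card J = min r (card I)}"
  have finJ: "finite (?J r)" for r by (rule finite_subset[of _ "Pow {..<card I}"]) auto
  have 1: "{\<omega>\<in>space ?M. \<forall>f\<in>{f\<in>sparse_fun n r. (\<Sum>i<n. (f i)\<^sup>2) = 1}. \<bar>(\<Sum>s\<in>I. (?row f s \<omega>)\<^sup>2) - 1\<bar> \<le> b} \<in> sets ?M" for r b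
    by (rule measurable_ball_le)
      (intro borel_measurable_abs borel_measurable_diff borel_measurable_sum borel_measurable_power row_measurable borel_measurable_const
        continuous_on_rabs continuous_on_diff continuous_on_sum continuous_on_power row_continuous continuous_on_const)+
  have fixed_J: "{\<omega>\<in>space ?M. \<forall>f\<in>sparse_fun n r. L2_set (\<lambda>k. ?row f (sorted_list_of_set I ! k) \<omega>) J \<le> b} \<in> sets ?M" for r b J
    unfolding L2_set_def
    by (rule measurable_ball_le)
      (intro measurable_compose[OF _ borel_measurable_sqrt] borel_measurable_sum borel_measurable_power row_measurable
        continuous_on_real_sqrt continuous_on_sum continuous_on_power row_continuous)+
  have 2: "{\<omega>\<in>space ?M. \<forall>J\<in>?J r. \<forall>f\<in>sparse_fun n r. L2_set (\<lambda>k. ?row f (sorted_list_of_set I ! k) \<omega>) J \<le> b} \<in> sets ?M" for r b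
    by (rule sets.sets_Collect_finite_All[OF fixed_J finJ])
  have "{\<omega>\<in>space ?M. \<forall>r\<in>{1..s_level p}.
      (\<forall>f\<in>{f\<in>sparse_fun n r. (\<Sum>i<n. (f i)\<^sup>2) = 1}. \<bar>(\<Sum>s\<in>I. (?row f s \<omega>)\<^sup>2) - 1\<bar> \<le> p * sqrt (real r)) \<and>
      (\<forall>J\<in>?J r. \<forall>f\<in>sparse_fun n r. L2_set (\<lambda>k. ?row f (sorted_list_of_set I ! k) \<omega>) J \<le> p * sqrt (real r))} \<in> sets ?M"
    by (rule sets.sets_Collect_finite_All, rule sets.sets_Collect_conj, rule 2, rule 1, simp)
  moreover have "rho_strongly_regular p (B_mat n I (Matrix.vec n (fst \<omega>)) (Matrix.vec n (fst (snd \<omega>))) (Matrix.vec n (snd (snd \<omega>))))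
    \<longleftrightarrow> (\<forall>r\<in>{1..s_level p}.
      (\<forall>f\<in>{f\<in>sparse_fun n r. (\<Sum>i<n. (f i)\<^sup>2) = 1}. \<bar>(\<Sum>s\<in>I. (?row f s \<omega>)\<^sup>2) - 1\<bar> \<le> p * sqrt (real r)) \<and>
      (\<forall>J\<in>?J r. \<forall>f\<in>sparse_fun n r. L2_set (\<lambda>k. ?row f (sorted_list_of_set I ! k) \<omega>) J \<le> p * sqrt (real r)))" for \<omega>
    unfolding strongly_regular_iff[OF I]
    by (rule ball_cong[OF refl arg_cong2[where f = "(\<and>)", OF refl]]) blast
  ultimately show ?thesis by simp
qed

text \<open>u is treated first, then v conditionally on a good u. Intersecting with the sign vectors
  makes the favourable set finite and thereby measurable; 3 = 1 + 2.\<close>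

lemma signs_whp:
  assumes reg: "regime m r0"
  shows "whp (rademacher.\<mu> n \<Otimes>\<^sub>M rademacher.\<mu> n) (3 * real n * (real n ^ 7 * exp (- \<tau>)))
    (\<lambda>w. first_good r0 (fst w) \<and> second_good m r0 (fst w) (snd w))"
proof -
  let ?R = "rademacher.\<mu> n"
  have r0: "r0 \<le> n" and m: "m > 0" using reg by (auto simp: regime_def)
  define G where "G = {w\<in>sign_vectors n \<times> sign_vectors n. first_good r0 (fst w) \<and> second_good m r0 (fst w) (snd w)}"
  have G: "G \<in> sets (?R \<Otimes>\<^sub>M ?R)" by (rule sign_vectors_pair_sets) (auto simp: G_def)
  define E where "E = space (?R \<Otimes>\<^sub>M ?R) - G"
  have E: "E \<in> sets (?R \<Otimes>\<^sub>M ?R)" unfolding E_def using G by auto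
  have e: "real n ^ 7 * exp (- \<tau>) \<ge> 0" by simp
  have sv: "u \<in> sign_vectors n" if "u \<in> space ?R" "\<forall>k<n. u k = 1 \<or> u k = - 1" for u
    using that unfolding rademacher_space sign_vectors_def by (auto simp: PiE_iff)
  have "emeasure (?R \<Otimes>\<^sub>M ?R) E \<le> ennreal (real n * (real n ^ 7 * exp (- \<tau>)) + 2 * real n * (real n ^ 7 * exp (- \<tau>)))"
  proof (rule emeasure_pair_le_left[OF rademacher.prob_\<mu> rademacher.prob_\<mu> E first_good_whp[OF r0]])
    fix u assume u: "u \<in> space ?R" and fg: "first_good r0 u"
    have us: "u \<in> sign_vectors n" using sv[OF u] fg by (simp add: first_good_def)
    obtain E2 where E2: "E2 \<in> sets ?R" "emeasure ?R E2 \<le> ennreal (2 * real n * (real n ^ 7 * exp (- \<tau>)))"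
      "\<forall>v\<in>space ?R - E2. second_good m r0 u v"
      using second_good_whp[OF r0 m fg regime_bounds(2)[OF reg]] unfolding whp_def by blast
    have "Pair u -` E \<subseteq> E2"
    proof
      fix v assume "v \<in> Pair u -` E"
      then have v: "v \<in> space ?R" "(u, v) \<notin> G" by (auto simp: E_def space_pair_measure)
      show "v \<in> E2"
      proof (rule ccontr)
        assume "v \<notin> E2"
        then have sg: "second_good m r0 u v" using E2(3) v by blast
        then have "v \<in> sign_vectors n" using sv[OF v(1)] by (simp add: second_good_def)
        then show False using v(2) us fg sg by (simp add: G_def)
      qed
    qed
    then have "emeasure ?R (Pair u -` E) \<le> emeasure ?R E2" using E2(1) by (rule emeasure_mono)
    then show "emeasure ?R (Pair u -` E) \<le> ennreal (2 * real n * (real n ^ 7 * exp (- \<tau>)))" using E2(2) by (rule order_trans)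
  qed auto
  then show ?thesis
    unfolding whp_def using E by (intro bexI[of _ E]) (auto simp: E_def G_def algebra_simps)
qed

text \<open>Conditioning on good signs leaves a statement about the Gaussian vector alone. The
  failure 3 n^8 + 4 n^8 = 7 n^8, times exp (- \<tau>), is absorbed by n^9.\<close>

lemma strongly_regular_prob:
  assumes I: "I \<subseteq> {..<n}" and reg: "regime (card I) (s_level (\<rho> (card I)))"
  shows "\<P>((g, e', e'') in joint_law n. rho_strongly_regular (\<rho> (card I))
      (B_mat n I (Matrix.vec n g) (Matrix.vec n e') (Matrix.vec n e''))) \<ge> 1 - real n ^ 9 * exp (- \<tau>)"
proof -
  let ?R = "rademacher.\<mu> n"
  let ?r0 = "s_level (\<rho> (card I))"
  interpret J: prob_space "joint_law n" by (rule prob_space_joint_law)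
  define Ev where "Ev = {\<omega>\<in>space (joint_law n). rho_strongly_regular (\<rho> (card I))
     (B_mat n I (Matrix.vec n (fst \<omega>)) (Matrix.vec n (fst (snd \<omega>))) (Matrix.vec n (snd (snd \<omega>))))}"
  have Ev: "Ev \<in> sets (joint_law n)" unfolding Ev_def by (rule strongly_regular_measurable[OF I])
  define A where "A = space (joint_law n) - Ev"
  have A: "A \<in> sets (gauss.\<mu> n \<Otimes>\<^sub>M (?R \<Otimes>\<^sub>M ?R))" unfolding A_def joint_law_eq[symmetric] using Ev by auto
  have "emeasure (gauss.\<mu> n \<Otimes>\<^sub>M (?R \<Otimes>\<^sub>M ?R)) A
      \<le> ennreal (3 * real n * (real n ^ 7 * exp (- \<tau>)) + 4 * real n * (real n ^ 7 * exp (- \<tau>)))"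
  proof (rule emeasure_pair_le_right[OF gauss.prob_\<mu> prob_space_pair[OF rademacher.prob_\<mu> rademacher.prob_\<mu>] A signs_whp[OF reg]])
    fix w assume w: "w \<in> space (?R \<Otimes>\<^sub>M ?R)" and good: "first_good ?r0 (fst w) \<and> second_good (card I) ?r0 (fst w) (snd w)"
    obtain E3 where E3: "E3 \<in> sets (gauss.\<mu> n)" "emeasure (gauss.\<mu> n) E3 \<le> ennreal (4 * real n * (real n ^ 7 * exp (- \<tau>)))"
      "\<forall>g\<in>space (gauss.\<mu> n) - E3. third_good I ?r0 (fst w) (snd w) g"
      using third_good_whp[OF reg I refl] good unfolding whp_def by blast
    have "(\<lambda>g. (g, w)) -` A \<subseteq> E3"
    proof
      fix g assume "g \<in> (\<lambda>g. (g, w)) -` A"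
      then have g: "g \<in> space (gauss.\<mu> n)" "(g, w) \<notin> Ev" "(g, w) \<in> space (joint_law n)"
        by (auto simp: A_def joint_law_eq space_pair_measure)
      show "g \<in> E3"
      proof (rule ccontr)
        assume "g \<notin> E3"
        then have "third_good I ?r0 (fst w) (snd w) g" using E3(3) g by blast
        from third_good_strongly_regular[OF I this] have "(g, w) \<in> Ev" using g(3) by (simp add: Ev_def)
        then show False using g(2) by contradiction
      qed
    qed
    then have "emeasure (gauss.\<mu> n) ((\<lambda>g. (g, w)) -` A) \<le> emeasure (gauss.\<mu> n) E3" using E3(1) by (rule emeasure_mono)
    then show "emeasure (gauss.\<mu> n) ((\<lambda>g. (g, w)) -` A) \<le> ennreal (4 * real n * (real n ^ 7 * exp (- \<tau>)))"
      using E3(2) by (rule order_trans)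
  qed auto
  also have "3 * real n * (real n ^ 7 * exp (- \<tau>)) + 4 * real n * (real n ^ 7 * exp (- \<tau>)) = 7 * real n ^ 8 * exp (- \<tau>)"
    by (simp add: power_Suc[symmetric] eval_nat_numeral)
  finally have le: "emeasure (joint_law n) A \<le> ennreal (7 * real n ^ 8 * exp (- \<tau>))" by (simp only: joint_law_eq)
  have "7 * real n ^ 8 * exp (- \<tau>) \<le> real n * real n ^ 8 * exp (- \<tau>)" using n by (intro mult_right_mono) auto
  also have "\<dots> = real n ^ 9 * exp (- \<tau>)" by (simp add: eval_nat_numeral)
  finally have "emeasure (joint_law n) A \<le> ennreal (real n ^ 9 * exp (- \<tau>))" using le ennreal_leI order_trans by blast
  then have "J.prob A \<le> real n ^ 9 * exp (- \<tau>)" by (simp add: J.emeasure_eq_measure)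
  moreover have "J.prob A = 1 - J.prob Ev"
    unfolding A_def by (rule J.prob_compl[OF Ev])
  moreover have eq: "{(g, e', e''). (g, e', e'') \<in> space (joint_law n) \<and> rho_strongly_regular (\<rho> (card I))
      (B_mat n I (Matrix.vec n g) (Matrix.vec n e') (Matrix.vec n e''))} = Ev"
    unfolding Ev_def by auto
  ultimately show ?thesis by (subst eq) linarith
qed

text \<open>\<rho> sqrt m >= 1 bounds the largest sparsity by m. Because of the ceiling \<rho> sqrt
  r may exceed 1, but for \<rho> <= 1 one has \<rho>^2 r <= 1 + \<rho>^2 <= 2 <= 9/4, hence the
  bound 3/2.\<close>

lemma regime_s_level:
  assumes star: "3 * 10 ^ 16 * \<Gamma> ^ 5 * l ^ 7 \<le> sqrt (real n)" and m: "0 < m" "m \<le> n"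
  shows "regime m (s_level (\<rho> m))"
proof -
  have \<phi>1: "1 \<le> \<phi> m * sqrt (real m)" using l_ge sqrt_l_ge m by (simp add: \<phi>_eq mult_ge1_I)
  have c2: "c2 \<ge> 1" using one_le_power[OF \<Gamma>, of 2] by (simp add: c2_def)
  have "\<phi> m \<noteq> 0" using \<phi>1 by auto
  then have "\<phi> m > 0" using \<phi>_nonneg[of m] by simp
  then have \<rho>p: "\<rho> m > 0" unfolding \<rho>_def using c2 by (intro mult_pos_pos) auto
  have pw: "\<rho> m powi (- 2) = 1 / (\<rho> m)\<^sup>2" by (simp add: power_int_minus divide_inverse)
  have inv: "1 / (\<rho> m)\<^sup>2 \<le> real m"
  proof -
    have "1 * 1 \<le> c2 * (\<phi> m * sqrt (real m))" using c2 \<phi>1 by (intro mult_mono) auto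
    then have "1 \<le> (\<rho> m * sqrt (real m))\<^sup>2" by (intro one_le_power) (simp add: \<rho>_def mult.assoc)
    then have "1 \<le> real m * (\<rho> m)\<^sup>2" by (simp add: power_mult_distrib mult.commute)
    then show ?thesis using \<rho>p by (simp add: pos_divide_le_eq)
  qed
  have s_le: "real (s_level (\<rho> m)) < 1 / (\<rho> m)\<^sup>2 + 1"
  proof -
    have "-1 < 1 / (\<rho> m)\<^sup>2" by (rule less_le_trans[of _ 0]) auto
    then have "0 \<le> \<lceil>1 / (\<rho> m)\<^sup>2\<rceil>" by simp
    then show ?thesis unfolding s_level_def pw by (simp only: of_nat_nat) linarith
  qed
  have "s_level (\<rho> m) \<le> m"
    unfolding s_level_def pw using inv by (simp add: ceiling_le_iff nat_le_iff)
  moreover have "s_level (\<rho> m) = 1 \<and> \<rho> m > 1 \<or> (\<forall>r\<in>{1..s_level (\<rho> m)}. \<rho> m * sqrt (real r) \<le> 3 / 2)"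
  proof (cases "\<rho> m > 1")
    case True
    then have "(\<rho> m)\<^sup>2 \<ge> 1" by (intro one_le_power) simp
    then have "1 / (\<rho> m)\<^sup>2 \<le> 1" "1 / (\<rho> m)\<^sup>2 > 0" using \<rho>p by (simp_all add: divide_le_eq_1)
    then have "\<lceil>1 / (\<rho> m)\<^sup>2\<rceil> = 1" by linarith
    then show ?thesis using True by (simp add: s_level_def pw)
  next
    case False
    have "\<rho> m * sqrt (real r) \<le> 3 / 2" if r: "r \<in> {1..s_level (\<rho> m)}" for r
    proof -
      have "real r \<le> 1 / (\<rho> m)\<^sup>2 + 1" using r s_le by auto
      then have "(\<rho> m)\<^sup>2 * real r \<le> (\<rho> m)\<^sup>2 * (1 / (\<rho> m)\<^sup>2 + 1)" by (intro mult_left_mono) auto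
      also have "\<dots> = 1 + (\<rho> m)\<^sup>2" using \<rho>p by (simp add: distrib_left)
      also have "\<dots> \<le> 1 + 1" using False \<rho>p by (intro add_left_mono power_le_one) auto
      also have "\<dots> \<le> (3 / 2)\<^sup>2" by (simp add: power2_eq_square)
      finally have "(\<rho> m * sqrt (real r))\<^sup>2 \<le> (3 / 2)\<^sup>2" by (simp add: power_mult_distrib)
      then show ?thesis by (rule power2_le_imp_le) simp
    qed
    then show ?thesis by blast
  qed
  ultimately show ?thesis using star m by (simp add: regime_def)
qed

end

text \<open>Rounding up costs at most 1. This is absorbed by the factor 2 in the bounds on L and 2^d
  and, for J, by 2 log_2 n <= 3 l.\<close>

lemma scales_exist:
  assumes n: "n \<ge> 32" and \<Gamma>: "\<Gamma> \<ge> 1"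
  shows "\<exists>L J d. scales n \<Gamma> (ln (real n)) L J d"
proof -
  define l where "l = ln (real n)"
  have l1: "l \<ge> 1" unfolding l_def by (rule ln_ge_1[OF n])
  have n_powr: "2 powr (log 2 (real n)) = real n" using n by simp
  have log_pos: "log 2 (real n) \<ge> 0" using n by simp
  have log_le: "log 2 (real n) \<le> 3 / 2 * l"
  proof -
    have "log 2 (real n) = l / ln 2" by (simp add: log_def l_def)
    also have "\<dots> \<le> l / (2 / 3)" using ln2_ge_two_thirds l1 by (intro divide_left_mono) auto
    finally show ?thesis by simp
  qed
  define L where "L = nat \<lceil>\<Gamma> * l\<rceil>"
  define J where "J = nat \<lceil>2 * log 2 (real n)\<rceil>"
  define d where "d = nat \<lceil>log 2 (real n)\<rceil>"
  have gl: "1 \<le> \<Gamma> * l" using \<Gamma> l1 by (simp add: mult_ge1_I)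
  have L: "\<Gamma> * l \<le> real L" "real L \<le> \<Gamma> * l + 1" using gl by (simp_all add: L_def, linarith?)
  have Jb: "2 * log 2 (real n) \<le> real J" "real J \<le> 2 * log 2 (real n) + 1" using log_pos by (simp_all add: J_def, linarith?)
  have db: "log 2 (real n) \<le> real d" "real d \<le> log 2 (real n) + 1" using log_pos by (simp_all add: d_def, linarith?)
  have "scales n \<Gamma> l L J d"
  proof
    show "32 \<le> n" "1 \<le> \<Gamma>" "l = ln (real n)" by (fact n, fact \<Gamma>, fact l_def)
    show "\<Gamma> * l \<le> real L" "real L \<le> 2 * \<Gamma> * l" using L gl by auto
    have "(real n)\<^sup>2 = 2 powr (2 * log 2 (real n))"
      by (simp only: mult_2 powr_add power2_eq_square n_powr)
    also have "\<dots> \<le> 2 powr (real J)" using Jb by simp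
    finally show "(real n)\<^sup>2 \<le> 2 ^ J" by (simp add: powr_realpow)
    show "real J \<le> 4 * l" using Jb log_le l1 by linarith
    have "real n \<le> 2 powr (real d)" using db n_powr by (metis powr_mono one_le_numeral)
    then have "real n \<le> real (2 ^ d)" by (simp add: powr_realpow)
    then show "n \<le> 2 ^ d" by (simp only: of_nat_le_iff)
    have "2 powr (real d) \<le> 2 powr (log 2 (real n) + 1)" using db by simp
    also have "\<dots> = real (2 * n)" by (simp add: powr_add n_powr)
    finally have "real (2 ^ d) \<le> real (2 * n)" by (simp add: powr_realpow)
    then show "2 ^ d \<le> 2 * n" by (simp only: of_nat_le_iff)
  qed
  then show ?thesis unfolding l_def by blast
qed

text \<open>ln y <= y is applied to y = x^(1/24), whose sixth power is the fourth root of x.\<close>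

lemma ln_pow_le:
  assumes "x \<ge> 1"
  shows "ln x ^ 6 \<le> 24 ^ 6 * sqrt (sqrt x)"
proof -
  define y where "y = x powr (1 / 24)"
  have y: "y > 0" using assms by (simp add: y_def)
  have "ln x = 24 * ln y" using assms by (simp add: y_def ln_powr)
  also have "\<dots> \<le> 24 * y" using ln_le_minus_one[OF y] by simp
  finally have "ln x ^ 6 \<le> (24 * y) ^ 6" using assms by (intro power_mono) auto
  also have "\<dots> = 24 ^ 6 * y ^ 6" by (rule power_mult_distrib)
  also have "y ^ 6 = x powr (1 / 4)"
    using assms by (simp add: y_def powr_power)
  also have "x powr (1 / 4) = sqrt (sqrt x)"
    using assms by (simp add: powr_half_sqrt[symmetric] powr_powr)
  finally show ?thesis .
qed

theorem theorem4p1: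
  shows "\<exists>c\<^sub>0::real. c\<^sub>0 > 0 \<and>
    (\<exists>p\<^sub>1 p\<^sub>2 :: real poly. \<forall>\<gamma>::real. \<gamma> \<ge> 1 \<longrightarrow>
      (let c\<^sub>1 = poly p\<^sub>1 \<gamma>; c\<^sub>2 = poly p\<^sub>2 \<gamma> in
        c\<^sub>1 > 0 \<and> c\<^sub>2 > 0 \<and>
        (\<forall>(n::nat) (m::nat) (I::nat set).
          n \<ge> 1 \<and> m \<ge> 1 \<and> I \<subseteq> {..<n} \<and> card I = m \<and>
          real m \<le> real n / (c\<^sub>1 * ln (real n) ^ 4) \<longrightarrow>
          \<P>((g, e', e'') in joint_law n.
              rho_strongly_regular (c\<^sub>2 * ln (real n) powr (5 / 2) / sqrt (real m))
                (B_mat n I (Matrix.vec n g) (Matrix.vec n e') (Matrix.vec n e'')))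
            \<ge> 1 - 2 * exp (- c\<^sub>0 * \<gamma> * (ln (real n))\<^sup>2))))"
proof -
  \<comment> \<open>\<open>24 ^ 6\<close> comes from \<open>ln_pow_le\<close>, the rest from the largeness condition in \<open>regime\<close> with \<open>\<Gamma> = 10 * \<gamma>\<close>.\<close>
  define K :: real where "K = 24 ^ 6 * (3 * 10 ^ 16 * 10 ^ 5)"
  \<comment> \<open>\<open>p1\<close> is the fourth power of c = K \<gamma>^5, and \<open>p2\<close>
    is \<open>c2\<close> at \<Gamma> = 10 \<gamma>.\<close>
  define p1 p2 :: "real poly" where "p1 = monom (K ^ 4) 20" and "p2 = monom (10 ^ 8) 2"
  have K: "K \<ge> 1" by (simp add: K_def)
  have main: "poly p1 \<gamma> > 0 \<and> poly p2 \<gamma> > 0 \<and>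
      (\<forall>(n::nat) (m::nat) (I::nat set).
          n \<ge> 1 \<and> m \<ge> 1 \<and> I \<subseteq> {..<n} \<and> card I = m \<and>
          real m \<le> real n / (poly p1 \<gamma> * ln (real n) ^ 4) \<longrightarrow>
          \<P>((g, e', e'') in joint_law n.
              rho_strongly_regular (poly p2 \<gamma> * ln (real n) powr (5 / 2) / sqrt (real m))
                (B_mat n I (Matrix.vec n g) (Matrix.vec n e') (Matrix.vec n e'')))
            \<ge> 1 - 2 * exp (- 1 * \<gamma> * (ln (real n))\<^sup>2))" if \<gamma>: "\<gamma> \<ge> 1" for \<gamma> :: real
  proof (intro conjI allI impI)
    show "poly p1 \<gamma> > 0" "poly p2 \<gamma> > 0" using \<gamma> K by (simp_all add: p1_def p2_def poly_monom)
    fix n m :: nat and I :: "nat set"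
    assume a: "n \<ge> 1 \<and> m \<ge> 1 \<and> I \<subseteq> {..<n} \<and> card I = m \<and> real m \<le> real n / (poly p1 \<gamma> * ln (real n) ^ 4)"
    define c where "c = K * \<gamma> ^ 5"
    have c: "c \<ge> K" using K \<gamma> one_le_power[OF \<gamma>, of 5] by (simp add: c_def)
    have p1c: "poly p1 \<gamma> = c ^ 4" by (simp add: p1_def poly_monom c_def power_mult_distrib power_mult[symmetric])
    have "n \<noteq> 1"
    proof
      assume "n = 1" \<comment> \<open>then \<open>ln n = 0\<close>, and the bound on \<open>m\<close> is the junk value \<open>n / 0 = 0\<close>\<close>
      then show False using a by auto
    qed
    then have n2: "n \<ge> 2" using a by simp
    define l where "l = ln (real n)"
    have "ln 2 \<le> l" using n2 by (simp add: l_def)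
    then have lh: "l \<ge> 1 / 2" using ln2_ge_two_thirds by linarith
    then have lp: "l > 0" by simp
    have cp: "c > 0" using c K by linarith
    have "real m * (c * l) ^ 4 \<le> real n" using a lp cp
      by (simp add: p1c l_def[symmetric] pos_le_divide_eq power_mult_distrib)
    \<comment> \<open>With m >= 1 the bound on m gives n >= (c l)^4, which makes n large compared
      with powers of its logarithm.\<close>
    moreover have "1 * (c * l) ^ 4 \<le> real m * (c * l) ^ 4" using a by (intro mult_right_mono) auto
    ultimately have cl: "(c * l) ^ 4 \<le> real n" by simp
    have "(32::real) \<le> 64 ^ 4" by simp
    also have "(64::real) ^ 4 \<le> (c * l) ^ 4"
    proof (rule power_mono)
      have "128 * (1 / 2) \<le> c * l" using c lh by (intro mult_mono) (auto simp: K_def)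
      then show "64 \<le> c * l" by simp
    qed simp
    finally have n32: "n \<ge> 32" using cl by simp
    have l1: "l \<ge> 1" unfolding l_def by (rule ln_ge_1[OF n32])
    have mn: "m \<le> n" using a card_mono[of "{..<n}" I] by auto
    have root: "c * l \<le> sqrt (sqrt (real n))"
    proof -
      have "(c * l)\<^sup>2 \<le> sqrt (real n)" using cl by (intro real_le_rsqrt) (simp add: power_mult[symmetric])
      then show ?thesis by (rule real_le_rsqrt)
    qed
    \<comment> \<open>The seventh power is split as l times l^6. The first factor with its constant
      is at most n^(1/4) by \<open>root\<close>, the second at most 24^6 n^(1/4).\<close>
    have star: "3 * 10 ^ 16 * (10 * \<gamma>) ^ 5 * l ^ 7 \<le> sqrt (real n)"
    proof -
      have "24 ^ 6 * (3 * 10 ^ 16 * (10 * \<gamma>) ^ 5 * l ^ 7) = (c * l) * l ^ 6"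
        by (simp add: c_def K_def power_mult_distrib eval_nat_numeral)
      also have "\<dots> \<le> sqrt (sqrt (real n)) * (24 ^ 6 * sqrt (sqrt (real n)))"
        unfolding l_def using n32 lp cp by (intro mult_mono root[unfolded l_def] ln_pow_le) auto
      also have "\<dots> = 24 ^ 6 * (sqrt (sqrt (real n)) * sqrt (sqrt (real n)))" by (simp only: mult.left_commute)
      also have "sqrt (sqrt (real n)) * sqrt (sqrt (real n)) = sqrt (real n)" by simp
      finally show ?thesis by simp
    qed
    obtain L J d where "scales n (10 * \<gamma>) (ln (real n)) L J d"
      using scales_exist[OF n32, of "10 * \<gamma>"] \<gamma> by auto
    then interpret scales n "10 * \<gamma>" l L J d by (simp add: l_def)
    have rho: "poly p2 \<gamma> * l powr (5 / 2) / sqrt (real m) = \<rho> m"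
      by (simp add: \<rho>_def \<phi>_def c2_def p2_def poly_monom power_mult_distrib)
    have "1 - real n ^ 9 * exp (- \<tau>) \<le> \<P>((g, e', e'') in joint_law n.
        rho_strongly_regular (\<rho> m) (B_mat n I (Matrix.vec n g) (Matrix.vec n e') (Matrix.vec n e'')))"
      using strongly_regular_prob[of I] regime_s_level[OF star _ mn] a by simp
    \<comment> \<open>n^9 = exp (9 l), while \<Gamma> = 10 \<gamma> leaves a surplus of 9 \<gamma>
      l^2 >= 9 l in the exponent. This is the reason for the factor 10 and permits the absolute
      constant 1.\<close>
    moreover have "real n ^ 9 * exp (- \<tau>) \<le> 2 * exp (- 1 * \<gamma> * l\<^sup>2)"
    proof -
      have "real n ^ 9 = exp (9 * l)"
        using n32 exp_of_nat_mult[of 9 l] by (simp add: l_def)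
      then have "real n ^ 9 * exp (- \<tau>) = exp (9 * l - 10 * \<gamma> * l\<^sup>2)"
        by (simp add: \<tau>_def exp_add[symmetric])
      also have "\<dots> \<le> exp (- 1 * \<gamma> * l\<^sup>2)"
      proof -
        have "1 * l \<le> \<gamma> * (l * l)" using \<gamma> l1 by (intro mult_mono) (auto simp: mult_le_cancel_right1)
        then show ?thesis by (simp add: power2_eq_square)
      qed
      also have "\<dots> \<le> 2 * exp (- 1 * \<gamma> * l\<^sup>2)" by simp
      finally show ?thesis .
    qed
    ultimately show "1 - 2 * exp (- 1 * \<gamma> * (ln (real n))\<^sup>2) \<le> \<P>((g, e', e'') in joint_law n.
        rho_strongly_regular (poly p2 \<gamma> * ln (real n) powr (5 / 2) / sqrt (real m))
          (B_mat n I (Matrix.vec n g) (Matrix.vec n e') (Matrix.vec n e'')))"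
      unfolding l_def[symmetric] rho by linarith
  qed
  show ?thesis
    unfolding Let_def using main by (intro exI[of _ 1] conjI exI[of _ p1] exI[of _ p2]) auto
qed

end
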